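(* If $\hat w$ is a weak minimum of problem (P), then $$\max_{\lambda\in\Lambda^{\#}}\Omega[\lambda](\bar x,\bar u,\bar v)\ge0\qquad\text{for all }(\bar x,\bar u,\bar v)\in\mathcal C_2 .$$
   Context: **Problem.** $h_t$ is the value of $h$ at time $t$; $\mathbb R^{k,*}$ denotes row vectors. Let $T>0$ and let $f_i:\mathbb R^{n+l}\to\mathbb R^n$ ($i=0,\dots,m$), $\varphi_i:\mathbb R^{2n}\to\mathbb R$ ($i=0,\dots,d_\varphi$), $\eta_j:\mathbb R^{2n}\to\mathbb R$ ($j=1,\dots,d_\eta$) have Lipschitz-continuous second derivatives. Put $F(x,u,v):=f_0(x,u)+\sum_{i=1}^m v_if_i(x,u)$ and $\mathcal W:=W^{1,\infty}(0,T;\mathbb R^n)\times L^\infty(0,T;\mathbb R^l)\times L^\infty(0,T;\mathbb R^m)$. Problem (P): minimize $\varphi_0(x_0,x_T)$ over $w=(x,u,v)\in\mathcal W$ subject to $\dot x_t=F(x_t,u_t,v_t)$ a.e. on $[0,T]$, $\eta_j(x_0,x_T)=0$ ($j=1,\dots,d_\eta$), $\varphi_i(x_0,x_T)\le0$ ($i=1,\dots,d_\varphi$). A feasible trajectory $\hat w$ is a weak minimum if for some $\varepsilon>0$ it minimizes the cost among feasible $w$ with $\|x-\hat x\|_\infty,\|u-\hat u\|_\infty,\|v-\hat v\|_\infty<\varepsilon$. $\hat w=(\hat x,\hat u,\hat v)$ is a fixed feasible trajectory with $\varphi_i(\hat x_0,\hat x_T)=0$ for $i=1,\dots,d_\varphi$.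 Omitted arguments mean evaluation along $\hat w$; $F_x,F_u,F_v$ are the derivatives of $F$ along $\hat w$. **Multipliers.** For $\lambda=(\alpha,\beta,p)\in\mathbb R^{d_\varphi+1,*}\times\mathbb R^{d_\eta,*}\times W^{1,\infty}(0,T;\mathbb R^{n,*})$ let $H[\lambda](x,u,v,t):=p_tF(x,u,v)$, $\ell[\lambda](q):=\sum_{i=0}^{d_\varphi}\alpha_i\varphi_i(q)+\sum_{j=1}^{d_\eta}\beta_j\eta_j(q)$. $\Lambda$ is the set of $\lambda$ with $|\alpha|+|\beta|=1$, $\alpha\ge0$, $-\dot p_t=H_x[\lambda](\hat w_t,t)$, $p_0=-D_{x_0}\ell[\lambda](\hat x_0,\hat x_T)$, $p_T=D_{x_T}\ell[\lambda](\hat x_0,\hat x_T)$, $H_u[\lambda](\hat w_t,t)=0$ and $H_v[\lambda](\hat w_t,t)=0$ a.e. **Second variation.** Let $\mathcal W_2:=W^{1,2}(0,T;\mathbb R^n)\times L^2(0,T;\mathbb R^l)\times L^2(0,T;\mathbb R^m)$, $\mathcal H_2:=\{(\bar x,\bar u,\bar v)\in\mathcal W_2:\dot{\bar x}=F_x\bar x+F_u\bar u+F_v\bar v\text{ a.e.}\}$, and $\Omega[\lambda](\bar x,\bar u,\bar v):=\tfrac12D^2\ell[\lambda](\hat x_0,\hat x_T)(\bar x_0,\bar x_T)^2+\int_0^T[\tfrac12\bar x^\top H_{xx}\bar x+\bar u^\top H_{ux}\bar x+\bar v^\top H_{vx}\bar x+\tfrac12\bar u^\top H_{uu}\bar u+\bar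 v^\top H_{vu}\bar u]\,dt$ (all with $[\lambda]$). $\Lambda^{\#}:=\{\lambda\in\Lambda:\Omega[\lambda]\text{ is weakly lower semicontinuous on }\mathcal H_2\}$. **Critical cone.** $\mathcal C_2:=\{(\bar x,\bar u,\bar v)\in\mathcal H_2: D\eta_j(\hat x_0,\hat x_T)(\bar x_0,\bar x_T)=0\ (j=1,\dots,d_\eta),\ D\varphi_i(\hat x_0,\hat x_T)(\bar x_0,\bar x_T)\le0\ (i=0,\dots,d_\varphi)\}$. A maximum over the empty set is $-\infty$. *)

theory Defs
  imports "HOL-Analysis.Analysis" "HOL-Probability.Essential_Supremum"
begin

section \<open>Function spaces on the interval from 0 to \<open>T\<close>\<close>

text \<open>Elements of the Lebesgue and Sobolev spaces are represented by functions on \<^typ>\<open>real\<close>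
  whose values outside \<open>{0..T}\<close> are ignored.\<close>

definition Linf_norm :: "real \<Rightarrow> (real \<Rightarrow> 'a::euclidean_space) \<Rightarrow> ereal" where
  "Linf_norm T u = esssup (lebesgue_on {0..T}) (\<lambda>t. ereal (norm (u t)))"

definition Linf :: "real \<Rightarrow> (real \<Rightarrow> 'a::euclidean_space) set" where
  "Linf T = {u \<in> borel_measurable (lebesgue_on {0..T}). Linf_norm T u < \<infinity>}"

definition L2 :: "real \<Rightarrow> (real \<Rightarrow> 'a::euclidean_space) set" where
  "L2 T = {u \<in> borel_measurable (lebesgue_on {0..T}).
             integrable (lebesgue_on {0..T}) (\<lambda>t. (norm (u t))\<^sup>2)}"

definition L2_norm :: "real \<Rightarrow> (real \<Rightarrow> 'a::euclidean_space) \<Rightarrow> real" where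
  "L2_norm T u = sqrt (LINT t|lebesgue_on {0..T}. (norm (u t))\<^sup>2)"

text \<open>A Sobolev function of one variable is identified with its absolutely continuous
  representative, that is, with a primitive of an integrable function; point values such as
  \<open>x 0\<close> and \<open>x T\<close> refer to this representative. The derivative \<open>g\<close> is determined almost
  everywhere on \<open>{0..T}\<close>, so the choice made in \<open>wderiv\<close> is immaterial.\<close>

definition has_wderiv :: "real \<Rightarrow> (real \<Rightarrow> 'a::euclidean_space) \<Rightarrow> (real \<Rightarrow> 'a) \<Rightarrow> bool" where
  "has_wderiv T x g \<longleftrightarrow> integrable (lebesgue_on {0..T}) g \<and>
     (\<forall>t\<in>{0..T}. x t = x 0 + (LINT s|lebesgue_on {0..t}. g s))"

definition wderiv :: "real \<Rightarrow> (real \<Rightarrow> 'a::euclidean_space) \<Rightarrow> real \<Rightarrow> 'a" where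
  "wderiv T x = (SOME g. has_wderiv T x g)"

definition W1inf :: "real \<Rightarrow> (real \<Rightarrow> 'a::euclidean_space) set" where
  "W1inf T = {x. \<exists>g \<in> Linf T. has_wderiv T x g}"

definition W12 :: "real \<Rightarrow> (real \<Rightarrow> 'a::euclidean_space) set" where
  "W12 T = {x. \<exists>g \<in> L2 T. has_wderiv T x g}"

section \<open>Derivatives\<close>

definition lipschitz_second_derivative ::
    "('a::euclidean_space \<Rightarrow> 'b::euclidean_space) \<Rightarrow> bool" where
  "lipschitz_second_derivative f \<longleftrightarrow>
     (\<exists>(f' :: 'a \<Rightarrow> 'a \<Rightarrow>\<^sub>L 'b) (f'' :: 'a \<Rightarrow> 'a \<Rightarrow>\<^sub>L 'a \<Rightarrow>\<^sub>L 'b).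
        (\<forall>z. (f has_derivative blinfun_apply (f' z)) (at z)) \<and>
        (\<forall>z. (f' has_derivative blinfun_apply (f'' z)) (at z)) \<and>
        (\<exists>L. L-lipschitz_on UNIV f''))"

text \<open>Row vectors are represented by ordinary vectors, and the product of a row vector with a
  column vector by the inner product; the derivative of a real function is then its gradient.\<close>

definition grad :: "('a::euclidean_space \<Rightarrow> real) \<Rightarrow> 'a \<Rightarrow> 'a" where
  "grad g z = (\<Sum>b\<in>Basis. frechet_derivative g (at z) b *\<^sub>R b)"

definition D2 :: "('a::euclidean_space \<Rightarrow> real) \<Rightarrow> 'a \<Rightarrow> 'a \<Rightarrow> 'a \<Rightarrow> real" where
  "D2 g z h k = frechet_derivative (\<lambda>y. frechet_derivative g (at y) h) (at z) k"

text \<open>The mixed second partial derivative: \<open>Dmix g a b h k\<close> is \<open>h\<close> transposed times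
  \<open>g\<^sub>a\<^sub>b(a, b)\<close> times \<open>k\<close>.\<close>

definition Dmix :: "('a::euclidean_space \<Rightarrow> 'b::euclidean_space \<Rightarrow> real) \<Rightarrow> 'a \<Rightarrow> 'b
    \<Rightarrow> 'a \<Rightarrow> 'b \<Rightarrow> real" where
  "Dmix g a b h k =
     frechet_derivative (\<lambda>b'. frechet_derivative (\<lambda>a'. g a' b') (at a) h) (at b) k"

section \<open>The optimal control problem\<close>

text \<open>The cost is \<open>phi 0\<close>, the inequality constraints are \<open>phi i\<close> for \<open>i \<in> {1..dphi}\<close> and the
  equality constraints are \<open>eta j\<close> for \<open>j \<in> {1..deta}\<close>; other indices are ignored. The numbers
  \<open>dphi\<close> and \<open>deta\<close> may be zero.\<close>

record ('n, 'l, 'm) ocp =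
  horizon :: real
  f0 :: "(real^'n) \<times> (real^'l) \<Rightarrow> real^'n"
  fs :: "'m \<Rightarrow> (real^'n) \<times> (real^'l) \<Rightarrow> real^'n"
  dphi :: nat
  phi :: "nat \<Rightarrow> (real^'n) \<times> (real^'n) \<Rightarrow> real"
  deta :: nat
  eta :: "nat \<Rightarrow> (real^'n) \<times> (real^'n) \<Rightarrow> real"

type_synonym ('n, 'l, 'm) traj =
  "(real \<Rightarrow> real^'n) \<times> (real \<Rightarrow> real^'l) \<times> (real \<Rightarrow> real^'m)"

definition smooth_data :: "('n::finite, 'l::finite, 'm::finite) ocp \<Rightarrow> bool" where
  "smooth_data P \<longleftrightarrow>
     lipschitz_second_derivative (f0 P) \<and>
     (\<forall>i. lipschitz_second_derivative (fs P i)) \<and>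
     (\<forall>i\<in>{0..dphi P}. lipschitz_second_derivative (phi P i)) \<and>
     (\<forall>j\<in>{1..deta P}. lipschitz_second_derivative (eta P j))"

definition dyn :: "('n::finite, 'l::finite, 'm::finite) ocp
    \<Rightarrow> real^'n \<Rightarrow> real^'l \<Rightarrow> real^'m \<Rightarrow> real^'n" where
  "dyn P x u v = f0 P (x, u) + (\<Sum>i\<in>UNIV. (v $ i) *\<^sub>R fs P i (x, u))"

definition feasible :: "('n::finite, 'l::finite, 'm::finite) ocp \<Rightarrow> ('n, 'l, 'm) traj set" where
  "feasible P = {(x, u, v).
     x \<in> W1inf (horizon P) \<and> u \<in> Linf (horizon P) \<and> v \<in> Linf (horizon P) \<and>
     (AE t in lebesgue_on {0..horizon P}. wderiv (horizon P) x t = dyn P (x t) (u t) (v t)) \<and>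
     (\<forall>j\<in>{1..deta P}. eta P j (x 0, x (horizon P)) = 0) \<and>
     (\<forall>i\<in>{1..dphi P}. phi P i (x 0, x (horizon P)) \<le> 0)}"

definition weak_minimum ::
    "('n::finite, 'l::finite, 'm::finite) ocp \<Rightarrow> ('n, 'l, 'm) traj \<Rightarrow> bool" where
  "weak_minimum P = (\<lambda>(xh, uh, vh).
     (xh, uh, vh) \<in> feasible P \<and>
     (\<exists>\<epsilon>>0. \<forall>(x, u, v) \<in> feasible P.
        Linf_norm (horizon P) (\<lambda>t. x t - xh t) < ereal \<epsilon> \<and>
        Linf_norm (horizon P) (\<lambda>t. u t - uh t) < ereal \<epsilon> \<and>
        Linf_norm (horizon P) (\<lambda>t. v t - vh t) < ereal \<epsilon> \<longrightarrow>
        phi P 0 (xh 0, xh (horizon P)) \<le> phi P 0 (x 0, x (horizon P))))"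

section \<open>Multipliers\<close>

type_synonym 'n multiplier = "(nat \<Rightarrow> real) \<times> (nat \<Rightarrow> real) \<times> (real \<Rightarrow> real^'n)"

definition Ham :: "('n::finite, 'l::finite, 'm::finite) ocp \<Rightarrow> 'n multiplier
    \<Rightarrow> real^'n \<Rightarrow> real^'l \<Rightarrow> real^'m \<Rightarrow> real \<Rightarrow> real" where
  "Ham P = (\<lambda>(\<alpha>, \<beta>, p) x u v t. p t \<bullet> dyn P x u v)"

definition ell :: "('n::finite, 'l::finite, 'm::finite) ocp \<Rightarrow> 'n multiplier
    \<Rightarrow> (real^'n) \<times> (real^'n) \<Rightarrow> real" where
  "ell P = (\<lambda>(\<alpha>, \<beta>, p) q.
     (\<Sum>i=0..dphi P. \<alpha> i * phi P i q) + (\<Sum>j=1..deta P. \<beta> j * eta P j q))"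

definition Lambda :: "('n::finite, 'l::finite, 'm::finite) ocp \<Rightarrow> ('n, 'l, 'm) traj
    \<Rightarrow> 'n multiplier set" where
  "Lambda P = (\<lambda>(xh, uh, vh). {(\<alpha>, \<beta>, p).
     \<alpha> \<in> {0..dphi P} \<rightarrow>\<^sub>E UNIV \<and> \<beta> \<in> {1..deta P} \<rightarrow>\<^sub>E UNIV \<and> p \<in> W1inf (horizon P) \<and>
     L2_set \<alpha> {0..dphi P} + L2_set \<beta> {1..deta P} = 1 \<and>
     (\<forall>i\<in>{0..dphi P}. 0 \<le> \<alpha> i) \<and>
     (AE t in lebesgue_on {0..horizon P}.
        - wderiv (horizon P) p t
          = grad (\<lambda>x. Ham P (\<alpha>, \<beta>, p) x (uh t) (vh t) t) (xh t)) \<and>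
     p 0 = - grad (\<lambda>x0. ell P (\<alpha>, \<beta>, p) (x0, xh (horizon P))) (xh 0) \<and>
     p (horizon P) = grad (\<lambda>xT. ell P (\<alpha>, \<beta>, p) (xh 0, xT)) (xh (horizon P)) \<and>
     (AE t in lebesgue_on {0..horizon P}.
        grad (\<lambda>u. Ham P (\<alpha>, \<beta>, p) (xh t) u (vh t) t) (uh t) = 0) \<and>
     (AE t in lebesgue_on {0..horizon P}.
        grad (\<lambda>v. Ham P (\<alpha>, \<beta>, p) (xh t) (uh t) v t) (vh t) = 0)})"

section \<open>Second variation\<close>

definition W2 :: "real \<Rightarrow> ('n::finite, 'l::finite, 'm::finite) traj set" where
  "W2 T = W12 T \<times> L2 T \<times> L2 T"

definition W2_norm :: "real \<Rightarrow> ('n::finite, 'l::finite, 'm::finite) traj \<Rightarrow> real" where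
  "W2_norm T = (\<lambda>(x, u, v). sqrt ((L2_norm T x)\<^sup>2 + (L2_norm T (wderiv T x))\<^sup>2
                                   + (L2_norm T u)\<^sup>2 + (L2_norm T v)\<^sup>2))"

definition W2_dual :: "real \<Rightarrow> (('n::finite, 'l::finite, 'm::finite) traj \<Rightarrow> real) set" where
  "W2_dual T = {L.
     (\<forall>(x, u, v) \<in> W2 T. \<forall>(y, r, s) \<in> W2 T.
        L (\<lambda>t. x t + y t, \<lambda>t. u t + r t, \<lambda>t. v t + s t) = L (x, u, v) + L (y, r, s)) \<and>
     (\<forall>(x, u, v) \<in> W2 T. \<forall>c.
        L (\<lambda>t. c *\<^sub>R x t, \<lambda>t. c *\<^sub>R u t, \<lambda>t. c *\<^sub>R v t) = c * L (x, u, v)) \<and>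
     (\<exists>C. \<forall>w \<in> W2 T. \<bar>L w\<bar> \<le> C * W2_norm T w)}"

definition weakly_converges :: "real \<Rightarrow> (nat \<Rightarrow> ('n::finite, 'l::finite, 'm::finite) traj)
    \<Rightarrow> ('n, 'l, 'm) traj \<Rightarrow> bool" where
  "weakly_converges T ws w \<longleftrightarrow> (\<forall>L \<in> W2_dual T. (\<lambda>k. L (ws k)) \<longlonglongrightarrow> L w)"

text \<open>Weak lower semicontinuity is understood sequentially, as usual in the calculus of
  variations. Lower semicontinuity in the weak topology is strictly stronger, even for
  continuous quadratic forms.\<close>

definition weakly_lsc_on :: "real \<Rightarrow> ('n::finite, 'l::finite, 'm::finite) traj set
    \<Rightarrow> (('n, 'l, 'm) traj \<Rightarrow> real) \<Rightarrow> bool" where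
  "weakly_lsc_on T S J \<longleftrightarrow>
     (\<forall>ws. \<forall>w\<in>S. (\<forall>k. ws k \<in> S) \<longrightarrow> weakly_converges T ws w \<longrightarrow>
        ereal (J w) \<le> liminf (\<lambda>k. ereal (J (ws k))))"

definition H2 :: "('n::finite, 'l::finite, 'm::finite) ocp \<Rightarrow> ('n, 'l, 'm) traj
    \<Rightarrow> ('n, 'l, 'm) traj set" where
  "H2 P = (\<lambda>(xh, uh, vh). {(x, u, v) \<in> W2 (horizon P).
     AE t in lebesgue_on {0..horizon P}.
       wderiv (horizon P) x t
         = frechet_derivative (\<lambda>y. dyn P y (uh t) (vh t)) (at (xh t)) (x t)
         + frechet_derivative (\<lambda>r. dyn P (xh t) r (vh t)) (at (uh t)) (u t)
         + frechet_derivative (\<lambda>s. dyn P (xh t) (uh t) s) (at (vh t)) (v t)})"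

definition Omega :: "('n::finite, 'l::finite, 'm::finite) ocp \<Rightarrow> ('n, 'l, 'm) traj
    \<Rightarrow> 'n multiplier \<Rightarrow> ('n, 'l, 'm) traj \<Rightarrow> real" where
  "Omega P = (\<lambda>(xh, uh, vh) lam (x, u, v).
     1/2 * D2 (ell P lam) (xh 0, xh (horizon P)) (x 0, x (horizon P)) (x 0, x (horizon P))
     + (LINT t|lebesgue_on {0..horizon P}.
          1/2 * D2 (\<lambda>y. Ham P lam y (uh t) (vh t) t) (xh t) (x t) (x t)
          + Dmix (\<lambda>r y. Ham P lam y r (vh t) t) (uh t) (xh t) (u t) (x t)
          + Dmix (\<lambda>s y. Ham P lam y (uh t) s t) (vh t) (xh t) (v t) (x t)
          + 1/2 * D2 (\<lambda>r. Ham P lam (xh t) r (vh t) t) (uh t) (u t) (u t)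
          + Dmix (\<lambda>s r. Ham P lam (xh t) r s t) (vh t) (uh t) (v t) (u t)))"

definition Lambda_sharp :: "('n::finite, 'l::finite, 'm::finite) ocp \<Rightarrow> ('n, 'l, 'm) traj
    \<Rightarrow> 'n multiplier set" where
  "Lambda_sharp P wh =
     {lam \<in> Lambda P wh. weakly_lsc_on (horizon P) (H2 P wh) (Omega P wh lam)}"

definition critical_cone :: "('n::finite, 'l::finite, 'm::finite) ocp \<Rightarrow> ('n, 'l, 'm) traj
    \<Rightarrow> ('n, 'l, 'm) traj set" where
  "critical_cone P = (\<lambda>(xh, uh, vh). {(x, u, v) \<in> H2 P (xh, uh, vh).
     (\<forall>j\<in>{1..deta P}. frechet_derivative (eta P j) (at (xh 0, xh (horizon P)))
                         (x 0, x (horizon P)) = 0) \<and>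
     (\<forall>i\<in>{0..dphi P}. frechet_derivative (phi P i) (at (xh 0, xh (horizon P)))
                         (x 0, x (horizon P)) \<le> 0)})"

end

(* The endpoint constraints are functions of a perturbation h of the initial state and of the
   bounded control. Restricted to a finite-dimensional family of perturbations, a penalty argument
   yields, without any constraint qualification, a unit multiplier that annihilates the first
   derivative, is nonnegative on the given critical direction, and whose quadratic form is not
   negative definite on any (K+1)-tuple of directions, K being the number of endpoint functions.
   By compactness one multiplier works for all bounded directions and, by density, for the square
   integrable ones. Its form has finite negative index, so it is bounded below by minus a finite sum
   of squares of linear functionals; this makes it weakly lower semicontinuous, i.e. the multiplier
   belongs to Lambda_sharp. Weakly convergent sequences being bounded, the set of normalized weakly
   lower semicontinuous multipliers is compact, so the maximum is attained. *)

theory Submission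
  imports Defs "HOL-Library.Function_Algebras"
begin

section \<open>Second-order necessary conditions in finite dimensions\<close>

text \<open>Without a constraint qualification the first derivatives of the endpoint functions may
  be linearly dependent. At nearby points their rank can be larger, so the common kernel there can
  be smaller than at the reference, and a second-order condition on the nearby kernels does not pass
  to the limit kernel. What survives is a dimension count: among the combinations of any K+1
  directions, K linear equations have a unit solution, and unit coefficient vectors converge along a
  subsequence. This is why the conditions speak of (K+1)-tuples, and why the limit form has negative
  index at most K. The critical direction enters as the centre s e_0 of the penalized problem, posed
  on a box whose size is proportional to R. The choice s = R^2 balances the second-order terms, of
  order s^2, against the quadratic weight acting at distance R: that weight tends to 0, and its
  positivity fixes the sign of the form on the critical direction. The multiplier found this way
  depends on the direction, and so the conclusion is a maximum over multipliers.\<close>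

instantiation "fun" :: (type, real_vector) real_vector
begin

text \<open>Coefficient sequences, as well as pairs of an initial value and a control, thereby
  become vectors. Equality in this space is pointwise on the whole line and not almost
  everywhere.\<close>

definition scaleR_fun :: "real \<Rightarrow> ('a \<Rightarrow> 'b) \<Rightarrow> 'a \<Rightarrow> 'b"
  where "scaleR_fun r f = (\<lambda>x. r *\<^sub>R f x)"

instance
  by standard (auto simp: scaleR_fun_def fun_eq_iff algebra_simps)

end

lemma scaleR_fun_apply [simp]: "(r *\<^sub>R f) x = r *\<^sub>R f x"
  by (simp add: scaleR_fun_def)

lemma sum_fun_apply: "(\<Sum>i\<in>A. f i) x = (\<Sum>i\<in>A. f i x)"
  for f :: "'i \<Rightarrow> 'a \<Rightarrow> 'b::real_vector"
  by (induction A rule: infinite_finite_induct) auto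

section \<open>Compactness and linear systems in finite dimensions\<close>

definition unit_seq :: "nat \<Rightarrow> nat \<Rightarrow> real"
  where "unit_seq j = (\<lambda>i. if i = j then 1 else 0)"

text \<open>R^k is modelled inside \<open>nat \<Rightarrow> real\<close> because the number of
  directions varies within one proof and cannot be a type. On sequences that vanish from index k on,
  the product topology is the usual one, and Tychonoff supplies compactness.\<close>

definition nbox :: "nat \<Rightarrow> real \<Rightarrow> (nat \<Rightarrow> real) set"
  where "nbox k r = {c. (\<forall>j<k. \<bar>c j\<bar> \<le> r) \<and> (\<forall>j\<ge>k. c j = 0)}"

definition vsupp :: "nat \<Rightarrow> (nat \<Rightarrow> real) set"
  where "vsupp k = {c. \<forall>j\<ge>k. c j = 0}"

definition usphere :: "nat \<Rightarrow> (nat \<Rightarrow> real) set"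
  where "usphere N = {a. (\<forall>m\<ge>N. a m = 0) \<and> (\<Sum>m<N. (a m)\<^sup>2) = 1}"

lemma compact_nat_box: "compact {c::nat \<Rightarrow> real. \<forall>j. a j \<le> c j \<and> c j \<le> b j}"
proof -
  have "{c::nat \<Rightarrow> real. \<forall>j. a j \<le> c j \<and> c j \<le> b j} = PiE UNIV (\<lambda>j. {a j..b j})"
    by (auto simp: PiE_def Pi_def)
  moreover have "compactin (product_topology (\<lambda>i. euclidean) UNIV) (PiE UNIV (\<lambda>j. {a j..b j::real}))"
    by (subst compactin_PiE) auto
  ultimately show ?thesis
    by (simp add: euclidean_product_topology)
qed

lemma continuous_on_coord [continuous_intros]: "continuous_on S (\<lambda>c::nat \<Rightarrow> real. c j)"
  by (rule continuous_on_product_then_coordinatewise) (rule continuous_on_id)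

lemma compact_usphere: "compact (usphere N)"
proof -
  let ?B = "{c::nat \<Rightarrow> real. \<forall>j. (if j < N then -1 else 0) \<le> c j \<and> c j \<le> (if j < N then 1 else 0)}"
  let ?S = "{a::nat \<Rightarrow> real. (\<Sum>m<N. (a m)\<^sup>2) = 1}"
  have "a \<in> ?B \<inter> ?S" if a: "a \<in> usphere N" for a
  proof -
    have "\<bar>a j\<bar> \<le> 1" if "j < N" for j
    proof -
      have "(a j)\<^sup>2 \<le> (\<Sum>m<N. (a m)\<^sup>2)"
        using that by (intro member_le_sum) auto
      also have "\<dots> = 1" using a by (simp add: usphere_def)
      finally show ?thesis by (simp add: abs_square_le_1)
    qed
    moreover have "a j = 0" if "\<not> j < N" for j
      using a that by (simp add: usphere_def)
    ultimately have **: "(if j < N then -1 else 0) \<le> a j \<and> a j \<le> (if j < N then 1 else 0)" for j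
      apply -
      subgoal premises p using p(1)[of j] p(2)[of j]
      by (auto simp: abs_real_def split: if_splits)
      done
    have "a \<in> ?S" using a by (simp add: usphere_def)
    then show ?thesis using ** by blast
  qed
  moreover have "a \<in> usphere N" if "a \<in> ?B \<inter> ?S" for a
  proof -
    have "a m = 0" if "m \<ge> N" for m
    proof -
      have "\<forall>m. (if m < N then -1 else 0) \<le> a m \<and> a m \<le> (if m < N then 1 else 0)"
        using \<open>a \<in> ?B \<inter> ?S\<close> by blast
      from this[rule_format, of m] show ?thesis using that by simp
    qed
    then show ?thesis using that by (simp add: usphere_def)
  qed
  ultimately have "usphere N = ?B \<inter> ?S"
    by blast
  moreover have "closed ?S"
    by (rule closed_Collect_eq) (intro continuous_on_sum continuous_on_power continuous_on_coord continuous_on_const)+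
  ultimately show ?thesis
    using compact_Int_closed[OF compact_nat_box[of "\<lambda>j. if j < N then -1 else 0" "\<lambda>j. if j < N then 1 else 0"]]
    by simp
qed

lemma tendsto_coord: "(f \<longlongrightarrow> l) F \<Longrightarrow> ((\<lambda>n. f n j) \<longlongrightarrow> l j) F" for l :: "nat \<Rightarrow> real"
  using continuous_on_tendsto_compose[OF continuous_on_coord[of UNIV j]] by auto

lemma usphere_convergent_subseq:
  assumes "\<And>n::nat. a n \<in> usphere N"
  obtains r l where "strict_mono (r :: nat \<Rightarrow> nat)" "l \<in> usphere N" "\<And>j. (\<lambda>n. a (r n) j) \<longlonglongrightarrow> l j"
proof -
  have "seq_compact (usphere N)"
    using compact_usphere compact_imp_seq_compact by blast
  then obtain l r where "l \<in> usphere N" "strict_mono r" "(a \<circ> r) \<longlonglongrightarrow> l"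
    using assms unfolding seq_compact_def by metis
  then show ?thesis
    using that[of r l] tendsto_coord[of "a \<circ> r" l] by (auto simp: o_def)
qed

text \<open>Gaussian elimination by induction on the number of equations: if the last equation is
  not trivial, an unknown occurring in it is eliminated, so that one equation and one unknown
  disappear together.\<close>

lemma homogeneous_system:
  fixes M :: "nat \<Rightarrow> nat \<Rightarrow> real"
  assumes "finite S" "K < card S"
  shows "\<exists>a. (\<exists>m\<in>S. a m \<noteq> 0) \<and> (\<forall>i<K. (\<Sum>m\<in>S. M i m * a m) = 0)"
  using assms
proof (induction K arbitrary: S M)
  case 0
  then show ?case by (intro exI[of _ "\<lambda>_. 1"]) (auto simp: card_gt_0_iff)
next
  case (Suc K)
  show ?case
  proof (cases "\<forall>m\<in>S. M K m = 0")
    case True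
    obtain a where "(\<exists>m\<in>S. a m \<noteq> 0)" "\<forall>i<K. (\<Sum>m\<in>S. M i m * a m) = 0"
      using Suc.IH[of S M] Suc.prems by auto
    with True show ?thesis by (intro exI[of _ a]) (auto simp: less_Suc_eq)
  next
    case False
    then obtain m0 where m0: "m0 \<in> S" "M K m0 \<noteq> 0" by auto
    let ?S = "S - {m0}"
    \<comment> \<open>The system left after the last equation has been used to eliminate
      \<open>m0\<close>; \<open>a0\<close> below recovers that unknown.\<close>
    let ?M = "\<lambda>i m. M i m - M i m0 * M K m / M K m0"
    have "K < card ?S" using Suc.prems m0 by (simp add: card_Diff_singleton)
    then obtain a where a: "\<exists>m\<in>?S. a m \<noteq> 0" "\<forall>i<K. (\<Sum>m\<in>?S. ?M i m * a m) = 0"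
      using Suc.IH[of ?S ?M] Suc.prems by auto
    define a0 where "a0 = - (\<Sum>m\<in>?S. M K m * a m) / M K m0"
    let ?a = "\<lambda>m. if m = m0 then a0 else a m"
    have split: "(\<Sum>m\<in>S. M i m * ?a m) = M i m0 * a0 + (\<Sum>m\<in>?S. M i m * a m)" for i
    proof -
      have "(\<Sum>m\<in>S. M i m * ?a m) = M i m0 * ?a m0 + (\<Sum>m\<in>?S. M i m * ?a m)"
        using Suc.prems m0 by (intro sum.remove) auto
      also have "(\<Sum>m\<in>?S. M i m * ?a m) = (\<Sum>m\<in>?S. M i m * a m)"
        by (intro sum.cong) auto
      finally show ?thesis by simp
    qed
    have "(\<Sum>m\<in>S. M i m * ?a m) = 0" if "i < Suc K" for i
    proof (cases "i = K")
      case True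
      then show ?thesis unfolding split using m0 by (simp add: a0_def)
    next
      case False
      then have "(\<Sum>m\<in>?S. ?M i m * a m) = 0" using a that by auto
      moreover have "(\<Sum>m\<in>?S. ?M i m * a m) = (\<Sum>m\<in>?S. M i m * a m) - (M i m0 / M K m0) * (\<Sum>m\<in>?S. M K m * a m)"
        by (simp add: sum_distrib_left sum_subtractf[symmetric] algebra_simps)
      ultimately show ?thesis unfolding split using m0 by (simp add: a0_def field_simps)
    qed
    moreover have "\<exists>m\<in>S. ?a m \<noteq> 0" using a(1) by auto
    ultimately show ?thesis by (intro exI[of _ ?a] conjI allI impI)
  qed
qed

lemma usphere_normalize:
  assumes "\<exists>m<N. a m \<noteq> 0"
  obtains t :: real where "t > 0" "(\<lambda>m. if m < N then t * a m else 0) \<in> usphere N"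
proof -
  have pos: "(\<Sum>m<N. (a m)\<^sup>2) > 0"
  proof -
    obtain m where "m < N" "a m \<noteq> 0" using assms by auto
    then show ?thesis by (intro sum_pos2[of _ m]) auto
  qed
  define t where "t = 1 / sqrt (\<Sum>m<N. (a m)\<^sup>2)"
  have "(\<Sum>m<N. (t * a m)\<^sup>2) = t\<^sup>2 * (\<Sum>m<N. (a m)\<^sup>2)"
    by (simp add: power_mult_distrib sum_distrib_left)
  also have "\<dots> = 1" using pos by (simp add: t_def power_divide)
  finally have "(\<lambda>m. if m < N then t * a m else 0) \<in> usphere N"
    by (auto simp: usphere_def)
  moreover have "t > 0" using pos by (simp add: t_def)
  ultimately show ?thesis using that by blast
qed

lemma homogeneous_system_usphere:
  fixes M :: "nat \<Rightarrow> nat \<Rightarrow> real"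
  obtains a where "a \<in> usphere (Suc K)" "\<And>i. i < K \<Longrightarrow> (\<Sum>m<Suc K. a m * M i m) = 0"
proof -
  obtain a where a: "\<exists>m\<in>{..<Suc K}. a m \<noteq> 0" "\<forall>i<K. (\<Sum>m\<in>{..<Suc K}. M i m * a m) = 0"
    using homogeneous_system[of "{..<Suc K}" K M] by auto
  then obtain t where t: "t > 0" "(\<lambda>m. if m < Suc K then t * a m else 0) \<in> usphere (Suc K)"
    using usphere_normalize[of "Suc K" a] by auto
  have "(\<Sum>m<Suc K. (if m < Suc K then t * a m else 0) * M i m) = t * (\<Sum>m\<in>{..<Suc K}. M i m * a m)" for i
    unfolding sum_distrib_left by (intro sum.cong) auto
  with a t show ?thesis by (intro that[OF t(2)]) (simp)
qed


text \<open>The squared positive part is not twice differentiable. This smooth majorant touches it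
  at d = 0, which is enough to read first and second order conditions off a minimizer of the
  penalty.\<close>

lemma pos_part_square_le:
  fixes y d :: real
  shows "(if P then max (y + d) 0 else y + d)\<^sup>2 \<le> ((if P then max y 0 else y) + d)\<^sup>2"
proof (cases "P \<and> y + d > 0")
  case True
  then have "y + d \<le> max y 0 + d" "0 \<le> y + d" by auto
  then have "(y + d)\<^sup>2 \<le> (max y 0 + d)\<^sup>2" by (intro power_mono) auto
  then show ?thesis using True by auto
qed auto

lemma tendsto_nonneg_affine:
  fixes x :: "nat \<Rightarrow> real"
  assumes "\<And>n. 0 \<le> x n" "x \<longlonglongrightarrow> l"
  shows "0 \<le> l"
  using assms by (meson LIMSEQ_le_const)

text \<open>Index \<open>0\<close> is the cost, the indices below \<open>q\<close> are the cost and the inequality constraints, those from \<open>q\<close> on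
  the equality constraints. The first unit vector is the critical direction under consideration.\<close>

locale expansion =
  fixes k K q :: nat and \<rho> :: real
    and G :: "(nat \<Rightarrow> real) \<Rightarrow> nat \<Rightarrow> real"
    and D1 D2 :: "(nat \<Rightarrow> real) \<Rightarrow> (nat \<Rightarrow> real) \<Rightarrow> nat \<Rightarrow> real"
  assumes q: "0 < q" "q \<le> K" and k: "0 < k" and rho: "0 < \<rho>"
    and cont: "\<And>i. i < K \<Longrightarrow> continuous_on (nbox k \<rho>) (\<lambda>c. G c i)"
    and D1lin: "\<And>c i. i < K \<Longrightarrow> c \<in> nbox k \<rho> \<Longrightarrow> linear (\<lambda>\<xi>. D1 c \<xi> i)"
    and taylor: "\<And>c \<xi> i t. i < K \<Longrightarrow> c \<in> nbox k \<rho> \<Longrightarrow> \<xi> \<in> vsupp k \<Longrightarrow> t \<longlonglongrightarrow> 0 \<Longrightarrow>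
        (\<And>n. t n \<noteq> 0) \<Longrightarrow> (\<And>n. c + t n *\<^sub>R \<xi> \<in> nbox k \<rho>) \<Longrightarrow>
        (\<lambda>n. (G (c + t n *\<^sub>R \<xi>) i - G c i - t n * D1 c \<xi> i) / (t n)\<^sup>2) \<longlonglongrightarrow> D2 c \<xi> i / 2"
    and D1conv: "\<And>c \<xi> i. i < K \<Longrightarrow> \<xi> \<in> vsupp k \<Longrightarrow> (\<And>n::nat. c n \<in> nbox k \<rho>) \<Longrightarrow>
        (\<And>j. (\<lambda>n. c n j) \<longlonglongrightarrow> 0) \<Longrightarrow> (\<lambda>n. D1 (c n) \<xi> i) \<longlonglongrightarrow> D1 0 \<xi> i"
    and D2conv: "\<And>c \<xi> \<xi>' i. i < K \<Longrightarrow> (\<And>n::nat. \<xi> n \<in> vsupp k) \<Longrightarrow> (\<And>n. c n \<in> nbox k \<rho>) \<Longrightarrow>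
        (\<And>j. (\<lambda>n. c n j) \<longlonglongrightarrow> 0) \<Longrightarrow> (\<And>j. (\<lambda>n. \<xi> n j) \<longlonglongrightarrow> \<xi>' j) \<Longrightarrow>
        (\<lambda>n. D2 (c n) (\<xi> n) i) \<longlonglongrightarrow> D2 0 \<xi>' i"
    and G0: "\<And>i. i < K \<Longrightarrow> G 0 i = 0"
    and crit: "\<And>i. i < q \<Longrightarrow> D1 0 (unit_seq 0) i \<le> 0"
      "\<And>i. q \<le> i \<Longrightarrow> i < K \<Longrightarrow> D1 0 (unit_seq 0) i = 0"
    and nomin: "\<And>c. c \<in> nbox k \<rho> \<Longrightarrow> G c 0 < 0 \<Longrightarrow> (\<And>i. i < q \<Longrightarrow> G c i \<le> 0) \<Longrightarrow>
        (\<And>i. q \<le> i \<Longrightarrow> i < K \<Longrightarrow> G c i = 0) \<Longrightarrow> False"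
begin

text \<open>The minimizer of \<open>R\<^sup>2 \<tau> + \<bar>c - s e\<^sub>0\<bar>\<^sup>2\<close> plus \<open>n\<close> times the squared constraint violation of
  \<open>G c + \<kappa> e\<^sub>0 - \<tau> b\<close> over a box, with an artificial variable \<open>\<tau>\<close>. The choice of \<open>b\<close> makes
  \<open>(s e\<^sub>0, 1)\<close> violation-free, while minimality of the origin keeps the violation away from \<open>0\<close> at
  \<open>\<tau> = 0\<close>. Hence \<open>\<tau> > 0\<close>, and stationarity in \<open>\<tau>\<close> makes the residuals nonzero; \<open>\<mu>\<close> is their normalization.\<close>

lemma penalized_minimizer:
  assumes s: "0 < s" "0 < R" "s + 2 * R \<le> \<rho>" "0 < \<kappa>"
    and b: "\<And>i. b i = G (s *\<^sub>R unit_seq 0) i - s * D1 0 (unit_seq 0) i + (if i = 0 then \<kappa> else 0)"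
  obtains c \<mu> w where "c \<in> nbox k \<rho>" "\<mu> \<in> usphere K" "0 < w"
    "w * R\<^sup>2 \<le> 2 * (\<Sum>i<K. \<mu> i * b i)"
    "(\<Sum>j<k. (c j - s * unit_seq 0 j)\<^sup>2) \<le> R\<^sup>2" "\<And>i. i < q \<Longrightarrow> 0 \<le> \<mu> i"
    "\<And>\<xi>. \<xi> \<in> vsupp k \<Longrightarrow> (\<Sum>i<K. \<mu> i * D1 c \<xi> i) = - w * (\<Sum>j<k. (c j - s * unit_seq 0 j) * \<xi> j)"
    "\<And>\<xi>. \<xi> \<in> vsupp k \<Longrightarrow> (\<And>i. i < K \<Longrightarrow> D1 c \<xi> i = 0) \<Longrightarrow>
       - w * (\<Sum>j<k. (\<xi> j)\<^sup>2) \<le> (\<Sum>i<K. \<mu> i * D2 c \<xi> i)"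
proof -
  let ?e = "s *\<^sub>R unit_seq 0"
  define pp where "pp i y = (if i < q then max y 0 else y)" for i and y :: real
  \<comment> \<open>Without \<kappa> the origin would satisfy all constraints at \<tau> = 0. Raising
    the cost by \<kappa> makes a violation-free point at \<tau> = 0 a point that
    \<open>nomin\<close> forbids.\<close>
  define Gt where "Gt c \<tau> i = G c i + (if i = 0 then \<kappa> else 0) - \<tau> * b i" for c \<tau> i
  define D where "D c \<tau> = (\<Sum>i<K. (pp i (Gt c \<tau> i))\<^sup>2)" for c \<tau>
  \<comment> \<open>The half-width is 2 R, while \<open>Qle\<close> puts the minimizer within R of
    the centre. A short step in any direction therefore stays in the box, which is what
    \<open>seq\<close> records.\<close>
  define C0 where "C0 = {c::nat \<Rightarrow> real. \<forall>j. (if j < k then ?e j - 2 * R else 0) \<le> c j \<and> c j \<le> (if j < k then ?e j + 2 * R else 0)}"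
  define Q where "Q c = (\<Sum>j<k. (c j - ?e j)\<^sup>2)" for c :: "nat \<Rightarrow> real"
  have C0iff: "c \<in> C0 \<longleftrightarrow> (\<forall>j<k. \<bar>c j - ?e j\<bar> \<le> 2 * R) \<and> (\<forall>j\<ge>k. c j = 0)" for c
  proof -
    have "(if j < k then ?e j - 2 * R else 0) \<le> c j \<and> c j \<le> (if j < k then ?e j + 2 * R else 0)
      \<longleftrightarrow> (j < k \<longrightarrow> \<bar>c j - ?e j\<bar> \<le> 2 * R) \<and> (j \<ge> k \<longrightarrow> c j = 0)" for j
      by (auto simp: abs_le_iff)
    then show ?thesis unfolding C0_def by blast
  qed
  have C0sub: "C0 \<subseteq> nbox k \<rho>"
  proof
    fix c assume "c \<in> C0"
    then have c: "\<forall>j<k. \<bar>c j - ?e j\<bar> \<le> 2 * R" "\<forall>j\<ge>k. c j = 0" using C0iff by auto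
    have "\<bar>c j\<bar> \<le> \<rho>" if "j < k" for j
    proof -
      have "\<bar>?e j\<bar> \<le> s" using s by (simp add: unit_seq_def)
      with c(1) that s show ?thesis by (smt (verit))
    qed
    then show "c \<in> nbox k \<rho>" using c by (simp add: nbox_def)
  qed
  have compC0: "compact C0"
    unfolding C0_def by (rule compact_nat_box)
  have e_in: "?e \<in> C0" using s k by (auto simp: C0iff unit_seq_def)
  have contG: "continuous_on C0 (\<lambda>c. G c i)" if "i < K" for i
    using cont[OF that] C0sub continuous_on_subset by blast
  have contD: "continuous_on (C0 \<times> {0..1}) (\<lambda>p. D (fst p) (snd p))"
    unfolding D_def Gt_def pp_def
  proof (intro continuous_on_sum continuous_on_power)
    fix i assume i: "i \<in> {..<K}"
    have 1: "continuous_on (C0 \<times> {0..1::real}) (\<lambda>p. G (fst p) i)"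
      by (rule continuous_on_compose2[OF contG[of i]]) (use i in \<open>auto intro: continuous_intros\<close>)
    have 2: "continuous_on (C0 \<times> {0..1::real}) (\<lambda>p. G (fst p) i + (if i = 0 then \<kappa> else 0) - snd p * b i)"
      by (intro continuous_intros 1)
    show "continuous_on (C0 \<times> {0..1::real}) (\<lambda>p. if i < q then max (G (fst p) i + (if i = 0 then \<kappa> else 0) - snd p * b i) 0
           else G (fst p) i + (if i = 0 then \<kappa> else 0) - snd p * b i)"
      using 2 by (cases "i < q") (auto intro!: continuous_on_max continuous_on_const)
  qed
  have D_nonneg: "0 \<le> D c \<tau>" for c \<tau> unfolding D_def by (intro sum_nonneg) auto
  have D0pos: "0 < D c 0" if "c \<in> C0" for c
  proof (rule ccontr)
    assume "\<not> 0 < D c 0"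
    then have "D c 0 = 0" using D_nonneg[of c 0] by linarith
    then have z: "pp i (Gt c 0 i) = 0" if "i < K" for i
      using that by (auto simp: D_def sum_nonneg_eq_0_iff)
    have "G c 0 + \<kappa> \<le> 0" using z[of 0] q by (auto simp: pp_def Gt_def max_def split: if_splits)
    moreover have "G c i \<le> 0" if "i < q" for i
    proof (cases "i = 0")
      case True then show ?thesis using calculation s by simp
    next
      case False then show ?thesis using z[of i] that q by (auto simp: pp_def Gt_def max_def split: if_splits)
    qed
    moreover have "G c i = 0" if "q \<le> i" "i < K" for i
      using z[of i] that q by (auto simp: pp_def Gt_def)
    ultimately show False using nomin[of c] that C0sub s by force
  qed
  have De: "D ?e 1 = 0"
  proof -
    have "pp i (Gt ?e 1 i) = 0" if "i < K" for i
    proof -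
      have "Gt ?e 1 i = s * D1 0 (unit_seq 0) i" by (simp add: Gt_def b)
      then show ?thesis using crit[of i] that s by (auto simp: pp_def max_def mult_le_0_iff mult_less_0_iff)
    qed
    then show ?thesis unfolding D_def by (intro sum.neutral) auto
  qed
  obtain d where d: "d > 0" "\<And>c. c \<in> C0 \<Longrightarrow> d \<le> D c 0"
  proof -
    have "continuous_on C0 (\<lambda>c. D c 0)"
      using continuous_on_compose2[OF contD continuous_on_Pair[OF continuous_on_id continuous_on_const[of C0 "0::real"]]]
      by (simp add: image_subset_iff)
    then obtain c1 where "c1 \<in> C0" "\<forall>c\<in>C0. D c1 0 \<le> D c 0"
      using continuous_attains_inf[OF compC0, of "\<lambda>c. D c 0"] e_in by auto
    then show ?thesis using that[of "D c1 0"] D0pos by auto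
  qed
  \<comment> \<open>\<open>d\<close> bounds the violation at \<tau> = 0 from below, so this weight
    makes the penalty there exceed R^2, the value of the functional at the competitor (s e_0,
    1).\<close>
  define n where "n = R\<^sup>2 / d + 1"
  have n: "n > 0" "n * d > R\<^sup>2"
    using d s by (auto simp: n_def field_simps intro!: add_nonneg_pos)
  define I where "I c \<tau> = R\<^sup>2 * \<tau> + Q c + n * D c \<tau>" for c \<tau>
  have contI: "continuous_on (C0 \<times> {0..1}) (\<lambda>p. I (fst p) (snd p))"
  proof -
    have "continuous_on (C0 \<times> {0..1::real}) (\<lambda>p. fst p j)" for j
      by (rule continuous_on_compose2[OF continuous_on_coord[of C0 j]]) (auto intro: continuous_intros)
    then have "continuous_on (C0 \<times> {0..1::real}) (\<lambda>p. Q (fst p))"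
      unfolding Q_def by (intro continuous_on_sum continuous_on_power continuous_on_diff continuous_on_const)
    then show ?thesis unfolding I_def
      by (intro continuous_on_add continuous_on_mult continuous_on_const contD continuous_on_snd continuous_on_id)
  qed
  have "compact (C0 \<times> {0..1::real})" using compC0 by (intro compact_Times) auto
  moreover have "C0 \<times> {0..1::real} \<noteq> {}" using e_in by auto
  ultimately have "\<exists>p\<in>C0 \<times> {0..1}. \<forall>p'\<in>C0 \<times> {0..1}. I (fst p) (snd p) \<le> I (fst p') (snd p')"
    using contI by (rule continuous_attains_inf)
  then obtain p where p: "p \<in> C0 \<times> {0..1}" "\<And>p'. p' \<in> C0 \<times> {0..1} \<Longrightarrow> I (fst p) (snd p) \<le> I (fst p') (snd p')"
    by blast
  define c \<tau> where "c = fst p" and "\<tau> = snd p"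
  have c: "c \<in> C0" and t: "\<tau> \<in> {0..1}" using p by (auto simp: c_def \<tau>_def)
  have min: "I c \<tau> \<le> I c' \<tau>'" if "c' \<in> C0" "\<tau>' \<in> {0..1}" for c' \<tau>'
    using p(2)[of "(c', \<tau>')"] that by (auto simp: c_def \<tau>_def)
  have Qnn: "0 \<le> Q c'" for c' unfolding Q_def by (intro sum_nonneg) auto
  have Ile: "I c \<tau> \<le> R\<^sup>2"
    using min[OF e_in, of 1] by (simp add: I_def De Q_def)
  have tpos: "\<tau> > 0"
  proof (rule ccontr)
    assume "\<not> \<tau> > 0"
    then have "\<tau> = 0" using t by auto
    then have "n * d \<le> R\<^sup>2" using Ile d(2)[OF c] Qnn[of c] n
      by (simp add: I_def) (smt (verit) mult_left_mono)
    then show False using n by linarith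
  qed
  have Qle: "Q c \<le> R\<^sup>2"
  proof -
    have "0 \<le> R\<^sup>2 * \<tau> + n * D c \<tau>" using tpos D_nonneg n by (intro add_nonneg_nonneg mult_nonneg_nonneg) auto
    then show ?thesis using Ile by (simp add: I_def)
  qed
  define r where "r i = pp i (Gt c \<tau> i)" for i
  have Dle: "(\<Sum>i<K. (pp i (Gt c \<tau> i + y i))\<^sup>2) \<le> D c \<tau> + (\<Sum>i<K. 2 * r i * y i + (y i)\<^sup>2)" for y
  proof -
    have "(\<Sum>i<K. (pp i (Gt c \<tau> i + y i))\<^sup>2) \<le> (\<Sum>i<K. (r i + y i)\<^sup>2)"
      unfolding r_def pp_def by (intro sum_mono pos_part_square_le)
    also have "\<dots> = D c \<tau> + (\<Sum>i<K. 2 * r i * y i + (y i)\<^sup>2)"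
      unfolding D_def sum.distrib[symmetric] r_def by (intro sum.cong) (auto simp: power2_eq_square algebra_simps)
    finally show ?thesis .
  qed
  \<comment> \<open>One-sided stationarity: \<tau> may equal 1, so it is only decreased. The linear
    term R^2 \<tau> then falls with slope R^2, which must not exceed the first-order growth of the
    penalty.\<close>
  have tau_cond: "R\<^sup>2 \<le> 2 * n * (\<Sum>i<K. r i * b i)"
  proof -
    define x where "x m = \<tau> / real (Suc m)" for m
    have x: "0 < x m" "x m \<le> \<tau>" for m using tpos by (auto simp: x_def field_simps)
    have xlim: "x \<longlonglongrightarrow> 0" unfolding x_def
      using LIMSEQ_Suc[OF lim_const_over_n[of \<tau>]] by simp
    have "0 \<le> - R\<^sup>2 + n * (\<Sum>i<K. 2 * r i * b i + x m * (b i)\<^sup>2)" for m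
    proof -
      have "I c \<tau> \<le> I c (\<tau> - x m)" using min[OF c, of "\<tau> - x m"] x[of m] t by auto
      moreover define T where "T = (\<Sum>i<K. 2 * r i * (x m * b i) + (x m * b i)\<^sup>2)"
      have "D c (\<tau> - x m) \<le> D c \<tau> + T"
        using Dle[of "\<lambda>i. x m * b i"] by (simp add: D_def Gt_def T_def algebra_simps)
      then have "n * D c (\<tau> - x m) \<le> n * D c \<tau> + n * T"
        using mult_left_mono[of "D c (\<tau> - x m)" "D c \<tau> + T" n] n by (simp add: distrib_left)
      ultimately have "0 \<le> - R\<^sup>2 * x m + n * T"
        by (simp add: I_def right_diff_distrib)
      then have "0 \<le> - R\<^sup>2 * x m + n * (\<Sum>i<K. 2 * r i * (x m * b i) + (x m * b i)\<^sup>2)"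
        unfolding T_def .
      also have "(\<Sum>i<K. 2 * r i * (x m * b i) + (x m * b i)\<^sup>2) = x m * (\<Sum>i<K. 2 * r i * b i + x m * (b i)\<^sup>2)"
        unfolding sum_distrib_left by (intro sum.cong) (auto simp: power2_eq_square algebra_simps)
      finally have "0 \<le> x m * (- R\<^sup>2 + n * (\<Sum>i<K. 2 * r i * b i + x m * (b i)\<^sup>2))" by (simp add: algebra_simps)
      then show ?thesis using x[of m] by (simp add: zero_le_mult_iff)
    qed
    moreover have "(\<lambda>m. - R\<^sup>2 + n * (\<Sum>i<K. 2 * r i * b i + x m * (b i)\<^sup>2)) \<longlonglongrightarrow>
        - R\<^sup>2 + n * (\<Sum>i<K. 2 * r i * b i + 0 * (b i)\<^sup>2)"
      by (intro tendsto_intros xlim)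
    ultimately have "0 \<le> - R\<^sup>2 + n * (\<Sum>i<K. 2 * r i * b i + 0 * (b i)\<^sup>2)"
      by (rule tendsto_nonneg_affine)
    then show ?thesis by (simp add: sum_distrib_left algebra_simps)
  qed
  define nr where "nr = sqrt (\<Sum>i<K. (r i)\<^sup>2)"
  have nr: "nr > 0"
  proof (rule ccontr)
    assume "\<not> nr > 0"
    then have "(\<Sum>i<K. (r i)\<^sup>2) = 0"
      unfolding nr_def by (metis real_sqrt_gt_0_iff sum_nonneg zero_le_power2 less_eq_real_def)
    then have "r i = 0" if "i < K" for i using that by (auto simp: sum_nonneg_eq_0_iff)
    then have "(\<Sum>i<K. r i * b i) = 0" by (intro sum.neutral) auto
    then show False using tau_cond s by auto
  qed
  define \<mu> where "\<mu> i = (if i < K then r i / nr else 0)" for i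
  \<comment> \<open>Division by n times the length of the residual vector gives the stationarity
    relations a unit multiplier; \<open>w\<close> is the weight left on the distance to s
    e_0.\<close>
  define w where "w = 1 / (n * nr)"
  have w: "w > 0" using n nr by (simp add: w_def)
  have rl: "(\<Sum>i<K. \<mu> i * y i) = (\<Sum>i<K. r i * y i) / nr" for y
    unfolding sum_divide_distrib by (intro sum.cong) (auto simp: \<mu>_def)
  have mu_in: "\<mu> \<in> usphere K"
  proof -
    have "(\<Sum>i<K. (\<mu> i)\<^sup>2) = (\<Sum>i<K. (r i)\<^sup>2) / nr\<^sup>2"
      unfolding sum_divide_distrib by (intro sum.cong) (auto simp: \<mu>_def power_divide)
    also have "nr\<^sup>2 = (\<Sum>i<K. (r i)\<^sup>2)" unfolding nr_def by (intro real_sqrt_pow2 sum_nonneg) auto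
    finally have "(\<Sum>i<K. (\<mu> i)\<^sup>2) = 1" using nr unfolding nr_def by auto
    then show ?thesis by (simp add: usphere_def \<mu>_def)
  qed
  have cb: "c \<in> nbox k \<rho>" using c C0sub by auto
  have seq: "\<exists>x. (\<forall>m. x m > 0 \<and> c + x m *\<^sub>R \<xi> \<in> C0) \<and> x \<longlonglongrightarrow> 0" if xi: "\<xi> \<in> vsupp k" for \<xi>
  proof -
    define S where "S = 1 + (\<Sum>j<k. \<bar>\<xi> j\<bar>)"
    have S: "S > 0" unfolding S_def by (intro add_pos_nonneg sum_nonneg) auto
    define x where "x m = (R / S) / real (Suc m)" for m
    have "x \<longlonglongrightarrow> 0" unfolding x_def using LIMSEQ_Suc[OF lim_const_over_n[of "R / S"]] by simp
    moreover have xpos: "x m > 0" for m using S s by (simp add: x_def)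
    moreover have "c + x m *\<^sub>R \<xi> \<in> C0" for m
    proof -
      have "\<bar>c j + x m * \<xi> j - ?e j\<bar> \<le> 2 * R" if "j < k" for j
      proof -
        have "(c j - ?e j)\<^sup>2 \<le> Q c" unfolding Q_def using that by (intro member_le_sum) auto
        then have "\<bar>c j - ?e j\<bar> \<le> R" using Qle s by (meson abs_le_square_iff abs_of_pos order_trans power2_le_iff_abs_le less_imp_le)
        moreover have "\<bar>x m * \<xi> j\<bar> \<le> R"
        proof -
          have "\<bar>\<xi> j\<bar> \<le> (\<Sum>j<k. \<bar>\<xi> j\<bar>)" using that by (intro member_le_sum) auto
          then have "\<bar>\<xi> j\<bar> \<le> S" by (simp add: S_def)
          moreover have "x m \<le> R / S"
            using S s divide_left_mono[of 1 "real (Suc m)" "R / S"] by (simp add: x_def)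
          ultimately have "x m * \<bar>\<xi> j\<bar> \<le> R / S * S" using S s xpos[of m] by (intro mult_mono) auto
          then show ?thesis using S xpos[of m] by (simp add: abs_mult)
        qed
        ultimately show ?thesis by linarith
      qed
      then show ?thesis using c xi by (auto simp: C0iff vsupp_def)
    qed
    ultimately show ?thesis by (intro exI[of _ x]) auto
  qed
  have quad: "Q (c + x *\<^sub>R \<xi>) = Q c + 2 * x * (\<Sum>j<k. (c j - ?e j) * \<xi> j) + x\<^sup>2 * (\<Sum>j<k. (\<xi> j)\<^sup>2)" for x \<xi>
    unfolding Q_def sum_distrib_left sum.distrib[symmetric]
    by (intro sum.cong) (auto simp: power2_eq_square algebra_simps)
  \<comment> \<open>Comparison with another point of the box at the same \<tau>. The positive parts
    are replaced by the smooth majorant \<open>Dle\<close>, so both orders of stationarity follow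
    from this one inequality.\<close>
  have step: "0 \<le> n * (\<Sum>i<K. 2 * r i * y i + (y i)\<^sup>2) + 2 * x * (\<Sum>j<k. (c j - ?e j) * \<xi> j) + x\<^sup>2 * (\<Sum>j<k. (\<xi> j)\<^sup>2)"
    if "c + x *\<^sub>R \<xi> \<in> C0" "y = (\<lambda>i. G (c + x *\<^sub>R \<xi>) i - G c i)" for x \<xi> y
  proof -
    have "I c \<tau> \<le> I (c + x *\<^sub>R \<xi>) \<tau>" using min[OF that(1), of \<tau>] t by auto
    moreover define T where "T = (\<Sum>i<K. 2 * r i * y i + (y i)\<^sup>2)"
    have "D (c + x *\<^sub>R \<xi>) \<tau> \<le> D c \<tau> + T"
    proof -
      have eq: "Gt (c + x *\<^sub>R \<xi>) \<tau> i = Gt c \<tau> i + y i" for i by (simp add: Gt_def that(2))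
      show ?thesis using Dle[of y] unfolding eq[symmetric] by (simp add: D_def T_def)
    qed
    then have "n * D (c + x *\<^sub>R \<xi>) \<tau> \<le> n * D c \<tau> + n * T"
      using mult_left_mono[of "D (c + x *\<^sub>R \<xi>) \<tau>" "D c \<tau> + T" n] n by (simp add: distrib_left)
    ultimately show ?thesis unfolding T_def[symmetric] using quad[of x \<xi>] by (simp add: I_def)
  qed
  have first_ineq: "0 \<le> 2 * n * (\<Sum>i<K. r i * D1 c \<xi> i) + 2 * (\<Sum>j<k. (c j - ?e j) * \<xi> j)"
    if xi: "\<xi> \<in> vsupp k" for \<xi>
  proof -
    obtain x where x: "\<And>m. x m > 0" "\<And>m. c + x m *\<^sub>R \<xi> \<in> C0" "x \<longlonglongrightarrow> 0"
      using seq[OF xi] by auto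
    define y where "y m i = (G (c + x m *\<^sub>R \<xi>) i - G c i) / x m" for m i
    have ylim: "(\<lambda>m. y m i) \<longlonglongrightarrow> D1 c \<xi> i" if "i < K" for i
    proof -
      have x0: "x m \<noteq> 0" and xin: "c + x m *\<^sub>R \<xi> \<in> nbox k \<rho>" for m using x(1,2)[of m] C0sub by auto
      have "(\<lambda>m. x m * ((G (c + x m *\<^sub>R \<xi>) i - G c i - x m * D1 c \<xi> i) / (x m)\<^sup>2) + D1 c \<xi> i) \<longlonglongrightarrow> 0 * (D2 c \<xi> i / 2) + D1 c \<xi> i"
        by (intro tendsto_intros x taylor[OF that cb xi] x0 xin)
      moreover have "x m * ((G (c + x m *\<^sub>R \<xi>) i - G c i - x m * D1 c \<xi> i) / (x m)\<^sup>2) + D1 c \<xi> i = y m i" for m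
        using x(1)[of m] by (simp add: y_def field_simps power2_eq_square)
      ultimately show ?thesis by simp
    qed
    have "0 \<le> n * (\<Sum>i<K. 2 * r i * y m i + x m * (y m i)\<^sup>2) + 2 * (\<Sum>j<k. (c j - ?e j) * \<xi> j) + x m * (\<Sum>j<k. (\<xi> j)\<^sup>2)" for m
    proof -
      have "0 \<le> n * (\<Sum>i<K. 2 * r i * (x m * y m i) + (x m * y m i)\<^sup>2) + 2 * x m * (\<Sum>j<k. (c j - ?e j) * \<xi> j) + (x m)\<^sup>2 * (\<Sum>j<k. (\<xi> j)\<^sup>2)"
        using x(1)[of m] by (intro step x) (auto simp: y_def fun_eq_iff)
      also have "(\<Sum>i<K. 2 * r i * (x m * y m i) + (x m * y m i)\<^sup>2) = x m * (\<Sum>i<K. 2 * r i * y m i + x m * (y m i)\<^sup>2)"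
        unfolding sum_distrib_left by (intro sum.cong) (auto simp: power2_eq_square algebra_simps)
      finally have "0 \<le> x m * (n * (\<Sum>i<K. 2 * r i * y m i + x m * (y m i)\<^sup>2) + 2 * (\<Sum>j<k. (c j - ?e j) * \<xi> j) + x m * (\<Sum>j<k. (\<xi> j)\<^sup>2))"
        by (simp add: power2_eq_square algebra_simps)
      then show ?thesis using x(1)[of m] by (simp add: zero_le_mult_iff)
    qed
    moreover have "(\<lambda>m. n * (\<Sum>i<K. 2 * r i * y m i + x m * (y m i)\<^sup>2) + 2 * (\<Sum>j<k. (c j - ?e j) * \<xi> j) + x m * (\<Sum>j<k. (\<xi> j)\<^sup>2))
      \<longlonglongrightarrow> n * (\<Sum>i<K. 2 * r i * D1 c \<xi> i + 0 * (D1 c \<xi> i)\<^sup>2) + 2 * (\<Sum>j<k. (c j - ?e j) * \<xi> j) + 0 * (\<Sum>j<k. (\<xi> j)\<^sup>2)"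
      by (intro tendsto_intros x ylim) auto
    ultimately have "0 \<le> n * (\<Sum>i<K. 2 * r i * D1 c \<xi> i + 0 * (D1 c \<xi> i)\<^sup>2) + 2 * (\<Sum>j<k. (c j - ?e j) * \<xi> j) + 0 * (\<Sum>j<k. (\<xi> j)\<^sup>2)"
      by (rule tendsto_nonneg_affine)
    then show ?thesis by (simp add: sum_distrib_left algebra_simps)
  qed
  have first: "n * (\<Sum>i<K. r i * D1 c \<xi> i) = - (\<Sum>j<k. (c j - ?e j) * \<xi> j)" if xi: "\<xi> \<in> vsupp k" for \<xi>
  proof -
    have "- \<xi> \<in> vsupp k" using xi by (auto simp: vsupp_def)
    define A B where "A = (\<Sum>i<K. r i * D1 c \<xi> i)" and "B = (\<Sum>j<k. (c j - ?e j) * \<xi> j)"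
    have "(\<Sum>i<K. r i * D1 c (- \<xi>) i) = - A"
      unfolding A_def sum_negf[symmetric]
      by (intro sum.cong) (use linear_neg[OF D1lin[OF _ cb]] in auto)
    moreover have "(\<Sum>j<k. (c j - ?e j) * (- \<xi>) j) = - B"
      unfolding B_def sum_negf[symmetric] by (intro sum.cong) auto
    ultimately have "0 \<le> 2 * n * (- A) + 2 * (- B)"
      using first_ineq[OF \<open>- \<xi> \<in> vsupp k\<close>] by metis
    moreover have "0 \<le> 2 * n * A + 2 * B" using first_ineq[OF xi] by (simp only: A_def B_def)
    ultimately have "n * A = - B" by (simp add: mult.commute)
    then show ?thesis by (simp only: A_def B_def)
  qed
  have second: "- (\<Sum>j<k. (\<xi> j)\<^sup>2) \<le> n * (\<Sum>i<K. r i * D2 c \<xi> i)"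
    if xi: "\<xi> \<in> vsupp k" and ker: "\<And>i. i < K \<Longrightarrow> D1 c \<xi> i = 0" for \<xi>
  proof -
    obtain x where x: "\<And>m. x m > 0" "\<And>m. c + x m *\<^sub>R \<xi> \<in> C0" "x \<longlonglongrightarrow> 0"
      using seq[OF xi] by auto
    define y where "y m i = (G (c + x m *\<^sub>R \<xi>) i - G c i) / (x m)\<^sup>2" for m i
    have ylim: "(\<lambda>m. y m i) \<longlonglongrightarrow> D2 c \<xi> i / 2" if "i < K" for i
    proof -
      have x0: "x m \<noteq> 0" and xin: "c + x m *\<^sub>R \<xi> \<in> nbox k \<rho>" for m using x(1,2)[of m] C0sub by auto
      show ?thesis using taylor[OF that cb xi x(3) x0 xin] ker[OF that] by (simp add: y_def)
    qed
    \<comment> \<open>On directions killed by all first derivatives, first-order stationarity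
      removes the linear term of the distance as well, so the inequality can be divided by the
      square of the step.\<close>
    have dot: "(\<Sum>j<k. (c j - ?e j) * \<xi> j) = 0"
    proof -
      have "(\<Sum>i<K. r i * D1 c \<xi> i) = 0" using ker by (intro sum.neutral) auto
      then show ?thesis using first[OF xi] by simp
    qed
    have "0 \<le> n * (\<Sum>i<K. 2 * r i * y m i + (x m)\<^sup>2 * (y m i)\<^sup>2) + (\<Sum>j<k. (\<xi> j)\<^sup>2)" for m
    proof -
      have "0 \<le> n * (\<Sum>i<K. 2 * r i * ((x m)\<^sup>2 * y m i) + ((x m)\<^sup>2 * y m i)\<^sup>2) + 2 * x m * (\<Sum>j<k. (c j - ?e j) * \<xi> j) + (x m)\<^sup>2 * (\<Sum>j<k. (\<xi> j)\<^sup>2)"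
        using x(1)[of m] by (intro step x) (auto simp: y_def fun_eq_iff)
      also have "(\<Sum>i<K. 2 * r i * ((x m)\<^sup>2 * y m i) + ((x m)\<^sup>2 * y m i)\<^sup>2) = (x m)\<^sup>2 * (\<Sum>i<K. 2 * r i * y m i + (x m)\<^sup>2 * (y m i)\<^sup>2)"
        unfolding sum_distrib_left by (intro sum.cong) (auto simp: power2_eq_square algebra_simps)
      finally have "0 \<le> (x m)\<^sup>2 * (n * (\<Sum>i<K. 2 * r i * y m i + (x m)\<^sup>2 * (y m i)\<^sup>2) + (\<Sum>j<k. (\<xi> j)\<^sup>2))"
        using dot by (simp add: algebra_simps)
      then show ?thesis using x(1)[of m] by (simp add: zero_le_mult_iff)
    qed
    moreover have "(\<lambda>m. n * (\<Sum>i<K. 2 * r i * y m i + (x m)\<^sup>2 * (y m i)\<^sup>2) + (\<Sum>j<k. (\<xi> j)\<^sup>2))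
      \<longlonglongrightarrow> n * (\<Sum>i<K. 2 * r i * (D2 c \<xi> i / 2) + 0\<^sup>2 * (D2 c \<xi> i / 2)\<^sup>2) + (\<Sum>j<k. (\<xi> j)\<^sup>2)"
      by (intro tendsto_intros x ylim) auto
    ultimately have "0 \<le> n * (\<Sum>i<K. 2 * r i * (D2 c \<xi> i / 2) + 0\<^sup>2 * (D2 c \<xi> i / 2)\<^sup>2) + (\<Sum>j<k. (\<xi> j)\<^sup>2)"
      by (rule tendsto_nonneg_affine)
    then show ?thesis by simp
  qed
  have nn: "n * X = Y \<Longrightarrow> X / nr = w * Y" for X Y using n nr by (auto simp: w_def field_simps)
  show ?thesis
  proof (rule that[of c \<mu> w])
    show "c \<in> nbox k \<rho>" by (rule cb)
    show "\<mu> \<in> usphere K" by (rule mu_in)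
    show "0 < w" by (rule w)
    show "w * R\<^sup>2 \<le> 2 * (\<Sum>i<K. \<mu> i * b i)"
      unfolding rl using tau_cond n nr by (simp add: w_def field_simps)
    show "(\<Sum>j<k. (c j - s * unit_seq 0 j)\<^sup>2) \<le> R\<^sup>2" using Qle by (simp add: Q_def)
    show "0 \<le> \<mu> i" if "i < q" for i
      using that nr by (auto simp: \<mu>_def r_def pp_def)
    show "(\<Sum>i<K. \<mu> i * D1 c \<xi> i) = - w * (\<Sum>j<k. (c j - s * unit_seq 0 j) * \<xi> j)" if "\<xi> \<in> vsupp k" for \<xi>
      unfolding rl using nn[OF first[OF that]] by simp
    show "- w * (\<Sum>j<k. (\<xi> j)\<^sup>2) \<le> (\<Sum>i<K. \<mu> i * D2 c \<xi> i)"
      if "\<xi> \<in> vsupp k" "\<And>i. i < K \<Longrightarrow> D1 c \<xi> i = 0" for \<xi>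
      unfolding rl using second[OF that] n nr by (simp add: w_def field_simps)
  qed
qed

text \<open>The penalized minimizers are followed as R tends to 0 with s = R^2. Since b is of order
  s^2 = R^4, the bound on w R^2 by twice the sum of the \<mu> i b i gives w = O(R^2), and the
  perturbation terms disappear in the limit. At each minimizer K+1 directions have a unit
  combination in the kernel of the first derivatives; the limit of these combinations gives the last
  claim.\<close>

lemma multiplier_exists:
  "\<exists>\<mu>\<in>usphere K. (\<forall>i<q. 0 \<le> \<mu> i) \<and> (\<forall>\<xi>\<in>vsupp k. (\<Sum>i<K. \<mu> i * D1 0 \<xi> i) = 0) \<and>
     0 \<le> (\<Sum>i<K. \<mu> i * D2 0 (unit_seq 0) i) \<and>
     (\<forall>J. (\<forall>l<Suc K. J l < k) \<longrightarrow> (\<exists>a\<in>usphere (Suc K).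
        0 \<le> (\<Sum>i<K. \<mu> i * D2 0 (\<Sum>l<Suc K. a l *\<^sub>R unit_seq (J l)) i)))"
proof -
  define x where "x = min 1 (\<rho> / 3)"
  have x: "0 < x" "x \<le> 1" "3 * x \<le> \<rho>" using rho by (auto simp: x_def)
  define R where "R m = x / real (Suc m)" for m
  define s where "s m = (R m)\<^sup>2" for m
  have R: "0 < R m" "R m \<le> x" for m using x by (auto simp: R_def field_simps)
  have s: "0 < s m" for m using R[of m] by (simp add: s_def)
  have sR: "s m + 2 * R m \<le> \<rho>" for m
  proof -
    have "s m \<le> R m * 1" unfolding s_def power2_eq_square using R[of m] x by (intro mult_left_mono) auto
    then show ?thesis using R[of m] x by linarith
  qed
  have Rlim: "R \<longlonglongrightarrow> 0" unfolding R_def using LIMSEQ_Suc[OF lim_const_over_n[of x]] by simp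
  have slim: "s \<longlonglongrightarrow> 0" unfolding s_def using tendsto_power[OF Rlim, of 2] by simp
  \<comment> \<open>The shift \<kappa> = s^3 is of smaller order than s^2, so \<open>\<beta>\<close>
    still converges to half the second derivative along the critical direction.\<close>
  define b where "b m i = G (s m *\<^sub>R unit_seq 0) i - s m * D1 0 (unit_seq 0) i + (if i = 0 then (s m)^3 else 0)" for m i
  define \<beta> where "\<beta> m i = b m i / (s m)\<^sup>2" for m i
  have e0: "unit_seq 0 \<in> vsupp k" using k by (auto simp: vsupp_def unit_seq_def)
  have se0: "s m *\<^sub>R unit_seq 0 \<in> nbox k \<rho>" for m
    using k s[of m] sR[of m] R[of m] rho by (auto simp: nbox_def unit_seq_def)
  have zero_in: "0 \<in> nbox k \<rho>" using rho by (auto simp: nbox_def)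
  have \<beta>lim: "(\<lambda>m. \<beta> m i) \<longlonglongrightarrow> D2 0 (unit_seq 0) i / 2" if "i < K" for i
  proof -
    have s0: "s m \<noteq> 0" and s1: "0 + s m *\<^sub>R unit_seq 0 \<in> nbox k \<rho>" for m using s[of m] se0[of m] by simp_all
    have "(\<lambda>m. (G (0 + s m *\<^sub>R unit_seq 0) i - G 0 i - s m * D1 0 (unit_seq 0) i) / (s m)\<^sup>2 + (if i = 0 then s m else 0))
      \<longlonglongrightarrow> D2 0 (unit_seq 0) i / 2 + (if i = 0 then 0 else 0)"
      by (intro tendsto_add taylor[OF that zero_in e0 slim s0 s1]) (cases "i = 0"; use slim in simp)
    moreover have "(G (0 + s m *\<^sub>R unit_seq 0) i - G 0 i - s m * D1 0 (unit_seq 0) i) / (s m)\<^sup>2 + (if i = 0 then s m else 0) = \<beta> m i" for m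
      using s[of m] by (auto simp: \<beta>_def b_def G0[OF that] field_simps power2_eq_square power3_eq_cube)
    ultimately show ?thesis by simp
  qed
  define good where "good m c \<mu> w \<longleftrightarrow> c \<in> nbox k \<rho> \<and> \<mu> \<in> usphere K \<and> 0 < w \<and>
    w * (R m)\<^sup>2 \<le> 2 * (\<Sum>i<K. \<mu> i * b m i) \<and>
    (\<Sum>j<k. (c j - s m * unit_seq 0 j)\<^sup>2) \<le> (R m)\<^sup>2 \<and> (\<forall>i<q. 0 \<le> \<mu> i) \<and>
    (\<forall>\<xi>\<in>vsupp k. (\<Sum>i<K. \<mu> i * D1 c \<xi> i) = - w * (\<Sum>j<k. (c j - s m * unit_seq 0 j) * \<xi> j)) \<and>
    (\<forall>\<xi>\<in>vsupp k. (\<forall>i<K. D1 c \<xi> i = 0) \<longrightarrow>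
       - w * (\<Sum>j<k. (\<xi> j)\<^sup>2) \<le> (\<Sum>i<K. \<mu> i * D2 c \<xi> i))" for m c \<mu> w
  have "\<exists>c \<mu> w. good m c \<mu> w" for m
    apply (rule penalized_minimizer[OF s[of m] R(1)[of m] sR[of m] zero_less_power[OF s[of m], of 3] b_def[of m]])
    unfolding good_def by blast
  then obtain c0 \<mu>0 w0 where good0: "\<And>m. good m (c0 m) (\<mu>0 m) (w0 m)" by metis
  obtain r \<mu> where r: "strict_mono r" and mu: "\<mu> \<in> usphere K" and mulim: "\<And>j. (\<lambda>m. \<mu>0 (r m) j) \<longlonglongrightarrow> \<mu> j"
    using usphere_convergent_subseq[of \<mu>0 K] good0 unfolding good_def by metis
  define c1 \<mu>1 w1 where "c1 m = c0 (r m)" and "\<mu>1 m = \<mu>0 (r m)" and "w1 m = w0 (r m)" for m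
  have g: "good (r m) (c1 m) (\<mu>1 m) (w1 m)" for m using good0 by (simp add: c1_def \<mu>1_def w1_def)
  have c1: "c1 m \<in> nbox k \<rho>" for m using g by (auto simp: good_def)
  have mul: "(\<lambda>m. \<mu>1 m j) \<longlonglongrightarrow> \<mu> j" for j using mulim by (simp add: \<mu>1_def)
  have sub: "f \<longlonglongrightarrow> l \<Longrightarrow> (\<lambda>m. f (r m)) \<longlonglongrightarrow> l" for f :: "nat \<Rightarrow> real" and l
    using LIMSEQ_subseq_LIMSEQ[OF _ r, of f l] by (simp add: o_def)
  have dlim: "(\<lambda>m. c1 m j - s (r m) * unit_seq 0 j) \<longlonglongrightarrow> 0" if "j < k" for j
  proof (rule Lim_null_comparison)
    show "\<forall>\<^sub>F m in sequentially. norm (c1 m j - s (r m) * unit_seq 0 j) \<le> R (r m)"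
    proof (intro always_eventually allI)
      fix m
      have "(c1 m j - s (r m) * unit_seq 0 j)\<^sup>2 \<le> (\<Sum>j<k. (c1 m j - s (r m) * unit_seq 0 j)\<^sup>2)"
        using that by (intro member_le_sum) auto
      also have "\<dots> \<le> (R (r m))\<^sup>2" using g[of m] by (auto simp: good_def)
      finally show "norm (c1 m j - s (r m) * unit_seq 0 j) \<le> R (r m)"
        using R[of "r m"] by (simp add: abs_le_square_iff[symmetric])
    qed
    show "(\<lambda>m. R (r m)) \<longlonglongrightarrow> 0" by (rule sub[OF Rlim])
  qed
  have clim: "(\<lambda>m. c1 m j) \<longlonglongrightarrow> 0" for j
  proof (cases "j < k")
    case True
    have "(\<lambda>m. (c1 m j - s (r m) * unit_seq 0 j) + s (r m) * unit_seq 0 j) \<longlonglongrightarrow> 0 + 0 * unit_seq 0 j"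
      by (intro tendsto_intros dlim True sub[OF slim])
    then show ?thesis by simp
  next
    case False
    then have "c1 m j = 0" for m using c1[of m] by (simp add: nbox_def)
    then show ?thesis by simp
  qed
  define S where "S m = (\<Sum>i<K. \<mu>1 m i * \<beta> (r m) i)" for m
  have Slim: "S \<longlonglongrightarrow> (\<Sum>i<K. \<mu> i * (D2 0 (unit_seq 0) i / 2))"
    unfolding S_def by (intro tendsto_intros mul sub[OF \<beta>lim]) auto
  have wS: "w1 m \<le> 2 * (R (r m))\<^sup>2 * S m" for m
  proof -
    have "w1 m * (R (r m))\<^sup>2 \<le> 2 * (\<Sum>i<K. \<mu>1 m i * b (r m) i)" using g[of m] by (auto simp: good_def)
    also have "(\<Sum>i<K. \<mu>1 m i * b (r m) i) = (s (r m))\<^sup>2 * S m"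
      unfolding S_def \<beta>_def sum_distrib_left using s[of "r m"] by (intro sum.cong) auto
    finally have "w1 m * (R (r m))\<^sup>2 \<le> (2 * (R (r m))\<^sup>2 * S m) * (R (r m))\<^sup>2"
      by (simp add: s_def power2_eq_square algebra_simps)
    then show ?thesis by (rule mult_right_le_imp_le) (use R[of "r m"] in simp)
  qed
  have wpos: "0 < w1 m" for m using g[of m] by (auto simp: good_def)
  \<comment> \<open>Strict positivity of \<open>w1\<close> fixes the sign here; in the limit this
    becomes nonnegativity on the critical direction.\<close>
  have Snn: "0 \<le> S m" for m
  proof (rule ccontr)
    assume "\<not> 0 \<le> S m"
    then have "2 * (R (r m))\<^sup>2 * S m \<le> 0" by (simp add: mult_nonneg_nonpos)
    then show False using wS[of m] wpos[of m] by linarith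
  qed
  have "(\<lambda>m. 2 * (R (r m))\<^sup>2 * S m) \<longlonglongrightarrow> 0"
    using tendsto_mult[OF tendsto_mult_left[OF tendsto_power[OF sub[OF Rlim], of 2], of 2] Slim] by simp
  then have wlim: "w1 \<longlonglongrightarrow> 0"
    by (rule tendsto_sandwich[OF _ _ tendsto_const, rotated 2])
       (auto intro!: always_eventually intro: wS less_imp_le[OF wpos])
  show ?thesis
  proof (intro bexI[OF _ mu] conjI allI impI ballI)
    show "0 \<le> \<mu> i" if "i < q" for i
    proof (rule tendsto_nonneg_affine[OF _ mul])
      show "0 \<le> \<mu>1 m i" for m using g[of m] that by (auto simp: good_def)
    qed
    show "(\<Sum>i<K. \<mu> i * D1 0 \<xi> i) = 0" if xi: "\<xi> \<in> vsupp k" for \<xi>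
    proof (rule LIMSEQ_unique)
      show "(\<lambda>m. \<Sum>i<K. \<mu>1 m i * D1 (c1 m) \<xi> i) \<longlonglongrightarrow> (\<Sum>i<K. \<mu> i * D1 0 \<xi> i)"
        by (intro tendsto_intros mul D1conv xi c1 clim) auto
      have "(\<lambda>m. - w1 m * (\<Sum>j<k. (c1 m j - s (r m) * unit_seq 0 j) * \<xi> j)) \<longlonglongrightarrow> - 0 * (\<Sum>j<k. 0 * \<xi> j)"
        by (intro tendsto_intros wlim dlim) auto
      moreover have "(\<Sum>i<K. \<mu>1 m i * D1 (c1 m) \<xi> i) = - w1 m * (\<Sum>j<k. (c1 m j - s (r m) * unit_seq 0 j) * \<xi> j)" for m
        using g[of m] xi by (auto simp: good_def)
      ultimately show "(\<lambda>m. \<Sum>i<K. \<mu>1 m i * D1 (c1 m) \<xi> i) \<longlonglongrightarrow> 0" by simp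
    qed
    show "0 \<le> (\<Sum>i<K. \<mu> i * D2 0 (unit_seq 0) i)"
      using tendsto_nonneg_affine[OF Snn Slim] by (simp add: sum_divide_distrib[symmetric])
    fix J :: "nat \<Rightarrow> nat" assume J: "\<forall>l<Suc K. J l < k"
    \<comment> \<open>The kernel at \<open>c1 m\<close> may be smaller than the kernel at 0, so the
      combination is chosen anew for every m, and only its coefficients converge.\<close>
    have "\<exists>a. a \<in> usphere (Suc K) \<and> (\<forall>i<K. (\<Sum>l<Suc K. a l * D1 (c1 m) (unit_seq (J l)) i) = 0)" for m
      using homogeneous_system_usphere[of K "\<lambda>i l. D1 (c1 m) (unit_seq (J l)) i"] by metis
    then obtain a0 where a0: "\<And>m. a0 m \<in> usphere (Suc K)"
      "\<And>m i. i < K \<Longrightarrow> (\<Sum>l<Suc K. a0 m l * D1 (c1 m) (unit_seq (J l)) i) = 0" by metis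
    obtain r' a where r': "strict_mono r'" and a: "a \<in> usphere (Suc K)" and alim: "\<And>j. (\<lambda>m. a0 (r' m) j) \<longlonglongrightarrow> a j"
      using usphere_convergent_subseq[of a0 "Suc K"] a0(1) by metis
    have sub': "f \<longlonglongrightarrow> l \<Longrightarrow> (\<lambda>m. f (r' m)) \<longlonglongrightarrow> l" for f :: "nat \<Rightarrow> real" and l
      using LIMSEQ_subseq_LIMSEQ[OF _ r', of f l] by (simp add: o_def)
    define \<xi> where "\<xi> m = (\<Sum>l<Suc K. a0 m l *\<^sub>R unit_seq (J l))" for m
    have uJ: "unit_seq (J l) j = 0" if "l < Suc K" "j \<ge> k" for l j
    proof -
      have "J l < k" using J that(1) by blast
      then show ?thesis using that by (auto simp: unit_seq_def)
    qed
    have xi: "\<xi> m \<in> vsupp k" for m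
      unfolding vsupp_def \<xi>_def sum_fun_apply using uJ by (auto intro!: sum.neutral simp del: sum.lessThan_Suc)
    have xilim: "(\<lambda>m. \<xi> (r' m) j) \<longlonglongrightarrow> (\<Sum>l<Suc K. a l *\<^sub>R unit_seq (J l)) j" for j
      unfolding \<xi>_def sum_fun_apply scaleR_fun_apply real_scaleR_def
      by (intro tendsto_intros alim)
    have D1z: "D1 (c1 m) (\<xi> m) i = 0" if "i < K" for m i
    proof -
      interpret linear "\<lambda>\<xi>. D1 (c1 m) \<xi> i" by (rule D1lin[OF that c1])
      show ?thesis unfolding \<xi>_def sum scale using a0(2)[OF that, of m] by simp
    qed
    have lim1: "(\<lambda>m. (\<Sum>i<K. \<mu>1 (r' m) i * D2 (c1 (r' m)) (\<xi> (r' m)) i) + w1 (r' m) * (\<Sum>j<k. (\<xi> (r' m) j)\<^sup>2))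
       \<longlonglongrightarrow> (\<Sum>i<K. \<mu> i * D2 0 (\<Sum>l<Suc K. a l *\<^sub>R unit_seq (J l)) i) + 0 * (\<Sum>j<k. ((\<Sum>l<Suc K. a l *\<^sub>R unit_seq (J l)) j)\<^sup>2)"
      by (intro tendsto_intros D2conv sub'[OF mul] sub'[OF wlim] xilim xi c1 sub'[OF clim]) auto
    have "0 \<le> (\<Sum>i<K. \<mu>1 m i * D2 (c1 m) (\<xi> m) i) + w1 m * (\<Sum>j<k. (\<xi> m j)\<^sup>2)" for m
      using g[of m] xi[of m] D1z[of _ m] by (force simp: good_def)
    from tendsto_nonneg_affine[OF this lim1]
    have "0 \<le> (\<Sum>i<K. \<mu> i * D2 0 (\<Sum>l<Suc K. a l *\<^sub>R unit_seq (J l)) i)" by simp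
    then show "\<exists>a\<in>usphere (Suc K). 0 \<le> (\<Sum>i<K. \<mu> i * D2 0 (\<Sum>l<Suc K. a l *\<^sub>R unit_seq (J l)) i)"
      using a by blast
  qed
qed

end

section \<open>Quadratic forms of finite negative index\<close>

text \<open>Linearity is demanded on H only: the integral functionals to which this is applied are
  linear on integrable or square integrable arguments, while the type contains all
  functions.\<close>

definition lin_on :: "'v::real_vector set \<Rightarrow> ('v \<Rightarrow> real) \<Rightarrow> bool"
  where "lin_on H f \<longleftrightarrow> (\<forall>x\<in>H. \<forall>y\<in>H. f (x + y) = f x + f y) \<and> (\<forall>x\<in>H. \<forall>c. f (c *\<^sub>R x) = c * f x)"

definition bilin_on :: "'v::real_vector set \<Rightarrow> ('v \<Rightarrow> 'v \<Rightarrow> real) \<Rightarrow> bool"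
  where "bilin_on H b \<longleftrightarrow> (\<forall>y\<in>H. lin_on H (\<lambda>x. b x y)) \<and> (\<forall>x\<in>H. \<forall>y\<in>H. b x y = b y x)"

lemma lin_on_add: "lin_on H f \<Longrightarrow> x \<in> H \<Longrightarrow> y \<in> H \<Longrightarrow> f (x + y) = f x + f y"
  and lin_on_scale: "lin_on H f \<Longrightarrow> x \<in> H \<Longrightarrow> f (c *\<^sub>R x) = c * f x"
  by (auto simp: lin_on_def)

lemma lin_on_0: "lin_on H f \<Longrightarrow> subspace H \<Longrightarrow> f 0 = 0"
  using lin_on_scale[of H f 0 0] subspace_0[of H] by auto

lemma lin_on_sum:
  assumes "lin_on H f" "subspace H" "\<And>i. i \<in> I \<Longrightarrow> g i \<in> H"
  shows "f (\<Sum>i\<in>I. a i *\<^sub>R g i) = (\<Sum>i\<in>I. a i * f (g i))"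
  using assms(3)
proof (induction I rule: infinite_finite_induct)
  case (insert i I)
  have "(\<Sum>i\<in>I. a i *\<^sub>R g i) \<in> H" using insert by (intro subspace_sum[OF assms(2)] subspace_scale[OF assms(2)]) auto
  then show ?case using insert assms by (simp add: lin_on_add[OF assms(1)] lin_on_scale[OF assms(1)] subspace_scale)
qed (auto simp: lin_on_0[OF assms(1,2)])

lemma lin_on_diff:
  assumes "lin_on H f" "subspace H" "x \<in> H" "y \<in> H"
  shows "f (x - y) = f x - f y"
  using lin_on_add[OF assms(1), of x "(-1) *\<^sub>R y"] lin_on_scale[OF assms(1), of y "-1"] assms subspace_scale[OF assms(2,4), of "-1"]
  by simp

lemma lin_on_mono: "lin_on H f \<Longrightarrow> X \<subseteq> H \<Longrightarrow> lin_on X f"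
  unfolding lin_on_def by blast

lemma bilin_on_lin: "bilin_on H b \<Longrightarrow> y \<in> H \<Longrightarrow> lin_on H (\<lambda>x. b x y)"
  and bilin_on_sym: "bilin_on H b \<Longrightarrow> x \<in> H \<Longrightarrow> y \<in> H \<Longrightarrow> b x y = b y x"
  by (auto simp: bilin_on_def)

lemma bilin_on_lin':
  assumes b: "bilin_on H b" and H: "subspace H" and y: "y \<in> H"
  shows "lin_on H (\<lambda>x. b y x)"
proof -
  have "b y x = b x y" if "x \<in> H" for x using bilin_on_sym[OF b y that] .
  with bilin_on_lin[OF b y] subspace_add[OF H] subspace_scale[OF H] show ?thesis
    by (simp add: lin_on_def)
qed

lemma bilin_on_lincomb:
  assumes "\<And>i. i \<in> I \<Longrightarrow> bilin_on H (b i)"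
  shows "bilin_on H (\<lambda>x y. \<Sum>i\<in>I. \<mu> i * b i x y)"
  unfolding bilin_on_def
proof (intro conjI ballI)
  fix y assume y: "y \<in> H"
  show "lin_on H (\<lambda>x. \<Sum>i\<in>I. \<mu> i * b i x y)"
    unfolding lin_on_def
  proof (intro conjI ballI allI)
    fix x x' assume x: "x \<in> H" "x' \<in> H"
    have "\<mu> i * b i (x + x') y = \<mu> i * b i x y + \<mu> i * b i x' y" if "i \<in> I" for i
      using lin_on_add[OF bilin_on_lin[OF assms[OF that] y] x] by (simp add: distrib_left)
    then show "(\<Sum>i\<in>I. \<mu> i * b i (x + x') y) = (\<Sum>i\<in>I. \<mu> i * b i x y) + (\<Sum>i\<in>I. \<mu> i * b i x' y)"
      by (simp add: sum.distrib)
  next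
    fix x c assume x: "x \<in> H"
    have "\<mu> i * b i (c *\<^sub>R x) y = c * (\<mu> i * b i x y)" if "i \<in> I" for i
      using lin_on_scale[OF bilin_on_lin[OF assms[OF that] y] x] by simp
    then show "(\<Sum>i\<in>I. \<mu> i * b i (c *\<^sub>R x) y) = c * (\<Sum>i\<in>I. \<mu> i * b i x y)"
      unfolding sum_distrib_left by (rule sum.cong[OF refl])
  qed
next
  fix x y assume "x \<in> H" "y \<in> H"
  then show "(\<Sum>i\<in>I. \<mu> i * b i x y) = (\<Sum>i\<in>I. \<mu> i * b i y x)"
    by (intro sum.cong) (auto simp: bilin_on_sym[OF assms])
qed

text \<open>By \<open>ind\<close>, a family g with Q (g i) (g j) = -\<delta>_ij cannot have N
  members. For a family of a length that cannot be exceeded by one, the Q-orthogonal remainder v of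
  any w satisfies Q v v \<ge> 0, and Q v v equals Q w w plus the sum of the squares of the Q w (g
  j).\<close>

lemma finite_index_lower_bound:
  assumes Q: "bilin_on H Q" and H: "subspace H"
    and ind: "\<And>g. (\<And>l. l < N \<Longrightarrow> g l \<in> H) \<Longrightarrow>
      \<exists>a\<in>usphere N. 0 \<le> (\<Sum>l<N. \<Sum>l'<N. a l * a l' * Q (g l) (g l'))"
  shows "\<exists>(r::nat) g. (\<forall>j<r. g j \<in> H) \<and> (\<forall>w\<in>H. - (\<Sum>j<r. (Q w (g j))\<^sup>2) \<le> Q w w)"
proof -
  define P where "P r \<longleftrightarrow> (\<exists>g. (\<forall>j<r. g j \<in> H) \<and> (\<forall>i<r. \<forall>j<r. Q (g i) (g j) = (if i = j then -1 else 0)))" for r :: nat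
  have P0: "P 0" by (auto simp: P_def)
  have PN: "\<not> P N"
  proof
    assume "P N"
    then obtain g where g: "\<And>j. j < N \<Longrightarrow> g j \<in> H"
      "\<And>i j. i < N \<Longrightarrow> j < N \<Longrightarrow> Q (g i) (g j) = (if i = j then -1 else 0)"
      by (auto simp: P_def)
    obtain a where a: "a \<in> usphere N" "0 \<le> (\<Sum>l<N. \<Sum>l'<N. a l * a l' * Q (g l) (g l'))"
      using ind[of g] g(1) by blast
    have "(\<Sum>l<N. \<Sum>l'<N. a l * a l' * Q (g l) (g l')) = (\<Sum>l<N. \<Sum>l'<N. if l' = l then - (a l)\<^sup>2 else 0)"
      by (intro sum.cong) (auto simp: g power2_eq_square)
    also have "\<dots> = - (\<Sum>l<N. (a l)\<^sup>2)" by (simp add: sum_negf)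
    finally show False using a by (simp add: usphere_def)
  qed
  have "\<exists>r. P r \<and> \<not> P (Suc r)"
    using P0 PN by (metis nat_induct)
  then obtain r where Pr: "P r" and nP: "\<not> P (Suc r)" by blast
  from Pr obtain g where g: "\<And>j. j < r \<Longrightarrow> g j \<in> H"
      "\<And>i j. i < r \<Longrightarrow> j < r \<Longrightarrow> Q (g i) (g j) = (if i = j then -1 else 0)"
      by (auto simp: P_def)
  have "- (\<Sum>j<r. (Q w (g j))\<^sup>2) \<le> Q w w" if w: "w \<in> H" for w
  proof (rule ccontr)
    assume neg: "\<not> - (\<Sum>j<r. (Q w (g j))\<^sup>2) \<le> Q w w"
    \<comment> \<open>Minus the Q-orthogonal projection of w onto the span of the g j: the remainder
      is w + S, with a plus sign because Q is -1 on each g j.\<close>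
    define S where "S = (\<Sum>j<r. Q w (g j) *\<^sub>R g j)"
    define v where "v = w + S"
    have S: "S \<in> H" unfolding S_def using g by (intro subspace_sum[OF H] subspace_scale[OF H]) auto
    have v: "v \<in> H" unfolding v_def using w S H by (simp add: subspace_add)
    have Qvg: "Q v (g i) = 0" if i: "i < r" for i
    proof -
      have "Q v (g i) = Q w (g i) + (\<Sum>j<r. Q w (g j) * Q (g j) (g i))"
        unfolding v_def S_def
        using lin_on_add[OF bilin_on_lin[OF Q g(1)[OF i]] w S] lin_on_sum[OF bilin_on_lin[OF Q g(1)[OF i]] H, of "{..<r}" g] g(1)
        by (simp add: S_def)
      also have "(\<Sum>j<r. Q w (g j) * Q (g j) (g i)) = (\<Sum>j<r. if j = i then - Q w (g i) else 0)"
        using i g(2) by (intro sum.cong) auto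
      finally show ?thesis using i by simp
    qed
    have "Q v v = Q v w + Q v S"
      using lin_on_add[OF bilin_on_lin'[OF Q H v] w S] by (simp add: v_def)
    also have "Q v S = (\<Sum>j<r. Q w (g j) * Q v (g j))"
      unfolding S_def using g(1) by (intro lin_on_sum[OF bilin_on_lin'[OF Q H v] H]) auto
    also have "\<dots> = 0" using Qvg by simp
    also have "Q v w = Q w w + Q S w"
      using lin_on_add[OF bilin_on_lin[OF Q w] w S] by (simp add: v_def)
    also have "Q S w = (\<Sum>j<r. Q w (g j) * Q (g j) w)"
      unfolding S_def using g(1) by (intro lin_on_sum[OF bilin_on_lin[OF Q w] H]) auto
    also have "\<dots> = (\<Sum>j<r. (Q w (g j))\<^sup>2)"
      using bilin_on_sym[OF Q w] g(1) by (intro sum.cong) (auto simp: power2_eq_square)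
    finally have Qvv: "Q v v < 0" using neg by simp
    define t where "t = 1 / sqrt (- Q v v)"
    define g' where "g' j = (if j = r then t *\<^sub>R v else g j)" for j
    have tv: "t *\<^sub>R v \<in> H" using v H by (simp add: subspace_scale)
    have t2: "t * (t * Q v v) = -1" using Qvv by (simp add: t_def field_simps)
    have "\<forall>j<Suc r. g' j \<in> H" using g(1) tv by (auto simp: g'_def less_Suc_eq)
    moreover have "Q (g' i) (g' j) = (if i = j then -1 else 0)" if "i < Suc r" "j < Suc r" for i j
    proof -
      have 1: "Q (t *\<^sub>R v) y = t * Q v y" if "y \<in> H" for y
        using lin_on_scale[OF bilin_on_lin[OF Q that] v] .
      have 2: "Q y (t *\<^sub>R v) = t * Q v y" if "y \<in> H" for y
        using bilin_on_sym[OF Q that tv] 1[OF that] by simp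
      show ?thesis
        using that g Qvg t2 tv v by (auto simp: g'_def 1 2 less_Suc_eq)
    qed
    ultimately have "P (Suc r)" unfolding P_def by blast
    then show False using nP by simp
  qed
  then show ?thesis using g(1) by (intro exI[of _ r] exI[of _ g]) auto
qed

lemma psd_Cauchy_Schwarz:
  assumes b: "bilin_on H b" and H: "subspace H" and psd: "\<And>x. x \<in> H \<Longrightarrow> 0 \<le> b x x"
    and xy: "x \<in> H" "y \<in> H"
  shows "(b x y)\<^sup>2 \<le> b x x * b y y"
proof -
  have ex: "0 \<le> b x x + 2 * t * b x y + t\<^sup>2 * b y y" for t
  proof -
    have ty: "t *\<^sub>R y \<in> H" using xy H by (simp add: subspace_scale)
    have z: "x + t *\<^sub>R y \<in> H" using xy ty H by (simp add: subspace_add)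
    have "b (x + t *\<^sub>R y) (x + t *\<^sub>R y) = b x (x + t *\<^sub>R y) + t * b y (x + t *\<^sub>R y)"
      using lin_on_add[OF bilin_on_lin[OF b z] xy(1) ty] lin_on_scale[OF bilin_on_lin[OF b z] xy(2)] by simp
    also have "b x (x + t *\<^sub>R y) = b x x + t * b x y"
      using lin_on_add[OF bilin_on_lin'[OF b H xy(1)] xy(1) ty] lin_on_scale[OF bilin_on_lin'[OF b H xy(1)] xy(2)] by simp
    also have "b y (x + t *\<^sub>R y) = b x y + t * b y y"
      using lin_on_add[OF bilin_on_lin'[OF b H xy(2)] xy(1) ty] lin_on_scale[OF bilin_on_lin'[OF b H xy(2)] xy(2)]
        bilin_on_sym[OF b xy] by simp
    finally show ?thesis using psd[OF z] by (simp add: power2_eq_square algebra_simps)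
  qed
  show ?thesis
  proof (cases "b y y = 0")
    case True
    have "b x y = 0"
    proof (rule ccontr)
      assume n: "b x y \<noteq> 0"
      \<comment> \<open>When b y y = 0 the quadratic in t is affine, and this t gives it the value
        -1.\<close>
      have "0 \<le> b x x + 2 * (- (b x x + 1) / (2 * b x y)) * b x y"
        using ex[of "- (b x x + 1) / (2 * b x y)"] True by simp
      also have "\<dots> = -1" using n by (simp add: field_simps)
      finally show False by simp
    qed
    then show ?thesis using True by simp
  next
    case False
    then have p: "b y y > 0" using psd[OF xy(2)] by simp
    have "0 \<le> b x x - (b x y)\<^sup>2 / b y y"
      using ex[of "- b x y / b y y"] p by (simp add: power2_eq_square field_simps)
    then show ?thesis using p by (simp add: field_simps)
  qed
qed

text \<open>A uniform boundedness principle on spaces that need not be complete.\<close>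

lemma gliding_hump:
  fixes w :: "nat \<Rightarrow> 'v::real_vector"
  assumes ip: "bilin_on H ip" and H: "subspace H" and psd: "\<And>x. x \<in> H \<Longrightarrow> 0 \<le> ip x x"
    and w: "\<And>k. w k \<in> H"
    and bdd: "\<And>e s. (\<And>j. e j \<in> H) \<Longrightarrow> (\<And>j. ip (e j) (e j) \<le> 1) \<Longrightarrow> (\<And>j::nat. \<bar>s j\<bar> \<le> (1/3)^j) \<Longrightarrow>
      \<exists>B. \<forall>k. \<bar>\<Sum>j. s j * ip (w k) (e j)\<bar> \<le> B"
  shows "\<exists>C. \<forall>k. ip (w k) (w k) \<le> C"
proof (rule ccontr)
  assume "\<nexists>C. \<forall>k. ip (w k) (w k) \<le> C"
  then have "\<forall>n. \<exists>k. ((4::real)^n)\<^sup>2 \<le> ip (w k) (w k)" by (meson linear)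
  then obtain \<kappa> where \<kappa>: "\<And>n::nat. ((4::real)^n)\<^sup>2 \<le> ip (w (\<kappa> n)) (w (\<kappa> n))" by metis
  define nw where "nw x = sqrt (ip x x)" for x
  have nwk: "(4::real)^n \<le> nw (w (\<kappa> n))" for n
    unfolding nw_def using \<kappa>[of n] by (intro real_le_rsqrt)
  have nwpos: "nw (w (\<kappa> n)) > 0" for n using nwk[of n] by (meson less_le_trans zero_less_numeral zero_less_power)
  have nw2: "nw (w k) * nw (w k) = ip (w k) (w k)" for k
    unfolding nw_def using psd[OF w] by simp
  define e where "e n = (1 / nw (w (\<kappa> n))) *\<^sub>R w (\<kappa> n)" for n
  have eH: "e n \<in> H" for n unfolding e_def using w H by (simp add: subspace_scale)
  have ipe: "ip x (e n) = ip x (w (\<kappa> n)) / nw (w (\<kappa> n))" if "x \<in> H" for x n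
    unfolding e_def using lin_on_scale[OF bilin_on_lin'[OF ip H that] w] by simp
  have e1: "ip (e n) (e n) = 1" for n
  proof -
    have "ip (e n) (w (\<kappa> n)) = nw (w (\<kappa> n))"
      unfolding e_def using lin_on_scale[OF bilin_on_lin[OF ip w] w] nwpos[of n] nw2[of "\<kappa> n"]
      by (simp add: field_simps)
    then show ?thesis using ipe[OF eH] nwpos[of n] by simp
  qed
  have bound: "\<bar>ip (w k) (e n)\<bar> \<le> nw (w k)" for k n
    using psd_Cauchy_Schwarz[OF ip H psd w eH, of k n] by (simp add: nw_def e1 real_le_rsqrt)
  \<comment> \<open>The recursion carries all coefficients found so far, since the sign of the n-th
    one is chosen to agree with the partial sum of the earlier terms against
    \<open>w (\<kappa> n)\<close>; the earlier terms then cannot cancel the n-th one.\<close>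
  define S where "S = rec_nat (\<lambda>_. 0) (\<lambda>n f. f(n := (1/3)^n * (if 0 \<le> (\<Sum>j<n. f j * ip (w (\<kappa> n)) (e j)) then 1 else -1 :: real)))"
  have S_Suc: "S (Suc n) = (S n)(n := (1/3)^n * (if 0 \<le> (\<Sum>j<n. S n j * ip (w (\<kappa> n)) (e j)) then 1 else -1))" for n
    by (simp add: S_def)
  define s where "s n = S (Suc n) n" for n
  have Ss: "S n j = s j" if "j < n" for n j
    using that
  proof (induction n)
    case (Suc n)
    then show ?case by (cases "j = n") (auto simp: s_def S_Suc)
  qed simp
  have s_eq: "s n = (1/3)^n * (if 0 \<le> (\<Sum>j<n. s j * ip (w (\<kappa> n)) (e j)) then 1 else -1)" for n
  proof -
    have "(\<Sum>j<n. S n j * ip (w (\<kappa> n)) (e j)) = (\<Sum>j<n. s j * ip (w (\<kappa> n)) (e j))"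
      by (intro sum.cong) (auto simp: Ss)
    then show ?thesis unfolding s_def[of n] S_Suc by simp
  qed
  have s_abs: "\<bar>s n\<bar> \<le> (1/3)^n" for n by (subst s_eq) (auto simp: abs_mult)
  have "\<exists>B. \<forall>k. \<bar>\<Sum>j. s j * ip (w k) (e j)\<bar> \<le> B"
    by (rule bdd[OF eH _ s_abs]) (simp add: e1)
  then obtain B where B: "\<And>k. \<bar>\<Sum>j. s j * ip (w k) (e j)\<bar> \<le> B" by blast
  have term_le: "\<bar>s j * ip (w k) (e j)\<bar> \<le> (1/3)^j * nw (w k)" for j k
    unfolding abs_mult using s_abs bound by (intro mult_mono) auto
  have geo: "summable (\<lambda>j. (1/3::real)^j * c)" for c by (intro summable_mult2 summable_geometric) auto
  have summ: "summable (\<lambda>j. s j * ip (w k) (e j))" for k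
    by (rule summable_comparison_test'[OF geo[of "nw (w k)"], of 0]) (use term_le in auto)
  \<comment> \<open>The first n+1 terms contribute at least 3^-n times the norm of
    \<open>w (\<kappa> n)\<close>, and the geometric tail takes away at most half of that. Since
    this norm is at least 4^n, the values are unbounded in n.\<close>
  have low: "(4/3)^n / 2 \<le> B" for n
  proof -
    let ?x = "w (\<kappa> n)"
    define t where "t = (\<lambda>j. s j * ip ?x (e j))"
    have tn: "summable t" using summ by (simp add: t_def)
    have "ip ?x (e n) = (nw ?x * nw ?x) / nw ?x" using ipe[OF w, of "\<kappa> n" n] nw2[of "\<kappa> n"] by simp
    then have ipn: "ip ?x (e n) = nw ?x" using nwpos[of n] by simp
    have head: "(1/3)^n * nw ?x \<le> \<bar>\<Sum>j<Suc n. t j\<bar>"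
    proof -
      have p: "0 \<le> (1/3)^n * nw ?x" using nwpos[of n] by simp
      have "t n = (if 0 \<le> (\<Sum>j<n. t j) then 1 else -1) * ((1/3)^n * nw ?x)"
        unfolding t_def by (subst s_eq) (simp add: ipn)
      then show ?thesis using p by (auto split: if_splits)
    qed
    have "\<bar>\<Sum>j. t (j + Suc n)\<bar> \<le> (\<Sum>j. (1/3)^(j + Suc n) * nw ?x)"
    proof -
      have sm: "summable (\<lambda>j. (1/3)^(j + Suc n) * nw ?x)"
        using summable_ignore_initial_segment[OF geo[of "nw ?x"], of "Suc n"] by simp
      have le: "norm (t (j + Suc n)) \<le> (1/3)^(j + Suc n) * nw ?x" for j using term_le[of "j + Suc n" "\<kappa> n"] by (simp add: t_def)
      have "summable (\<lambda>j. norm (t (j + Suc n)))"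
        by (rule summable_comparison_test'[OF sm, of 0]) (use le in auto)
      then have "\<bar>\<Sum>j. t (j + Suc n)\<bar> \<le> (\<Sum>j. norm (t (j + Suc n)))" using summable_norm[of "\<lambda>j. t (j + Suc n)"] by simp
      also have "\<dots> \<le> (\<Sum>j. (1/3)^(j + Suc n) * nw ?x)"
        by (intro suminf_le le sm \<open>summable (\<lambda>j. norm (t (j + Suc n)))\<close>)
      finally show ?thesis .
    qed
    also have "(\<Sum>j. (1/3::real)^(j + Suc n) * nw ?x) = (1/3)^n * nw ?x / 2"
    proof -
      have "(\<lambda>j. (1/3::real)^j * ((1/3)^(Suc n) * nw ?x)) sums (1 / (1 - 1/3) * ((1/3)^(Suc n) * nw ?x))"
        by (intro sums_mult2 geometric_sums) auto
      then show ?thesis by (simp add: power_add sums_iff algebra_simps)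
    qed
    finally have tail: "\<bar>\<Sum>j. t (j + Suc n)\<bar> \<le> (1/3)^n * nw ?x / 2" .
    have "(\<Sum>j. t j) = (\<Sum>j. t (j + Suc n)) + (\<Sum>j<Suc n. t j)"
      by (rule suminf_split_initial_segment[OF tn])
    then have "(1/3)^n * nw ?x / 2 \<le> \<bar>\<Sum>j. t j\<bar>" using head tail by linarith
    also have "\<dots> \<le> B" using B[of "\<kappa> n"] by (simp add: t_def)
    finally have "(1/3)^n * nw ?x / 2 \<le> B" .
    moreover have "(1/3::real)^n * 4^n \<le> (1/3)^n * nw ?x" using nwk[of n] by (intro mult_left_mono) auto
    moreover have "(1/3::real)^n * 4^n = (4/3)^n" by (simp add: power_mult_distrib[symmetric])
    ultimately show ?thesis by linarith
  qed
  obtain n where "2 * B < (4/3::real)^n" using real_arch_pow[of "4/3" "2 * B"] by auto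
  then show False using low[of n] by linarith
qed

section \<open>Abnormal problems in infinite dimensions\<close>

definition comb :: "nat \<Rightarrow> (nat \<Rightarrow> 'v::real_vector) \<Rightarrow> (nat \<Rightarrow> real) \<Rightarrow> 'v"
  where "comb k g c = (\<Sum>j<k. c j *\<^sub>R g j)"

lemma comb_unit_seq: "j < k \<Longrightarrow> comb k g (unit_seq j) = g j"
proof -
  assume j: "j < k"
  have "comb k g (unit_seq j) = (\<Sum>i<k. if i = j then g j else 0)"
    unfolding comb_def by (intro sum.cong) (auto simp: unit_seq_def)
  then show ?thesis using j by simp
qed

lemma linear_comb: "linear (comb k g)"
  by (rule linearI) (auto simp: comb_def sum.distrib scaleR_add_left scaleR_sum_right)

lemma unit_seq_vsupp: "j < k \<Longrightarrow> unit_seq j \<in> vsupp k"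
  by (auto simp: vsupp_def unit_seq_def)

lemma subspace_vsupp: "subspace (vsupp k)"
  by (auto simp: vsupp_def subspace_def)

text \<open>Serves to correct an approximation in X so that all K functionals take exactly the
  desired values: I is a maximal independent subfamily and the e j are dual to it. The induction
  adds one functional; either it depends on the earlier ones, or a vector on which the difference
  \<open>R\<close> is nonzero yields a new dual vector.\<close>

lemma biorthogonal_basis:
  assumes A: "\<And>i. i < K \<Longrightarrow> lin_on X (A i)" and X: "subspace X"
  shows "\<exists>I e \<gamma>. I \<subseteq> {..<K::nat} \<and> (\<forall>j\<in>I. e j \<in> X) \<and>
    (\<forall>i\<in>I. \<forall>j\<in>I. A i (e j) = (if i = j then 1 else 0)) \<and>
    (\<forall>i<K. \<forall>x\<in>X. A i x = (\<Sum>j\<in>I. \<gamma> i j * A j x))"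
  using A
proof (induction K)
  case 0
  show ?case by (intro exI[of _ "{}"]) auto
next
  case (Suc K)
  have "\<exists>I e \<gamma>. I \<subseteq> {..<K} \<and> (\<forall>j\<in>I. e j \<in> X) \<and>
    (\<forall>i\<in>I. \<forall>j\<in>I. A i (e j) = (if i = j then 1 else 0)) \<and>
    (\<forall>i<K. \<forall>x\<in>X. A i x = (\<Sum>j\<in>I. \<gamma> i j * A j x))"
    by (rule Suc.IH) (use Suc.prems in auto)
  then obtain I e \<gamma> where *: "I \<subseteq> {..<K} \<and> (\<forall>j\<in>I. e j \<in> X) \<and>
    (\<forall>i\<in>I. \<forall>j\<in>I. A i (e j) = (if i = j then 1 else 0)) \<and>
    (\<forall>i<K. \<forall>x\<in>X. A i x = (\<Sum>j\<in>I. \<gamma> i j * A j x))" by (elim exE)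
  then have I: "I \<subseteq> {..<K}" and e: "\<And>j. j \<in> I \<Longrightarrow> e j \<in> X"
    and bi: "\<And>i j. i \<in> I \<Longrightarrow> j \<in> I \<Longrightarrow> A i (e j) = (if i = j then 1 else 0)"
    and sp: "\<And>i x. i < K \<Longrightarrow> x \<in> X \<Longrightarrow> A i x = (\<Sum>j\<in>I. \<gamma> i j * A j x)"
    by blast+
  have lin: "lin_on X (A i)" if "i < Suc K" for i using Suc.prems that by auto
  have finI: "finite I" using I finite_subset by blast
  define R where "R x = A K x - (\<Sum>j\<in>I. A K (e j) * A j x)" for x
  show ?case
  proof (cases "\<forall>x\<in>X. R x = 0")
    case True
    then have "A K x = (\<Sum>j\<in>I. A K (e j) * A j x)" if "x \<in> X" for x using that by (simp add: R_def)
    then show ?thesis using I e bi sp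
      by (intro exI[of _ I] exI[of _ e] exI[of _ "\<lambda>i j. if i = K then A K (e j) else \<gamma> i j"])
         (auto simp: less_Suc_eq)
  next
    case False
    then obtain x where x: "x \<in> X" "R x \<noteq> 0" by auto
    define z where "z = (\<Sum>j\<in>I. A j x *\<^sub>R e j)"
    define y where "y = (1 / R x) *\<^sub>R (x - z)"
    have z: "z \<in> X" unfolding z_def using e by (intro subspace_sum[OF X] subspace_scale[OF X]) auto
    have xz: "x - z \<in> X" using x z X by (simp add: subspace_diff)
    have y: "y \<in> X" unfolding y_def using xz X by (simp add: subspace_scale)
    have Az: "A i z = (\<Sum>j\<in>I. A j x * A i (e j))" if "i < Suc K" for i
      unfolding z_def by (rule lin_on_sum[OF lin[OF that] X]) (use e in auto)
    have Ay: "A i y = (1 / R x) * (A i x - A i z)" if "i < Suc K" for i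
      unfolding y_def using lin_on_scale[OF lin[OF that] xz] lin_on_diff[OF lin[OF that] X x(1) z] by simp
    have yI: "A i y = 0" if i: "i \<in> I" for i
    proof -
      have "A i z = (\<Sum>j\<in>I. if j = i then A i x else 0)"
        using Az[of i] i I bi by (subst Az) (auto intro!: sum.cong)
      then have "A i z = A i x" using i finI by simp
      then show ?thesis using Ay[of i] i I by auto
    qed
    have yK: "A K y = 1"
      using Ay[of K] Az[of K] x by (simp add: R_def mult.commute)
    \<comment> \<open>The old dual vectors are shifted along y so that the new functional vanishes
      on them; y is invisible to the old functionals in I.\<close>
    define e' where "e' j = (if j = K then y else e j - A K (e j) *\<^sub>R y)" for j
    have KI: "K \<notin> I" using I by auto
    have e'X: "e' j \<in> X" if "j \<in> insert K I" for j
      using that y e X by (auto simp: e'_def intro!: subspace_diff subspace_scale)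
    have Ae': "A i (e' j) = A i (e j) - A K (e j) * A i y" if "i < Suc K" "j \<in> I" for i j
      using lin_on_diff[OF lin[OF that(1)] X e[OF that(2)] subspace_scale[OF X y]] lin_on_scale[OF lin[OF that(1)] y] that KI
      by (auto simp: e'_def)
    have bi': "A i (e' j) = (if i = j then 1 else 0)" if "i \<in> insert K I" "j \<in> insert K I" for i j
    proof (cases "j = K")
      case True
      then show ?thesis using that yI yK by (auto simp: e'_def)
    next
      case False
      then have j: "j \<in> I" using that by auto
      show ?thesis using Ae'[OF _ j, of i] that False yI yK bi j I KI by auto
    qed
    define \<gamma>' where "\<gamma>' i j = (if i = K then (if j = K then 1 else 0) else (if j = K then 0 else \<gamma> i j))" for i j
    have "A i x = (\<Sum>j\<in>insert K I. \<gamma>' i j * A j x)" if "i < Suc K" "x \<in> X" for i x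
    proof (cases "i = K")
      case True
      have "(\<Sum>j\<in>I. \<gamma>' i j * A j x) = 0" using True KI by (intro sum.neutral) (auto simp: \<gamma>'_def)
      then show ?thesis using True KI finI by (simp add: \<gamma>'_def)
    next
      case False
      have "(\<Sum>j\<in>I. \<gamma>' i j * A j x) = (\<Sum>j\<in>I. \<gamma> i j * A j x)"
        using False KI by (intro sum.cong) (auto simp: \<gamma>'_def)
      then show ?thesis using False KI finI sp[of i x] that by (simp add: \<gamma>'_def)
    qed
    then show ?thesis using I e'X bi'
      by (intro exI[of _ "insert K I"] exI[of _ e'] exI[of _ \<gamma>']) auto
  qed
qed

text \<open>Expansions are available only along directions from \<open>X\<close> (bounded controls); \<open>ap\<close> approximates the
  directions in \<open>H\<close> (square integrable controls).\<close>

locale abnormal_problem =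
  fixes X H :: "'v::real_vector set" and A :: "nat \<Rightarrow> 'v \<Rightarrow> real" and b :: "nat \<Rightarrow> 'v \<Rightarrow> 'v \<Rightarrow> real"
    and ap :: "nat \<Rightarrow> 'v \<Rightarrow> 'v" and q K :: nat
  assumes X: "subspace X" and H: "subspace H" and XH: "X \<subseteq> H"
    and A: "\<And>i. i < K \<Longrightarrow> lin_on H (A i)" and b: "\<And>i. i < K \<Longrightarrow> bilin_on H (b i)"
    and loc: "\<And>k g. 0 < k \<Longrightarrow> (\<And>j. j < k \<Longrightarrow> g j \<in> X) \<Longrightarrow> (\<And>i. i < q \<Longrightarrow> A i (g 0) \<le> 0) \<Longrightarrow>
      (\<And>i. q \<le> i \<Longrightarrow> i < K \<Longrightarrow> A i (g 0) = 0) \<Longrightarrow>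
      \<exists>\<rho> G D1 D2. expansion k K q \<rho> G D1 D2 \<and>
        (\<forall>\<xi>\<in>vsupp k. \<forall>i<K. D1 0 \<xi> i = A i (comb k g \<xi>) \<and> D2 0 \<xi> i = b i (comb k g \<xi>) (comb k g \<xi>))"
    and apX: "\<And>m h. h \<in> H \<Longrightarrow> ap m h \<in> X"
    and apA: "\<And>h i. h \<in> H \<Longrightarrow> i < K \<Longrightarrow> (\<lambda>m. A i (ap m h)) \<longlonglongrightarrow> A i h"
    and apb: "\<And>h h' i. h \<in> H \<Longrightarrow> h' \<in> H \<Longrightarrow> i < K \<Longrightarrow> (\<lambda>m. b i (ap m h) (ap m h')) \<longlonglongrightarrow> b i h h'"
    and apb1: "\<And>h h' i. h \<in> H \<Longrightarrow> h' \<in> H \<Longrightarrow> i < K \<Longrightarrow> (\<lambda>m. b i (ap m h) h') \<longlonglongrightarrow> b i h h'"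
begin

text \<open>The \<mu>-weighted form at the combination of the g l with coefficients a, expanded by
  bilinearity, so that limits in \<mu>, a and g are limits of finite sums.\<close>

definition qf :: "(nat \<Rightarrow> real) \<Rightarrow> (nat \<Rightarrow> real) \<Rightarrow> (nat \<Rightarrow> 'v) \<Rightarrow> real"
  where "qf \<mu> a g = (\<Sum>i<K. \<mu> i * (\<Sum>l<Suc K. \<Sum>l'<Suc K. a l * a l' * b i (g l) (g l')))"

lemma b_comb:
  assumes "i < K" "\<And>l. l < N \<Longrightarrow> g l \<in> H"
  shows "b i (\<Sum>l<N. a l *\<^sub>R g l) (\<Sum>l<N. a l *\<^sub>R g l) = (\<Sum>l<N. \<Sum>l'<N. a l * a l' * b i (g l) (g l'))"
proof -
  let ?S = "\<Sum>l<N. a l *\<^sub>R g l"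
  have S: "?S \<in> H" using assms(2) by (intro subspace_sum[OF H] subspace_scale[OF H]) auto
  have "b i ?S ?S = (\<Sum>l<N. a l * b i (g l) ?S)"
    using assms(2) by (intro lin_on_sum[OF bilin_on_lin[OF b[OF assms(1)] S] H]) auto
  also have "\<dots> = (\<Sum>l<N. a l * (\<Sum>l'<N. a l' * b i (g l) (g l')))"
  proof (intro sum.cong refl arg_cong[where f = "(*) _"])
    fix l assume "l \<in> {..<N}"
    then have l: "g l \<in> H" using assms(2) by auto
    show "b i (g l) ?S = (\<Sum>l'<N. a l' * b i (g l) (g l'))"
      using assms(2) by (intro lin_on_sum[OF bilin_on_lin'[OF b[OF assms(1)] H l] H]) auto
  qed
  finally show ?thesis by (simp add: sum_distrib_left mult.assoc)
qed

definition mult :: "(nat \<Rightarrow> real) \<Rightarrow> bool"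
  where "mult \<mu> \<longleftrightarrow> \<mu> \<in> usphere K \<and> (\<forall>i<q. 0 \<le> \<mu> i) \<and> (\<forall>x\<in>X. (\<Sum>i<K. \<mu> i * A i x) = 0)"

text \<open>The witnesses lie on a compact sphere, so a subsequence of them converges and provides a
  witness for the limit multiplier.\<close>

lemma tuple_limit:
  assumes "\<And>n. \<exists>a\<in>usphere (Suc K). 0 \<le> qf (x n) a g" and xl: "\<And>j. (\<lambda>n. x n j) \<longlonglongrightarrow> l j"
  shows "\<exists>a\<in>usphere (Suc K). 0 \<le> qf l a g"
proof -
  obtain a where a: "\<And>n. a n \<in> usphere (Suc K)" "\<And>n. 0 \<le> qf (x n) (a n) g" using assms(1) by metis
  obtain r a' where r: "strict_mono r" and a': "a' \<in> usphere (Suc K)" and al: "\<And>j. (\<lambda>n. a (r n) j) \<longlonglongrightarrow> a' j"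
    using usphere_convergent_subseq[of a "Suc K"] a(1) by metis
  have xr: "(\<lambda>n. x (r n) j) \<longlonglongrightarrow> l j" for j
    using LIMSEQ_subseq_LIMSEQ[OF xl[of j] r] by (simp add: o_def)
  have "(\<lambda>n. qf (x (r n)) (a (r n)) g) \<longlonglongrightarrow> qf l a' g"
    unfolding qf_def by (intro tendsto_intros xr al)
  from tendsto_nonneg_affine[OF a(2) this] show ?thesis using a' by blast
qed

lemma tuple_closed: "closed {\<mu>. \<exists>a\<in>usphere (Suc K). 0 \<le> qf \<mu> a g}"
  unfolding closed_sequential_limits using tuple_limit tendsto_coord by blast

lemma closed_lincomb: "closed {\<mu>::nat \<Rightarrow> real. (\<Sum>i<K. \<mu> i * c i) = 0}"
  by (rule closed_Collect_eq) (intro continuous_on_sum continuous_on_mult continuous_on_coord continuous_on_const)+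

lemma closed_lincomb_ge: "closed {\<mu>::nat \<Rightarrow> real. 0 \<le> (\<Sum>i<K. \<mu> i * c i)}"
  by (rule closed_Collect_le) (intro continuous_on_sum continuous_on_mult continuous_on_coord continuous_on_const)+

text \<open>Finitely many tuples are handled by the finite-dimensional result applied to their span; the finite
  intersection property on the compact sphere then gives one \<open>\<mu>\<close> for all tuples.\<close>

lemma multiplier_in_X:
  assumes h: "h \<in> X" "\<And>i. i < q \<Longrightarrow> A i h \<le> 0" "\<And>i. q \<le> i \<Longrightarrow> i < K \<Longrightarrow> A i h = 0"
  shows "\<exists>\<mu>. mult \<mu> \<and> 0 \<le> (\<Sum>i<K. \<mu> i * b i h h) \<and>
    (\<forall>g. (\<forall>l<Suc K. g l \<in> X) \<longrightarrow> (\<exists>a\<in>usphere (Suc K). 0 \<le> qf \<mu> a g))"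
proof -
  define S where "S = usphere K \<inter> ((\<Inter>i\<in>{..<q}. {\<mu>::nat \<Rightarrow> real. 0 \<le> \<mu> i}) \<inter> {\<mu>. 0 \<le> (\<Sum>i<K. \<mu> i * b i h h)})"
  define C where "C g = (\<Inter>l\<in>{..<Suc K}. {\<mu>. (\<Sum>i<K. \<mu> i * A i (g l)) = 0}) \<inter> {\<mu>. \<exists>a\<in>usphere (Suc K). 0 \<le> qf \<mu> a g}" for g
  let ?T = "{g. \<forall>l<Suc K. g l \<in> X}"
  have comp: "compact S" unfolding S_def
    by (intro compact_Int_closed compact_usphere closed_Int closed_INT ballI closed_lincomb_ge closed_Collect_le
        continuous_on_const continuous_on_coord)
  have cl: "closed c" if "c \<in> C ` ?T" for c
    using that unfolding C_def by (auto intro!: closed_Int closed_INT tuple_closed closed_lincomb)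
  have fip: "S \<inter> \<Inter>F \<noteq> {}" if F: "finite F" "F \<subseteq> C ` ?T" for F
  proof -
    have "\<exists>T. T \<subseteq> ?T \<and> finite T \<and> F = C ` T"
      using finite_subset_image[OF F] .
    then obtain T where T: "T \<subseteq> ?T" "finite T" "F = C ` T" by (elim exE conjE)
    obtain gs where gs: "set gs = T" using finite_list[OF T(2)] by blast
    define n where "n = Suc K"
    \<comment> \<open>Direction 0 is h. The tuples of the finite list follow in consecutive blocks
      of length K+1, addressed by quotient and remainder of j - 1.\<close>
    define gen where "gen j = (if j = 0 then h else (gs ! ((j - 1) div n)) ((j - 1) mod n))" for j
    define k where "k = Suc (length gs * n)"
    have n0: "n > 0" by (simp add: n_def)
    have genX: "gen j \<in> X" if "j < k" for j
    proof (cases "j = 0")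
      case False
      then have "(j - 1) div n < length gs" using that n0 by (auto simp: k_def less_mult_imp_div_less)
      then have "gs ! ((j - 1) div n) \<in> set gs" by (rule nth_mem)
      then have "gs ! ((j - 1) div n) \<in> ?T" unfolding gs using T(1) by (rule rev_subsetD)
      moreover have "(j - 1) mod n < Suc K" using n0 by (simp add: n_def)
      ultimately show ?thesis using False by (simp add: gen_def)
    qed (use h in \<open>auto simp: gen_def\<close>)
    have "\<exists>\<rho> G D1 D2. expansion k K q \<rho> G D1 D2 \<and>
        (\<forall>\<xi>\<in>vsupp k. \<forall>i<K. D1 0 \<xi> i = A i (comb k gen \<xi>) \<and> D2 0 \<xi> i = b i (comb k gen \<xi>) (comb k gen \<xi>))"
      using h by (intro loc genX) (auto simp: k_def gen_def)
    then obtain \<rho> G D1 D2 where ex: "expansion k K q \<rho> G D1 D2"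
      and D: "\<And>\<xi> i. \<xi> \<in> vsupp k \<Longrightarrow> i < K \<Longrightarrow> D1 0 \<xi> i = A i (comb k gen \<xi>)"
        "\<And>\<xi> i. \<xi> \<in> vsupp k \<Longrightarrow> i < K \<Longrightarrow> D2 0 \<xi> i = b i (comb k gen \<xi>) (comb k gen \<xi>)" by blast
    interpret E: expansion k K q \<rho> G D1 D2 by (rule ex)
    obtain \<mu> where mu0: "\<mu> \<in> usphere K" and mu1: "(\<forall>i<q. 0 \<le> \<mu> i) \<and> (\<forall>\<xi>\<in>vsupp k. (\<Sum>i<K. \<mu> i * D1 0 \<xi> i) = 0) \<and>
      0 \<le> (\<Sum>i<K. \<mu> i * D2 0 (unit_seq 0) i) \<and>
      (\<forall>J. (\<forall>l<Suc K. J l < k) \<longrightarrow> (\<exists>a\<in>usphere (Suc K).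
        0 \<le> (\<Sum>i<K. \<mu> i * D2 0 (\<Sum>l<Suc K. a l *\<^sub>R unit_seq (J l)) i)))"
      using E.multiplier_exists by (elim bexE)
    from mu1 have mu: "\<And>i. i < q \<Longrightarrow> 0 \<le> \<mu> i"
      "\<And>\<xi>. \<xi> \<in> vsupp k \<Longrightarrow> (\<Sum>i<K. \<mu> i * D1 0 \<xi> i) = 0"
      "0 \<le> (\<Sum>i<K. \<mu> i * D2 0 (unit_seq 0) i)"
      "\<And>J. (\<forall>l<Suc K. J l < k) \<Longrightarrow> (\<exists>a\<in>usphere (Suc K).
        0 \<le> (\<Sum>i<K. \<mu> i * D2 0 (\<Sum>l<Suc K. a l *\<^sub>R unit_seq (J l)) i))"
      by blast+
    have k0: "0 < k" by (simp add: k_def)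
    have "(\<Sum>i<K. \<mu> i * D2 0 (unit_seq 0) i) = (\<Sum>i<K. \<mu> i * b i h h)"
      by (intro sum.cong refl) (simp add: D(2)[OF unit_seq_vsupp[OF k0]] comb_unit_seq[OF k0] gen_def)
    then have muS: "\<mu> \<in> S" using mu0 mu(1,3) by (simp add: S_def)
    have "\<mu> \<in> C g" if "g \<in> T" for g
    proof -
      have "\<exists>p. p < length gs \<and> gs ! p = g" using that unfolding gs[symmetric] in_set_conv_nth .
      then obtain p where p: "p < length gs" "gs ! p = g" by blast
      define J where "J l = Suc (p * n + l)" for l
      have Jk: "J l < k" if "l < n" for l
      proof -
        have "p * n + l < Suc p * n" using that by simp
        also have "\<dots> \<le> length gs * n" using p(1) by (intro mult_le_mono1) simp
        finally show ?thesis by (simp add: J_def k_def)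
      qed
      have genJ: "gen (J l) = g l" if "l < n" for l
        using that p(2) by (simp add: gen_def J_def)
      have 1: "(\<Sum>i<K. \<mu> i * A i (g l)) = 0" if "l < n" for l
      proof -
        have "(\<Sum>i<K. \<mu> i * D1 0 (unit_seq (J l)) i) = (\<Sum>i<K. \<mu> i * A i (g l))"
          by (intro sum.cong refl) (simp add: D(1)[OF unit_seq_vsupp[OF Jk[OF that]]] comb_unit_seq[OF Jk[OF that]] genJ[OF that])
        then show ?thesis using mu(2)[OF unit_seq_vsupp[OF Jk[OF that]]] by simp
      qed
      obtain a where a: "a \<in> usphere (Suc K)" "0 \<le> (\<Sum>i<K. \<mu> i * D2 0 (\<Sum>l<Suc K. a l *\<^sub>R unit_seq (J l)) i)"
        using mu(4)[of J] Jk unfolding n_def by blast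
      let ?s = "\<Sum>l<Suc K. a l *\<^sub>R unit_seq (J l)"
      have s: "?s \<in> vsupp k"
        using Jk by (intro subspace_sum[OF subspace_vsupp] subspace_scale[OF subspace_vsupp] unit_seq_vsupp) (auto simp: n_def)
      interpret lc: linear "comb k gen" by (rule linear_comb)
      have "comb k gen ?s = (\<Sum>l<Suc K. a l *\<^sub>R comb k gen (unit_seq (J l)))" by (simp only: lc.sum lc.scale)
      also have "\<dots> = (\<Sum>l<Suc K. a l *\<^sub>R g l)"
        using Jk genJ by (intro sum.cong refl) (simp add: comb_unit_seq n_def)
      finally have cs: "comb k gen ?s = (\<Sum>l<Suc K. a l *\<^sub>R g l)" .
      have gH: "g l \<in> H" if "l < Suc K" for l using \<open>g \<in> T\<close> T(1) XH that by blast
      have "(\<Sum>i<K. \<mu> i * D2 0 ?s i) = qf \<mu> a g"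
        unfolding qf_def
      proof (intro sum.cong refl arg_cong[where f = "(*) _"])
        fix i assume "i \<in> {..<K}"
        then have i: "i < K" by simp
        show "D2 0 ?s i = (\<Sum>l<Suc K. \<Sum>l'<Suc K. a l * a l' * b i (g l) (g l'))"
          unfolding D(2)[OF s i] cs by (rule b_comb[OF i gH])
      qed
      then have "0 \<le> qf \<mu> a g" using a(2) by simp
      then show ?thesis using 1 a(1) unfolding C_def by (auto simp: n_def)
    qed
    then show ?thesis using muS T(3) by blast
  qed
  have "S \<inter> \<Inter>(C ` ?T) \<noteq> {}"
    by (rule compact_imp_fip[OF comp cl fip])
  then obtain \<mu> where mu: "\<mu> \<in> S" "\<And>g. g \<in> ?T \<Longrightarrow> \<mu> \<in> C g" by blast
  have CD: "(\<Sum>i<K. \<mu> i * A i (g 0)) = 0" "\<exists>a\<in>usphere (Suc K). 0 \<le> qf \<mu> a g" if "\<mu> \<in> C g" for g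
    using that unfolding C_def by blast+
  \<comment> \<open>Constant tuples give annihilation of single vectors.\<close>
  have "(\<Sum>i<K. \<mu> i * A i x) = 0" if "x \<in> X" for x
    using CD(1)[OF mu(2)[of "\<lambda>_. x"]] that by simp
  then have "mult \<mu>" using mu(1) unfolding mult_def S_def by auto
  moreover have "0 \<le> (\<Sum>i<K. \<mu> i * b i h h)" using mu(1) unfolding S_def by auto
  moreover have "\<exists>a\<in>usphere (Suc K). 0 \<le> qf \<mu> a g" if "\<forall>l<Suc K. g l \<in> X" for g
    using CD(2)[OF mu(2)[of g]] that by blast
  ultimately show ?thesis by blast
qed

text \<open>Witnesses for the truncated tuples accumulate on the sphere. Both arguments of the forms
  are truncated, so joint convergence \<open>apb\<close> is what carries the inequality to the
  limit.\<close>

lemma tuple_extend: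
  assumes "\<And>g. (\<forall>l<Suc K. g l \<in> X) \<Longrightarrow> (\<exists>a\<in>usphere (Suc K). 0 \<le> qf \<mu> a g)"
    and g: "\<And>l. l < Suc K \<Longrightarrow> g l \<in> H"
  shows "\<exists>a\<in>usphere (Suc K). 0 \<le> qf \<mu> a g"
proof -
  have "\<exists>a. a \<in> usphere (Suc K) \<and> 0 \<le> qf \<mu> a (\<lambda>l. ap m (g l))" for m
    using assms(1)[of "\<lambda>l. ap m (g l)"] apX g by blast
  then obtain a where a: "\<And>m. a m \<in> usphere (Suc K)" "\<And>m. 0 \<le> qf \<mu> (a m) (\<lambda>l. ap m (g l))" by metis
  obtain r a' where r: "strict_mono r" and a': "a' \<in> usphere (Suc K)" and al: "\<And>j. (\<lambda>n. a (r n) j) \<longlonglongrightarrow> a' j"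
    using usphere_convergent_subseq[of a "Suc K"] a(1) by metis
  have sub: "f \<longlonglongrightarrow> l \<Longrightarrow> (\<lambda>m. f (r m)) \<longlonglongrightarrow> l" for f :: "nat \<Rightarrow> real" and l
    using LIMSEQ_subseq_LIMSEQ[OF _ r, of f l] by (simp add: o_def)
  have "(\<lambda>n. qf \<mu> (a (r n)) (\<lambda>l. ap (r n) (g l))) \<longlonglongrightarrow> qf \<mu> a' g"
    unfolding qf_def
  proof (intro tendsto_sum tendsto_mult tendsto_const al)
    fix i l l' assume "i \<in> {..<K}" "l \<in> {..<Suc K}" "l' \<in> {..<Suc K}"
    then show "(\<lambda>n. b i (ap (r n) (g l)) (ap (r n) (g l'))) \<longlonglongrightarrow> b i (g l) (g l')"
      using sub[OF apb[OF g g]] by auto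
  qed
  from tendsto_nonneg_affine[OF a(2) this] show ?thesis using a' by auto
qed

text \<open>\<open>multiplier_in_X\<close> needs the sign conditions exactly, whereas
  \<open>ap m h\<close> satisfies them only in the limit. The error in each independent functional
  is removed with its dual vector, and the coefficients of this correction tend to 0, so the
  quadratic values still converge.\<close>

lemma approx_exact:
  assumes h: "h \<in> H"
  obtains y where "\<And>m. y m \<in> X" "\<And>m i. i < K \<Longrightarrow> A i (y m) = A i h"
    "\<And>i. i < K \<Longrightarrow> (\<lambda>m. b i (y m) (y m)) \<longlonglongrightarrow> b i h h"
proof -
  have "\<exists>I e \<gamma>. I \<subseteq> {..<K} \<and> (\<forall>j\<in>I. e j \<in> X) \<and>
    (\<forall>i\<in>I. \<forall>j\<in>I. A i (e j) = (if i = j then 1 else 0)) \<and>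
    (\<forall>i<K. \<forall>x\<in>X. A i x = (\<Sum>j\<in>I. \<gamma> i j * A j x))"
    by (rule biorthogonal_basis[OF lin_on_mono[OF A XH] X])
  then obtain I e \<gamma> where *: "I \<subseteq> {..<K} \<and> (\<forall>j\<in>I. e j \<in> X) \<and>
    (\<forall>i\<in>I. \<forall>j\<in>I. A i (e j) = (if i = j then 1 else 0)) \<and>
    (\<forall>i<K. \<forall>x\<in>X. A i x = (\<Sum>j\<in>I. \<gamma> i j * A j x))" by (elim exE)
  then have I: "I \<subseteq> {..<K}" and e: "\<And>j. j \<in> I \<Longrightarrow> e j \<in> X"
    and bi: "\<And>i j. i \<in> I \<Longrightarrow> j \<in> I \<Longrightarrow> A i (e j) = (if i = j then 1 else 0)"
    and sp: "\<And>i x. i < K \<Longrightarrow> x \<in> X \<Longrightarrow> A i x = (\<Sum>j\<in>I. \<gamma> i j * A j x)"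
    by blast+
  have finI: "finite I" using I finite_subset by blast
  have IK: "i < K" if "i \<in> I" for i using that I by auto
  have eH: "e j \<in> H" if "j \<in> I" for j using that e XH by auto
  define d where "d m j = A j h - A j (ap m h)" for m j
  have dlim: "(\<lambda>m. d m j) \<longlonglongrightarrow> 0" if "j \<in> I" for j
    using tendsto_diff[OF tendsto_const[of "A j h"] apA[OF h IK[OF that]]] by (simp add: d_def)
  define z where "z m = (\<Sum>j\<in>I. d m j *\<^sub>R e j)" for m
  define y where "y m = ap m h + z m" for m
  have zX: "z m \<in> X" for m unfolding z_def using e by (intro subspace_sum[OF X] subspace_scale[OF X]) auto
  have yX: "y m \<in> X" for m unfolding y_def using zX apX[OF h] X by (simp add: subspace_add)
  have apH: "ap m h \<in> H" and zH: "z m \<in> H" and yH: "y m \<in> H" for m using apX[OF h] zX yX XH by auto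
  have Ay: "A i (y m) = A i (ap m h) + (\<Sum>j\<in>I. d m j * A i (e j))" if "i < K" for i m
    unfolding y_def using lin_on_add[OF A[OF that] apH zH, of m m] lin_on_sum[OF A[OF that] H, of I e] eH
    by (simp add: z_def)
  have yI: "A i (y m) = A i h" if "i \<in> I" for i m
  proof -
    have "(\<Sum>j\<in>I. d m j * A i (e j)) = (\<Sum>j\<in>I. if j = i then d m i else 0)"
      using bi that by (intro sum.cong) auto
    then show ?thesis using Ay[OF IK[OF that]] that finI by (simp add: d_def)
  qed
  \<comment> \<open>Dependence among the functionals is known on X only; it extends to h by passing
    to the limit along \<open>ap m h\<close>.\<close>
  have yK: "A i (y m) = A i h" if i: "i < K" for i m
  proof -
    have "(\<lambda>m. A i (ap m h)) \<longlonglongrightarrow> (\<Sum>j\<in>I. \<gamma> i j * A j h)"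
      unfolding sp[OF i apX[OF h]] by (intro tendsto_sum tendsto_mult tendsto_const apA h IK)
    then have "A i h = (\<Sum>j\<in>I. \<gamma> i j * A j h)" using apA[OF h i] LIMSEQ_unique by blast
    also have "\<dots> = (\<Sum>j\<in>I. \<gamma> i j * A j (y m))" using yI by simp
    also have "\<dots> = A i (y m)" using sp[OF i yX] by simp
    finally show ?thesis by simp
  qed
  have "(\<lambda>m. b i (y m) (y m)) \<longlonglongrightarrow> b i h h" if i: "i < K" for i
  proof -
    note l1 = bilin_on_lin[OF b[OF i]] and l2 = bilin_on_lin'[OF b[OF i] H]
    have "b i (y m) (y m) = b i (ap m h) (ap m h) + 2 * (\<Sum>j\<in>I. d m j * b i (ap m h) (e j))
       + (\<Sum>j\<in>I. d m j * (\<Sum>j'\<in>I. d m j' * b i (e j) (e j')))" for m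
    proof -
      have "b i (y m) (y m) = b i (ap m h) (ap m h) + b i (ap m h) (z m) + (b i (z m) (ap m h) + b i (z m) (z m))"
        using lin_on_add[OF l1[OF yH] apH zH, of m m m] lin_on_add[OF l2[OF apH] apH zH, of m m m] lin_on_add[OF l2[OF zH] apH zH, of m m m]
        by (simp add: y_def)
      moreover have "b i (z m) (ap m h) = b i (ap m h) (z m)" by (rule bilin_on_sym[OF b[OF i] zH apH])
      moreover have "b i (ap m h) (z m) = (\<Sum>j\<in>I. d m j * b i (ap m h) (e j))"
        unfolding z_def by (rule lin_on_sum[OF l2[OF apH] H eH])
      moreover have "b i (z m) (z m) = (\<Sum>j\<in>I. d m j * b i (e j) (z m))"
        unfolding z_def[of m] by (rule lin_on_sum[OF l1 H eH]) (use zH[of m] in \<open>simp_all add: z_def\<close>)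
      moreover have "b i (e j) (z m) = (\<Sum>j'\<in>I. d m j' * b i (e j) (e j'))" if "j \<in> I" for j
        unfolding z_def by (rule lin_on_sum[OF l2[OF eH[OF that]] H eH])
      ultimately show ?thesis by (simp cong: sum.cong)
    qed
    moreover have "(\<lambda>m. b i (ap m h) (ap m h) + 2 * (\<Sum>j\<in>I. d m j * b i (ap m h) (e j))
       + (\<Sum>j\<in>I. d m j * (\<Sum>j'\<in>I. d m j' * b i (e j) (e j'))))
       \<longlonglongrightarrow> b i h h + 2 * (\<Sum>j\<in>I. 0 * b i h (e j)) + (\<Sum>j\<in>I. 0 * (\<Sum>j'\<in>I. 0 * b i (e j) (e j')))"
      by (intro tendsto_add tendsto_mult tendsto_sum tendsto_const dlim apb apb1 h eH i)
    ultimately show ?thesis by simp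
  qed
  then show ?thesis using that yX yK by blast
qed

text \<open>Multipliers for the exact approximations y m accumulate on the sphere, and signs,
  annihilation and the tuple condition are closed. Density carries the tuple condition to H, where
  it is the hypothesis \<open>ind\<close> of \<open>finite_index_lower_bound\<close> with N =
  K+1.\<close>

theorem multiplier_finite_index:
  assumes h: "h \<in> H" "\<And>i. i < q \<Longrightarrow> A i h \<le> 0" "\<And>i. q \<le> i \<Longrightarrow> i < K \<Longrightarrow> A i h = 0" and q: "q \<le> K"
  shows "\<exists>\<mu>. mult \<mu> \<and> 0 \<le> (\<Sum>i<K. \<mu> i * b i h h) \<and>
    (\<exists>(r::nat) g. (\<forall>j<r. g j \<in> H) \<and>
      (\<forall>w\<in>H. - (\<Sum>j<r. (\<Sum>i<K. \<mu> i * b i w (g j))\<^sup>2) \<le> (\<Sum>i<K. \<mu> i * b i w w)))"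
proof -
  obtain y where y: "\<And>m. y m \<in> X" "\<And>m i. i < K \<Longrightarrow> A i (y m) = A i h"
    "\<And>i. i < K \<Longrightarrow> (\<lambda>m. b i (y m) (y m)) \<longlonglongrightarrow> b i h h"
    by (rule approx_exact[OF h(1)]) blast
  define P where "P m \<mu> \<longleftrightarrow> mult \<mu> \<and> 0 \<le> (\<Sum>i<K. \<mu> i * b i (y m) (y m)) \<and>
    (\<forall>g. (\<forall>l<Suc K. g l \<in> X) \<longrightarrow> (\<exists>a\<in>usphere (Suc K). 0 \<le> qf \<mu> a g))" for m \<mu>
  have "\<exists>\<mu>. P m \<mu>" for m
    unfolding P_def using y q h by (intro multiplier_in_X) auto
  then obtain \<mu>0 where P0: "\<And>m. P m (\<mu>0 m)" by metis
  obtain r \<mu> where r: "strict_mono r" and mu: "\<mu> \<in> usphere K" and mul: "\<And>j. (\<lambda>n. \<mu>0 (r n) j) \<longlonglongrightarrow> \<mu> j"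
  proof (rule usphere_convergent_subseq[of \<mu>0 K])
    show "\<mu>0 n \<in> usphere K" for n using P0[of n] by (simp add: P_def mult_def)
  qed blast
  have sub: "f \<longlonglongrightarrow> l \<Longrightarrow> (\<lambda>m. f (r m)) \<longlonglongrightarrow> l" for f :: "nat \<Rightarrow> real" and l
    using LIMSEQ_subseq_LIMSEQ[OF _ r, of f l] by (simp add: o_def)
  have "mult \<mu>" unfolding mult_def
  proof (intro conjI mu allI impI ballI)
    show "0 \<le> \<mu> i" if "i < q" for i
      by (rule tendsto_nonneg_affine[OF _ mul]) (use P0 that in \<open>auto simp: P_def mult_def\<close>)
    show "(\<Sum>i<K. \<mu> i * A i x) = 0" if "x \<in> X" for x
    proof (rule LIMSEQ_unique)
      show "(\<lambda>n. \<Sum>i<K. \<mu>0 (r n) i * A i x) \<longlonglongrightarrow> (\<Sum>i<K. \<mu> i * A i x)"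
        by (intro tendsto_intros mul)
      have "(\<Sum>i<K. \<mu>0 (r n) i * A i x) = 0" for n using P0[of "r n"] that by (auto simp: P_def mult_def)
      then show "(\<lambda>n. \<Sum>i<K. \<mu>0 (r n) i * A i x) \<longlonglongrightarrow> 0" by simp
    qed
  qed
  moreover have "0 \<le> (\<Sum>i<K. \<mu> i * b i h h)"
  proof (rule tendsto_nonneg_affine)
    show "0 \<le> (\<Sum>i<K. \<mu>0 (r n) i * b i (y (r n)) (y (r n)))" for n using P0[of "r n"] by (auto simp: P_def)
    show "(\<lambda>n. \<Sum>i<K. \<mu>0 (r n) i * b i (y (r n)) (y (r n))) \<longlonglongrightarrow> (\<Sum>i<K. \<mu> i * b i h h)"
      by (intro tendsto_sum tendsto_mult mul sub[OF y(3)]) auto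
  qed
  moreover have tup: "\<exists>a\<in>usphere (Suc K). 0 \<le> qf \<mu> a g" if g: "\<forall>l<Suc K. g l \<in> X" for g
    by (rule tuple_limit[OF _ mul]) (use P0 g in \<open>auto simp: P_def\<close>)
  define Q where "Q x z = (\<Sum>i<K. \<mu> i * b i x z)" for x z
  have "\<exists>(r::nat) g. (\<forall>j<r. g j \<in> H) \<and> (\<forall>w\<in>H. - (\<Sum>j<r. (Q w (g j))\<^sup>2) \<le> Q w w)"
  proof (rule finite_index_lower_bound[OF _ H, of Q "Suc K"])
    show "bilin_on H Q" unfolding Q_def by (intro bilin_on_lincomb b) auto
    fix g :: "nat \<Rightarrow> 'v" assume "\<And>l. l < Suc K \<Longrightarrow> g l \<in> H"
    then obtain a where a: "a \<in> usphere (Suc K)" "0 \<le> qf \<mu> a g" using tuple_extend[OF tup] by blast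
    have "qf \<mu> a g = (\<Sum>l<Suc K. \<Sum>l'<Suc K. a l * a l' * Q (g l) (g l'))"
    proof -
      have sw: "(\<Sum>i<K. \<Sum>n<Suc K. \<Sum>n'<Suc K. f i n n') = (\<Sum>n<Suc K. \<Sum>n'<Suc K. \<Sum>i<K. f i n n')"
        for f :: "nat \<Rightarrow> nat \<Rightarrow> nat \<Rightarrow> real"
        by (subst sum.swap) (intro sum.cong refl sum.swap)
      show ?thesis unfolding qf_def Q_def sum_distrib_left sw
        by (intro sum.cong refl) (simp only: mult.left_commute)
    qed
    then show "\<exists>a\<in>usphere (Suc K). 0 \<le> (\<Sum>l<Suc K. \<Sum>l'<Suc K. a l * a l' * Q (g l) (g l'))"
      using a by auto
  qed
  ultimately show ?thesis unfolding Q_def by blast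
qed

end

section \<open>Integral equations on a compact interval\<close>

abbreviation leb :: "real \<Rightarrow> real measure"
  where "leb t \<equiv> lebesgue_on {0..t}"

lemma leb_integrable_mono:
  fixes f :: "real \<Rightarrow> 'a::euclidean_space"
  assumes "integrable (leb T) f" "t \<le> T"
  shows "integrable (leb t) f"
  using integrable_subinterval[OF assms(1), of 0 t] assms(2) by auto

lemma leb_AE_mono:
  assumes "AE s in leb T. P s" "t \<le> T"
  shows "AE s in leb t. P s"
proof -
  have "AE s in lebesgue. s \<in> {0..T} \<longrightarrow> P s" using assms(1) by (simp add: AE_restrict_space_iff)
  then have "AE s in lebesgue. s \<in> {0..t} \<longrightarrow> P s" by eventually_elim (use assms(2) in auto)
  then show ?thesis by (simp add: AE_restrict_space_iff)
qed

lemma leb_integral_eq: 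
  fixes f :: "real \<Rightarrow> 'a::euclidean_space"
  assumes "integrable (leb T) f"
  shows "integral\<^sup>L (leb T) f = integral {0..T} f"
  using lebesgue_integral_eq_integral[OF assms] by simp

lemma leb_finite: "finite_measure (leb T)"
  by (rule finite_measure_lebesgue_on) (simp add: fmeasurable_cbox[of 0 T, simplified])

lemma leb_bounded_integrable:
  fixes f :: "real \<Rightarrow> 'a::euclidean_space"
  assumes "f \<in> borel_measurable (leb T)" "\<And>t. t \<in> {0..T} \<Longrightarrow> norm (f t) \<le> B"
  shows "integrable (leb T) f"
proof -
  interpret finite_measure "leb T" by (rule leb_finite)
  show ?thesis by (rule integrable_const_bound[of _ B]) (use assms in \<open>auto intro!: AE_I2\<close>)
qed

lemma leb_continuous_integrable:
  fixes f :: "real \<Rightarrow> 'a::euclidean_space"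
  assumes "continuous_on {0..T} f"
  shows "integrable (leb T) f"
proof -
  have "f absolutely_integrable_on cbox 0 T"
    using assms by (intro absolutely_integrable_continuous) simp
  then show ?thesis by (auto intro: absolutely_integrable_imp_integrable)
qed

lemma leb_continuous_measurable:
  fixes f :: "real \<Rightarrow> 'a::euclidean_space"
  assumes "continuous_on {0..T} f"
  shows "f \<in> borel_measurable (leb T)"
  using leb_continuous_integrable[OF assms] by auto

lemma leb_integral_le:
  fixes f g :: "real \<Rightarrow> real"
  assumes "integrable (leb T) f" "integrable (leb T) g" "\<And>t. t \<in> {0..T} \<Longrightarrow> f t \<le> g t"
  shows "integral\<^sup>L (leb T) f \<le> integral\<^sup>L (leb T) g"
  by (rule integral_mono[OF assms(1,2)]) (use assms(3) in auto)

lemma leb_integral_mono_set: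
  fixes f :: "real \<Rightarrow> real"
  assumes "integrable (leb T) f" "t \<le> T" "\<And>s. s \<in> {0..T} \<Longrightarrow> 0 \<le> f s"
  shows "integral\<^sup>L (leb t) f \<le> integral\<^sup>L (leb T) f"
proof -
  have "integral {0..t} f \<le> integral {0..T} f"
    using assms integrable_on_lebesgue_on[OF assms(1)] integrable_on_lebesgue_on[OF leb_integrable_mono[OF assms(1,2)]]
    by (intro integral_subset_le) auto
  then show ?thesis using leb_integral_eq[OF assms(1)] leb_integral_eq[OF leb_integrable_mono[OF assms(1,2)]] by simp
qed

lemma leb_integral_diff:
  fixes f :: "real \<Rightarrow> 'a::euclidean_space"
  assumes "integrable (leb T) f" "0 \<le> s" "s \<le> t" "t \<le> T"
  shows "integral\<^sup>L (leb t) f - integral\<^sup>L (leb s) f = integral\<^sup>L (lebesgue_on {s..t}) f"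
proof -
  have 1: "integrable (leb t) f" "integrable (leb s) f" "integrable (lebesgue_on {s..t}) f"
    using leb_integrable_mono[OF assms(1)] integrable_subinterval[OF assms(1), of s t] assms by auto
  have "integral {0..s} f + integral {s..t} f = integral {0..t} f"
    using assms integrable_on_lebesgue_on[OF 1(1)] by (intro Henstock_Kurzweil_Integration.integral_combine) auto
  then show ?thesis
    using leb_integral_eq[OF 1(1)] leb_integral_eq[OF 1(2)] lebesgue_integral_eq_integral[OF 1(3)]
    by (simp add: algebra_simps)
qed

lemma leb_exp_integral:
  assumes "K > 0" "t \<ge> 0"
  shows "(LINT s|leb t. exp (K * s)) \<le> exp (K * t) / K"
proof -
  have "((\<lambda>s. exp (K * s)) has_integral (exp (K * t) / K - exp (K * 0) / K)) {0..t}"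
    using assms by (intro fundamental_theorem_of_calculus)
      (auto intro!: derivative_eq_intros simp flip: has_real_derivative_iff_has_vector_derivative)
  moreover have "integrable (leb t) (\<lambda>s. exp (K * s))"
    by (intro leb_continuous_integrable continuous_intros)
  ultimately have "(LINT s|leb t. exp (K * s)) = exp (K * t) / K - exp (K * 0) / K"
    using leb_integral_eq integral_unique by metis
  then show ?thesis using assms by simp
qed

definition gron :: "real \<Rightarrow> real \<Rightarrow> real"
  where "gron L T = (L + 1) * exp ((L + 1) * T)"

lemma gron_pos: "L \<ge> 0 \<Longrightarrow> gron L T > 0"
  by (simp add: gron_def)

text \<open>With K = L + 1, the maximum M of e t exp (- K t) satisfies M \<le> C + M L / K when it
  is nonnegative, hence M \<le> C K because K - L = 1. This works with the integral inequality
  directly; the price is a constant larger than exp (L T).\<close>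

lemma gronwall:
  fixes e :: "real \<Rightarrow> real"
  assumes T: "0 \<le> T" and L: "0 \<le> L" and e: "continuous_on {0..T} e"
    and le: "\<And>t. t \<in> {0..T} \<Longrightarrow> e t \<le> C + L * (LINT s|leb t. e s)"
    and C: "0 \<le> C" and t: "t \<in> {0..T}"
  shows "e t \<le> C * gron L T"
proof -
  define K where "K = L + 1"
  have K: "K > 0" using L by (simp add: K_def)
  have "continuous_on {0..T} (\<lambda>t. e t * exp (- K * t))" by (intro continuous_intros e)
  then obtain t0 where t0: "t0 \<in> {0..T}" "\<And>t. t \<in> {0..T} \<Longrightarrow> e t * exp (- K * t) \<le> e t0 * exp (- K * t0)"
    using continuous_attains_sup[of "{0..T}" "\<lambda>t. e t * exp (- K * t)"] T by auto
  define M where "M = e t0 * exp (- K * t0)"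
  have eM: "e t \<le> M * exp (K * t)" if "t \<in> {0..T}" for t
  proof -
    have "e t * exp (- K * t) * exp (K * t) \<le> M * exp (K * t)"
      using t0(2)[OF that] by (intro mult_right_mono) (auto simp: M_def)
    moreover have "e t * exp (- K * t) * exp (K * t) = e t"
      by (simp only: mult.assoc mult_exp_exp) simp
    ultimately show ?thesis by linarith
  qed
  have MCK: "M \<le> C * K"
  proof (cases "M \<ge> 0")
    case True
    have "(LINT s|leb t0. e s) \<le> (LINT s|leb t0. M * exp (K * s))"
      using t0 eM by (intro leb_integral_le leb_continuous_integrable continuous_on_subset[OF e] continuous_intros) auto
    also have "\<dots> = M * (LINT s|leb t0. exp (K * s))" by simp
    also have "\<dots> \<le> M * (exp (K * t0) / K)"
      using t0 True by (intro mult_left_mono leb_exp_integral K) auto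
    finally have "L * (LINT s|leb t0. e s) \<le> L * (M * (exp (K * t0) / K))"
      using L by (intro mult_left_mono)
    then have "e t0 \<le> C + L * (M * (exp (K * t0) / K))" using le[OF t0(1)] by linarith
    then have "M \<le> (C + L * (M * (exp (K * t0) / K))) * exp (- K * t0)"
      unfolding M_def[symmetric] by (simp add: M_def)
    also have "\<dots> = C * exp (- K * t0) + L * M / K"
      by (simp add: distrib_right exp_minus)
    also have "\<dots> \<le> C + L * M / K"
      using C K t0 mult_left_mono[of "exp (- K * t0)" 1 C] by simp
    finally have "M * K \<le> C * K + L * M" using K by (simp add: field_simps)
    then show ?thesis by (simp add: K_def algebra_simps)
  next
    case False
    then show ?thesis using C K by (smt (verit) mult_nonneg_nonneg)
  qed
  have "e t \<le> C * K * exp (K * t)"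
    using eM[OF t] mult_right_mono[OF MCK exp_ge_zero[of "K * t"]] by linarith
  also have "\<dots> \<le> C * K * exp (K * T)"
    using t C K by (intro mult_left_mono) auto
  finally show ?thesis by (simp add: gron_def K_def)
qed

lemma primitive_continuous:
  fixes g :: "real \<Rightarrow> 'a::euclidean_space"
  assumes "integrable (leb T) g" "\<And>t. t \<in> {0..T} \<Longrightarrow> z t = z0 + (LINT s|leb t. g s)"
  shows "continuous_on {0..T} z"
proof -
  have "continuous_on {0..T} (\<lambda>t. z0 + (LINT s|leb t. g s))"
    by (intro continuous_intros indefinite_integral_continuous_real assms)
  then show ?thesis
    by (rule continuous_on_eq) (use assms(2) in auto)
qed

text \<open>The form used for all trajectory estimates: the derivative is bounded only almost
  everywhere and the source r only in L^1, so r enters through its integral.\<close>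

lemma gronwall_primitive:
  fixes z :: "real \<Rightarrow> 'a::euclidean_space"
  assumes T: "0 \<le> T" and L: "0 \<le> L" and g: "integrable (leb T) g"
    and z: "\<And>t. t \<in> {0..T} \<Longrightarrow> z t = z0 + (LINT s|leb t. g s)"
    and r: "integrable (leb T) r" "\<And>s. s \<in> {0..T} \<Longrightarrow> 0 \<le> r s"
    and le: "AE s in leb T. norm (g s) \<le> L * norm (z s) + r s"
    and t: "t \<in> {0..T}"
  shows "norm (z t) \<le> (norm z0 + (LINT s|leb T. r s)) * gron L T"
proof (rule gronwall[OF T L _ _ _ t])
  have zc: "continuous_on {0..T} z" using primitive_continuous[OF g z] by blast
  show cn: "continuous_on {0..T} (\<lambda>t. norm (z t))" by (intro continuous_intros zc)
  have "0 \<le> (LINT s|leb T. r s)" using r by (intro integral_nonneg_AE) (auto intro!: AE_I2)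
  then show "0 \<le> norm z0 + (LINT s|leb T. r s)" by simp
  fix t assume t: "t \<in> {0..T}"
  then have tT: "t \<le> T" by simp
  have zi: "integrable (leb t) (\<lambda>s. norm (z s))"
    using t by (intro leb_continuous_integrable continuous_on_subset[OF cn]) auto
  have "norm (z t) \<le> norm z0 + norm (LINT s|leb t. g s)" using z[OF t] norm_triangle_ineq by metis
  also have "norm (LINT s|leb t. g s) \<le> (LINT s|leb t. norm (g s))" by simp
  also have "\<dots> \<le> (LINT s|leb t. L * norm (z s) + r s)"
    using leb_AE_mono[OF le tT] leb_integrable_mono[OF g tT] leb_integrable_mono[OF r(1) tT] zi
    by (intro integral_mono_AE) auto
  also have "\<dots> = L * (LINT s|leb t. norm (z s)) + (LINT s|leb t. r s)"
    using zi leb_integrable_mono[OF r(1) tT] by simp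
  also have "(LINT s|leb t. r s) \<le> (LINT s|leb T. r s)" using leb_integral_mono_set[OF r(1) tT r(2)] .
  finally show "norm (z t) \<le> norm z0 + (LINT s|leb T. r s) + L * (LINT s|leb t. norm (z s))" by simp
qed

text \<open>Picard iteration for the unknown exp (- K t) x t. With K = 2 L + 1 the exponential
  weight makes the integral operator a contraction of factor 1/2 on the whole interval at once, and
  in time only integrability is involved.\<close>

lemma ode_exists:
  fixes f :: "real \<Rightarrow> 'a::euclidean_space \<Rightarrow> 'a"
  assumes T: "0 \<le> T" and L: "0 \<le> L"
    and lip: "\<And>t x y. t \<in> {0..T} \<Longrightarrow> norm (f t x - f t y) \<le> L * norm (x - y)"
    and int: "\<And>y. continuous_on {0..T} y \<Longrightarrow> integrable (leb T) (\<lambda>t. f t (y t))"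
  shows "\<exists>x. continuous_on {0..T} x \<and> (\<forall>t\<in>{0..T}. x t = x0 + (LINT s|leb t. f s (x s)))"
proof -
  define K where "K = 2 * L + 1"
  have K: "K > 0" using L by (simp add: K_def)
  define op where "op y t = exp (- K * t) *\<^sub>R (x0 + (LINT s|leb t. f s (exp (K * s) *\<^sub>R y s)))" for y :: "real \<Rightarrow> 'a" and t
  have fint: "integrable (leb T) (\<lambda>s. f s (exp (K * s) *\<^sub>R apply_bcontfun y s))" for y :: "real \<Rightarrow>\<^sub>C 'a"
    by (intro int continuous_intros) auto
  \<comment> \<open>The fixed point theorem is applied in the complete space of bounded continuous
    functions on the line; \<open>clamp\<close> extends the image of the operator constantly beyond
    the interval.\<close>
  have "\<exists>g :: real \<Rightarrow>\<^sub>C 'a. \<forall>t. apply_bcontfun g t = op (apply_bcontfun y) (clamp 0 T t)" for y :: "real \<Rightarrow>\<^sub>C 'a"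
  proof -
    have "continuous_on (cbox 0 T) (op (apply_bcontfun y))"
      unfolding op_def cbox_interval
      by (intro continuous_intros indefinite_integral_continuous_real fint)
    then obtain g :: "real \<Rightarrow>\<^sub>C 'a" where "\<And>x. g x = op (apply_bcontfun y) (clamp 0 T x)"
      by (rule continuous_on_cbox_bcontfunE) blast
    then show ?thesis by blast
  qed
  then obtain \<Phi> where \<Phi>2: "\<And>y t. apply_bcontfun (\<Phi> y) t = op (apply_bcontfun y) (clamp 0 T t)" by metis
  have \<Phi>1: "apply_bcontfun (\<Phi> y) t = op (apply_bcontfun y) t" if "t \<in> {0..T}" for y t
    using \<Phi>2[of y t] that by (simp add: clamp_cancel_cbox)
  have contr: "dist (\<Phi> y) (\<Phi> z) \<le> (1/2) * dist y z" for y z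
  proof (rule dist_bound)
    fix t
    define u where "u = clamp 0 T t"
    have u: "u \<in> {0..T}" using T clamp_in_interval[of 0 T t] by (simp add: u_def)
    then have uT: "u \<le> T" by simp
    let ?fy = "\<lambda>s. f s (exp (K * s) *\<^sub>R apply_bcontfun y s)" and ?fz = "\<lambda>s. f s (exp (K * s) *\<^sub>R apply_bcontfun z s)"
    have iy: "integrable (leb u) ?fy" and iz: "integrable (leb u) ?fz"
      using leb_integrable_mono[OF fint uT] by auto
    have "dist (apply_bcontfun (\<Phi> y) t) (apply_bcontfun (\<Phi> z) t) = norm (op (apply_bcontfun y) u - op (apply_bcontfun z) u)"
      unfolding \<Phi>2 u_def dist_norm ..
    also have "op (apply_bcontfun y) u - op (apply_bcontfun z) u = exp (- K * u) *\<^sub>R (LINT s|leb u. ?fy s - ?fz s)"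
      unfolding op_def using iy iz by (simp add: scaleR_diff_right[symmetric])
    also have "norm \<dots> = exp (- K * u) * norm (LINT s|leb u. ?fy s - ?fz s)" by simp
    also have "\<dots> \<le> exp (- K * u) * (LINT s|leb u. (L * dist y z) * exp (K * s))"
    proof (intro mult_left_mono)
      show "norm (LINT s|leb u. ?fy s - ?fz s) \<le> (LINT s|leb u. (L * dist y z) * exp (K * s))"
      proof (rule Bochner_Integration.integral_norm_bound_integral)
        show "integrable (leb u) (\<lambda>s. ?fy s - ?fz s)" using iy iz by simp
        show "integrable (leb u) (\<lambda>s. (L * dist y z) * exp (K * s))"
          by (intro leb_continuous_integrable continuous_intros)
        fix s assume "s \<in> space (leb u)"
        then have s: "s \<in> {0..T}" using u by auto
        have "norm (?fy s - ?fz s) \<le> L * norm (exp (K * s) *\<^sub>R apply_bcontfun y s - exp (K * s) *\<^sub>R apply_bcontfun z s)"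
          by (rule lip[OF s])
        also have "\<dots> = L * (exp (K * s) * dist (apply_bcontfun y s) (apply_bcontfun z s))"
          by (simp add: dist_norm scaleR_diff_right[symmetric])
        also have "\<dots> \<le> L * (exp (K * s) * dist y z)"
          using L dist_bounded[of y s z] by (intro mult_left_mono) auto
        finally show "norm (?fy s - ?fz s) \<le> (L * dist y z) * exp (K * s)" by (simp add: mult_ac)
      qed
    qed auto
    also have "(LINT s|leb u. (L * dist y z) * exp (K * s)) = (L * dist y z) * (LINT s|leb u. exp (K * s))" by simp
    also have "exp (- K * u) * ((L * dist y z) * (LINT s|leb u. exp (K * s))) \<le> exp (- K * u) * ((L * dist y z) * (exp (K * u) / K))"
      using L u by (intro mult_left_mono leb_exp_integral K) auto
    also have "\<dots> = (L / K) * dist y z" by (simp add: exp_minus)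
    also have "\<dots> \<le> (1/2) * dist y z"
      using L by (intro mult_right_mono) (auto simp: K_def field_simps)
    finally show "dist (apply_bcontfun (\<Phi> y) t) (apply_bcontfun (\<Phi> z) t) \<le> (1/2) * dist y z" .
  qed
  have "\<exists>!y. \<Phi> y = y" by (rule banach_fix_type[of "1/2"]) (use contr in auto)
  then obtain y where y: "\<Phi> y = y" by blast
  define x where "x t = exp (K * t) *\<^sub>R apply_bcontfun y t" for t
  have "continuous_on {0..T} x" unfolding x_def by (intro continuous_intros) auto
  moreover have "x t = x0 + (LINT s|leb t. f s (x s))" if "t \<in> {0..T}" for t
  proof -
    have "apply_bcontfun y t = op (apply_bcontfun y) t" using \<Phi>1[OF that, of y] y by simp
    then have "x t = exp (K * t) *\<^sub>R op (apply_bcontfun y) t" by (simp add: x_def)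
    then show ?thesis unfolding op_def x_def by (simp add: exp_minus)
  qed
  ultimately show ?thesis by blast
qed

section \<open>Uniqueness of weak derivatives and integration by parts\<close>

lemma sigma_finite_lebesgue: "sigma_finite_measure (lebesgue :: 'a::euclidean_space measure)"
proof
  obtain A :: "'a set set" where A: "countable A" "A \<subseteq> sets lborel" "\<Union>A = space lborel" "\<forall>a\<in>A. emeasure lborel a \<noteq> \<infinity>"
    using lborel.sigma_finite_countable[where 'a='a] by (elim exE conjE) (rule that)
  have "emeasure lebesgue a \<noteq> \<infinity>" if "a \<in> A" for a
  proof -
    have "a \<in> sets lborel" using A(2) that by blast
    then show ?thesis using A(4) that by simp
  qed
  moreover have "A \<subseteq> sets (lebesgue :: 'a measure)" using A(2) by (intro subset_trans[OF A(2)] subsetI) simp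
  moreover have "\<Union>A = space (lebesgue :: 'a measure)" using A(3) by simp
  ultimately show "\<exists>A. countable A \<and> A \<subseteq> sets (lebesgue :: 'a measure) \<and> \<Union>A = space lebesgue \<and> (\<forall>a\<in>A. emeasure lebesgue a \<noteq> \<infinity>)"
    using A(1) by blast
qed

text \<open>The integral of h vanishes on half-lines, hence on Borel sets by induction over this
  intersection-stable generator, and on Lebesgue sets because they differ from Borel sets by null
  sets. A function all of whose integrals vanish is zero almost everywhere.\<close>

lemma primitive_zero_AE:
  fixes h :: "real \<Rightarrow> 'a::euclidean_space"
  assumes h: "integrable (leb T) h" and z: "\<And>t. t \<in> {0..T} \<Longrightarrow> (LINT s|leb t. h s) = 0" and T: "0 \<le> T"
  shows "AE s in leb T. h s = 0"
proof -
  define k where "k s = (if s \<in> {0..T} then h s else 0)" for s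
  have k: "integrable lebesgue k" unfolding k_def using h by (subst Lebesgue_Measure.integrable_restrict_UNIV) auto
  have seti: "set_integrable lebesgue A k" if "A \<in> sets lebesgue" for A
    unfolding set_integrable_def using integrable_mult_indicator[OF that k] .
  have kA: "set_lebesgue_integral lebesgue {..a} k = 0" for a
  proof -
    have "set_lebesgue_integral lebesgue {..a} k = (LINT s|lebesgue. (if s \<in> {0..min a T} then h s else 0))"
      unfolding set_lebesgue_integral_def by (intro Bochner_Integration.integral_cong) (auto simp: k_def indicator_def)
    also have "\<dots> = (LINT s|leb (min a T). h s)" by (rule Lebesgue_Measure.integral_restrict_UNIV) auto
    also have "\<dots> = 0"
    proof (cases "a < 0")
      case True
      then show ?thesis by (simp add: min_def)
    next
      case False
      then show ?thesis using z[of "min a T"] T by auto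
    qed
    finally show ?thesis .
  qed
  have kU: "(LINT s|lebesgue. k s) = 0"
    unfolding k_def using Lebesgue_Measure.integral_restrict_UNIV[of "{0..T}" h] z[of T] T by auto
  have borel0: "set_lebesgue_integral lebesgue A k = 0" if "A \<in> sets borel" for A
  proof -
    have mem: "A \<in> sigma_sets UNIV (range (\<lambda>a::real. {..a}))"
      using that unfolding borel_eq_atMost by simp
    have leb: "B \<in> sets lebesgue" if "B \<in> sigma_sets UNIV (range (\<lambda>a::real. {..a}))" for B
    proof -
      have "B \<in> sets borel" unfolding borel_eq_atMost using that by simp
      then show ?thesis by simp
    qed
    have "Int_stable (range (\<lambda>a::real. {..a}))"
      by (auto simp: Int_stable_def)
    from this subset_Pow_Union[of "range (\<lambda>a::real. {..a})"] have st: "Int_stable (range (\<lambda>a::real. {..a}))" "range (\<lambda>a::real. {..a}) \<subseteq> Pow UNIV"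
      by auto
    from st mem show ?thesis
    proof (induction rule: sigma_sets_induct_disjoint)
      case (basic A) then show ?case using kA by auto
    next
      case empty then show ?case by (simp add: set_lebesgue_integral_def)
    next
      case (compl A)
      then have A: "A \<in> sets lebesgue" using leb by blast
      have "set_lebesgue_integral lebesgue (UNIV - A) k + set_lebesgue_integral lebesgue A k = set_lebesgue_integral lebesgue UNIV k"
        proof -
        have "UNIV - A \<in> sets lebesgue" using sets.Diff[OF sets.top[of lebesgue] A] by simp
        moreover have "(UNIV - A) \<inter> A = {}" "(UNIV - A) \<union> A = UNIV" by auto
        ultimately show ?thesis using set_integral_Un[of "UNIV - A" A lebesgue k] seti[OF A] seti[of "UNIV - A"] by simp
      qed
      then show ?case using compl kU by (simp add: set_lebesgue_integral_def)
    next
      case (union A)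
      have A: "A i \<in> sets lebesgue" for i
        using union(2) leb by blast
      have "set_lebesgue_integral lebesgue (\<Union>i. A i) k = (\<Sum>i. set_lebesgue_integral lebesgue (A i) k)"
        using A union(1) by (intro lebesgue_integral_countable_add seti) (auto simp: disjoint_family_on_def)
      then show ?case using union by simp
    qed
  qed
  have "AE s in lebesgue. k s = 0"
  proof (rule sigma_finite_measure.density_zero[OF _ k])
    show "sigma_finite_measure (lebesgue :: real measure)" by (rule sigma_finite_lebesgue)
  next
    fix A :: "real set" assume A: "A \<in> sets lebesgue"
    obtain S N N' where S: "A = S \<union> N" "N \<subseteq> N'" "N' \<in> null_sets lborel" "S \<in> sets lborel"
      using sets_completionE[OF A] by metis
    have ae: "AE s in lebesgue. s \<notin> N'" using S(3) by (intro AE_not_in null_sets_completionI)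
    have "set_lebesgue_integral lebesgue A k = set_lebesgue_integral lebesgue S k"
      unfolding set_lebesgue_integral_def
    proof (rule integral_cong_AE)
      show "AE s in lebesgue. indicat_real A s *\<^sub>R k s = indicat_real S s *\<^sub>R k s"
        using ae by eventually_elim (use S in \<open>auto simp: indicator_def\<close>)
      have kb: "k \<in> borel_measurable lebesgue" using k by auto
      show "(\<lambda>s. indicat_real A s *\<^sub>R k s) \<in> borel_measurable lebesgue" "(\<lambda>s. indicat_real S s *\<^sub>R k s) \<in> borel_measurable lebesgue"
        using kb A S(4) by (auto intro!: borel_measurable_scaleR borel_measurable_indicator)
    qed
    then show "set_lebesgue_integral lebesgue A k = 0" using borel0[of S] S(4) by simp
  qed
  then have "AE s in lebesgue. s \<in> {0..T} \<longrightarrow> h s = 0"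
    by eventually_elim (auto simp: k_def)
  then show ?thesis by (simp add: AE_restrict_space_iff)
qed

text \<open>Makes the choice in \<open>wderiv\<close> harmless: whichever derivative it picks agrees
  almost everywhere with any derivative at hand.\<close>

lemma has_wderiv_AE_unique:
  assumes "has_wderiv T x g" "has_wderiv T x g'" "0 \<le> T"
  shows "AE s in leb T. g s = g' s"
proof -
  have i: "integrable (leb T) g" "integrable (leb T) g'" using assms unfolding has_wderiv_def by blast+
  have "AE s in leb T. g s - g' s = 0"
  proof (rule primitive_zero_AE)
    show "integrable (leb T) (\<lambda>s. g s - g' s)" using i by simp
    fix t assume t: "t \<in> {0..T}"
    then have "integrable (leb t) g" "integrable (leb t) g'" using leb_integrable_mono[OF i(1)] leb_integrable_mono[OF i(2)] by auto
    then have "(LINT s|leb t. g s - g' s) = (LINT s|leb t. g s) - (LINT s|leb t. g' s)" by simp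
    moreover have "x t = x 0 + (LINT s|leb t. g s)" "x t = x 0 + (LINT s|leb t. g' s)"
      using assms t unfolding has_wderiv_def by blast+
    ultimately show "(LINT s|leb t. g s - g' s) = 0" by simp
  qed (use assms in auto)
  then show ?thesis by eventually_elim simp
qed

lemma has_wderiv_wderiv: "has_wderiv T x g \<Longrightarrow> has_wderiv T x (wderiv T x)"
  unfolding wderiv_def by (rule someI[of "has_wderiv T x"])

lemma wderiv_AE: "has_wderiv T x g \<Longrightarrow> 0 \<le> T \<Longrightarrow> AE s in leb T. wderiv T x s = g s"
  using has_wderiv_AE_unique has_wderiv_wderiv by blast

text \<open>Integration by parts without differentiating: the defect D has increments bounded by the
  squared increments of the primitive m of |f| + |g|, so summation over a fine partition shows that
  D takes the same value at both ends.\<close>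

lemma primitive_product:
  fixes F G f g :: "real \<Rightarrow> 'a::euclidean_space"
  assumes T: "0 \<le> T" and f: "integrable (leb T) f" and g: "integrable (leb T) g"
    and F: "\<And>t. t \<in> {0..T} \<Longrightarrow> F t = F0 + (LINT s|leb t. f s)"
    and G: "\<And>t. t \<in> {0..T} \<Longrightarrow> G t = G0 + (LINT s|leb t. g s)"
  shows "F T \<bullet> G T - F 0 \<bullet> G 0 = (LINT s|leb T. f s \<bullet> G s + F s \<bullet> g s)"
proof -
  have Fc: "continuous_on {0..T} F" and Gc: "continuous_on {0..T} G"
    using primitive_continuous[OF f F] primitive_continuous[OF g G] by blast+
  have prod_int: "integrable (leb T) (\<lambda>s. u s \<bullet> U s)" if u: "integrable (leb T) u" and U: "continuous_on {0..T} U" for u U :: "real \<Rightarrow> 'a"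
  proof -
    have "\<exists>B. \<forall>s\<in>{0..T}. norm (U s) \<le> B"
      using compact_imp_bounded[OF compact_continuous_image[OF U compact_Icc]] by (auto simp: bounded_iff)
    then obtain B where B: "\<And>s. s \<in> {0..T} \<Longrightarrow> norm (U s) \<le> B" by blast
    show ?thesis
    proof (rule Bochner_Integration.integrable_bound)
      show "integrable (leb T) (\<lambda>s. norm (u s) * B)" using u by simp
      show "(\<lambda>s. u s \<bullet> U s) \<in> borel_measurable (leb T)"
        using u leb_continuous_measurable[OF U] by (intro borel_measurable_inner) auto
      show "AE s in leb T. norm (u s \<bullet> U s) \<le> norm (norm (u s) * B)"
      proof (rule AE_I2)
        fix s assume "s \<in> space (leb T)"
        then have "s \<in> {0..T}" by simp
        have "\<bar>u s \<bullet> U s\<bar> \<le> norm (u s) * norm (U s)" by (rule Cauchy_Schwarz_ineq2)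
        also have "\<dots> \<le> norm (u s) * B" using B[OF \<open>s \<in> {0..T}\<close>] by (intro mult_left_mono) auto
        finally show "norm (u s \<bullet> U s) \<le> norm (norm (u s) * B)" by simp
      qed
    qed
  qed
  define p where "p s = f s \<bullet> G s + F s \<bullet> g s" for s
  have pint: "integrable (leb T) p"
    unfolding p_def using prod_int[OF f Gc] prod_int[OF g Fc] by (simp add: inner_commute)
  define m where "m t = (LINT s|leb t. norm (f s) + norm (g s))" for t
  have mi: "integrable (leb T) (\<lambda>s. norm (f s) + norm (g s))" using f g by simp
  have mc: "continuous_on {0..T} m" unfolding m_def by (rule indefinite_integral_continuous_real[OF mi])
  have mmono: "m s \<le> m t" if "s \<le> t" "t \<le> T" for s t
    unfolding m_def by (rule leb_integral_mono_set[OF leb_integrable_mono[OF mi that(2)] that(1)]) auto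
  define D where "D t = F t \<bullet> G t - (LINT s|leb t. p s)" for t
  have Finc: "norm (F t - F s) \<le> m t - m s" and Ginc: "norm (G t - G s) \<le> m t - m s" if st: "0 \<le> s" "s \<le> t" "t \<le> T" for s t
  proof -
    have i: "integrable (lebesgue_on {s..t}) f" "integrable (lebesgue_on {s..t}) g"
      using integrable_subinterval[OF f, of s t] integrable_subinterval[OF g, of s t] st by auto
    have m: "m t - m s = (LINT r|lebesgue_on {s..t}. norm (f r) + norm (g r))"
      unfolding m_def by (rule leb_integral_diff[OF mi st])
    have "F t - F s = (LINT r|lebesgue_on {s..t}. f r)"
      using F[of t] F[of s] leb_integral_diff[OF f st] st by simp
    then show "norm (F t - F s) \<le> m t - m s" unfolding m using i
      by (simp only:) (intro Bochner_Integration.integral_norm_bound_integral Bochner_Integration.integrable_add integrable_norm, auto)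
    have "G t - G s = (LINT r|lebesgue_on {s..t}. g r)"
      using G[of t] G[of s] leb_integral_diff[OF g st] st by simp
    then show "norm (G t - G s) \<le> m t - m s" unfolding m using i
      by (simp only:) (intro Bochner_Integration.integral_norm_bound_integral Bochner_Integration.integrable_add integrable_norm, auto)
  qed
  \<comment> \<open>On {s..t} the values of F and G differ from those at the end points by at most m
    t - m s, so the integrand of the defect is at most (|f| + |g|) (m t - m s).\<close>
  have Dinc: "\<bar>D t - D s\<bar> \<le> 2 * (m t - m s)\<^sup>2" if st: "0 \<le> s" "s \<le> t" "t \<le> T" for s t
  proof -
    let ?I = "lebesgue_on {s..t}"
    have i: "integrable ?I f" "integrable ?I g" "integrable ?I p"
      using integrable_subinterval[OF f, of s t] integrable_subinterval[OF g, of s t] integrable_subinterval[OF pint, of s t] st by auto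
    have dF: "F t - F s = (LINT r|?I. f r)"
      using F[of t] F[of s] leb_integral_diff[OF f st] st by simp
    have dG: "G t - G s = (LINT r|?I. g r)"
      using G[of t] G[of s] leb_integral_diff[OF g st] st by simp
    have dm: "m t - m s = (LINT r|?I. norm (f r) + norm (g r))"
      unfolding m_def by (rule leb_integral_diff[OF mi st])
    have "D t - D s = (F t - F s) \<bullet> G t + F s \<bullet> (G t - G s) - (LINT r|?I. p r)"
      using leb_integral_diff[OF pint st] by (simp add: D_def inner_diff_left inner_diff_right)
    also have "\<dots> = (LINT r|?I. f r \<bullet> G t + F s \<bullet> g r - p r)"
      unfolding dF dG using i by simp
    finally have "\<bar>D t - D s\<bar> = norm (LINT r|?I. f r \<bullet> G t + F s \<bullet> g r - p r)" by simp
    also have "\<dots> \<le> (LINT r|?I. (norm (f r) + norm (g r)) * (m t - m s))"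
    proof (rule Bochner_Integration.integral_norm_bound_integral)
      show "integrable ?I (\<lambda>r. f r \<bullet> G t + F s \<bullet> g r - p r)" using i by simp
      show "integrable ?I (\<lambda>r. (norm (f r) + norm (g r)) * (m t - m s))" using i by simp
      fix r assume "r \<in> space ?I"
      then have r: "s \<le> r" "r \<le> t" by auto
      have "norm (f r \<bullet> (G t - G r)) \<le> norm (f r) * norm (G t - G r)" by (simp add: Cauchy_Schwarz_ineq2)
      also have "\<dots> \<le> norm (f r) * (m t - m s)"
        using Ginc[of r t] mmono[of s r] r st by (intro mult_left_mono) auto
      finally have 1: "norm (f r \<bullet> (G t - G r)) \<le> norm (f r) * (m t - m s)" .
      have "norm ((F r - F s) \<bullet> g r) \<le> norm (F r - F s) * norm (g r)" by (simp add: Cauchy_Schwarz_ineq2)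
      also have "\<dots> \<le> (m t - m s) * norm (g r)"
        using Finc[of s r] mmono[of r t] r st by (intro mult_right_mono) auto
      finally have 2: "norm ((F r - F s) \<bullet> g r) \<le> (m t - m s) * norm (g r)" .
      have "f r \<bullet> G t + F s \<bullet> g r - p r = f r \<bullet> (G t - G r) - (F r - F s) \<bullet> g r"
        by (simp add: p_def inner_diff_left inner_diff_right)
      then show "norm (f r \<bullet> G t + F s \<bullet> g r - p r) \<le> (norm (f r) + norm (g r)) * (m t - m s)"
        using 1 2 norm_triangle_ineq4[of "f r \<bullet> (G t - G r)" "(F r - F s) \<bullet> g r"] by (simp add: algebra_simps)
    qed
    also have "\<dots> = (m t - m s) * (m t - m s)" unfolding dm by simp
    also have "\<dots> \<le> 2 * (m t - m s)\<^sup>2" by (simp add: power2_eq_square)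
    finally show ?thesis .
  qed
  have "\<bar>D T - D 0\<bar> \<le> 0"
  proof (rule field_le_epsilon)
    fix \<epsilon> :: real assume "\<epsilon> > 0"
    define M where "M = m T - m 0 + 1"
    have M: "M > 0" using mmono[of 0 T] T by (simp add: M_def)
    define \<epsilon>' where "\<epsilon>' = \<epsilon> / (2 * M)"
    have \<epsilon>': "\<epsilon>' > 0" using \<open>\<epsilon> > 0\<close> M by (simp add: \<epsilon>'_def)
    obtain d where d: "d > 0" "\<And>s t. s \<in> {0..T} \<Longrightarrow> t \<in> {0..T} \<Longrightarrow> dist t s < d \<Longrightarrow> dist (m t) (m s) < \<epsilon>'"
      using compact_uniformly_continuous[OF mc compact_Icc] \<epsilon>' unfolding uniformly_continuous_on_def by metis
    \<comment> \<open>A uniform partition with mesh below d makes each squared increment of m at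
      most \<epsilon>' times the increment itself, and the sum of the increments telescopes.\<close>
    obtain N :: nat where N: "T / d < real N" using reals_Archimedean2 by blast
    have N0: "N > 0" using N T d by (cases N) (auto simp: field_simps)
    define \<tau> where "\<tau> i = T * real i / real N" for i
    have \<tau>0: "\<tau> 0 = 0" and \<tau>N: "\<tau> N = T" using N0 by (auto simp: \<tau>_def)
    have \<tau>le: "\<tau> i \<le> \<tau> (Suc i)" for i using T by (simp add: \<tau>_def divide_right_mono mult_left_mono)
    have \<tau>in: "\<tau> i \<in> {0..T}" if "i \<le> N" for i
      using that T N0 by (auto simp: \<tau>_def field_simps mult_left_mono)
    have \<tau>d: "\<tau> (Suc i) - \<tau> i < d" for i
    proof -
      have "\<tau> (Suc i) - \<tau> i = T / real N" by (simp add: \<tau>_def diff_divide_distrib[symmetric] algebra_simps)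
      also have "\<dots> < d" using N d N0 by (simp add: field_simps)
      finally show ?thesis .
    qed
    have "\<bar>D (\<tau> j) - D 0\<bar> \<le> 2 * \<epsilon>' * (m (\<tau> j) - m 0)" if "j \<le> N" for j
      using that
    proof (induction j)
      case 0 then show ?case by (simp add: \<tau>0)
    next
      case (Suc i)
      have in1: "\<tau> i \<in> {0..T}" and in2: "\<tau> (Suc i) \<in> {0..T}" using \<tau>in Suc.prems by auto
      have dm0: "0 \<le> m (\<tau> (Suc i)) - m (\<tau> i)" using mmono[OF \<tau>le] in2 by auto
      have "dist (m (\<tau> (Suc i))) (m (\<tau> i)) < \<epsilon>'"
        using d(2)[OF in1 in2] \<tau>d[of i] \<tau>le[of i] by (simp add: dist_real_def)
      then have "m (\<tau> (Suc i)) - m (\<tau> i) \<le> \<epsilon>'" by (simp add: dist_real_def)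
      then have "(m (\<tau> (Suc i)) - m (\<tau> i))\<^sup>2 \<le> \<epsilon>' * (m (\<tau> (Suc i)) - m (\<tau> i))"
        unfolding power2_eq_square using dm0 by (intro mult_right_mono) auto
      moreover have "\<bar>D (\<tau> (Suc i)) - D (\<tau> i)\<bar> \<le> 2 * (m (\<tau> (Suc i)) - m (\<tau> i))\<^sup>2"
        using in1 in2 \<tau>le by (intro Dinc) auto
      moreover have "\<bar>D (\<tau> i) - D 0\<bar> \<le> 2 * \<epsilon>' * (m (\<tau> i) - m 0)" using Suc by simp
      ultimately show ?case by (simp add: algebra_simps)
    qed
    from this[of N] have "\<bar>D T - D 0\<bar> \<le> 2 * \<epsilon>' * (m T - m 0)" by (simp add: \<tau>N)
    also have "\<dots> \<le> 2 * \<epsilon>' * M" using \<epsilon>' by (intro mult_left_mono) (auto simp: M_def)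
    also have "\<dots> = 0 + \<epsilon>" using M by (simp add: \<epsilon>'_def)
    finally show "\<bar>D T - D 0\<bar> \<le> 0 + \<epsilon>" .
  qed
  moreover have "D 0 = F 0 \<bullet> G 0"
  proof -
    have "(LINT s|leb 0. p s) = 0" using leb_integral_eq[OF leb_integrable_mono[OF pint T]] by simp
    then show ?thesis by (simp add: D_def)
  qed
  ultimately show ?thesis by (simp add: D_def p_def)
qed

section \<open>Twice continuously differentiable maps\<close>

text \<open>\<open>f2 z h k\<close> differentiates \<open>f1 _ h\<close> in the direction k. Plain
  functions in place of bounded linear maps keep partial derivatives and compositions free of
  conversions; linearity in each direction is derived below.\<close>

definition C2fun :: "('z::euclidean_space \<Rightarrow> 'b::euclidean_space) \<Rightarrow> ('z \<Rightarrow> 'z \<Rightarrow> 'b) \<Rightarrow> ('z \<Rightarrow> 'z \<Rightarrow> 'z \<Rightarrow> 'b) \<Rightarrow> bool"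
  where "C2fun f f1 f2 \<longleftrightarrow> (\<forall>z. (f has_derivative f1 z) (at z)) \<and>
    (\<forall>z h. ((\<lambda>z. f1 z h) has_derivative f2 z h) (at z)) \<and>
    continuous_on UNIV (\<lambda>(z, h, k). f2 z h k)"

context
  fixes f :: "'z::euclidean_space \<Rightarrow> 'b::euclidean_space" and f1 f2
  assumes f: "C2fun f f1 f2"
begin

lemma C2_d1: "(f has_derivative f1 z) (at z within S)"
  using f unfolding C2fun_def by (blast intro: has_derivative_at_withinI)

lemma C2_d2: "((\<lambda>z. f1 z h) has_derivative f2 z h) (at z within S)"
  using f unfolding C2fun_def by (blast intro: has_derivative_at_withinI)

lemma C2_lin1: "linear (f1 z)"
  using C2_d1[of z UNIV] by (rule has_derivative_linear)

lemma C2_lin2: "linear (f2 z h)"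
  using C2_d2[of h z UNIV] by (rule has_derivative_linear)

text \<open>Linearity in the direction differentiated first comes from uniqueness of the derivative
  of z \<mapsto> f1 z (x + y).\<close>

lemma C2_lin2': "linear (\<lambda>h. f2 z h k)"
proof (rule linearI)
  fix x y
  have "((\<lambda>z. f1 z (x + y)) has_derivative (\<lambda>k. f2 z x k + f2 z y k)) (at z)"
    unfolding linear_add[OF C2_lin1] by (intro has_derivative_add C2_d2)
  then have "f2 z (x + y) = (\<lambda>k. f2 z x k + f2 z y k)"
    using C2_d2[of "x + y" z UNIV] has_derivative_unique by blast
  then show "f2 z (x + y) k = f2 z x k + f2 z y k" by simp
next
  fix x c
  have "((\<lambda>z. f1 z (c *\<^sub>R x)) has_derivative (\<lambda>k. c *\<^sub>R f2 z x k)) (at z)"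
    unfolding linear_scale[OF C2_lin1] by (intro has_derivative_scaleR_right C2_d2)
  then have "f2 z (c *\<^sub>R x) = (\<lambda>k. c *\<^sub>R f2 z x k)"
    using C2_d2[of "c *\<^sub>R x" z UNIV] has_derivative_unique by blast
  then show "f2 z (c *\<^sub>R x) k = c *\<^sub>R f2 z x k" by simp
qed

lemma C2_cont: "continuous_on S f"
  using C2_d1 has_derivative_continuous_on by blast

lemma C2_f2_tendsto:
  assumes "(z \<longlongrightarrow> z0) G" "(h \<longlongrightarrow> h0) G" "(k \<longlongrightarrow> k0) G"
  shows "((\<lambda>n. f2 (z n) (h n) (k n)) \<longlongrightarrow> f2 z0 h0 k0) G"
proof -
  have "isCont (\<lambda>(z, h, k). f2 z h k) (z0, h0, k0)"
    using f unfolding C2fun_def by (simp add: continuous_on_eq_continuous_at)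
  from isCont_tendsto_compose[OF this tendsto_Pair[OF assms(1) tendsto_Pair[OF assms(2,3)]]]
  show ?thesis by simp
qed

lemma C2_f1_expand: "f1 z h = (\<Sum>b\<in>Basis. (h \<bullet> b) *\<^sub>R f1 z b)"
proof -
  have "f1 z h = f1 z (\<Sum>b\<in>Basis. (h \<bullet> b) *\<^sub>R b)" by (simp add: euclidean_representation)
  then show ?thesis by (simp add: linear_sum[OF C2_lin1] linear_scale[OF C2_lin1])
qed

lemma C2_f1_tendsto:
  assumes "(z \<longlongrightarrow> z0) G" "(h \<longlongrightarrow> h0) G"
  shows "((\<lambda>n. f1 (z n) (h n)) \<longlongrightarrow> f1 z0 h0) G"
proof -
  have "((\<lambda>n. f1 (z n) b) \<longlongrightarrow> f1 z0 b) G" for b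
    using isCont_tendsto_compose[OF has_derivative_continuous[OF C2_d2[of b z0 UNIV]] assms(1)] .
  then show ?thesis unfolding C2_f1_expand[of "z _" "h _"] C2_f1_expand[of z0 h0]
    by (intro tendsto_intros assms)
qed

lemma C2_continuous_f1: "continuous_on UNIV (\<lambda>p. f1 (fst p) (snd p))"
  unfolding continuous_on_def by (intro ballI C2_f1_tendsto tendsto_fst tendsto_snd tendsto_ident_at)

lemma C2_continuous_f2: "continuous_on UNIV (\<lambda>p. f2 (fst p) (fst (snd p)) (snd (snd p)))"
  unfolding continuous_on_def by (intro ballI C2_f2_tendsto tendsto_fst tendsto_snd tendsto_ident_at)

text \<open>Compactness of S times unit balls bounds the derivatives on unit directions, and
  linearity restores the norms of general ones.\<close>

lemma C2_bounds:
  assumes S: "compact S"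
  shows "\<exists>C\<ge>0. \<forall>z\<in>S. (\<forall>h. norm (f1 z h) \<le> C * norm h) \<and> (\<forall>h k. norm (f2 z h k) \<le> C * norm h * norm k)"
proof -
  have "compact (S \<times> cball 0 1 :: ('z \<times> 'z) set)" using S by (intro compact_Times) auto
  then have "bounded ((\<lambda>p. f1 (fst p) (snd p)) ` (S \<times> cball 0 1))"
    by (intro compact_imp_bounded compact_continuous_image continuous_on_subset[OF C2_continuous_f1]) auto
  then obtain C1 where C1: "C1 > 0" "\<And>z h. z \<in> S \<Longrightarrow> norm h \<le> 1 \<Longrightarrow> norm (f1 z h) \<le> C1"
    unfolding bounded_pos by force
  have "compact (S \<times> cball 0 1 \<times> cball 0 1 :: ('z \<times> 'z \<times> 'z) set)" using S by (intro compact_Times) auto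
  then have "bounded ((\<lambda>p. f2 (fst p) (fst (snd p)) (snd (snd p))) ` (S \<times> cball 0 1 \<times> cball 0 1))"
    by (intro compact_imp_bounded compact_continuous_image continuous_on_subset[OF C2_continuous_f2]) auto
  then obtain C2 where C2: "C2 > 0" "\<And>z h k. z \<in> S \<Longrightarrow> norm h \<le> 1 \<Longrightarrow> norm k \<le> 1 \<Longrightarrow> norm (f2 z h k) \<le> C2"
    unfolding bounded_pos by force
  have unit: "h = norm h *\<^sub>R sgn h" "norm (sgn h) \<le> 1" for h :: 'z
    by (cases "h = 0"; simp add: sgn_div_norm)+
  have b1: "norm (f1 z h) \<le> C1 * norm h" if "z \<in> S" for z h
  proof -
    have "norm (f1 z h) = norm h * norm (f1 z (sgn h))"
      by (subst unit(1)) (simp only: linear_scale[OF C2_lin1] norm_scaleR abs_norm_cancel)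
    also have "\<dots> \<le> norm h * C1" using C1(2)[OF that unit(2)] by (intro mult_left_mono) auto
    finally show ?thesis by (simp add: mult.commute)
  qed
  have b2: "norm (f2 z h k) \<le> C2 * norm h * norm k" if "z \<in> S" for z h k
  proof -
    have "norm (f2 z h k) = norm k * (norm h * norm (f2 z (sgn h) (sgn k)))"
      by (subst unit(1)[of h], subst unit(1)[of k])
         (simp only: linear_scale[OF C2_lin2] linear_scale[OF C2_lin2'] norm_scaleR abs_norm_cancel)
    also have "\<dots> \<le> norm k * (norm h * C2)" using C2(2)[OF that unit(2) unit(2)] by (intro mult_left_mono) auto
    finally show ?thesis by (simp add: mult_ac)
  qed
  have "norm (f1 z h) \<le> max C1 C2 * norm h" if "z \<in> S" for z h
    using b1[OF that, of h] mult_right_mono[of C1 "max C1 C2" "norm h"] by auto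
  moreover have "norm (f2 z h k) \<le> max C1 C2 * norm h * norm k" if "z \<in> S" for z h k
  proof -
    have "C2 * (norm h * norm k) \<le> max C1 C2 * (norm h * norm k)" by (intro mult_right_mono) auto
    then show ?thesis using b2[OF that, of h k] by (simp add: mult.assoc)
  qed
  ultimately show ?thesis using C1(1) by (intro exI[of _ "max C1 C2"]) auto
qed

lemma C2_lipschitz:
  assumes S: "compact S" "convex S"
  shows "\<exists>C\<ge>0. (\<forall>z\<in>S. \<forall>y\<in>S. norm (f y - f z) \<le> C * norm (y - z) \<and>
    norm (f y - f z - f1 z (y - z)) \<le> C * (norm (y - z))\<^sup>2 \<and> (\<forall>h. norm (f1 y h - f1 z h) \<le> C * norm (y - z) * norm h)) \<and>
    (\<forall>z\<in>S. (\<forall>h. norm (f1 z h) \<le> C * norm h) \<and> (\<forall>h k. norm (f2 z h k) \<le> C * norm h * norm k))"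
proof -
  obtain C where C: "C \<ge> 0" "\<And>z h. z \<in> S \<Longrightarrow> norm (f1 z h) \<le> C * norm h"
    "\<And>z h k. z \<in> S \<Longrightarrow> norm (f2 z h k) \<le> C * norm h * norm k"
    using C2_bounds[OF S(1)] by blast
  have 1: "norm (f y - f z) \<le> C * norm (y - z)" if "z \<in> S" "y \<in> S" for z y
    by (rule differentiable_bound[OF S(2) C2_d1 onorm_bound]) (use C that in auto)
  have 2: "norm (f1 y h - f1 z h) \<le> C * norm h * norm (y - z)" if "z \<in> S" "y \<in> S" for z y h
    by (rule differentiable_bound[OF S(2) C2_d2 onorm_bound]) (use C that in auto)
  have 3: "norm (f y - f z - f1 z (y - z)) \<le> C * (norm (y - z))\<^sup>2" if zy: "z \<in> S" "y \<in> S" for z y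
  proof -
    have seg: "closed_segment z y \<subseteq> S" using zy S(2) by (rule closed_segment_subset)
    \<comment> \<open>Subtracting the linear map \<open>f1 z\<close> leaves a function whose
      derivative on the segment is of order |y - z|, so the mean value inequality gives a quadratic
      remainder.\<close>
    have d: "((\<lambda>v. f v - f1 z v) has_derivative (\<lambda>h. f1 v h - f1 z h)) (at v within closed_segment z y)" for v
      by (intro has_derivative_diff C2_d1 linear_imp_has_derivative C2_lin1)
    have "norm ((f y - f1 z y) - (f z - f1 z z)) \<le> C * norm (y - z) * norm (y - z)"
    proof (rule differentiable_bound[OF convex_closed_segment d onorm_bound])
      fix v h assume v: "v \<in> closed_segment z y"
      have "norm (f1 v h - f1 z h) \<le> C * norm h * norm (v - z)" using v seg zy by (intro 2) auto
      also have "\<dots> \<le> C * norm h * norm (y - z)"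
        using segment_bound(1)[OF v] C(1) by (intro mult_left_mono) auto
      finally show "norm (f1 v h - f1 z h) \<le> C * norm (y - z) * norm h" by (simp add: mult_ac)
    qed (use C in auto)
    then show ?thesis by (simp add: linear_diff[OF C2_lin1] power2_eq_square algebra_simps)
  qed
  have "norm (f1 y h - f1 z h) \<le> C * norm (y - z) * norm h" if "z \<in> S" "y \<in> S" for z y h
    using 2[OF that, of h] by (simp add: mult_ac)
  then show ?thesis using C 1 3 by (intro exI[of _ C]) auto
qed

text \<open>Differentiability of \<open>f1 _ b\<close> at z for the finitely many basis vectors b
  controls the first-order remainder of f1 uniformly in the direction; the mean value inequality
  along the segment turns this into the second-order remainder of f.\<close>

lemma C2_taylor2_eps:
  assumes "\<epsilon> > 0"
  shows "\<exists>r>0. \<forall>d. norm d < r \<longrightarrow> norm (f (z + d) - f z - f1 z d - (1/2) *\<^sub>R f2 z d d) \<le> \<epsilon> * (norm d)\<^sup>2"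
proof -
  define \<epsilon>' where "\<epsilon>' = \<epsilon> / real DIM('z)"
  have \<epsilon>': "\<epsilon>' > 0" using assms by (simp add: \<epsilon>'_def)
  have "\<exists>r>0. \<forall>y. norm (y - z) < r \<longrightarrow> norm (f1 y b - f1 z b - f2 z b (y - z)) \<le> \<epsilon>' * norm (y - z)" for b
    using C2_d2[of b z UNIV] \<epsilon>' unfolding has_derivative_at_alt by blast
  then obtain r where r: "\<And>b. r b > 0" "\<And>b y. norm (y - z) < r b \<Longrightarrow> norm (f1 y b - f1 z b - f2 z b (y - z)) \<le> \<epsilon>' * norm (y - z)"
    by metis
  define R where "R = Min (r ` (Basis :: 'z set))"
  have R: "R > 0" unfolding R_def using r(1) by (subst Min_gr_iff) auto
  have bd: "norm (f1 y h - f1 z h - f2 z h (y - z)) \<le> \<epsilon> * norm h * norm (y - z)" if y: "norm (y - z) < R" for y h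
  proof -
    have e: "f2 z h (y - z) = (\<Sum>b\<in>Basis. (h \<bullet> b) *\<^sub>R f2 z b (y - z))"
    proof -
      have "f2 z h (y - z) = f2 z (\<Sum>b\<in>Basis. (h \<bullet> b) *\<^sub>R b) (y - z)" by (simp add: euclidean_representation)
      then show ?thesis by (simp only: linear_sum[OF C2_lin2'] linear_scale[OF C2_lin2'])
    qed
    have "f1 y h - f1 z h - f2 z h (y - z) = (\<Sum>b\<in>Basis. (h \<bullet> b) *\<^sub>R (f1 y b - f1 z b - f2 z b (y - z)))"
      unfolding e C2_f1_expand[of y h] C2_f1_expand[of z h] by (simp add: sum_subtractf scaleR_diff_right)
    also have "norm \<dots> \<le> (\<Sum>b\<in>(Basis::'z set). norm h * (\<epsilon>' * norm (y - z)))"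
    proof (rule sum_norm_le)
      fix b :: 'z assume b: "b \<in> Basis"
      have "R \<le> r b" unfolding R_def using b by (intro Min_le) auto
      then have "norm (f1 y b - f1 z b - f2 z b (y - z)) \<le> \<epsilon>' * norm (y - z)" using y by (intro r(2)) auto
      moreover have "\<bar>h \<bullet> b\<bar> \<le> norm h" using b by (rule Basis_le_norm)
      ultimately show "norm ((h \<bullet> b) *\<^sub>R (f1 y b - f1 z b - f2 z b (y - z))) \<le> norm h * (\<epsilon>' * norm (y - z))"
        unfolding norm_scaleR by (intro mult_mono) auto
    qed
    also have "\<dots> = \<epsilon> * norm h * norm (y - z)" by (simp add: \<epsilon>'_def)
    finally show ?thesis .
  qed
  have "norm (f (z + d) - f z - f1 z d - (1/2) *\<^sub>R f2 z d d) \<le> \<epsilon> * (norm d)\<^sup>2" if d: "norm d < R" for d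
  proof -
    \<comment> \<open>Its derivative is the first-order remainder of f1 along the segment, while g 1
      - g 0 is the second-order remainder of f.\<close>
    define g where "g s = f (z + s *\<^sub>R d) - s *\<^sub>R f1 z d - (s\<^sup>2 / 2) *\<^sub>R f2 z d d" for s :: real
    have gd: "(g has_derivative (\<lambda>x. x *\<^sub>R (f1 (z + s *\<^sub>R d) d - f1 z d - s *\<^sub>R f2 z d d))) (at s within {0..1})" for s
    proof -
      have "((\<lambda>s. f (z + s *\<^sub>R d)) has_derivative (\<lambda>x. f1 (z + s *\<^sub>R d) (x *\<^sub>R d))) (at s within {0..1})"
        by (rule has_derivative_compose[where g = f and f = "\<lambda>s. z + s *\<^sub>R d"])
           (auto intro!: derivative_eq_intros C2_d1)
      then show ?thesis unfolding g_def
        by (auto intro!: derivative_eq_intros simp: linear_scale[OF C2_lin1] algebra_simps)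
    qed
    have "norm (g 1 - g 0) \<le> (\<epsilon> * (norm d)\<^sup>2) * norm (1 - 0 :: real)"
    proof (rule differentiable_bound[OF convex_real_interval(5)[of 0 1] gd onorm_bound])
      fix s x :: real assume s: "s \<in> {0..1}"
      have "norm (s *\<^sub>R d) \<le> norm d" using s mult_right_mono[of s 1 "norm d"] by auto
      then have "norm (f1 (z + s *\<^sub>R d) d - f1 z d - f2 z d (z + s *\<^sub>R d - z)) \<le> \<epsilon> * norm d * norm (z + s *\<^sub>R d - z)"
        using d by (intro bd) auto
      also have "\<dots> \<le> \<epsilon> * norm d * norm d"
        using \<open>norm (s *\<^sub>R d) \<le> norm d\<close> assms by (intro mult_left_mono) auto
      finally have "norm (f1 (z + s *\<^sub>R d) d - f1 z d - s *\<^sub>R f2 z d d) \<le> \<epsilon> * (norm d)\<^sup>2"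
        by (simp add: linear_scale[OF C2_lin2] power2_eq_square mult.assoc)
      then have "\<bar>x\<bar> * norm (f1 (z + s *\<^sub>R d) d - f1 z d - s *\<^sub>R f2 z d d) \<le> \<bar>x\<bar> * (\<epsilon> * (norm d)\<^sup>2)"
        by (intro mult_left_mono) auto
      then show "norm (x *\<^sub>R (f1 (z + s *\<^sub>R d) d - f1 z d - s *\<^sub>R f2 z d d)) \<le> \<epsilon> * (norm d)\<^sup>2 * norm x"
        by (simp add: mult.commute)
    qed (use assms in auto)
    then show ?thesis by (simp add: g_def algebra_simps)
  qed
  then show ?thesis using R by blast
qed

text \<open>The direction moves with n because it will contain difference quotients of the state,
  which reach their limit direction only asymptotically.\<close>

lemma C2_taylor2_tendsto:
  assumes d: "d \<longlonglongrightarrow> d0" and t: "t \<longlonglongrightarrow> 0" "\<And>n::nat. t n \<noteq> 0"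
  shows "(\<lambda>n. (1 / (t n)\<^sup>2) *\<^sub>R (f (z + t n *\<^sub>R d n) - f z - t n *\<^sub>R f1 z (d n))) \<longlonglongrightarrow> (1/2) *\<^sub>R f2 z d0 d0"
proof -
  define R where "R v = f (z + v) - f z - f1 z v - (1/2) *\<^sub>R f2 z v v" for v
  have eq: "(1 / (t n)\<^sup>2) *\<^sub>R (f (z + t n *\<^sub>R d n) - f z - t n *\<^sub>R f1 z (d n))
    = (1 / (t n)\<^sup>2) *\<^sub>R R (t n *\<^sub>R d n) + (1/2) *\<^sub>R f2 z (d n) (d n)" for n
    using t(2)[of n] unfolding R_def linear_scale[OF C2_lin1] linear_scale[OF C2_lin2] linear_scale[OF C2_lin2']
    by (simp add: algebra_simps power2_eq_square)
  have "(\<lambda>n. (1 / (t n)\<^sup>2) *\<^sub>R R (t n *\<^sub>R d n)) \<longlonglongrightarrow> 0"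
  proof (rule tendstoI)
    fix e :: real assume e: "e > 0"
    obtain B where B: "B > 0" "\<And>n. norm (d n) \<le> B"
      using Bseq_def convergent_imp_Bseq[of d] d convergentI by metis
    define \<epsilon> where "\<epsilon> = e / (2 * B\<^sup>2)"
    have \<epsilon>: "\<epsilon> > 0" using e B by (simp add: \<epsilon>_def)
    obtain r where r: "r > 0" "\<And>v. norm v < r \<Longrightarrow> norm (R v) \<le> \<epsilon> * (norm v)\<^sup>2"
      using C2_taylor2_eps[OF \<epsilon>, of z] unfolding R_def by blast
    have "(\<lambda>n. t n *\<^sub>R d n) \<longlonglongrightarrow> 0 *\<^sub>R d0" by (intro tendsto_intros t d)
    then have "\<forall>\<^sub>F n in sequentially. norm (t n *\<^sub>R d n) < r"
      using tendstoD[OF _ r(1)] by fastforce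
    then show "\<forall>\<^sub>F n in sequentially. dist ((1 / (t n)\<^sup>2) *\<^sub>R R (t n *\<^sub>R d n)) 0 < e"
    proof eventually_elim
      fix n assume n: "norm (t n *\<^sub>R d n) < r"
      have "norm ((1 / (t n)\<^sup>2) *\<^sub>R R (t n *\<^sub>R d n)) = (1 / (t n)\<^sup>2) * norm (R (t n *\<^sub>R d n))" by simp
      also have "\<dots> \<le> (1 / (t n)\<^sup>2) * (\<epsilon> * (norm (t n *\<^sub>R d n))\<^sup>2)" using r(2)[OF n] by (intro mult_left_mono) auto
      also have "\<dots> = \<epsilon> * (norm (d n))\<^sup>2" using t(2)[of n] by (simp add: power_mult_distrib)
      also have "\<dots> \<le> \<epsilon> * B\<^sup>2" using \<epsilon> B(2)[of n] by (intro mult_left_mono power_mono) auto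
      also have "\<dots> = e / 2" using B by (simp add: \<epsilon>_def)
      finally have "norm ((1 / (t n)\<^sup>2) *\<^sub>R R (t n *\<^sub>R d n)) < e" using e by linarith
      then show "dist ((1 / (t n)\<^sup>2) *\<^sub>R R (t n *\<^sub>R d n)) 0 < e" by (simp only: dist_norm diff_zero)
    qed
  qed
  then have "(\<lambda>n. (1 / (t n)\<^sup>2) *\<^sub>R R (t n *\<^sub>R d n) + (1/2) *\<^sub>R f2 z (d n) (d n)) \<longlonglongrightarrow> 0 + (1/2) *\<^sub>R f2 z d0 d0"
    by (intro tendsto_intros C2_f2_tendsto d)
  then show ?thesis unfolding eq by simp
qed

text \<open>Both orders of differentiation are limits of the same second difference quotient: two
  applications of the mean value theorem express it through \<open>f2\<close> at an intermediate
  point. The theorem is scalar, so one component b is treated at a time.\<close>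

lemma C2_symmetric: "f2 z h k = f2 z k h"
proof (rule euclidean_eqI)
  fix b :: 'b assume "b \<in> Basis"
  have key: "\<exists>\<sigma>\<in>{0<..<s}. \<exists>\<tau>\<in>{0<..<s}. (f (z + s *\<^sub>R h + s *\<^sub>R k) - f (z + s *\<^sub>R h) - f (z + s *\<^sub>R k) + f z) \<bullet> b
      = s * s * (f2 (z + \<sigma> *\<^sub>R h + \<tau> *\<^sub>R k) h k \<bullet> b)" if s: "s > 0" for s h k
  proof -
    define g where "g \<sigma> = (f (z + \<sigma> *\<^sub>R h + s *\<^sub>R k) - f (z + \<sigma> *\<^sub>R h)) \<bullet> b" for \<sigma> :: real
    have d1: "((\<lambda>\<sigma>. f (y + \<sigma> *\<^sub>R h + v)) has_derivative (\<lambda>x. f1 (y + \<sigma> *\<^sub>R h + v) (x *\<^sub>R h))) (at \<sigma> within S)" for y v \<sigma> S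
      by (rule has_derivative_compose[where g = f and f = "\<lambda>\<sigma>. y + \<sigma> *\<^sub>R h + v"])
         (auto intro!: derivative_eq_intros C2_d1)
    have gd: "(g has_derivative (\<lambda>x. x * ((f1 (z + \<sigma> *\<^sub>R h + s *\<^sub>R k) h - f1 (z + \<sigma> *\<^sub>R h) h) \<bullet> b))) (at \<sigma> within {0..s})" for \<sigma>
    proof -
      have "(g has_derivative (\<lambda>x. (f1 (z + \<sigma> *\<^sub>R h + s *\<^sub>R k) (x *\<^sub>R h) - f1 (z + \<sigma> *\<^sub>R h + 0) (x *\<^sub>R h)) \<bullet> b)) (at \<sigma> within {0..s})"
        unfolding g_def using d1[of z 0] by (intro has_derivative_inner_left has_derivative_diff d1) simp
      then show ?thesis by (simp add: linear_scale[OF C2_lin1] scaleR_diff_right[symmetric])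
    qed
    obtain \<sigma> where \<sigma>: "\<sigma> \<in> {0<..<s}" "g s - g 0 = (s - 0) * ((f1 (z + \<sigma> *\<^sub>R h + s *\<^sub>R k) h - f1 (z + \<sigma> *\<^sub>R h) h) \<bullet> b)"
      using mvt_simple[OF s gd] by blast
    define u where "u \<tau> = f1 (z + \<sigma> *\<^sub>R h + \<tau> *\<^sub>R k) h \<bullet> b" for \<tau> :: real
    have ud: "(u has_derivative (\<lambda>x. x * (f2 (z + \<sigma> *\<^sub>R h + \<tau> *\<^sub>R k) h k \<bullet> b))) (at \<tau> within {0..s})" for \<tau>
    proof -
      have "((\<lambda>\<tau>. f1 (z + \<sigma> *\<^sub>R h + \<tau> *\<^sub>R k) h) has_derivative (\<lambda>x. f2 (z + \<sigma> *\<^sub>R h + \<tau> *\<^sub>R k) h (x *\<^sub>R k))) (at \<tau> within {0..s})"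
        by (rule has_derivative_compose[where g = "\<lambda>z. f1 z h" and f = "\<lambda>\<tau>. z + \<sigma> *\<^sub>R h + \<tau> *\<^sub>R k"])
           (auto intro!: derivative_eq_intros C2_d2)
      then have "(u has_derivative (\<lambda>x. f2 (z + \<sigma> *\<^sub>R h + \<tau> *\<^sub>R k) h (x *\<^sub>R k) \<bullet> b)) (at \<tau> within {0..s})"
        unfolding u_def by (intro has_derivative_inner_left)
      then show ?thesis by (simp add: linear_scale[OF C2_lin2])
    qed
    obtain \<tau> where \<tau>: "\<tau> \<in> {0<..<s}" "u s - u 0 = (s - 0) * (f2 (z + \<sigma> *\<^sub>R h + \<tau> *\<^sub>R k) h k \<bullet> b)"
      using mvt_simple[OF s ud] by blast
    have "(f (z + s *\<^sub>R h + s *\<^sub>R k) - f (z + s *\<^sub>R h) - f (z + s *\<^sub>R k) + f z) \<bullet> b = g s - g 0"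
      by (simp add: g_def inner_diff_left inner_add_left)
    also have "\<dots> = s * (u s - u 0)" using \<sigma>(2) by (simp add: u_def inner_diff_left)
    also have "\<dots> = s * s * (f2 (z + \<sigma> *\<^sub>R h + \<tau> *\<^sub>R k) h k \<bullet> b)" using \<tau>(2) by simp
    finally show ?thesis using \<sigma>(1) \<tau>(1) by blast
  qed
  define s where "s n = 1 / real (Suc n)" for n
  have s: "s n > 0" for n by (simp add: s_def)
  have slim: "s \<longlonglongrightarrow> 0" unfolding s_def using LIMSEQ_Suc[OF lim_const_over_n[of 1]] by simp
  have ex: "\<exists>\<sigma> \<tau>. \<forall>n. \<sigma> n \<in> {0<..<s n} \<and> \<tau> n \<in> {0<..<s n} \<and>
     (f (z + s n *\<^sub>R h + s n *\<^sub>R k) - f (z + s n *\<^sub>R h) - f (z + s n *\<^sub>R k) + f z) \<bullet> b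
      = s n * s n * (f2 (z + \<sigma> n *\<^sub>R h + \<tau> n *\<^sub>R k) h k \<bullet> b)" for h k
  proof -
    define Q where "Q n \<sigma> \<tau> \<longleftrightarrow> \<sigma> \<in> {0<..<s n} \<and> \<tau> \<in> {0<..<s n} \<and>
     (f (z + s n *\<^sub>R h + s n *\<^sub>R k) - f (z + s n *\<^sub>R h) - f (z + s n *\<^sub>R k) + f z) \<bullet> b
      = s n * s n * (f2 (z + \<sigma> *\<^sub>R h + \<tau> *\<^sub>R k) h k \<bullet> b)" for n \<sigma> \<tau>
    have "\<forall>n. \<exists>\<sigma>. \<exists>\<tau>. Q n \<sigma> \<tau>" using key[OF s] unfolding Q_def by blast
    then obtain \<sigma> where "\<forall>n. \<exists>\<tau>. Q n (\<sigma> n) \<tau>" using choice by metis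
    then obtain \<tau> where "\<forall>n. Q n (\<sigma> n) (\<tau> n)" using choice by metis
    then show ?thesis unfolding Q_def by blast
  qed
  obtain \<sigma> \<tau> where st: "\<And>n. \<sigma> n \<in> {0<..<s n}" "\<And>n. \<tau> n \<in> {0<..<s n}"
    "\<And>n. (f (z + s n *\<^sub>R h + s n *\<^sub>R k) - f (z + s n *\<^sub>R h) - f (z + s n *\<^sub>R k) + f z) \<bullet> b
      = s n * s n * (f2 (z + \<sigma> n *\<^sub>R h + \<tau> n *\<^sub>R k) h k \<bullet> b)" using ex[of h k] by blast
  obtain \<sigma>' \<tau>' where st': "\<And>n. \<sigma>' n \<in> {0<..<s n}" "\<And>n. \<tau>' n \<in> {0<..<s n}"
    "\<And>n. (f (z + s n *\<^sub>R k + s n *\<^sub>R h) - f (z + s n *\<^sub>R k) - f (z + s n *\<^sub>R h) + f z) \<bullet> b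
      = s n * s n * (f2 (z + \<sigma>' n *\<^sub>R k + \<tau>' n *\<^sub>R h) k h \<bullet> b)" using ex[of k h] by blast
  have eq: "f2 (z + \<sigma> n *\<^sub>R h + \<tau> n *\<^sub>R k) h k \<bullet> b = f2 (z + \<sigma>' n *\<^sub>R k + \<tau>' n *\<^sub>R h) k h \<bullet> b" for n
  proof -
    have "s n * s n * (f2 (z + \<sigma> n *\<^sub>R h + \<tau> n *\<^sub>R k) h k \<bullet> b) = s n * s n * (f2 (z + \<sigma>' n *\<^sub>R k + \<tau>' n *\<^sub>R h) k h \<bullet> b)"
      unfolding st(3)[symmetric] st'(3)[symmetric] by (simp add: algebra_simps)
    then show ?thesis using s[of n] by simp
  qed
  have lim: "x \<longlonglongrightarrow> 0" if "\<And>n. x n \<in> {0<..<s n}" for x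
    by (rule tendsto_sandwich[OF _ _ tendsto_const slim]) (use that in \<open>auto intro!: always_eventually less_imp_le\<close>)
  have "(\<lambda>n. f2 (z + \<sigma> n *\<^sub>R h + \<tau> n *\<^sub>R k) h k \<bullet> b) \<longlonglongrightarrow> f2 (z + 0 *\<^sub>R h + 0 *\<^sub>R k) h k \<bullet> b"
    by (intro tendsto_intros C2_f2_tendsto lim st)
  moreover have "(\<lambda>n. f2 (z + \<sigma>' n *\<^sub>R k + \<tau>' n *\<^sub>R h) k h \<bullet> b) \<longlonglongrightarrow> f2 (z + 0 *\<^sub>R k + 0 *\<^sub>R h) k h \<bullet> b"
    by (intro tendsto_intros C2_f2_tendsto lim st')
  ultimately have "f2 (z + 0 *\<^sub>R h + 0 *\<^sub>R k) h k \<bullet> b = f2 (z + 0 *\<^sub>R k + 0 *\<^sub>R h) k h \<bullet> b"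
    unfolding eq by (rule LIMSEQ_unique)
  then show "f2 z h k \<bullet> b = f2 z k h \<bullet> b" by simp
qed

end

section \<open>Measurability and dominated convergence on the interval\<close>

lemma borel_measurable_pair_compose:
  fixes f :: "'a::second_countable_topology \<Rightarrow> 'b::second_countable_topology \<Rightarrow> 'c::topological_space"
  assumes "continuous_on UNIV (\<lambda>p. f (fst p) (snd p))" "g \<in> borel_measurable M" "h \<in> borel_measurable M"
  shows "(\<lambda>s. f (g s) (h s)) \<in> borel_measurable M"
proof -
  have 1: "(\<lambda>p. f (fst p) (snd p)) \<in> borel_measurable borel" by (rule borel_measurable_continuous_onI[OF assms(1)])
  have "(\<lambda>s. (g s, h s)) \<in> borel_measurable M" using assms(2,3) by (rule borel_measurable_Pair)
  from measurable_compose[OF this 1] show ?thesis by simp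
qed

lemma C2_measurable:
  fixes f :: "'z::euclidean_space \<Rightarrow> 'b::euclidean_space"
  assumes "C2fun f f1 f2" "z \<in> borel_measurable M" "h \<in> borel_measurable M" "k \<in> borel_measurable M"
  shows "(\<lambda>s. f (z s)) \<in> borel_measurable M" "(\<lambda>s. f1 (z s) (h s)) \<in> borel_measurable M"
    "(\<lambda>s. f2 (z s) (h s) (k s)) \<in> borel_measurable M"
proof -
  show "(\<lambda>s. f (z s)) \<in> borel_measurable M"
    using borel_measurable_continuous_onI[OF C2_cont[OF assms(1)]] assms(2) by (rule measurable_compose_rev)
  show "(\<lambda>s. f1 (z s) (h s)) \<in> borel_measurable M"
    by (rule borel_measurable_pair_compose[OF C2_continuous_f1[OF assms(1)] assms(2,3)])
  have "(\<lambda>s. f2 (z s) (fst (h s, k s)) (snd (h s, k s))) \<in> borel_measurable M"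
    by (rule borel_measurable_pair_compose[of "\<lambda>z p. f2 z (fst p) (snd p)", OF C2_continuous_f2[OF assms(1)] assms(2) borel_measurable_Pair[OF assms(3,4)]])
  then show "(\<lambda>s. f2 (z s) (h s) (k s)) \<in> borel_measurable M" by simp
qed

lemma leb_dominated:
  fixes r :: "nat \<Rightarrow> real \<Rightarrow> 'a::euclidean_space"
  assumes "\<And>n. r n \<in> borel_measurable (leb T)" "q \<in> borel_measurable (leb T)"
    and "\<And>n s. s \<in> {0..T} \<Longrightarrow> norm (r n s) \<le> B" and "\<And>s. s \<in> {0..T} \<Longrightarrow> (\<lambda>n. r n s) \<longlonglongrightarrow> q s"
  shows "(\<lambda>n. LINT s|leb T. norm (r n s - q s)) \<longlonglongrightarrow> 0"
proof -
  have qB: "norm (q s) \<le> B" if "s \<in> {0..T}" for s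
    using tendsto_norm[OF assms(4)[OF that]] by (rule LIMSEQ_le_const2) (use assms(3)[OF that] in blast)
  have "(\<lambda>n. LINT s|leb T. norm (r n s - q s)) \<longlonglongrightarrow> (LINT s|leb T. 0)"
  proof (rule integral_dominated_convergence[where w = "\<lambda>_. 2 * B"])
    show "(\<lambda>s. norm (r n s - q s)) \<in> borel_measurable (leb T)" for n using assms(1,2) by auto
    show "integrable (leb T) (\<lambda>_. 2 * B)" by (intro leb_continuous_integrable continuous_intros)
    show "AE s in leb T. (\<lambda>n. norm (r n s - q s)) \<longlonglongrightarrow> 0"
    proof (rule AE_I2)
      fix s assume "s \<in> space (leb T)"
      then have "s \<in> {0..T}" by simp
      from tendsto_norm_zero[OF LIM_zero[OF assms(4)[OF this]]] show "(\<lambda>n. norm (r n s - q s)) \<longlonglongrightarrow> 0" .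
    qed
    show "AE s in leb T. norm (norm (r n s - q s)) \<le> 2 * B" for n
    proof (rule AE_I2)
      fix s assume "s \<in> space (leb T)"
      then have s: "s \<in> {0..T}" by simp
      show "norm (norm (r n s - q s)) \<le> 2 * B"
        using norm_triangle_ineq4[of "r n s" "q s"] assms(3)[OF s, of n] qB[OF s] by simp
    qed
  qed auto
  then show ?thesis by simp
qed

lemma leb_integral_const:
  fixes c :: real
  assumes "0 \<le> T"
  shows "(LINT s|leb T. c) = T * c"
proof -
  have "integrable (leb T) (\<lambda>s. c)" by (intro leb_continuous_integrable continuous_intros)
  then show ?thesis using leb_integral_eq[of T "\<lambda>s. c"] assms by simp
qed

section \<open>Expansion of the endpoint map\<close>

text \<open>Both controls are merged into the single control \<open>wh\<close>. It is bounded at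
  every time of the interval and not only almost everywhere, so the estimates below can be
  pointwise.\<close>

locale control_system =
  fixes T :: real and F :: "'a::euclidean_space \<times> 'w::euclidean_space \<Rightarrow> 'a" and F1 F2
    and xh :: "real \<Rightarrow> 'a" and wh :: "real \<Rightarrow> 'w"
  assumes T: "0 < T" and F: "C2fun F F1 F2"
    and wh: "wh \<in> borel_measurable (leb T)" and whb: "\<exists>M. \<forall>t\<in>{0..T}. norm (wh t) \<le> M"
    and xhc: "continuous_on {0..T} xh"
    and xh: "\<And>t. t \<in> {0..T} \<Longrightarrow> xh t = xh 0 + (LINT s|leb t. F (xh s, wh s))"
begin

definition "Rad = (SOME R. 0 \<le> R \<and> (\<forall>t\<in>{0..T}. norm (xh t) \<le> R \<and> norm (wh t) \<le> R))"

lemma Rad: "0 \<le> Rad" "\<And>t. t \<in> {0..T} \<Longrightarrow> norm (xh t) \<le> Rad" "\<And>t. t \<in> {0..T} \<Longrightarrow> norm (wh t) \<le> Rad"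
proof -
  obtain M where M: "\<forall>t\<in>{0..T}. norm (wh t) \<le> M" using whb by blast
  have "\<exists>B. \<forall>s\<in>{0..T}. norm (xh s) \<le> B"
    using compact_imp_bounded[OF compact_continuous_image[OF xhc compact_Icc]] by (auto simp: bounded_iff)
  then obtain B where B: "\<forall>s\<in>{0..T}. norm (xh s) \<le> B" by blast
  have "0 \<le> max 0 (max B M) \<and> (\<forall>t\<in>{0..T}. norm (xh t) \<le> max 0 (max B M) \<and> norm (wh t) \<le> max 0 (max B M))"
    using M B by (meson max.cobounded1 max.coboundedI1 max.coboundedI2)
  then have "0 \<le> Rad \<and> (\<forall>t\<in>{0..T}. norm (xh t) \<le> Rad \<and> norm (wh t) \<le> Rad)"
    unfolding Rad_def by (rule someI)
  then show "0 \<le> Rad" "\<And>t. t \<in> {0..T} \<Longrightarrow> norm (xh t) \<le> Rad" "\<And>t. t \<in> {0..T} \<Longrightarrow> norm (wh t) \<le> Rad" by blast+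
qed

text \<open>A convex compact tube around the reference values with margin 1. F is only locally
  Lipschitz, so the constant \<open>Lc\<close> is valid as long as states and controls stay in this
  set; convexity is what mean value estimates need.\<close>

definition K0 :: "('a \<times> 'w) set" where "K0 = cball 0 (Rad + 1) \<times> cball 0 (Rad + 1)"

lemma K0: "compact K0" "convex K0"
  unfolding K0_def by (intro compact_Times compact_cball convex_Times convex_cball)+

definition "lipc C \<longleftrightarrow> 0 \<le> C \<and> (\<forall>z\<in>K0. \<forall>y\<in>K0. norm (F y - F z) \<le> C * norm (y - z) \<and>
    norm (F y - F z - F1 z (y - z)) \<le> C * (norm (y - z))\<^sup>2 \<and> (\<forall>h. norm (F1 y h - F1 z h) \<le> C * norm (y - z) * norm h)) \<and>
    (\<forall>z\<in>K0. (\<forall>h. norm (F1 z h) \<le> C * norm h) \<and> (\<forall>h k. norm (F2 z h k) \<le> C * norm h * norm k))"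

definition "Lc = (SOME C. lipc C)"

lemma Lc: "0 \<le> Lc"
  "\<And>z y. z \<in> K0 \<Longrightarrow> y \<in> K0 \<Longrightarrow> norm (F y - F z) \<le> Lc * norm (y - z)"
  "\<And>z y. z \<in> K0 \<Longrightarrow> y \<in> K0 \<Longrightarrow> norm (F y - F z - F1 z (y - z)) \<le> Lc * (norm (y - z))\<^sup>2"
  "\<And>z h. z \<in> K0 \<Longrightarrow> norm (F1 z h) \<le> Lc * norm h"
  "\<And>z h k. z \<in> K0 \<Longrightarrow> norm (F2 z h k) \<le> Lc * norm h * norm k"
proof -
  have "\<exists>C. lipc C" using C2_lipschitz[OF F K0] unfolding lipc_def by blast
  then have "lipc Lc" unfolding Lc_def by (rule someI_ex)
  then show "0 \<le> Lc"
  "\<And>z y. z \<in> K0 \<Longrightarrow> y \<in> K0 \<Longrightarrow> norm (F y - F z) \<le> Lc * norm (y - z)"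
  "\<And>z y. z \<in> K0 \<Longrightarrow> y \<in> K0 \<Longrightarrow> norm (F y - F z - F1 z (y - z)) \<le> Lc * (norm (y - z))\<^sup>2"
  "\<And>z h. z \<in> K0 \<Longrightarrow> norm (F1 z h) \<le> Lc * norm h"
  "\<And>z h k. z \<in> K0 \<Longrightarrow> norm (F2 z h k) \<le> Lc * norm h * norm k"
    unfolding lipc_def by blast+
qed

abbreviation "gr \<equiv> gron Lc T"

lemma gr_pos: "0 < gr" using gron_pos Lc(1) by blast

lemma T0: "0 \<le> T" using T by simp

lemma F1_add: "F1 z (a, b) = F1 z (a, 0) + F1 z (0, b)"
  using linear_add[OF C2_lin1[OF F], of z "(a, 0)" "(0, b)"] by simp

definition adm :: "(real \<Rightarrow> 'a) \<Rightarrow> (real \<Rightarrow> 'w) \<Rightarrow> bool"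
  where "adm x w \<longleftrightarrow> continuous_on {0..T} x \<and> w \<in> borel_measurable (leb T) \<and> (\<forall>t\<in>{0..T}. (x t, w t) \<in> K0)"

lemma adm_ref: "adm xh wh"
  using Rad xhc wh unfolding adm_def K0_def by force

lemma adm_measurable:
  assumes "adm x w" "y \<in> borel_measurable (leb T)" "k \<in> borel_measurable (leb T)"
  shows "(\<lambda>s. F (x s, w s)) \<in> borel_measurable (leb T)"
    "(\<lambda>s. F1 (x s, w s) (y s, k s)) \<in> borel_measurable (leb T)"
    "(\<lambda>s. F2 (x s, w s) (y s, k s) (y s, k s)) \<in> borel_measurable (leb T)"
proof -
  have 1: "(\<lambda>s. (x s, w s)) \<in> borel_measurable (leb T)"
    using assms(1) unfolding adm_def by (intro borel_measurable_Pair) (auto intro: leb_continuous_measurable)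
  have 2: "(\<lambda>s. (y s, k s)) \<in> borel_measurable (leb T)" using assms(2,3) by (rule borel_measurable_Pair)
  show "(\<lambda>s. F (x s, w s)) \<in> borel_measurable (leb T)"
    "(\<lambda>s. F1 (x s, w s) (y s, k s)) \<in> borel_measurable (leb T)"
    "(\<lambda>s. F2 (x s, w s) (y s, k s) (y s, k s)) \<in> borel_measurable (leb T)"
    using C2_measurable[OF F 1 2 2] .
qed

lemma adm_F_integrable: 
  assumes "adm x w"
  shows "integrable (leb T) (\<lambda>s. F (x s, w s))"
proof -
  have "bounded (F ` K0)" by (intro compact_imp_bounded compact_continuous_image K0 C2_cont[OF F])
  then obtain B where B: "\<And>z. z \<in> K0 \<Longrightarrow> norm (F z) \<le> B" unfolding bounded_iff by blast
  show ?thesis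
    by (rule leb_bounded_integrable[OF adm_measurable(1)[OF assms borel_measurable_const borel_measurable_const], where B = B])
       (use assms in \<open>auto simp: adm_def intro: B\<close>)
qed

lemma adm_F1_integrable:
  assumes "adm x w" "integrable (leb T) y" "integrable (leb T) k"
  shows "integrable (leb T) (\<lambda>s. F1 (x s, w s) (y s, k s))"
proof (rule Bochner_Integration.integrable_bound)
  show "integrable (leb T) (\<lambda>s. Lc * (norm (y s) + norm (k s)))" using assms by simp
  show "(\<lambda>s. F1 (x s, w s) (y s, k s)) \<in> borel_measurable (leb T)"
    using assms by (intro adm_measurable) auto
  show "AE s in leb T. norm (F1 (x s, w s) (y s, k s)) \<le> norm (Lc * (norm (y s) + norm (k s)))"
  proof (rule AE_I2)
    fix s assume "s \<in> space (leb T)"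
    then have "(x s, w s) \<in> K0" using assms(1) by (auto simp: adm_def)
    then have "norm (F1 (x s, w s) (y s, k s)) \<le> Lc * norm (y s, k s)" by (rule Lc(4))
    also have "\<dots> \<le> Lc * (norm (y s) + norm (k s))" using Lc(1) by (intro mult_left_mono norm_Pair_le)
    finally show "norm (F1 (x s, w s) (y s, k s)) \<le> norm (Lc * (norm (y s) + norm (k s)))" using Lc(1) by simp
  qed
qed

text \<open>Integral form of z' = F_x z + r with z(0) = \<zeta> along (x, w). Variations of the
  control and second-order terms enter through r, so one theory serves \<open>Z\<close>,
  \<open>Y\<close> and the difference quotients.\<close>

definition lsol :: "(real \<Rightarrow> 'a) \<Rightarrow> (real \<Rightarrow> 'w) \<Rightarrow> 'a \<Rightarrow> (real \<Rightarrow> 'a) \<Rightarrow> (real \<Rightarrow> 'a) \<Rightarrow> bool"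
  where "lsol x w \<zeta> r z \<longleftrightarrow> continuous_on {0..T} z \<and>
    (\<forall>t\<in>{0..T}. z t = \<zeta> + (LINT s|leb t. F1 (x s, w s) (z s, 0) + r s))"

lemma lsol_integrable:
  assumes "adm x w" "integrable (leb T) r" "continuous_on {0..T} z"
  shows "integrable (leb T) (\<lambda>s. F1 (x s, w s) (z s, 0) + r s)"
  by (intro Bochner_Integration.integrable_add adm_F1_integrable assms(1,2) leb_continuous_integrable[OF assms(3)] integrable_zero)

lemma lsol_exists:
  assumes "adm x w" "integrable (leb T) r"
  shows "\<exists>z. lsol x w \<zeta> r z"
  unfolding lsol_def
proof (rule ode_exists[OF T0 Lc(1)])
  fix t y y' assume "t \<in> {0..T}"
  then have z: "(x t, w t) \<in> K0" using assms(1) by (auto simp: adm_def)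
  have "F1 (x t, w t) (y, 0) + r t - (F1 (x t, w t) (y', 0) + r t) = F1 (x t, w t) (y - y', 0)"
    using linear_diff[OF C2_lin1[OF F], of "(x t, w t)" "(y, 0)" "(y', 0)"] by simp
  then show "norm (F1 (x t, w t) (y, 0) + r t - (F1 (x t, w t) (y', 0) + r t)) \<le> Lc * norm (y - y')"
    using Lc(4)[OF z, of "(y - y', 0)"] by (simp add: norm_Pair)
qed (rule lsol_integrable[OF assms])

lemma lsol_bound:
  assumes a: "adm x w" and r: "integrable (leb T) r" and z: "lsol x w \<zeta> r z" and t: "t \<in> {0..T}"
  shows "norm (z t) \<le> (norm \<zeta> + (LINT s|leb T. norm (r s))) * gr"
proof (rule gronwall_primitive[OF T0 Lc(1) lsol_integrable[OF a r] _ _ _ _ t])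
  show zc: "continuous_on {0..T} z" using z by (simp add: lsol_def)
  show "\<And>t. t \<in> {0..T} \<Longrightarrow> z t = \<zeta> + (LINT s|leb t. F1 (x s, w s) (z s, 0) + r s)" using z by (simp add: lsol_def)
  show "AE s in leb T. norm (F1 (x s, w s) (z s, 0) + r s) \<le> Lc * norm (z s) + norm (r s)"
  proof (rule AE_I2)
    fix s assume "s \<in> space (leb T)"
    then have "(x s, w s) \<in> K0" using a by (auto simp: adm_def)
    then have "norm (F1 (x s, w s) (z s, 0)) \<le> Lc * norm (z s)" using Lc(4)[of "(x s, w s)" "(z s, 0)"] by (simp add: norm_Pair)
    then show "norm (F1 (x s, w s) (z s, 0) + r s) \<le> Lc * norm (z s) + norm (r s)"
      using norm_triangle_ineq[of "F1 (x s, w s) (z s, 0)" "r s"] by linarith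
  qed
qed (use r in auto)

lemma lsol_lincomb:
  assumes a: "adm x w" and r: "integrable (leb T) r" "integrable (leb T) r'"
    and z: "lsol x w \<zeta> r z" "lsol x w \<zeta>' r' z'"
  shows "lsol x w (c *\<^sub>R \<zeta> + d *\<^sub>R \<zeta>') (\<lambda>s. c *\<^sub>R r s + d *\<^sub>R r' s) (\<lambda>s. c *\<^sub>R z s + d *\<^sub>R z' s)"
  unfolding lsol_def
proof (intro conjI ballI)
  have zc: "continuous_on {0..T} z" "continuous_on {0..T} z'" using z by (auto simp: lsol_def)
  then show "continuous_on {0..T} (\<lambda>s. c *\<^sub>R z s + d *\<^sub>R z' s)" by (intro continuous_intros)
  fix t assume t: "t \<in> {0..T}"
  then have tT: "t \<le> T" by simp
  note i1 = leb_integrable_mono[OF lsol_integrable[OF a r(1) zc(1)] tT]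
  note i2 = leb_integrable_mono[OF lsol_integrable[OF a r(2) zc(2)] tT]
  have e: "F1 p (c *\<^sub>R u + d *\<^sub>R u', 0) = c *\<^sub>R F1 p (u, 0) + d *\<^sub>R F1 p (u', 0)" for p u u'
    using linear_add[OF C2_lin1[OF F], of p "c *\<^sub>R (u, 0)" "d *\<^sub>R (u', 0)"]
      linear_scale[OF C2_lin1[OF F], of p c "(u, 0)"] linear_scale[OF C2_lin1[OF F], of p d "(u', 0)"] by simp
  have "z t = \<zeta> + (LINT s|leb t. F1 (x s, w s) (z s, 0) + r s)" "z' t = \<zeta>' + (LINT s|leb t. F1 (x s, w s) (z' s, 0) + r' s)"
    using z t by (auto simp: lsol_def)
  then have "c *\<^sub>R z t + d *\<^sub>R z' t = c *\<^sub>R \<zeta> + d *\<^sub>R \<zeta>' +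
     (c *\<^sub>R (LINT s|leb t. F1 (x s, w s) (z s, 0) + r s) + d *\<^sub>R (LINT s|leb t. F1 (x s, w s) (z' s, 0) + r' s))"
    by (simp add: scaleR_add_right)
  also have "c *\<^sub>R (LINT s|leb t. F1 (x s, w s) (z s, 0) + r s) + d *\<^sub>R (LINT s|leb t. F1 (x s, w s) (z' s, 0) + r' s)
    = (LINT s|leb t. c *\<^sub>R (F1 (x s, w s) (z s, 0) + r s) + d *\<^sub>R (F1 (x s, w s) (z' s, 0) + r' s))"
    using i1 i2 by (subst Bochner_Integration.integral_add) auto
  also have "\<dots> = (LINT s|leb t. F1 (x s, w s) (c *\<^sub>R z s + d *\<^sub>R z' s, 0) + (c *\<^sub>R r s + d *\<^sub>R r' s))"
    by (intro Bochner_Integration.integral_cong refl) (simp add: e scaleR_add_right)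
  finally show "c *\<^sub>R z t + d *\<^sub>R z' t = c *\<^sub>R \<zeta> + d *\<^sub>R \<zeta>' +
     (LINT s|leb t. F1 (x s, w s) (c *\<^sub>R z s + d *\<^sub>R z' s, 0) + (c *\<^sub>R r s + d *\<^sub>R r' s))" .
qed

lemma lsol_unique:
  assumes a: "adm x w" and r: "integrable (leb T) r" and z: "lsol x w \<zeta> r z" "lsol x w \<zeta> r z'" and t: "t \<in> {0..T}"
  shows "z t = z' t"
proof -
  have l: "lsol x w (1 *\<^sub>R \<zeta> + (-1) *\<^sub>R \<zeta>) (\<lambda>s. 1 *\<^sub>R r s + (-1) *\<^sub>R r s) (\<lambda>s. 1 *\<^sub>R z s + (-1) *\<^sub>R z' s)"
    by (rule lsol_lincomb[OF a r r z])
  have "norm (1 *\<^sub>R z t + (-1) *\<^sub>R z' t) \<le> (norm (1 *\<^sub>R \<zeta> + (-1) *\<^sub>R \<zeta>) + (LINT s|leb T. norm (1 *\<^sub>R r s + (-1) *\<^sub>R r s))) * gr"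
    by (rule lsol_bound[OF a _ l t]) (use r in auto)
  then show ?thesis by simp
qed

lemma lsol_cong:
  assumes "lsol x w \<zeta> r z" "\<And>s. s \<in> {0..T} \<Longrightarrow> r s = r' s" "\<And>s. s \<in> {0..T} \<Longrightarrow> z s = z' s"
  shows "lsol x w \<zeta> r' z'"
  unfolding lsol_def
proof (intro conjI ballI)
  have "continuous_on {0..T} z" using assms(1) by (simp add: lsol_def)
  then show "continuous_on {0..T} z'" by (rule continuous_on_eq) (rule assms(3))
  fix t assume t: "t \<in> {0..T}"
  have "(LINT s|leb t. F1 (x s, w s) (z s, 0) + r s) = (LINT s|leb t. F1 (x s, w s) (z' s, 0) + r' s)"
    using t assms(2,3) by (intro Bochner_Integration.integral_cong refl) auto
  then show "z' t = \<zeta> + (LINT s|leb t. F1 (x s, w s) (z' s, 0) + r' s)"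
    using assms(1) t assms(3)[OF t] by (simp add: lsol_def)
qed

text \<open>The difference solves a linear equation along the n-th coefficients, with the change of
  the coefficients applied to z0 plus the change of r as source. Both tend to 0 in L^1, and
  \<open>gronwall_primitive\<close> makes the convergence uniform in time.\<close>

lemma lsol_converges:
  assumes a: "\<And>n::nat. adm (x n) (w n)" "adm x0 w0"
    and x: "\<And>s. s \<in> {0..T} \<Longrightarrow> (\<lambda>n. x n s) \<longlonglongrightarrow> x0 s" and w: "\<And>s. s \<in> {0..T} \<Longrightarrow> (\<lambda>n. w n s) \<longlonglongrightarrow> w0 s"
    and z: "\<And>n. lsol (x n) (w n) (\<zeta> n) (r n) (z n)" "lsol x0 w0 \<zeta>0 r0 z0"
    and \<zeta>: "\<zeta> \<longlonglongrightarrow> \<zeta>0" and r: "\<And>n. integrable (leb T) (r n)" "integrable (leb T) r0"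
    and rl: "(\<lambda>n. LINT s|leb T. norm (r n s - r0 s)) \<longlonglongrightarrow> 0"
  shows "\<exists>\<epsilon>. \<epsilon> \<longlonglongrightarrow> 0 \<and> (\<forall>n. \<forall>t\<in>{0..T}. norm (z n t - z0 t) \<le> \<epsilon> n)"
proof -
  define D where "D n s = F1 (x n s, w n s) (z0 s, 0)" for n s
  define D0 where "D0 s = F1 (x0 s, w0 s) (z0 s, 0)" for s
  have z0c: "continuous_on {0..T} z0" and znc: "continuous_on {0..T} (z n)" for n using z by (auto simp: lsol_def)
  have "\<exists>B. \<forall>s\<in>{0..T}. norm (z0 s) \<le> B"
    using compact_imp_bounded[OF compact_continuous_image[OF z0c compact_Icc]] by (auto simp: bounded_iff)
  then obtain B where B: "\<And>s. s \<in> {0..T} \<Longrightarrow> norm (z0 s) \<le> B" by blast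
  have Dm: "D n \<in> borel_measurable (leb T)" "D0 \<in> borel_measurable (leb T)" for n
    unfolding D_def D0_def using z0c by (intro adm_measurable a leb_continuous_measurable borel_measurable_const; simp)+
  have DB: "norm (D n s) \<le> Lc * B" if "s \<in> {0..T}" for n s
  proof -
    have "(x n s, w n s) \<in> K0" using a(1)[of n] that by (auto simp: adm_def)
    from Lc(4)[OF this, of "(z0 s, 0)"] have "norm (D n s) \<le> Lc * norm (z0 s)" by (simp add: D_def norm_Pair)
    also have "\<dots> \<le> Lc * B" using B[OF that] Lc(1) by (rule mult_left_mono)
    finally show ?thesis .
  qed
  have D0B: "norm (D0 s) \<le> Lc * B" if "s \<in> {0..T}" for s
  proof -
    have "(x0 s, w0 s) \<in> K0" using a(2) that by (auto simp: adm_def)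
    from Lc(4)[OF this, of "(z0 s, 0)"] have "norm (D0 s) \<le> Lc * norm (z0 s)" by (simp add: D0_def norm_Pair)
    also have "\<dots> \<le> Lc * B" using B[OF that] Lc(1) by (rule mult_left_mono)
    finally show ?thesis .
  qed
  have Di: "integrable (leb T) (D n)" "integrable (leb T) D0" for n
    by (rule leb_bounded_integrable[OF Dm(1) DB], assumption, rule leb_bounded_integrable[OF Dm(2) D0B], assumption)
  have Dl: "(\<lambda>n. LINT s|leb T. norm (D n s - D0 s)) \<longlonglongrightarrow> 0"
  proof (rule leb_dominated[OF Dm DB])
    show "(\<lambda>n. D n s) \<longlonglongrightarrow> D0 s" if "s \<in> {0..T}" for s
      unfolding D_def D0_def by (intro C2_f1_tendsto[OF F] tendsto_Pair tendsto_const x w that)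
  qed
  define \<epsilon> where "\<epsilon> n = (norm (\<zeta> n - \<zeta>0) + (LINT s|leb T. norm (D n s - D0 s) + norm (r n s - r0 s))) * gr" for n
  have split: "(LINT s|leb T. norm (D n s - D0 s) + norm (r n s - r0 s)) = (LINT s|leb T. norm (D n s - D0 s)) + (LINT s|leb T. norm (r n s - r0 s))" for n
    using Di r by (intro Bochner_Integration.integral_add) auto
  have tri: "norm (a + (b + c)) \<le> norm a + (norm b + norm c)" for a b c :: 'a
    by (intro order_trans[OF norm_triangle_ineq] add_left_mono norm_triangle_ineq)
  have "(\<lambda>n. (norm (\<zeta> n - \<zeta>0) + ((LINT s|leb T. norm (D n s - D0 s)) + (LINT s|leb T. norm (r n s - r0 s)))) * gr) \<longlonglongrightarrow> (norm (\<zeta>0 - \<zeta>0) + (0 + 0)) * gr"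
    by (intro tendsto_intros \<zeta> Dl rl)
  then have "\<epsilon> \<longlonglongrightarrow> 0" unfolding \<epsilon>_def split by simp
  moreover have "norm (z n t - z0 t) \<le> \<epsilon> n" if t: "t \<in> {0..T}" for n t
    unfolding \<epsilon>_def
  proof (rule gronwall_primitive[OF T0 Lc(1) _ _ _ _ _ t])
    let ?g = "\<lambda>s. (F1 (x n s, w n s) (z n s, 0) + r n s) - (F1 (x0 s, w0 s) (z0 s, 0) + r0 s)"
    note i1 = lsol_integrable[OF a(1) r(1) znc, of n n n] and i2 = lsol_integrable[OF a(2) r(2) z0c]
    show "integrable (leb T) ?g" using i1 i2 by (rule Bochner_Integration.integrable_diff)
    show "z n t - z0 t = (\<zeta> n - \<zeta>0) + (LINT s|leb t. ?g s)" if t: "t \<in> {0..T}" for t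
    proof -
      have tT: "t \<le> T" using t by simp
      have "(LINT s|leb t. ?g s) = (LINT s|leb t. F1 (x n s, w n s) (z n s, 0) + r n s) - (LINT s|leb t. F1 (x0 s, w0 s) (z0 s, 0) + r0 s)"
        by (rule Bochner_Integration.integral_diff[OF leb_integrable_mono[OF i1 tT] leb_integrable_mono[OF i2 tT]])
      moreover have "z n t = \<zeta> n + (LINT s|leb t. F1 (x n s, w n s) (z n s, 0) + r n s)"
        "z0 t = \<zeta>0 + (LINT s|leb t. F1 (x0 s, w0 s) (z0 s, 0) + r0 s)"
        using z t by (auto simp: lsol_def)
      ultimately show ?thesis by simp
    qed
    show "integrable (leb T) (\<lambda>s. norm (D n s - D0 s) + norm (r n s - r0 s))" using Di r by simp
    show "AE s in leb T. norm (?g s) \<le> Lc * norm (z n s - z0 s) + (norm (D n s - D0 s) + norm (r n s - r0 s))"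
    proof (rule AE_I2)
      fix s assume "s \<in> space (leb T)"
      then have K: "(x n s, w n s) \<in> K0" using a(1)[of n] by (auto simp: adm_def)
      have "F1 (x n s, w n s) (z n s, 0) = F1 (x n s, w n s) (z n s - z0 s, 0) + D n s"
        using linear_diff[OF C2_lin1[OF F], of "(x n s, w n s)" "(z n s, 0)" "(z0 s, 0)"] by (simp add: D_def)
      then have "?g s = F1 (x n s, w n s) (z n s - z0 s, 0) + ((D n s - D0 s) + (r n s - r0 s))"
        by (simp add: D0_def)
      then have "norm (?g s) \<le> norm (F1 (x n s, w n s) (z n s - z0 s, 0)) + (norm (D n s - D0 s) + norm (r n s - r0 s))"
        using tri by presburger
      moreover have "norm (F1 (x n s, w n s) (z n s - z0 s, 0)) \<le> Lc * norm (z n s - z0 s)"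
        using Lc(4)[OF K, of "(z n s - z0 s, 0)"] by (simp add: norm_Pair)
      ultimately show "norm (?g s) \<le> Lc * norm (z n s - z0 s) + (norm (D n s - D0 s) + norm (r n s - r0 s))" by linarith
    qed
  qed auto
  ultimately show ?thesis by blast
qed

definition Lin :: "(real \<Rightarrow> 'a) \<Rightarrow> (real \<Rightarrow> 'w) \<Rightarrow> 'a \<Rightarrow> (real \<Rightarrow> 'a) \<Rightarrow> real \<Rightarrow> 'a"
  where "Lin x w \<zeta> r = (SOME z. lsol x w \<zeta> r z)"

lemma Lin: "adm x w \<Longrightarrow> integrable (leb T) r \<Longrightarrow> lsol x w \<zeta> r (Lin x w \<zeta> r)"
  unfolding Lin_def by (rule someI_ex[OF lsol_exists])

section \<open>Trajectories for perturbed initial values and controls\<close>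

definition small :: "real \<Rightarrow> 'a \<times> (real \<Rightarrow> 'w) \<Rightarrow> bool"
  where "small \<rho> h \<longleftrightarrow> norm (fst h) \<le> \<rho> \<and> snd h \<in> borel_measurable (leb T) \<and> (\<forall>t\<in>{0..T}. norm (snd h t) \<le> \<rho>)"

definition W :: "'a \<times> (real \<Rightarrow> 'w) \<Rightarrow> real \<Rightarrow> 'w"
  where "W h s = wh s + snd h s"

definition traj :: "'a \<times> (real \<Rightarrow> 'w) \<Rightarrow> (real \<Rightarrow> 'a) \<Rightarrow> bool"
  where "traj h x \<longleftrightarrow> continuous_on {0..T} x \<and> (\<forall>t\<in>{0..T}. norm (x t - xh t) \<le> 1) \<and>
    (\<forall>t\<in>{0..T}. x t = xh 0 + fst h + (LINT s|leb t. F (x s, W h s)))"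

text \<open>Chosen so that the Gronwall bound (\<rho>0 + T Lc \<rho>0) gr on the deviation of the
  state is at most 1, the margin of \<open>K0\<close>; it is also at most 1 so that the controls
  stay in \<open>K0\<close>.\<close>

definition \<rho>0 :: real where "\<rho>0 = min 1 (1 / (gr * (1 + Lc * T)))"

lemma \<rho>0: "0 < \<rho>0" "\<rho>0 \<le> 1" "(\<rho>0 + T * (Lc * \<rho>0)) * gr \<le> 1"
proof -
  have p: "gr * (1 + Lc * T) > 0" using gr_pos Lc(1) T by (intro mult_pos_pos add_pos_nonneg) auto
  then show "0 < \<rho>0" "\<rho>0 \<le> 1" by (auto simp: \<rho>0_def)
  have "\<rho>0 \<le> 1 / (gr * (1 + Lc * T))" by (simp add: \<rho>0_def)
  then have "\<rho>0 * (gr * (1 + Lc * T)) \<le> 1" using p by (simp add: pos_le_divide_eq)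
  then show "(\<rho>0 + T * (Lc * \<rho>0)) * gr \<le> 1" by (simp add: algebra_simps)
qed

lemma W_in: "small \<rho>0 h \<Longrightarrow> t \<in> {0..T} \<Longrightarrow> norm (W h t) \<le> Rad + 1"
  using norm_triangle_ineq[of "wh t" "snd h t"] Rad(3)[of t] \<rho>0(2) unfolding small_def W_def by force

lemma W_measurable: "small \<rho>0 h \<Longrightarrow> W h \<in> borel_measurable (leb T)"
  unfolding W_def[abs_def] small_def using wh by (intro borel_measurable_add) auto

lemma traj_adm: "small \<rho>0 h \<Longrightarrow> traj h x \<Longrightarrow> adm x (W h)"
  unfolding adm_def
proof (intro conjI ballI)
  assume h: "small \<rho>0 h" "traj h x"
  show "continuous_on {0..T} x" using h by (simp add: traj_def)
  show "W h \<in> borel_measurable (leb T)" using h by (simp add: W_measurable)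
  fix t assume t: "t \<in> {0..T}"
  have "norm (x t) \<le> norm (xh t) + norm (x t - xh t)" using norm_triangle_ineq[of "xh t" "x t - xh t"] by simp
  then have "norm (x t) \<le> Rad + 1" using Rad(2)[OF t] h(2) t unfolding traj_def by force
  then show "(x t, W h t) \<in> K0" using W_in[OF h(1) t] by (simp add: K0_def)
qed

text \<open>The deviation from \<open>xh\<close> is first truncated by the projection
  \<open>cp\<close> onto the unit ball, which makes the equation globally Lipschitz. The Gronwall
  estimate with \<rho>0 then shows that the deviation never leaves the ball, so the truncation is
  inactive.\<close>

lemma traj_exists:
  assumes h: "small \<rho>0 h"
  shows "\<exists>x. traj h x"
proof -
  define cp :: "'a \<Rightarrow> 'a" where "cp = closest_point (cball 0 1)"
  have cp_in: "norm (cp y) \<le> 1" for y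
    using closest_point_in_set[of "cball 0 1 :: 'a set" y] by (simp add: cp_def)
  have cp_lip: "norm (cp y - cp y') \<le> norm (y - y')" for y y'
    using closest_point_lipschitz[of "cball 0 1 :: 'a set" y y'] by (simp add: cp_def dist_norm)
  have cp_self: "cp y = y" if "norm y \<le> 1" for y using that by (simp add: cp_def closest_point_self)
  have cp_le: "norm (cp y) \<le> norm y" for y using cp_lip[of y 0] cp_self[of 0] by simp
  have cp_cont: "continuous_on UNIV cp"
    unfolding cp_def by (rule continuous_on_closest_point) auto
  define u where "u t y = xh t + cp (y - xh t)" for t y
  have inK: "(u t y, W h t) \<in> K0" if "t \<in> {0..T}" for t y
  proof -
    have "norm (u t y) \<le> Rad + 1" unfolding u_def using norm_triangle_ineq[of "xh t" "cp (y - xh t)"] Rad(2)[OF that] cp_in[of "y - xh t"] by linarith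
    then show ?thesis using W_in[OF h that] by (simp add: K0_def)
  qed
  have adm_u: "adm (\<lambda>t. u t (y t)) (W h)" if "continuous_on {0..T} y" for y
    unfolding adm_def using W_measurable[OF h] inK that xhc
    by (auto simp: u_def intro!: continuous_intros continuous_on_compose2[OF cp_cont])
  have "\<exists>x. continuous_on {0..T} x \<and> (\<forall>t\<in>{0..T}. x t = (xh 0 + fst h) + (LINT s|leb t. F (u s (x s), W h s)))"
  proof (rule ode_exists[OF T0 Lc(1)])
    fix t x y assume t: "t \<in> {0..T}"
    have "norm (F (u t x, W h t) - F (u t y, W h t)) \<le> Lc * norm ((u t x, W h t) - (u t y, W h t))"
      by (rule Lc(2)[OF inK[OF t] inK[OF t]])
    also have "norm ((u t x, W h t) - (u t y, W h t)) \<le> norm (x - y)"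
      using cp_lip[of "x - xh t" "y - xh t"] by (simp add: u_def norm_Pair)
    finally show "norm (F (u t x, W h t) - F (u t y, W h t)) \<le> Lc * norm (x - y)"
      using Lc(1) by (simp add: mult_left_mono)
  next
    fix y :: "real \<Rightarrow> 'a" assume "continuous_on {0..T} y"
    then show "integrable (leb T) (\<lambda>t. F (u t (y t), W h t))" by (rule adm_F_integrable[OF adm_u])
  qed
  then obtain x where xc: "continuous_on {0..T} x"
    and x: "\<And>t. t \<in> {0..T} \<Longrightarrow> x t = xh 0 + fst h + (LINT s|leb t. F (u s (x s), W h s))" by blast
  have hm: "snd h \<in> borel_measurable (leb T)" and hb: "\<And>t. t \<in> {0..T} \<Longrightarrow> norm (snd h t) \<le> \<rho>0" and h1: "norm (fst h) \<le> \<rho>0"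
    using h by (auto simp: small_def)
  note i1 = adm_F_integrable[OF adm_u[OF xc]] and i2 = adm_F_integrable[OF adm_ref]
  have hi: "integrable (leb T) (\<lambda>s. Lc * norm (snd h s))"
  proof (rule leb_bounded_integrable)
    show "(\<lambda>s. Lc * norm (snd h s)) \<in> borel_measurable (leb T)" using hm by measurable
    show "norm (Lc * norm (snd h s)) \<le> Lc * \<rho>0" if "s \<in> {0..T}" for s using hb[OF that] Lc(1) by (simp add: abs_mult mult_left_mono)
  qed
  have est: "norm (x t - xh t) \<le> (norm (fst h) + (LINT s|leb T. Lc * norm (snd h s))) * gr" if t: "t \<in> {0..T}" for t
  proof (rule gronwall_primitive[OF T0 Lc(1) _ _ hi _ _ t])
    show "integrable (leb T) (\<lambda>s. F (u s (x s), W h s) - F (xh s, wh s))" using i1 i2 by simp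
    show "x t - xh t = fst h + (LINT s|leb t. F (u s (x s), W h s) - F (xh s, wh s))" if t: "t \<in> {0..T}" for t
    proof -
      have tT: "t \<le> T" using t by simp
      have "(LINT s|leb t. F (u s (x s), W h s) - F (xh s, wh s)) = (LINT s|leb t. F (u s (x s), W h s)) - (LINT s|leb t. F (xh s, wh s))"
        by (rule Bochner_Integration.integral_diff[OF leb_integrable_mono[OF i1 tT] leb_integrable_mono[OF i2 tT]])
      then show ?thesis using x[OF t] xh[OF t] by simp
    qed
    show "AE s in leb T. norm (F (u s (x s), W h s) - F (xh s, wh s)) \<le> Lc * norm (x s - xh s) + Lc * norm (snd h s)"
    proof (rule AE_I2)
      fix s assume "s \<in> space (leb T)"
      then have s: "s \<in> {0..T}" by simp
      have "(xh s, wh s) \<in> K0" using adm_ref s by (auto simp: adm_def)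
      then have "norm (F (u s (x s), W h s) - F (xh s, wh s)) \<le> Lc * norm ((u s (x s), W h s) - (xh s, wh s))"
        by (rule Lc(2)[OF _ inK[OF s]])
      also have "norm ((u s (x s), W h s) - (xh s, wh s)) \<le> norm (x s - xh s) + norm (snd h s)"
        using norm_Pair_le[of "cp (x s - xh s)" "snd h s"] cp_le[of "x s - xh s"] by (simp add: u_def W_def)
      finally show "norm (F (u s (x s), W h s) - F (xh s, wh s)) \<le> Lc * norm (x s - xh s) + Lc * norm (snd h s)"
        using Lc(1) by (simp add: mult_left_mono distrib_left)
    qed
  qed (use Lc(1) in auto)
  have le1: "norm (x t - xh t) \<le> 1" if t: "t \<in> {0..T}" for t
  proof -
    have "(LINT s|leb T. Lc * norm (snd h s)) \<le> (LINT s|leb T. Lc * \<rho>0)"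
      using hb Lc(1) by (intro leb_integral_le hi leb_continuous_integrable continuous_on_const mult_left_mono) auto
    then have "(LINT s|leb T. Lc * norm (snd h s)) \<le> T * (Lc * \<rho>0)" using leb_integral_const[OF T0, of "Lc * \<rho>0"] by linarith
    then have "norm (x t - xh t) \<le> (\<rho>0 + T * (Lc * \<rho>0)) * gr"
      using est[OF t] h1 gr_pos by (smt (verit) mult_right_mono)
    then show ?thesis using \<rho>0(3) by linarith
  qed
  have "u s (x s) = x s" if "s \<in> {0..T}" for s using cp_self[OF le1[OF that]] by (simp add: u_def)
  then have "(LINT s|leb t. F (u s (x s), W h s)) = (LINT s|leb t. F (x s, W h s))" if "t \<in> {0..T}" for t
    using that by (intro Bochner_Integration.integral_cong refl) auto
  then have "traj h x" unfolding traj_def using xc le1 x by simp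
  then show ?thesis by blast
qed

definition X :: "'a \<times> (real \<Rightarrow> 'w) \<Rightarrow> real \<Rightarrow> 'a" where "X h = (SOME x. traj h x)"

lemma X: "small \<rho>0 h \<Longrightarrow> traj h (X h)"
  unfolding X_def by (rule someI_ex[OF traj_exists])

lemma X_adm: "small \<rho>0 h \<Longrightarrow> adm (X h) (W h)"
  using X traj_adm by blast

lemma traj_diff:
  assumes h: "small \<rho>0 h" "traj h x" and k: "small \<rho>0 k" "traj k y" and t: "t \<in> {0..T}"
  shows "norm (y t - x t) \<le> (norm (fst k - fst h) + (LINT s|leb T. Lc * norm (snd k s - snd h s))) * gr"
proof (rule gronwall_primitive[OF T0 Lc(1) _ _ _ _ _ t])
  note a = traj_adm[OF h] traj_adm[OF k]
  note i1 = adm_F_integrable[OF a(1)] and i2 = adm_F_integrable[OF a(2)]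
  show "integrable (leb T) (\<lambda>s. F (y s, W k s) - F (x s, W h s))" using i1 i2 by simp
  show "y t - x t = (fst k - fst h) + (LINT s|leb t. F (y s, W k s) - F (x s, W h s))" if t: "t \<in> {0..T}" for t
  proof -
    have tT: "t \<le> T" using t by simp
    have "(LINT s|leb t. F (y s, W k s) - F (x s, W h s)) = (LINT s|leb t. F (y s, W k s)) - (LINT s|leb t. F (x s, W h s))"
      by (rule Bochner_Integration.integral_diff[OF leb_integrable_mono[OF i2 tT] leb_integrable_mono[OF i1 tT]])
    moreover have "x t = xh 0 + fst h + (LINT s|leb t. F (x s, W h s))" "y t = xh 0 + fst k + (LINT s|leb t. F (y s, W k s))"
      using h k t by (auto simp: traj_def)
    ultimately show ?thesis by simp
  qed
  show "integrable (leb T) (\<lambda>s. Lc * norm (snd k s - snd h s))"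
  proof (rule leb_bounded_integrable)
    show "(\<lambda>s. Lc * norm (snd k s - snd h s)) \<in> borel_measurable (leb T)" using h k by (auto simp: small_def)
    show "norm (Lc * norm (snd k s - snd h s)) \<le> Lc * (\<rho>0 + \<rho>0)" if "s \<in> {0..T}" for s
    proof -
      have "norm (snd k s - snd h s) \<le> \<rho>0 + \<rho>0" using h(1) k(1) that norm_triangle_ineq4[of "snd k s" "snd h s"]
        unfolding small_def by force
      then show ?thesis using Lc(1) by (simp add: abs_mult mult_left_mono)
    qed
  qed
  show "0 \<le> Lc * norm (snd k s - snd h s)" for s using Lc(1) by simp
  show "AE s in leb T. norm (F (y s, W k s) - F (x s, W h s)) \<le> Lc * norm (y s - x s) + Lc * norm (snd k s - snd h s)"
  proof (rule AE_I2)
    fix s assume "s \<in> space (leb T)"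
    then have "(x s, W h s) \<in> K0" "(y s, W k s) \<in> K0" using a by (auto simp: adm_def)
    then have "norm (F (y s, W k s) - F (x s, W h s)) \<le> Lc * norm ((y s, W k s) - (x s, W h s))" by (rule Lc(2))
    also have "norm ((y s, W k s) - (x s, W h s)) \<le> norm (y s - x s) + norm (snd k s - snd h s)"
      using norm_Pair_le[of "y s - x s" "snd k s - snd h s"] by (simp add: W_def)
    finally show "norm (F (y s, W k s) - F (x s, W h s)) \<le> Lc * norm (y s - x s) + Lc * norm (snd k s - snd h s)"
      using Lc(1) by (simp add: mult_left_mono distrib_left)
  qed
qed

lemma traj_unique:
  assumes "small \<rho>0 h" "traj h x" "traj h y" "t \<in> {0..T}"
  shows "y t = x t"
  using traj_diff[OF assms(1,2) assms(1,3,4)] by simp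

lemma zero_small: "0 \<le> \<rho> \<Longrightarrow> small \<rho> 0"
  by (simp add: small_def zero_fun_def)

lemma traj_ref: "traj 0 xh"
  unfolding traj_def
proof (intro conjI ballI xhc)
  fix t assume "t \<in> {0..T}"
  from xh[OF this] show "xh t = xh 0 + fst 0 + (LINT s|leb t. F (xh s, W 0 s))" by (simp add: W_def)
qed simp

lemma X_0: "t \<in> {0..T} \<Longrightarrow> X 0 t = xh t"
  using traj_unique[OF zero_small traj_ref X[OF zero_small]] \<rho>0(1) by simp

lemma W_0: "W 0 = wh"
  by (simp add: W_def fun_eq_iff)

text \<open>Bounded pointwise convergence of the controls: it holds for combinations of fixed
  bounded directions with convergent coefficients, and it is what dominated convergence asks
  for.\<close>

definition bconv :: "(nat \<Rightarrow> 'a \<times> (real \<Rightarrow> 'w)) \<Rightarrow> 'a \<times> (real \<Rightarrow> 'w) \<Rightarrow> bool"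
  where "bconv k k0 \<longleftrightarrow> (\<lambda>n. fst (k n)) \<longlonglongrightarrow> fst k0 \<and> (\<forall>n. snd (k n) \<in> borel_measurable (leb T)) \<and>
    snd k0 \<in> borel_measurable (leb T) \<and> (\<exists>B. \<forall>n. \<forall>s\<in>{0..T}. norm (snd (k n) s) \<le> B) \<and>
    (\<forall>s\<in>{0..T}. (\<lambda>n. snd (k n) s) \<longlonglongrightarrow> snd k0 s)"

definition uconv :: "(nat \<Rightarrow> real \<Rightarrow> 'a) \<Rightarrow> (real \<Rightarrow> 'a) \<Rightarrow> bool"
  where "uconv z z0 \<longleftrightarrow> (\<exists>\<epsilon>. \<epsilon> \<longlonglongrightarrow> 0 \<and> (\<forall>n. \<forall>t\<in>{0..T}. norm (z n t - z0 t) \<le> \<epsilon> n))"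

lemma uconv_tendsto: "uconv z z0 \<Longrightarrow> t \<in> {0..T} \<Longrightarrow> (\<lambda>n. z n t) \<longlonglongrightarrow> z0 t"
  unfolding uconv_def
  by (elim exE conjE, rule LIM_zero_cancel, rule Lim_null_comparison[rotated], assumption) (auto intro!: always_eventually)

lemma X_converges:
  assumes h: "\<And>n. small \<rho>0 (h n)" "small \<rho>0 h0" and c: "bconv h h0"
  shows "uconv (\<lambda>n. X (h n)) (X h0)"
proof -
  define \<epsilon> where "\<epsilon> n = (norm (fst (h n) - fst h0) + Lc * (LINT s|leb T. norm (snd (h n) s - snd h0 s))) * gr" for n
  have "norm (X (h n) t - X h0 t) \<le> \<epsilon> n" if "t \<in> {0..T}" for n t
    using traj_diff[OF h(2) X[OF h(2)] h(1) X[OF h(1)] that, of n] by (simp add: \<epsilon>_def)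
  moreover have "\<epsilon> \<longlonglongrightarrow> 0"
  proof -
    obtain B where B: "\<And>n s. s \<in> {0..T} \<Longrightarrow> norm (snd (h n) s) \<le> B" using c unfolding bconv_def by blast
    have "(\<lambda>n. LINT s|leb T. norm (snd (h n) s - snd h0 s)) \<longlonglongrightarrow> 0"
      by (rule leb_dominated[OF _ _ B]) (use c in \<open>auto simp: bconv_def\<close>)
    moreover have "(\<lambda>n. fst (h n)) \<longlonglongrightarrow> fst h0" using c by (simp add: bconv_def)
    ultimately have "\<epsilon> \<longlonglongrightarrow> (norm (fst h0 - fst h0) + Lc * 0) * gr"
      unfolding \<epsilon>_def by (intro tendsto_mult tendsto_add tendsto_norm tendsto_diff tendsto_const)
    then show ?thesis by simp
  qed
  ultimately show ?thesis unfolding uconv_def by blast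
qed

text \<open>\<open>Z h k\<close> and \<open>Y h k\<close> are the first and second derivatives of \<open>t \<mapsto> X (h + t k)\<close> at \<open>0\<close>.\<close>

definition Z :: "'a \<times> (real \<Rightarrow> 'w) \<Rightarrow> 'a \<times> (real \<Rightarrow> 'w) \<Rightarrow> real \<Rightarrow> 'a"
  where "Z h k = Lin (X h) (W h) (fst k) (\<lambda>s. F1 (X h s, W h s) (0, snd k s))"

definition Y :: "'a \<times> (real \<Rightarrow> 'w) \<Rightarrow> 'a \<times> (real \<Rightarrow> 'w) \<Rightarrow> real \<Rightarrow> 'a"
  where "Y h k = Lin (X h) (W h) 0 (\<lambda>s. F2 (X h s, W h s) (Z h k s, snd k s) (Z h k s, snd k s))"

lemma Z_rhs_integrable:
  assumes "small \<rho>0 h" "integrable (leb T) (snd k)"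
  shows "integrable (leb T) (\<lambda>s. F1 (X h s, W h s) (0, snd k s))"
  using adm_F1_integrable[OF X_adm[OF assms(1)] integrable_zero assms(2)] .

lemma Z_lsol:
  assumes "small \<rho>0 h" "integrable (leb T) (snd k)"
  shows "lsol (X h) (W h) (fst k) (\<lambda>s. F1 (X h s, W h s) (0, snd k s)) (Z h k)"
  unfolding Z_def by (rule Lin[OF X_adm[OF assms(1)] Z_rhs_integrable[OF assms]])

lemma bconv_integrable:
  assumes "bconv k k0"
  shows "integrable (leb T) (snd (k n))" "integrable (leb T) (snd k0)"
proof -
  obtain B where B: "\<And>n s. s \<in> {0..T} \<Longrightarrow> norm (snd (k n) s) \<le> B" using assms unfolding bconv_def by blast
  show "integrable (leb T) (snd (k n))"
    by (rule leb_bounded_integrable[OF _ B]) (use assms in \<open>auto simp: bconv_def\<close>)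
  have "norm (snd k0 s) \<le> B" if "s \<in> {0..T}" for s
  proof (rule LIMSEQ_le_const2[of "\<lambda>n. norm (snd (k n) s)"])
    show "(\<lambda>n. norm (snd (k n) s)) \<longlonglongrightarrow> norm (snd k0 s)" using assms that by (intro tendsto_norm) (auto simp: bconv_def)
  qed (use B[OF that] in blast)
  then show "integrable (leb T) (snd k0)"
    by (intro leb_bounded_integrable[of _ T B]) (use assms in \<open>auto simp: bconv_def\<close>)
qed

text \<open>Base point and direction may vary simultaneously; \<open>D2conv\<close> in the locale
  \<open>expansion\<close> asks for this, since the directions there are combinations with changing
  coefficients.\<close>

lemma Z_converges:
  assumes h: "\<And>n. small \<rho>0 (h n)" "small \<rho>0 h0" and c: "bconv h h0" and k: "bconv k k0"
  shows "uconv (\<lambda>n. Z (h n) (k n)) (Z h0 k0)"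
  unfolding uconv_def
proof (rule lsol_converges[OF X_adm[OF h(1)] X_adm[OF h(2)] _ _ Z_lsol[OF h(1) bconv_integrable(1)[OF k]] Z_lsol[OF h(2) bconv_integrable(2)[OF k]]
      _ Z_rhs_integrable[OF h(1) bconv_integrable(1)[OF k]] Z_rhs_integrable[OF h(2) bconv_integrable(2)[OF k]]])
  show xl: "(\<lambda>n. X (h n) s) \<longlonglongrightarrow> X h0 s" if "s \<in> {0..T}" for s
    using uconv_tendsto[OF X_converges[OF h c] that] .
  show wl: "(\<lambda>n. W (h n) s) \<longlonglongrightarrow> W h0 s" if "s \<in> {0..T}" for s
    unfolding W_def using c that by (intro tendsto_add tendsto_const) (auto simp: bconv_def)
  show "(\<lambda>n. fst (k n)) \<longlonglongrightarrow> fst k0" using k by (simp add: bconv_def)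
  obtain B where B: "\<And>n s. s \<in> {0..T} \<Longrightarrow> norm (snd (k n) s) \<le> B" using k unfolding bconv_def by blast
  have km: "snd (k n) \<in> borel_measurable (leb T)" "snd k0 \<in> borel_measurable (leb T)" for n using k by (auto simp: bconv_def)
  show "(\<lambda>n. LINT s|leb T. norm (F1 (X (h n) s, W (h n) s) (0, snd (k n) s) - F1 (X h0 s, W h0 s) (0, snd k0 s))) \<longlonglongrightarrow> 0"
  proof (rule leb_dominated)
    show "(\<lambda>s. F1 (X (h n) s, W (h n) s) (0, snd (k n) s)) \<in> borel_measurable (leb T)" for n
      by (intro adm_measurable X_adm h km borel_measurable_const)
    show "(\<lambda>s. F1 (X h0 s, W h0 s) (0, snd k0 s)) \<in> borel_measurable (leb T)"
      by (intro adm_measurable X_adm h km borel_measurable_const)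
    fix s assume s: "s \<in> {0..T}"
    show "norm (F1 (X (h n) s, W (h n) s) (0, snd (k n) s)) \<le> Lc * B" for n
    proof -
      have "(X (h n) s, W (h n) s) \<in> K0" using X_adm[OF h(1)] s by (auto simp: adm_def)
      from Lc(4)[OF this, of "(0, snd (k n) s)"] have "norm (F1 (X (h n) s, W (h n) s) (0, snd (k n) s)) \<le> Lc * norm (snd (k n) s)"
        by (simp add: norm_Pair)
      also have "\<dots> \<le> Lc * B" using B[OF s] Lc(1) by (intro mult_left_mono)
      finally show ?thesis .
    qed
    show "(\<lambda>n. F1 (X (h n) s, W (h n) s) (0, snd (k n) s)) \<longlonglongrightarrow> F1 (X h0 s, W h0 s) (0, snd k0 s)"
      using k s by (intro C2_f1_tendsto[OF F] tendsto_Pair tendsto_const xl wl) (auto simp: bconv_def)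
  qed
qed

lemma Z_continuous: "small \<rho>0 h \<Longrightarrow> integrable (leb T) (snd k) \<Longrightarrow> continuous_on {0..T} (Z h k)"
  using Z_lsol by (auto simp: lsol_def)

definition Bm :: "(real \<Rightarrow> 'w) set"
  where "Bm = {\<omega>. \<omega> \<in> borel_measurable (leb T) \<and> (\<exists>B. \<forall>t\<in>{0..T}. norm (\<omega> t) \<le> B)}"

lemma Bm_integrable: "\<omega> \<in> Bm \<Longrightarrow> integrable (leb T) \<omega>"
  unfolding Bm_def using leb_bounded_integrable by blast

lemma bconv_Bm:
  assumes "bconv k k0"
  shows "snd (k n) \<in> Bm" "snd k0 \<in> Bm"
proof -
  obtain B where B: "\<And>n s. s \<in> {0..T} \<Longrightarrow> norm (snd (k n) s) \<le> B" using assms unfolding bconv_def by blast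
  then show "snd (k n) \<in> Bm" using assms unfolding bconv_def Bm_def by blast
  have "norm (snd k0 s) \<le> B" if "s \<in> {0..T}" for s
  proof (rule LIMSEQ_le_const2[of "\<lambda>n. norm (snd (k n) s)"])
    show "(\<lambda>n. norm (snd (k n) s)) \<longlonglongrightarrow> norm (snd k0 s)" using assms that by (intro tendsto_norm) (auto simp: bconv_def)
  qed (use B[OF that] in blast)
  then show "snd k0 \<in> Bm" using assms unfolding bconv_def Bm_def by blast
qed

lemma F2_rhs:
  assumes "small \<rho>0 h" "snd k \<in> Bm" "continuous_on {0..T} z"
  shows "(\<lambda>s. F2 (X h s, W h s) (z s, snd k s) (z s, snd k s)) \<in> borel_measurable (leb T)"
    "integrable (leb T) (\<lambda>s. F2 (X h s, W h s) (z s, snd k s) (z s, snd k s))"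
proof -
  show m: "(\<lambda>s. F2 (X h s, W h s) (z s, snd k s) (z s, snd k s)) \<in> borel_measurable (leb T)"
    using assms(2) by (intro adm_measurable X_adm[OF assms(1)] leb_continuous_measurable[OF assms(3)]) (auto simp: Bm_def)
  have "\<exists>B. \<forall>s\<in>{0..T}. norm (z s) \<le> B"
    using compact_imp_bounded[OF compact_continuous_image[OF assms(3) compact_Icc]] by (auto simp: bounded_iff)
  then obtain B where B: "\<And>s. s \<in> {0..T} \<Longrightarrow> norm (z s) \<le> B" by blast
  obtain B' where B': "\<And>s. s \<in> {0..T} \<Longrightarrow> norm (snd k s) \<le> B'" using assms(2) unfolding Bm_def by blast
  show "integrable (leb T) (\<lambda>s. F2 (X h s, W h s) (z s, snd k s) (z s, snd k s))"
  proof (rule leb_bounded_integrable[OF m])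
    fix s assume s: "s \<in> {0..T}"
    have K: "(X h s, W h s) \<in> K0" using X_adm[OF assms(1)] s by (auto simp: adm_def)
    have n: "norm (z s, snd k s) \<le> B + B'" using norm_Pair_le[of "z s" "snd k s"] B[OF s] B'[OF s] by linarith
    have "norm (F2 (X h s, W h s) (z s, snd k s) (z s, snd k s)) \<le> Lc * norm (z s, snd k s) * norm (z s, snd k s)" by (rule Lc(5)[OF K])
    also have "\<dots> \<le> Lc * (B + B') * (B + B')"
      using n Lc(1) norm_ge_zero order_trans by (intro mult_mono mult_left_mono mult_nonneg_nonneg) blast+
    finally show "norm (F2 (X h s, W h s) (z s, snd k s) (z s, snd k s)) \<le> Lc * (B + B') * (B + B')" .
  qed
qed

lemma Y_lsol:
  assumes "small \<rho>0 h" "snd k \<in> Bm"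
  shows "lsol (X h) (W h) 0 (\<lambda>s. F2 (X h s, W h s) (Z h k s, snd k s) (Z h k s, snd k s)) (Y h k)"
  unfolding Y_def
  by (rule Lin[OF X_adm[OF assms(1)] F2_rhs(2)[OF assms Z_continuous[OF assms(1) Bm_integrable[OF assms(2)]]]])

lemma uconv_bounded:
  assumes "uconv z z0" "continuous_on {0..T} z0"
  shows "\<exists>B. \<forall>n. \<forall>s\<in>{0..T}. norm (z n s) \<le> B"
proof -
  have "\<exists>B. \<forall>s\<in>{0..T}. norm (z0 s) \<le> B"
    using compact_imp_bounded[OF compact_continuous_image[OF assms(2) compact_Icc]] by (auto simp: bounded_iff)
  then obtain B where B: "\<And>s. s \<in> {0..T} \<Longrightarrow> norm (z0 s) \<le> B" by blast
  obtain \<epsilon> where \<epsilon>: "\<epsilon> \<longlonglongrightarrow> 0" "\<And>n t. t \<in> {0..T} \<Longrightarrow> norm (z n t - z0 t) \<le> \<epsilon> n"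
    using assms(1) unfolding uconv_def by blast
  have "Bseq \<epsilon>" using \<epsilon>(1) by (meson convergentI convergent_imp_Bseq)
  then obtain C where C: "\<And>n. norm (\<epsilon> n) \<le> C" unfolding Bseq_def by blast
  have "norm (z n s) \<le> B + C" if s: "s \<in> {0..T}" for n s
    using norm_triangle_ineq[of "z0 s" "z n s - z0 s"] B[OF s] \<epsilon>(2)[OF s, of n] C[of n] by simp
  then show ?thesis by blast
qed

lemma Y_converges:
  assumes h: "\<And>n. small \<rho>0 (h n)" "small \<rho>0 h0" and c: "bconv h h0" and k: "bconv k k0"
  shows "uconv (\<lambda>n. Y (h n) (k n)) (Y h0 k0)"
  unfolding uconv_def
proof (rule lsol_converges[OF X_adm[OF h(1)] X_adm[OF h(2)] _ _ Y_lsol[OF h(1) bconv_Bm(1)[OF k]] Y_lsol[OF h(2) bconv_Bm(2)[OF k]]])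
  note zc = Z_continuous[OF h(1) bconv_integrable(1)[OF k]] and z0c = Z_continuous[OF h(2) bconv_integrable(2)[OF k]]
  show xl: "(\<lambda>n. X (h n) s) \<longlonglongrightarrow> X h0 s" if "s \<in> {0..T}" for s
    using uconv_tendsto[OF X_converges[OF h c] that] .
  show wl: "(\<lambda>n. W (h n) s) \<longlonglongrightarrow> W h0 s" if "s \<in> {0..T}" for s
    unfolding W_def using c that by (intro tendsto_add tendsto_const) (auto simp: bconv_def)
  show "integrable (leb T) (\<lambda>s. F2 (X (h n) s, W (h n) s) (Z (h n) (k n) s, snd (k n) s) (Z (h n) (k n) s, snd (k n) s))" for n
    by (rule F2_rhs(2)[OF h(1) bconv_Bm(1)[OF k] zc])
  show "integrable (leb T) (\<lambda>s. F2 (X h0 s, W h0 s) (Z h0 k0 s, snd k0 s) (Z h0 k0 s, snd k0 s))"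
    by (rule F2_rhs(2)[OF h(2) bconv_Bm(2)[OF k] z0c])
  obtain B where B: "\<And>n s. s \<in> {0..T} \<Longrightarrow> norm (snd (k n) s) \<le> B" using k unfolding bconv_def by blast
  obtain B' where B': "\<And>n s. s \<in> {0..T} \<Longrightarrow> norm (Z (h n) (k n) s) \<le> B'"
    using uconv_bounded[OF Z_converges[OF h c k] z0c] by blast
  show "(\<lambda>n. LINT s|leb T. norm (F2 (X (h n) s, W (h n) s) (Z (h n) (k n) s, snd (k n) s) (Z (h n) (k n) s, snd (k n) s) -
      F2 (X h0 s, W h0 s) (Z h0 k0 s, snd k0 s) (Z h0 k0 s, snd k0 s))) \<longlonglongrightarrow> 0"
  proof (rule leb_dominated[OF F2_rhs(1)[OF h(1) bconv_Bm(1)[OF k] zc] F2_rhs(1)[OF h(2) bconv_Bm(2)[OF k] z0c]])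
    fix s assume s: "s \<in> {0..T}"
    show "norm (F2 (X (h n) s, W (h n) s) (Z (h n) (k n) s, snd (k n) s) (Z (h n) (k n) s, snd (k n) s)) \<le> Lc * (B' + B) * (B' + B)" for n
    proof -
      have K: "(X (h n) s, W (h n) s) \<in> K0" using X_adm[OF h(1)] s by (auto simp: adm_def)
      have n: "norm (Z (h n) (k n) s, snd (k n) s) \<le> B' + B"
        using norm_Pair_le[of "Z (h n) (k n) s" "snd (k n) s"] B[OF s, of n] B'[OF s, of n] by linarith
      have "norm (F2 (X (h n) s, W (h n) s) (Z (h n) (k n) s, snd (k n) s) (Z (h n) (k n) s, snd (k n) s))
         \<le> Lc * norm (Z (h n) (k n) s, snd (k n) s) * norm (Z (h n) (k n) s, snd (k n) s)" by (rule Lc(5)[OF K])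
      also have "\<dots> \<le> Lc * (B' + B) * (B' + B)"
        using n Lc(1) norm_ge_zero order_trans by (intro mult_mono mult_left_mono mult_nonneg_nonneg) blast+
      finally show ?thesis .
    qed
    have zl: "(\<lambda>n. Z (h n) (k n) s) \<longlonglongrightarrow> Z h0 k0 s" using uconv_tendsto[OF Z_converges[OF h c k] s] .
    have kl: "(\<lambda>n. snd (k n) s) \<longlonglongrightarrow> snd k0 s" using k s by (auto simp: bconv_def)
    show "(\<lambda>n. F2 (X (h n) s, W (h n) s) (Z (h n) (k n) s, snd (k n) s) (Z (h n) (k n) s, snd (k n) s))
       \<longlonglongrightarrow> F2 (X h0 s, W h0 s) (Z h0 k0 s, snd k0 s) (Z h0 k0 s, snd k0 s)"
      by (intro C2_f2_tendsto[OF F] tendsto_Pair xl[OF s] wl[OF s] zl kl)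
  qed
qed auto

end

section \<open>Second-order expansion of perturbed trajectories\<close>

context control_system
begin

lemma lsol_init: "lsol x w \<zeta> r z \<Longrightarrow> z 0 = \<zeta>"
proof -
  assume "lsol x w \<zeta> r z"
  then have "z 0 = \<zeta> + (LINT s|leb 0. F1 (x s, w s) (z s, 0) + r s)" using T by (simp add: lsol_def)
  moreover have "(LINT s|leb 0. F1 (x s, w s) (z s, 0) + r s) = 0"
  proof -
    have "AE s in lebesgue. s \<noteq> (0::real)"
      unfolding eventually_ae_filter_negligible by (intro exI[of _ "{0}"]) auto
    then have "AE s in lebesgue. s \<in> {0..0} \<longrightarrow> F1 (x s, w s) (z s, 0) + r s = 0"
      by eventually_elim auto
    then have "AE s in leb 0. F1 (x s, w s) (z s, 0) + r s = 0"
      by (simp add: AE_restrict_space_iff)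
    then show ?thesis by (rule integral_eq_zero_AE)
  qed
  ultimately show ?thesis by simp
qed

lemma Z_lincomb:
  assumes h: "small \<rho>0 h" and k: "integrable (leb T) (snd k)" "integrable (leb T) (snd k')" and t: "t \<in> {0..T}"
  shows "Z h (c *\<^sub>R k + d *\<^sub>R k') t = c *\<^sub>R Z h k t + d *\<^sub>R Z h k' t"
proof (rule lsol_unique[OF X_adm[OF h] _ _ _ t])
  let ?k = "c *\<^sub>R k + d *\<^sub>R k'"
  have ki: "integrable (leb T) (snd ?k)" using k by (simp add: plus_fun_def scaleR_fun_def)
  show "integrable (leb T) (\<lambda>s. F1 (X h s, W h s) (0, snd ?k s))" by (rule Z_rhs_integrable[OF h ki])
  show "lsol (X h) (W h) (fst ?k) (\<lambda>s. F1 (X h s, W h s) (0, snd ?k s)) (Z h ?k)" by (rule Z_lsol[OF h ki])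
  have "lsol (X h) (W h) (c *\<^sub>R fst k + d *\<^sub>R fst k')
     (\<lambda>s. c *\<^sub>R F1 (X h s, W h s) (0, snd k s) + d *\<^sub>R F1 (X h s, W h s) (0, snd k' s)) (\<lambda>s. c *\<^sub>R Z h k s + d *\<^sub>R Z h k' s)"
    by (intro lsol_lincomb X_adm Z_rhs_integrable Z_lsol h k)
  moreover have "c *\<^sub>R F1 p (0, snd k s) + d *\<^sub>R F1 p (0, snd k' s) = F1 p (0, snd ?k s)" for p s
    using linear_add[OF C2_lin1[OF F], of p "c *\<^sub>R (0, snd k s)" "d *\<^sub>R (0, snd k' s)"]
      linear_scale[OF C2_lin1[OF F], of p c "(0, snd k s)"] linear_scale[OF C2_lin1[OF F], of p d "(0, snd k' s)"] by simp
  ultimately show "lsol (X h) (W h) (fst ?k) (\<lambda>s. F1 (X h s, W h s) (0, snd ?k s)) (\<lambda>s. c *\<^sub>R Z h k s + d *\<^sub>R Z h k' s)"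
    by simp
qed

text \<open>The quotient q n solves the linearized equation exactly, with an extra source \<rho> n
  of order |t n|; hence q n tends to Z. The difference divided once more by t n solves the equation
  with source \<rho> n / t n, which tends to half of the F2-term, so it tends to Y / 2.\<close>

lemma difference_quotients:
  assumes h: "small \<rho>0 h" and k: "snd k \<in> Bm" and t: "t \<longlonglongrightarrow> 0" "\<And>n::nat. t n \<noteq> 0"
    and ht: "\<And>n. small \<rho>0 (h + t n *\<^sub>R k)" and s: "s \<in> {0..T}"
  shows "(\<lambda>n. (1 / t n) *\<^sub>R (X (h + t n *\<^sub>R k) s - X h s)) \<longlonglongrightarrow> Z h k s"
    "(\<lambda>n. (1 / t n) *\<^sub>R ((1 / t n) *\<^sub>R (X (h + t n *\<^sub>R k) s - X h s) - Z h k s)) \<longlonglongrightarrow> (1/2) *\<^sub>R Y h k s"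
proof -
  define z where "z s = (X h s, W h s)" for s
  define q where "q n s = (1 / t n) *\<^sub>R (X (h + t n *\<^sub>R k) s - X h s)" for n s
  define v where "v n s = (q n s, snd k s)" for n s
  have zv: "z s + t n *\<^sub>R v n s = (X (h + t n *\<^sub>R k) s, W (h + t n *\<^sub>R k) s)" for n s
    using t(2)[of n] by (simp add: z_def v_def q_def W_def)
  note ki = Bm_integrable[OF k] and ax = X_adm[OF h] and axt = X_adm[OF ht]
  have km: "snd k \<in> borel_measurable (leb T)" using k by (simp add: Bm_def)
  obtain B where B: "\<And>s. s \<in> {0..T} \<Longrightarrow> norm (snd k s) \<le> B" using k unfolding Bm_def by blast
  \<comment> \<open>A bound on the quotients independent of n, from \<open>traj_diff\<close> for the
    perturbation t n k.\<close>
  define Q where "Q = (norm (fst k) + (LINT s|leb T. Lc * norm (snd k s))) * gr"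
  have qb: "norm (q n s) \<le> Q" if "s \<in> {0..T}" for n s
  proof -
    have "norm (X (h + t n *\<^sub>R k) s - X h s) \<le> (norm (t n *\<^sub>R fst k) + (LINT s|leb T. Lc * norm (t n *\<^sub>R snd k s))) * gr"
      using traj_diff[OF h X[OF h] ht X[OF ht] that, of n] by simp
    also have "(LINT s|leb T. Lc * norm (t n *\<^sub>R snd k s)) = \<bar>t n\<bar> * (LINT s|leb T. Lc * norm (snd k s))"
      by (simp add: mult.left_commute)
    also have "(norm (t n *\<^sub>R fst k) + \<bar>t n\<bar> * (LINT s|leb T. Lc * norm (snd k s))) * gr = \<bar>t n\<bar> * Q"
      by (simp add: Q_def algebra_simps)
    finally have "norm (X (h + t n *\<^sub>R k) s - X h s) \<le> \<bar>t n\<bar> * Q" .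
    then have "(1 / \<bar>t n\<bar>) * norm (X (h + t n *\<^sub>R k) s - X h s) \<le> (1 / \<bar>t n\<bar>) * (\<bar>t n\<bar> * Q)"
      by (intro mult_left_mono) auto
    then show ?thesis using t(2)[of n] unfolding q_def norm_scaleR by simp
  qed
  have vb: "norm (v n s) \<le> Q + B" if "s \<in> {0..T}" for n s
    using norm_Pair_le[of "q n s" "snd k s"] qb[OF that, of n] B[OF that] by (simp add: v_def)
  \<comment> \<open>First-order Taylor remainder of F divided by the step. A factor |t n| remains in
    the bound \<open>\<rho>b\<close>, so even \<rho> n / t n stays bounded and dominated convergence
    applies to it.\<close>
  define \<rho> where "\<rho> n s = (1 / t n) *\<^sub>R (F (z s + t n *\<^sub>R v n s) - F (z s)) - F1 (z s) (v n s)" for n s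
  have zK: "z s \<in> K0" and zvK: "z s + t n *\<^sub>R v n s \<in> K0" if "s \<in> {0..T}" for n s
    using ax axt[of n] that unfolding zv by (auto simp: adm_def z_def)
  have \<rho>b: "norm (\<rho> n s) \<le> \<bar>t n\<bar> * (Lc * (Q + B)\<^sup>2)" if s: "s \<in> {0..T}" for n s
  proof -
    have "\<rho> n s = (1 / t n) *\<^sub>R (F (z s + t n *\<^sub>R v n s) - F (z s) - F1 (z s) (t n *\<^sub>R v n s))"
      using t(2)[of n] by (simp add: \<rho>_def linear_scale[OF C2_lin1[OF F]] scaleR_diff_right)
    then have "norm (\<rho> n s) = (1 / \<bar>t n\<bar>) * norm (F (z s + t n *\<^sub>R v n s) - F (z s) - F1 (z s) (t n *\<^sub>R v n s))" by simp
    also have "\<dots> \<le> (1 / \<bar>t n\<bar>) * (Lc * (norm (t n *\<^sub>R v n s))\<^sup>2)"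
      using Lc(3)[OF zK[OF s] zvK[OF s, of n]] by (intro mult_left_mono) auto
    also have "\<dots> = \<bar>t n\<bar> * (Lc * (norm (v n s))\<^sup>2)"
    proof -
      have "(norm (t n *\<^sub>R v n s))\<^sup>2 = \<bar>t n\<bar> * (\<bar>t n\<bar> * (norm (v n s))\<^sup>2)" by (simp add: power2_eq_square)
      then show ?thesis using t(2)[of n] by simp
    qed
    also have "\<dots> \<le> \<bar>t n\<bar> * (Lc * (Q + B)\<^sup>2)"
      using vb[OF s, of n] Lc(1) by (intro mult_left_mono power_mono) auto
    finally show ?thesis .
  qed
  have qc: "continuous_on {0..T} (q n)" for n
    unfolding q_def using ax axt[of n] by (intro continuous_intros) (auto simp: adm_def)
  have \<rho>m: "\<rho> n \<in> borel_measurable (leb T)" for n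
  proof -
    have "(\<lambda>s. F (z s + t n *\<^sub>R v n s)) \<in> borel_measurable (leb T)" unfolding zv
      by (rule adm_measurable(1)[OF axt borel_measurable_const borel_measurable_const])
    moreover have "(\<lambda>s. F (z s)) \<in> borel_measurable (leb T)" unfolding z_def
      by (rule adm_measurable(1)[OF ax borel_measurable_const borel_measurable_const])
    moreover have "(\<lambda>s. F1 (z s) (v n s)) \<in> borel_measurable (leb T)" unfolding z_def v_def
      by (rule adm_measurable(2)[OF ax leb_continuous_measurable[OF qc] km])
    ultimately show ?thesis unfolding \<rho>_def[abs_def] by measurable
  qed
  have \<rho>i: "integrable (leb T) (\<rho> n)" for n by (rule leb_bounded_integrable[OF \<rho>m \<rho>b])
  define r0 where "r0 s = F1 (z s) (0, snd k s)" for s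
  have r0i: "integrable (leb T) r0" unfolding r0_def z_def by (rule Z_rhs_integrable[OF h ki])
  have lq: "lsol (X h) (W h) (fst k) (\<lambda>s. r0 s + \<rho> n s) (q n)" for n
    unfolding lsol_def
  proof (intro conjI ballI qc)
    fix u assume u: "u \<in> {0..T}"
    then have uT: "u \<le> T" by simp
    have i1: "integrable (leb u) (\<lambda>s. F (z s + t n *\<^sub>R v n s))" unfolding zv
      by (rule leb_integrable_mono[OF adm_F_integrable[OF axt] uT])
    have i2: "integrable (leb u) (\<lambda>s. F (z s))" unfolding z_def
      by (rule leb_integrable_mono[OF adm_F_integrable[OF ax] uT])
    have "X (h + t n *\<^sub>R k) u = xh 0 + fst (h + t n *\<^sub>R k) + (LINT s|leb u. F (z s + t n *\<^sub>R v n s))"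
      using X[OF ht[of n]] u unfolding zv by (simp add: traj_def)
    moreover have "X h u = xh 0 + fst h + (LINT s|leb u. F (z s))"
      using X[OF h] u by (simp add: traj_def z_def)
    ultimately have "X (h + t n *\<^sub>R k) u - X h u = t n *\<^sub>R fst k + (LINT s|leb u. F (z s + t n *\<^sub>R v n s) - F (z s))"
      using i1 i2 by simp
    then have "q n u = fst k + (1 / t n) *\<^sub>R (LINT s|leb u. F (z s + t n *\<^sub>R v n s) - F (z s))"
      using t(2)[of n] by (simp add: q_def scaleR_add_right)
    also have "(1 / t n) *\<^sub>R (LINT s|leb u. F (z s + t n *\<^sub>R v n s) - F (z s)) = (LINT s|leb u. (1 / t n) *\<^sub>R (F (z s + t n *\<^sub>R v n s) - F (z s)))"
      by simp
    also have "\<dots> = (LINT s|leb u. F1 (X h s, W h s) (q n s, 0) + (r0 s + \<rho> n s))"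
    proof (intro Bochner_Integration.integral_cong refl)
      fix s
      have "F1 (z s) (v n s) = F1 (z s) (q n s, 0) + r0 s" unfolding v_def r0_def by (rule F1_add)
      then show "(1 / t n) *\<^sub>R (F (z s + t n *\<^sub>R v n s) - F (z s)) = F1 (X h s, W h s) (q n s, 0) + (r0 s + \<rho> n s)"
        by (simp add: \<rho>_def z_def)
    qed
    finally show "q n u = fst k + (LINT s|leb u. F1 (X h s, W h s) (q n s, 0) + (r0 s + \<rho> n s))" .
  qed
  have lZ: "lsol (X h) (W h) (fst k) r0 (Z h k)" unfolding r0_def z_def by (rule Z_lsol[OF h ki])
  have "\<exists>C. \<forall>n. \<bar>t n\<bar> \<le> C"
    using convergent_imp_Bseq[of t] t(1) convergentI[of t] unfolding Bseq_def by auto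
  then obtain C where C: "\<And>n. \<bar>t n\<bar> \<le> C" by blast
  have \<rho>l: "(\<lambda>n. \<rho> n s) \<longlonglongrightarrow> 0" if "s \<in> {0..T}" for s
  proof (rule Lim_null_comparison)
    show "\<forall>\<^sub>F n in sequentially. norm (\<rho> n s) \<le> \<bar>t n\<bar> * (Lc * (Q + B)\<^sup>2)" using \<rho>b[OF that] by simp
    show "(\<lambda>n. \<bar>t n\<bar> * (Lc * (Q + B)\<^sup>2)) \<longlonglongrightarrow> 0"
      using tendsto_mult_left_zero[OF tendsto_rabs_zero[OF t(1)]] .
  qed
  have int\<rho>: "(\<lambda>n. LINT s|leb T. norm (\<rho> n s - 0)) \<longlonglongrightarrow> 0"
  proof (rule leb_dominated[OF \<rho>m borel_measurable_const _ \<rho>l])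
    show "norm (\<rho> n s) \<le> C * (Lc * (Q + B)\<^sup>2)" if "s \<in> {0..T}" for n s
    proof -
      have "\<bar>t n\<bar> * (Lc * (Q + B)\<^sup>2) \<le> C * (Lc * (Q + B)\<^sup>2)" using C Lc(1) by (intro mult_right_mono) auto
      then show ?thesis using \<rho>b[OF that, of n] by linarith
    qed
  qed
  have "\<exists>\<epsilon>. \<epsilon> \<longlonglongrightarrow> 0 \<and> (\<forall>n. \<forall>s\<in>{0..T}. norm (q n s - Z h k s) \<le> \<epsilon> n)"
  proof (rule lsol_converges[OF ax ax _ _ lq lZ tendsto_const])
    show "integrable (leb T) (\<lambda>s. r0 s + \<rho> n s)" for n using r0i \<rho>i by simp
    show "(\<lambda>n. LINT s|leb T. norm (r0 s + \<rho> n s - r0 s)) \<longlonglongrightarrow> 0" using int\<rho> by simp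
  qed (use r0i in auto)
  then have uq: "uconv q (Z h k)" by (simp add: uconv_def)
  note ql = uconv_tendsto[OF uq]
  show "(\<lambda>n. (1 / t n) *\<^sub>R (X (h + t n *\<^sub>R k) s - X h s)) \<longlonglongrightarrow> Z h k s"
    using ql[OF s] by (simp add: q_def)
  define e where "e n s = (1 / t n) *\<^sub>R (q n s - Z h k s)" for n s
  have le: "lsol (X h) (W h) 0 (\<lambda>s. (1 / t n) *\<^sub>R \<rho> n s) (e n)" for n
  proof -
    have "lsol (X h) (W h) ((1 / t n) *\<^sub>R fst k + (- (1 / t n)) *\<^sub>R fst k)
       (\<lambda>s. (1 / t n) *\<^sub>R (r0 s + \<rho> n s) + (- (1 / t n)) *\<^sub>R r0 s) (\<lambda>s. (1 / t n) *\<^sub>R q n s + (- (1 / t n)) *\<^sub>R Z h k s)"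
      by (rule lsol_lincomb[OF ax _ r0i lq lZ]) (use r0i \<rho>i in auto)
    then have "lsol (X h) (W h) 0 (\<lambda>s. (1 / t n) *\<^sub>R (r0 s + \<rho> n s) + (- (1 / t n)) *\<^sub>R r0 s) (\<lambda>s. (1 / t n) *\<^sub>R q n s + (- (1 / t n)) *\<^sub>R Z h k s)"
      by simp
    then show ?thesis by (rule lsol_cong) (auto simp: e_def algebra_simps)
  qed
  define r2 where "r2 s = F2 (X h s, W h s) (Z h k s, snd k s) (Z h k s, snd k s)" for s
  note zc = Z_continuous[OF h ki]
  have r2i: "integrable (leb T) r2" unfolding r2_def by (rule F2_rhs(2)[OF h k zc])
  have r2m: "r2 \<in> borel_measurable (leb T)" using r2i by auto
  have lY: "lsol (X h) (W h) 0 (\<lambda>s. (1/2) *\<^sub>R r2 s) (\<lambda>s. (1/2) *\<^sub>R Y h k s)"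
  proof -
    have Yl: "lsol (X h) (W h) 0 r2 (Y h k)" unfolding r2_def by (rule Y_lsol[OF h k])
    have "lsol (X h) (W h) ((1/2) *\<^sub>R 0 + 0 *\<^sub>R 0) (\<lambda>s. (1/2) *\<^sub>R r2 s + 0 *\<^sub>R r2 s) (\<lambda>s. (1/2) *\<^sub>R Y h k s + 0 *\<^sub>R Y h k s)"
      by (rule lsol_lincomb[OF ax r2i r2i Yl Yl])
    then show ?thesis by simp
  qed
  have lim2: "(\<lambda>n. (1 / t n) *\<^sub>R \<rho> n s) \<longlonglongrightarrow> (1/2) *\<^sub>R r2 s" if s: "s \<in> {0..T}" for s
  proof -
    have "(\<lambda>n. v n s) \<longlonglongrightarrow> (Z h k s, snd k s)" unfolding v_def by (intro tendsto_Pair ql s tendsto_const)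
    from C2_taylor2_tendsto[OF F this t, of "z s"]
    have "(\<lambda>n. (1 / (t n)\<^sup>2) *\<^sub>R (F (z s + t n *\<^sub>R v n s) - F (z s) - t n *\<^sub>R F1 (z s) (v n s))) \<longlonglongrightarrow> (1/2) *\<^sub>R r2 s"
      by (simp add: r2_def z_def)
    moreover have "(1 / (t n)\<^sup>2) *\<^sub>R (F (z s + t n *\<^sub>R v n s) - F (z s) - t n *\<^sub>R F1 (z s) (v n s)) = (1 / t n) *\<^sub>R \<rho> n s" for n
      using t(2)[of n] by (simp add: \<rho>_def scaleR_diff_right power2_eq_square)
    ultimately show ?thesis by simp
  qed
  have "\<exists>\<epsilon>. \<epsilon> \<longlonglongrightarrow> 0 \<and> (\<forall>n. \<forall>s\<in>{0..T}. norm (e n s - (1/2) *\<^sub>R Y h k s) \<le> \<epsilon> n)"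
  proof (rule lsol_converges[OF ax ax _ _ le lY tendsto_const])
    show "integrable (leb T) (\<lambda>s. (1 / t n) *\<^sub>R \<rho> n s)" for n using \<rho>i by simp
    show "integrable (leb T) (\<lambda>s. (1/2) *\<^sub>R r2 s)" using r2i by simp
    show "(\<lambda>n. LINT s|leb T. norm ((1 / t n) *\<^sub>R \<rho> n s - (1/2) *\<^sub>R r2 s)) \<longlonglongrightarrow> 0"
    proof (rule leb_dominated[OF _ _ _ lim2])
      show "(\<lambda>s. (1 / t n) *\<^sub>R \<rho> n s) \<in> borel_measurable (leb T)" for n using \<rho>m[of n] by measurable
      show "(\<lambda>s. (1/2) *\<^sub>R r2 s) \<in> borel_measurable (leb T)" using r2m by measurable
      show "norm ((1 / t n) *\<^sub>R \<rho> n s) \<le> Lc * (Q + B)\<^sup>2" if "s \<in> {0..T}" for n s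
        using \<rho>b[OF that, of n] t(2)[of n] by (simp add: field_simps)
    qed
  qed auto
  then have "uconv e (\<lambda>s. (1/2) *\<^sub>R Y h k s)" by (simp add: uconv_def)
  from uconv_tendsto[OF this s]
  show "(\<lambda>n. (1 / t n) *\<^sub>R ((1 / t n) *\<^sub>R (X (h + t n *\<^sub>R k) s - X h s) - Z h k s)) \<longlonglongrightarrow> (1/2) *\<^sub>R Y h k s"
    by (simp add: e_def q_def)
qed

lemma X_init:
  assumes "small \<rho>0 h"
  shows "X h 0 = xh 0 + fst h"
proof -
  \<comment> \<open>The nonlinear trajectory is read as the solution of a linear equation whose
    source absorbs the difference, so \<open>lsol_init\<close> applies.\<close>
  have "lsol (X h) (W h) (xh 0 + fst h) (\<lambda>s. F (X h s, W h s) - F1 (X h s, W h s) (X h s, 0)) (X h)"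
    using X[OF assms] by (simp add: lsol_def traj_def)
  then show ?thesis by (rule lsol_init)
qed

lemma subspace_Bm: "subspace Bm"
proof (rule subspaceI)
  show "0 \<in> Bm" by (auto simp: Bm_def zero_fun_def)
next
  fix x y assume "x \<in> Bm" "y \<in> Bm"
  then obtain A B where xy: "x \<in> borel_measurable (leb T)" "y \<in> borel_measurable (leb T)"
    "\<And>t. t \<in> {0..T} \<Longrightarrow> norm (x t) \<le> A" "\<And>t. t \<in> {0..T} \<Longrightarrow> norm (y t) \<le> B" unfolding Bm_def by blast
  have "norm ((x + y) t) \<le> A + B" if "t \<in> {0..T}" for t
    using xy(3,4)[OF that] norm_triangle_ineq[of "x t" "y t"] by simp
  moreover have "x + y \<in> borel_measurable (leb T)" unfolding plus_fun_def using xy by measurable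
  ultimately show "x + y \<in> Bm" unfolding Bm_def by blast
next
  fix c x assume "x \<in> Bm"
  then obtain A where x: "x \<in> borel_measurable (leb T)"
    "\<And>t. t \<in> {0..T} \<Longrightarrow> norm (x t) \<le> A" unfolding Bm_def by blast
  have "norm ((c *\<^sub>R x) t) \<le> \<bar>c\<bar> * A" if "t \<in> {0..T}" for t
    using x(2)[OF that] by (simp add: mult_left_mono)
  moreover have "c *\<^sub>R x \<in> borel_measurable (leb T)" unfolding scaleR_fun_def using x by measurable
  ultimately show "c *\<^sub>R x \<in> Bm" unfolding Bm_def by blast
qed

lemma subspace_Times_UNIV: "subspace (V :: 'c::real_vector set) \<Longrightarrow> subspace ((UNIV :: 'd::real_vector set) \<times> V)"
  by (auto simp: subspace_def zero_prod_def)

lemma comb_bconv: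
  assumes g: "\<And>j. j < N \<Longrightarrow> snd (g j) \<in> Bm" and c: "\<And>j. j < N \<Longrightarrow> (\<lambda>n. c n j) \<longlonglongrightarrow> c0 j"
  shows "bconv (\<lambda>n. comb N g (c n)) (comb N g c0)"
proof -
  have f: "fst (comb N g c) = (\<Sum>j<N. c j *\<^sub>R fst (g j))" and s: "snd (comb N g c) u = (\<Sum>j<N. c j *\<^sub>R snd (g j) u)" for c u
    by (simp_all add: comb_def fst_sum snd_sum sum_fun_apply)
  have sm: "snd (comb N g c) \<in> borel_measurable (leb T)" for c
  proof -
    have "(\<lambda>u. \<Sum>j<N. c j *\<^sub>R snd (g j) u) \<in> borel_measurable (leb T)"
      using g by (intro borel_measurable_sum borel_measurable_scaleR) (auto simp: Bm_def)
    then show ?thesis unfolding s[symmetric] by simp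
  qed
  have "\<forall>j. \<exists>B. j < N \<longrightarrow> (\<forall>u\<in>{0..T}. norm (snd (g j) u) \<le> B)" using g unfolding Bm_def by blast
  then obtain B where B: "\<And>j u. j < N \<Longrightarrow> u \<in> {0..T} \<Longrightarrow> norm (snd (g j) u) \<le> B j" by metis
  have "\<forall>j. \<exists>C. j < N \<longrightarrow> (\<forall>n. \<bar>c n j\<bar> \<le> C)"
  proof
    fix j show "\<exists>C. j < N \<longrightarrow> (\<forall>n. \<bar>c n j\<bar> \<le> C)"
    proof (cases "j < N")
      case True
      then have "Bseq (\<lambda>n. c n j)" using c[OF True] convergentI convergent_imp_Bseq by blast
      then show ?thesis unfolding Bseq_def by auto
    qed auto
  qed
  then obtain C where C: "\<And>j n. j < N \<Longrightarrow> \<bar>c n j\<bar> \<le> C j" by metis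
  have "norm (snd (comb N g (c n)) u) \<le> (\<Sum>j<N. C j * B j)" if u: "u \<in> {0..T}" for n u
    unfolding s
  proof (rule sum_norm_le)
    fix j assume "j \<in> {..<N}"
    then have j: "j < N" by simp
    have "0 \<le> C j" using C[OF j, of 0] by linarith
    then show "norm (c n j *\<^sub>R snd (g j) u) \<le> C j * B j"
      unfolding norm_scaleR using C[OF j, of n] B[OF j u] by (intro mult_mono) auto
  qed
  moreover have "(\<lambda>n. fst (comb N g (c n))) \<longlonglongrightarrow> fst (comb N g c0)"
    unfolding f by (intro tendsto_sum tendsto_scaleR tendsto_const c) auto
  moreover have "(\<lambda>n. snd (comb N g (c n)) u) \<longlonglongrightarrow> snd (comb N g c0) u" for u
    unfolding s by (intro tendsto_sum tendsto_scaleR tendsto_const c) auto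
  ultimately show ?thesis unfolding bconv_def using sm by blast
qed

lemma comb_small:
  assumes g: "\<And>j. j < N \<Longrightarrow> snd (g j) \<in> Bm" and \<epsilon>: "0 < \<epsilon>"
  shows "\<exists>\<rho>>0. \<forall>c\<in>nbox N \<rho>. small \<epsilon> (comb N g c)"
proof -
  have f: "fst (comb N g c) = (\<Sum>j<N. c j *\<^sub>R fst (g j))" and s: "snd (comb N g c) u = (\<Sum>j<N. c j *\<^sub>R snd (g j) u)" for c u
    by (simp_all add: comb_def fst_sum snd_sum sum_fun_apply)
  have sm: "snd (comb N g c) \<in> borel_measurable (leb T)" for c
  proof -
    have "bconv (\<lambda>n. comb N g c) (comb N g c)" by (rule comb_bconv[OF g tendsto_const])
    then show ?thesis by (simp add: bconv_def)
  qed
  have "\<forall>j. \<exists>B. j < N \<longrightarrow> (\<forall>u\<in>{0..T}. norm (snd (g j) u) \<le> B)" using g unfolding Bm_def by blast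
  then obtain B0 where B0: "\<And>j u. j < N \<Longrightarrow> u \<in> {0..T} \<Longrightarrow> norm (snd (g j) u) \<le> B0 j" by metis
  define B where "B j = max 0 (B0 j) + norm (fst (g j))" for j
  have B: "norm (snd (g j) u) \<le> B j" if "j < N" "u \<in> {0..T}" for j u
    using B0[OF that] norm_ge_zero[of "fst (g j)"] max.cobounded2[of "B0 j" 0] unfolding B_def by linarith
  have Bf: "norm (fst (g j)) \<le> B j" "0 \<le> B j" for j by (auto simp: B_def)
  define S where "S = (\<Sum>j<N. B j) + 1"
  have S: "S > 0" unfolding S_def using Bf(2) by (intro add_nonneg_pos sum_nonneg) auto
  define \<rho> where "\<rho> = \<epsilon> / S"
  have \<rho>: "\<rho> > 0" using S \<epsilon> by (simp add: \<rho>_def)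
  have le: "(\<Sum>j<N. \<rho> * B j) \<le> \<epsilon>"
  proof -
    have "(\<Sum>j<N. \<rho> * B j) = \<rho> * (S - 1)" by (simp add: S_def sum_distrib_left)
    also have "\<dots> \<le> \<rho> * S" using \<rho> by simp
    finally show ?thesis using S by (simp add: \<rho>_def)
  qed
  have "small \<epsilon> (comb N g c)" if c: "c \<in> nbox N \<rho>" for c
    unfolding small_def
  proof (intro conjI ballI sm)
    have "norm (fst (comb N g c)) \<le> (\<Sum>j<N. \<rho> * B j)"
      unfolding f
    proof (rule sum_norm_le)
      fix j assume "j \<in> {..<N}"
      then show "norm (c j *\<^sub>R fst (g j)) \<le> \<rho> * B j"
        unfolding norm_scaleR using c \<rho> Bf(1)[of j] by (intro mult_mono) (auto simp: nbox_def)
    qed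
    then show "norm (fst (comb N g c)) \<le> \<epsilon>" using le by linarith
    fix u assume u: "u \<in> {0..T}"
    have "norm (snd (comb N g c) u) \<le> (\<Sum>j<N. \<rho> * B j)"
      unfolding s
    proof (rule sum_norm_le)
      fix j assume "j \<in> {..<N}"
      then show "norm (c j *\<^sub>R snd (g j) u) \<le> \<rho> * B j"
        unfolding norm_scaleR using c \<rho> B[of j u] u by (intro mult_mono) (auto simp: nbox_def)
    qed
    then show "norm (snd (comb N g c) u) \<le> \<epsilon>" using le by linarith
  qed
  then show ?thesis using \<rho> by blast
qed

lemma small_mono: "small r h \<Longrightarrow> r \<le> r' \<Longrightarrow> small r' h"
  unfolding small_def by force

end

text \<open>All endpoint functions are normalized to vanish at the reference, so
  \<open>minimal\<close> excludes small perturbations with strictly lower cost that respect the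
  constraints. Smallness is measured on the initial value and the control, the free data of a
  trajectory.\<close>

locale endpoint_problem = control_system T F F1 F2 xh wh
  for T :: real and F :: "'a::euclidean_space \<times> 'w::euclidean_space \<Rightarrow> 'a" and F1 F2
    and xh :: "real \<Rightarrow> 'a" and wh :: "real \<Rightarrow> 'w" +
  fixes g :: "nat \<Rightarrow> 'a \<times> 'a \<Rightarrow> real" and g1 g2 and q K :: nat
  assumes g: "\<And>i. i < K \<Longrightarrow> C2fun (g i) (g1 i) (g2 i)" and q: "0 < q" "q \<le> K"
    and g0: "\<And>i. i < K \<Longrightarrow> g i (xh 0, xh T) = 0"
    and minimal: "\<exists>\<epsilon>>0. \<forall>h. small \<epsilon> h \<and> small \<rho>0 h \<longrightarrow>
      \<not> (g 0 (X h 0, X h T) < 0 \<and> (\<forall>i<q. g i (X h 0, X h T) \<le> 0) \<and> (\<forall>i. q \<le> i \<and> i < K \<longrightarrow> g i (X h 0, X h T) = 0))"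
begin

definition G :: "'a \<times> (real \<Rightarrow> 'w) \<Rightarrow> nat \<Rightarrow> real"
  where "G h i = g i (X h 0, X h T)"

definition D1 :: "'a \<times> (real \<Rightarrow> 'w) \<Rightarrow> 'a \<times> (real \<Rightarrow> 'w) \<Rightarrow> nat \<Rightarrow> real"
  where "D1 h k i = g1 i (X h 0, X h T) (fst k, Z h k T)"

text \<open>Second derivative of t \<mapsto> G (h + t k) at 0 by the chain rule. \<open>Y\<close>
  carries the curvature of the terminal state; the initial state is affine in t, whence the 0 next
  to it.\<close>

definition D2 :: "'a \<times> (real \<Rightarrow> 'w) \<Rightarrow> 'a \<times> (real \<Rightarrow> 'w) \<Rightarrow> nat \<Rightarrow> real"
  where "D2 h k i = g2 i (X h 0, X h T) (fst k, Z h k T) (fst k, Z h k T) + g1 i (X h 0, X h T) (0, Y h k T)"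

lemma G_taylor:
  assumes i: "i < K" and h: "small \<rho>0 h" and k: "snd k \<in> Bm" and t: "t \<longlonglongrightarrow> 0" "\<And>n::nat. t n \<noteq> 0"
    and ht: "\<And>n. small \<rho>0 (h + t n *\<^sub>R k)"
  shows "(\<lambda>n. (G (h + t n *\<^sub>R k) i - G h i - t n * D1 h k i) / (t n)\<^sup>2) \<longlonglongrightarrow> D2 h k i / 2"
proof -
  let ?p = "(X h 0, X h T)"
  have TT: "T \<in> {0..T}" using T by simp
  define qq where "qq n = (1 / t n) *\<^sub>R (X (h + t n *\<^sub>R k) T - X h T)" for n
  define e where "e n = (1 / t n) *\<^sub>R (qq n - Z h k T)" for n
  have ql: "qq \<longlonglongrightarrow> Z h k T" unfolding qq_def by (rule difference_quotients(1)[OF h k t ht TT])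
  have el: "e \<longlonglongrightarrow> (1/2) *\<^sub>R Y h k T" unfolding e_def qq_def by (rule difference_quotients(2)[OF h k t ht TT])
  have arg: "(X (h + t n *\<^sub>R k) 0, X (h + t n *\<^sub>R k) T) = ?p + t n *\<^sub>R (fst k, qq n)" for n
    using X_init[OF ht[of n]] X_init[OF h] t(2)[of n] by (simp add: qq_def)
  have vl: "(\<lambda>n. (fst k, qq n)) \<longlonglongrightarrow> (fst k, Z h k T)" by (intro tendsto_Pair tendsto_const ql)
  note lin = C2_lin1[OF g[OF i]]
  have "(\<lambda>n. (1 / (t n)\<^sup>2) *\<^sub>R (g i (?p + t n *\<^sub>R (fst k, qq n)) - g i ?p - t n *\<^sub>R g1 i ?p (fst k, qq n)) + g1 i ?p (0, e n))
    \<longlonglongrightarrow> (1/2) *\<^sub>R g2 i ?p (fst k, Z h k T) (fst k, Z h k T) + g1 i ?p (0, (1/2) *\<^sub>R Y h k T)"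
    by (intro tendsto_add C2_taylor2_tendsto[OF g[OF i] vl t] C2_f1_tendsto[OF g[OF i]] tendsto_Pair tendsto_const el)
  moreover have "(1 / (t n)\<^sup>2) *\<^sub>R (g i (?p + t n *\<^sub>R (fst k, qq n)) - g i ?p - t n *\<^sub>R g1 i ?p (fst k, qq n)) + g1 i ?p (0, e n)
    = (G (h + t n *\<^sub>R k) i - G h i - t n * D1 h k i) / (t n)\<^sup>2" for n
  proof -
    \<comment> \<open>Splitting Z off the quotient leaves t n times a convergent sequence, which
      moves into the second-order term.\<close>
    have "(fst k, qq n) = (fst k, Z h k T) + t n *\<^sub>R (0, e n)" using t(2)[of n] by (simp add: e_def)
    then have "g1 i ?p (fst k, qq n) = D1 h k i + t n * g1 i ?p (0, e n)"
      unfolding D1_def by (simp only: linear_add[OF lin] linear_scale[OF lin] real_scaleR_def)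
    then show ?thesis unfolding G_def arg using t(2)[of n] by (simp add: field_simps power2_eq_square)
  qed
  moreover have "g1 i ?p (0, (1/2) *\<^sub>R Y h k T) = g1 i ?p (0, Y h k T) / 2"
    using linear_scale[OF lin, of ?p "1/2" "(0, Y h k T)"] by simp
  ultimately show ?thesis by (simp add: D2_def add_divide_distrib)
qed

text \<open>Restriction to the span of finitely many directions with bounded controls. The box is so
  small that every combination lies both in the range of \<open>minimal\<close> and below
  \<rho>0.\<close>

lemma expansion_comb:
  assumes N: "0 < N" and gen: "\<And>j. j < N \<Longrightarrow> snd (gen j) \<in> Bm"
    and crit: "\<And>i. i < q \<Longrightarrow> D1 0 (gen 0) i \<le> 0" "\<And>i. q \<le> i \<Longrightarrow> i < K \<Longrightarrow> D1 0 (gen 0) i = 0"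
  shows "\<exists>\<rho>. expansion N K q \<rho> (\<lambda>c. G (comb N gen c)) (\<lambda>c \<xi>. D1 (comb N gen c) (comb N gen \<xi>)) (\<lambda>c \<xi>. D2 (comb N gen c) (comb N gen \<xi>))"
proof -
  obtain \<epsilon> where \<epsilon>: "\<epsilon> > 0" "\<And>h. small \<epsilon> h \<Longrightarrow> small \<rho>0 h \<Longrightarrow>
      \<not> (g 0 (X h 0, X h T) < 0 \<and> (\<forall>i<q. g i (X h 0, X h T) \<le> 0) \<and> (\<forall>i. q \<le> i \<and> i < K \<longrightarrow> g i (X h 0, X h T) = 0))"
    using minimal by blast
  have "\<exists>\<rho>>0. \<forall>c\<in>nbox N \<rho>. small (min \<epsilon> \<rho>0) (comb N gen c)"
    by (rule comb_small[OF gen]) (use \<epsilon>(1) \<rho>0(1) in auto)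
  then obtain \<rho> where \<rho>: "\<rho> > 0" "\<And>c. c \<in> nbox N \<rho> \<Longrightarrow> small (min \<epsilon> \<rho>0) (comb N gen c)" by blast
  have sm: "small \<rho>0 (comb N gen c)" and sm\<epsilon>: "small \<epsilon> (comb N gen c)" if "c \<in> nbox N \<rho>" for c
    using small_mono[OF \<rho>(2)[OF that]] by auto
  interpret C: linear "comb N gen" by (rule linear_comb)
  have BmC: "snd (comb N gen c) \<in> Bm" for c
    using bconv_Bm(2)[OF comb_bconv[OF gen tendsto_const]] .
  have TT: "T \<in> {0..T}" "0 \<in> {0..T}" using T by auto
  have D1conv: "(\<lambda>n. D1 (comb N gen (c n)) (comb N gen (\<xi> n)) i) \<longlonglongrightarrow> D1 (comb N gen c0) (comb N gen \<xi>0) i"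
    and D2conv: "(\<lambda>n. D2 (comb N gen (c n)) (comb N gen (\<xi> n)) i) \<longlonglongrightarrow> D2 (comb N gen c0) (comb N gen \<xi>0) i"
    and Gconv: "(\<lambda>n. G (comb N gen (c n)) i) \<longlonglongrightarrow> G (comb N gen c0) i"
    if i: "i < K" and c: "\<And>n. c n \<in> nbox N \<rho>" "c0 \<in> nbox N \<rho>" "\<And>j. j < N \<Longrightarrow> (\<lambda>n. c n j) \<longlonglongrightarrow> c0 j"
      and xi: "\<And>j. j < N \<Longrightarrow> (\<lambda>n. \<xi> n j) \<longlonglongrightarrow> \<xi>0 j" for c c0 \<xi> \<xi>0 i
  proof -
    note b1 = comb_bconv[OF gen c(3)] and b2 = comb_bconv[OF gen xi]
    note Xl = uconv_tendsto[OF X_converges[OF sm[OF c(1)] sm[OF c(2)] b1]]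
    note Zl = uconv_tendsto[OF Z_converges[OF sm[OF c(1)] sm[OF c(2)] b1 b2]]
    note Yl = uconv_tendsto[OF Y_converges[OF sm[OF c(1)] sm[OF c(2)] b1 b2]]
    have fl: "(\<lambda>n. fst (comb N gen (\<xi> n))) \<longlonglongrightarrow> fst (comb N gen \<xi>0)" using b2 by (simp add: bconv_def)
    show "(\<lambda>n. D1 (comb N gen (c n)) (comb N gen (\<xi> n)) i) \<longlonglongrightarrow> D1 (comb N gen c0) (comb N gen \<xi>0) i"
      unfolding D1_def by (intro C2_f1_tendsto[OF g[OF i]] tendsto_Pair Xl TT Zl fl)
    show "(\<lambda>n. D2 (comb N gen (c n)) (comb N gen (\<xi> n)) i) \<longlonglongrightarrow> D2 (comb N gen c0) (comb N gen \<xi>0) i"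
      unfolding D2_def by (intro tendsto_add C2_f2_tendsto[OF g[OF i]] C2_f1_tendsto[OF g[OF i]] tendsto_Pair tendsto_const Xl TT Zl fl Yl)
    have "isCont (g i) (X (comb N gen c0) 0, X (comb N gen c0) T)"
      using has_derivative_continuous[OF C2_d1[OF g[OF i]]] by blast
    then show "(\<lambda>n. G (comb N gen (c n)) i) \<longlonglongrightarrow> G (comb N gen c0) i"
      unfolding G_def by (rule isCont_tendsto_compose) (intro tendsto_Pair Xl TT)
  qed
  have zin: "0 \<in> nbox N \<rho>" using \<rho> by (simp add: nbox_def)
  have "expansion N K q \<rho> (\<lambda>c. G (comb N gen c)) (\<lambda>c \<xi>. D1 (comb N gen c) (comb N gen \<xi>)) (\<lambda>c \<xi>. D2 (comb N gen c) (comb N gen \<xi>))"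
  proof (rule expansion.intro)
    show "0 < q" "q \<le> K" "0 < N" "0 < \<rho>" using q N \<rho> by auto
    show "continuous_on (nbox N \<rho>) (\<lambda>c. G (comb N gen c) i)" if "i < K" for i
      unfolding continuous_on_sequentially
    proof (intro allI ballI impI, elim conjE)
      fix x a assume a: "a \<in> nbox N \<rho>" and x: "\<forall>n. x n \<in> nbox N \<rho>" "x \<longlonglongrightarrow> a"
      then show "((\<lambda>c. G (comb N gen c) i) \<circ> x) \<longlonglongrightarrow> G (comb N gen a) i"
        unfolding o_def using Gconv[OF that, of x a "\<lambda>_. 0" 0] tendsto_coord[OF x(2)] by simp
    qed
    show "linear (\<lambda>\<xi>. D1 (comb N gen c) (comb N gen \<xi>) i)" if i: "i < K" and c: "c \<in> nbox N \<rho>" for c i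
    proof -
      have comb: "D1 (comb N gen c) (comb N gen (a *\<^sub>R x + d *\<^sub>R y)) i = a * D1 (comb N gen c) (comb N gen x) i + d * D1 (comb N gen c) (comb N gen y) i" for a d x y
      proof -
        have "Z (comb N gen c) (comb N gen (a *\<^sub>R x + d *\<^sub>R y)) T = a *\<^sub>R Z (comb N gen c) (comb N gen x) T + d *\<^sub>R Z (comb N gen c) (comb N gen y) T"
          unfolding C.add C.scale by (rule Z_lincomb[OF sm[OF c] Bm_integrable[OF BmC] Bm_integrable[OF BmC] TT(1)])
        then have "(fst (comb N gen (a *\<^sub>R x + d *\<^sub>R y)), Z (comb N gen c) (comb N gen (a *\<^sub>R x + d *\<^sub>R y)) T)
          = a *\<^sub>R (fst (comb N gen x), Z (comb N gen c) (comb N gen x) T) + d *\<^sub>R (fst (comb N gen y), Z (comb N gen c) (comb N gen y) T)"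
          by (simp add: C.add C.scale)
        then show ?thesis unfolding D1_def by (simp only: linear_add[OF C2_lin1[OF g[OF i]]] linear_scale[OF C2_lin1[OF g[OF i]]] real_scaleR_def)
      qed
      show ?thesis
      proof (rule linearI)
        show "D1 (comb N gen c) (comb N gen (x + y)) i = D1 (comb N gen c) (comb N gen x) i + D1 (comb N gen c) (comb N gen y) i" for x y
          using comb[of 1 x 1 y] by simp
        show "D1 (comb N gen c) (comb N gen (a *\<^sub>R x)) i = a *\<^sub>R D1 (comb N gen c) (comb N gen x) i" for a x
          using comb[of a x 0 0] by simp
      qed
    qed
    show "(\<lambda>n. (G (comb N gen (c + t n *\<^sub>R \<xi>)) i - G (comb N gen c) i - t n * D1 (comb N gen c) (comb N gen \<xi>) i) / (t n)\<^sup>2)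
      \<longlonglongrightarrow> D2 (comb N gen c) (comb N gen \<xi>) i / 2"
      if "i < K" "c \<in> nbox N \<rho>" "\<xi> \<in> vsupp N" "t \<longlonglongrightarrow> 0" "\<And>n. t n \<noteq> 0" "\<And>n. c + t n *\<^sub>R \<xi> \<in> nbox N \<rho>" for c \<xi> i t
      unfolding C.add C.scale
      by (rule G_taylor[OF that(1) sm[OF that(2)] BmC that(4,5)]) (use sm[OF that(6)] in \<open>simp add: C.add C.scale\<close>)
    show "(\<lambda>n. D1 (comb N gen (c n)) (comb N gen \<xi>) i) \<longlonglongrightarrow> D1 (comb N gen 0) (comb N gen \<xi>) i"
      if "i < K" "\<And>n. c n \<in> nbox N \<rho>" "\<And>j. (\<lambda>n. c n j) \<longlonglongrightarrow> 0" for c \<xi> i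
      by (rule D1conv[OF that(1,2) zin]) (use that(3) in auto)
    show "(\<lambda>n. D2 (comb N gen (c n)) (comb N gen (\<xi> n)) i) \<longlonglongrightarrow> D2 (comb N gen 0) (comb N gen \<xi>') i"
      if "i < K" "\<And>n. c n \<in> nbox N \<rho>" "\<And>j. (\<lambda>n. c n j) \<longlonglongrightarrow> 0" "\<And>j. (\<lambda>n. \<xi> n j) \<longlonglongrightarrow> \<xi>' j" for c \<xi> \<xi>' i
      by (rule D2conv[OF that(1,2) zin]) (use that(3,4) in auto)
    show "G (comb N gen 0) i = 0" if "i < K" for i
      using g0[OF that] X_0 TT by (simp add: G_def C.zero)
    show "D1 (comb N gen 0) (comb N gen (unit_seq 0)) i \<le> 0" if "i < q" for i
      using crit(1)[OF that] by (simp add: C.zero comb_unit_seq[OF N])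
    show "D1 (comb N gen 0) (comb N gen (unit_seq 0)) i = 0" if "q \<le> i" "i < K" for i
      using crit(2)[OF that] by (simp add: C.zero comb_unit_seq[OF N])
    show False if "c \<in> nbox N \<rho>" "G (comb N gen c) 0 < 0" "\<And>i. i < q \<Longrightarrow> G (comb N gen c) i \<le> 0"
      "\<And>i. q \<le> i \<Longrightarrow> i < K \<Longrightarrow> G (comb N gen c) i = 0" for c
      using \<epsilon>(2)[OF sm\<epsilon>[OF that(1)] sm[OF that(1)]] that(2-4) unfolding G_def by blast
  qed
  then show ?thesis by blast
qed

end

section \<open>Adjoint equation and second variation\<close>

lemma L2_add:
  fixes x y :: "real \<Rightarrow> 'a::euclidean_space"
  assumes "x \<in> L2 T" "y \<in> L2 T"
  shows "(\<lambda>t. x t + y t) \<in> L2 T"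
proof -
  have m: "x \<in> borel_measurable (leb T)" "y \<in> borel_measurable (leb T)"
    and i: "integrable (leb T) (\<lambda>t. (norm (x t))\<^sup>2)" "integrable (leb T) (\<lambda>t. (norm (y t))\<^sup>2)"
    using assms by (auto simp: L2_def)
  have "integrable (leb T) (\<lambda>t. (norm (x t + y t))\<^sup>2)"
  proof (rule Bochner_Integration.integrable_bound)
    show "integrable (leb T) (\<lambda>t. 2 * (norm (x t))\<^sup>2 + 2 * (norm (y t))\<^sup>2)" using i by simp
    show "(\<lambda>t. (norm (x t + y t))\<^sup>2) \<in> borel_measurable (leb T)" using m by measurable
    show "AE t in leb T. norm ((norm (x t + y t))\<^sup>2) \<le> norm (2 * (norm (x t))\<^sup>2 + 2 * (norm (y t))\<^sup>2)"
    proof (rule AE_I2)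
      fix t
      have "(norm (x t + y t))\<^sup>2 \<le> (norm (x t) + norm (y t))\<^sup>2" by (intro power_mono norm_triangle_ineq) auto
      also have "\<dots> \<le> 2 * (norm (x t))\<^sup>2 + 2 * (norm (y t))\<^sup>2"
        using sum_squares_bound[of "norm (x t)" "norm (y t)"] by (simp add: power2_sum)
      finally show "norm ((norm (x t + y t))\<^sup>2) \<le> norm (2 * (norm (x t))\<^sup>2 + 2 * (norm (y t))\<^sup>2)" by simp
    qed
  qed
  moreover have "(\<lambda>t. x t + y t) \<in> borel_measurable (leb T)" using m by measurable
  ultimately show ?thesis by (simp add: L2_def)
qed

lemma L2_scale:
  fixes x :: "real \<Rightarrow> 'a::euclidean_space"
  assumes "x \<in> L2 T"
  shows "(\<lambda>t. c *\<^sub>R x t) \<in> L2 T"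
proof -
  have "(\<lambda>t. c *\<^sub>R x t) \<in> borel_measurable (leb T)" using assms by (auto simp: L2_def)
  moreover have "integrable (leb T) (\<lambda>t. c\<^sup>2 * (norm (x t))\<^sup>2)" using assms by (simp add: L2_def)
  ultimately show ?thesis by (simp add: L2_def power_mult_distrib)
qed

lemma subspace_L2: "subspace (L2 T :: (real \<Rightarrow> 'a::euclidean_space) set)"
proof (rule subspaceI)
  show "(0 :: real \<Rightarrow> 'a) \<in> L2 T" by (simp add: L2_def zero_fun_def)
  show "x + y \<in> L2 T" if "x \<in> L2 T" "y \<in> L2 T" for x y :: "real \<Rightarrow> 'a"
    using L2_add[OF that] by (simp add: plus_fun_def)
  show "c *\<^sub>R x \<in> L2 T" if "x \<in> L2 T" for c and x :: "real \<Rightarrow> 'a"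
    using L2_scale[OF that] by (simp add: scaleR_fun_def)
qed

lemma L2_measurable: "x \<in> L2 T \<Longrightarrow> x \<in> borel_measurable (leb T)"
  by (simp add: L2_def)

lemma L2_norm_mult_integrable:
  fixes x :: "real \<Rightarrow> 'a::euclidean_space" and y :: "real \<Rightarrow> 'b::euclidean_space"
  assumes "x \<in> L2 T" "y \<in> L2 T"
  shows "integrable (leb T) (\<lambda>t. norm (x t) * norm (y t))"
proof (rule Bochner_Integration.integrable_bound)
  show "integrable (leb T) (\<lambda>t. (norm (x t))\<^sup>2 + (norm (y t))\<^sup>2)" using assms by (simp add: L2_def)
  show "(\<lambda>t. norm (x t) * norm (y t)) \<in> borel_measurable (leb T)" using assms[THEN L2_measurable] by measurable
  show "AE t in leb T. norm (norm (x t) * norm (y t)) \<le> norm ((norm (x t))\<^sup>2 + (norm (y t))\<^sup>2)"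
  proof (rule AE_I2)
    fix t
    have "0 \<le> norm (x t) * norm (y t)" by simp
    then have "norm (x t) * norm (y t) \<le> (norm (x t))\<^sup>2 + (norm (y t))\<^sup>2"
      using sum_squares_bound[of "norm (x t)" "norm (y t)"] by linarith
    then show "norm (norm (x t) * norm (y t)) \<le> norm ((norm (x t))\<^sup>2 + (norm (y t))\<^sup>2)" by simp
  qed
qed

lemma const_L2: "(\<lambda>_. c) \<in> L2 T"
  unfolding L2_def by (auto intro!: leb_continuous_integrable continuous_intros)

lemma L2_norm_integrable:
  fixes x :: "real \<Rightarrow> 'a::euclidean_space"
  assumes "x \<in> L2 T"
  shows "integrable (leb T) (\<lambda>t. norm (x t))"
  using L2_norm_mult_integrable[OF assms const_L2[of "1::real" T]] by simp

lemma L2_integrable: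
  fixes x :: "real \<Rightarrow> 'a::euclidean_space"
  assumes "x \<in> L2 T"
  shows "integrable (leb T) x"
  using L2_norm_integrable[OF assms] L2_measurable[OF assms] by (simp add: integrable_norm_iff)

lemma continuous_on_Icc_bounded:
  fixes f :: "real \<Rightarrow> 'a::euclidean_space"
  assumes "continuous_on {0..T} f"
  obtains B where "0 \<le> B" "\<And>s. s \<in> {0..T} \<Longrightarrow> norm (f s) \<le> B"
proof -
  obtain B where "B > 0" "\<forall>x\<in>f ` {0..T}. norm x \<le> B"
    using compact_imp_bounded[OF compact_continuous_image[OF assms compact_Icc]] unfolding bounded_pos by blast
  then show ?thesis using that[of B] by auto
qed

section \<open>The adjoint equation and duality\<close>

context control_system
begin

lemma small_0: "small \<rho>0 0" using zero_small \<rho>0(1) by simp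

lemma adm_0: "adm (X 0) (W 0)" by (rule X_adm[OF small_0])

text \<open>The transpose of the state derivative of F along the reference, applied to y; row
  vectors are represented as ordinary vectors.\<close>

definition Adj :: "real \<Rightarrow> 'a \<Rightarrow> 'a"
  where "Adj s y = (\<Sum>b\<in>Basis. (y \<bullet> F1 (X 0 s, W 0 s) (b, 0)) *\<^sub>R b)"

lemma F1_fst_expand: "F1 p (a, 0) = (\<Sum>b\<in>Basis. (a \<bullet> b) *\<^sub>R F1 p (b, 0))"
proof -
  have l: "linear (\<lambda>a. F1 p (a, 0))"
    by (rule linearI) (use linear_add[OF C2_lin1[OF F], of p "(_, 0)" "(_, 0)"] linear_scale[OF C2_lin1[OF F], of p _ "(_, 0)"] in auto)
  have "F1 p (a, 0) = F1 p (\<Sum>b\<in>Basis. (a \<bullet> b) *\<^sub>R b, 0)" by (simp add: euclidean_representation)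
  then show ?thesis by (simp add: linear_sum[OF l] linear_scale[OF l])
qed

lemma Adj_inner: "Adj s y \<bullet> a = y \<bullet> F1 (X 0 s, W 0 s) (a, 0)"
  unfolding Adj_def F1_fst_expand[of _ a]
  by (simp add: inner_sum_left inner_sum_right inner_commute[of _ a] mult.commute)

lemma Adj_diff: "Adj s y - Adj s y' = Adj s (y - y')"
  by (simp add: Adj_def inner_diff_left scaleR_diff_left sum_subtractf)

lemma Adj_bound: "s \<in> {0..T} \<Longrightarrow> norm (Adj s y) \<le> Lc * norm y"
proof -
  assume s: "s \<in> {0..T}"
  have K: "(X 0 s, W 0 s) \<in> K0" using adm_0 s by (auto simp: adm_def)
  \<comment> \<open>A transpose has the same bound as the map itself: it is tested on its own
    value.\<close>
  have "(norm (Adj s y))\<^sup>2 = y \<bullet> F1 (X 0 s, W 0 s) (Adj s y, 0)"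
    using Adj_inner[of s y "Adj s y"] by (simp add: power2_norm_eq_inner)
  also have "\<dots> \<le> norm y * norm (F1 (X 0 s, W 0 s) (Adj s y, 0))" by (rule norm_cauchy_schwarz)
  also have "\<dots> \<le> norm y * (Lc * norm (Adj s y))"
    using Lc(4)[OF K, of "(Adj s y, 0)"] by (intro mult_left_mono) (auto simp: norm_Pair)
  finally have "norm (Adj s y) * norm (Adj s y) \<le> (Lc * norm y) * norm (Adj s y)" by (simp add: power2_eq_square mult_ac)
  then show ?thesis
  proof (cases "norm (Adj s y) = 0")
    case True
    then show ?thesis using Lc(1) by simp
  next
    case False
    then have "0 < norm (Adj s y)" by simp
    with \<open>norm (Adj s y) * norm (Adj s y) \<le> (Lc * norm y) * norm (Adj s y)\<close> show ?thesis by (rule mult_right_le_imp_le)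
  qed
qed

lemma Adj_integrable:
  assumes "continuous_on {0..T} y"
  shows "integrable (leb T) (\<lambda>s. Adj s (y s))"
proof -
  obtain B where B: "\<And>s. s \<in> {0..T} \<Longrightarrow> norm (y s) \<le> B" using continuous_on_Icc_bounded[OF assms] by blast
  have "(\<lambda>s. y s \<bullet> F1 (X 0 s, W 0 s) (b, 0)) \<in> borel_measurable (leb T)" for b
    by (intro borel_measurable_inner leb_continuous_measurable assms adm_measurable(2)[OF adm_0] borel_measurable_const)
  then have "(\<lambda>s. Adj s (y s)) \<in> borel_measurable (leb T)"
    unfolding Adj_def by (intro borel_measurable_sum borel_measurable_scaleR borel_measurable_const)
  then show ?thesis
  proof (rule leb_bounded_integrable)
    show "norm (Adj s (y s)) \<le> Lc * B" if "s \<in> {0..T}" for s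
      using Adj_bound[OF that, of "y s"] mult_left_mono[OF B[OF that] Lc(1)] by linarith
  qed
qed

definition adjsol :: "(real \<Rightarrow> 'a) \<Rightarrow> bool"
  where "adjsol p \<longleftrightarrow> continuous_on {0..T} p \<and> (\<forall>t\<in>{0..T}. p t = p 0 + (LINT s|leb t. - Adj s (p s)))"

lemma adjsol_init_exists: "\<exists>p. adjsol p \<and> p 0 = p0"
proof -
  have "\<exists>p. continuous_on {0..T} p \<and> (\<forall>t\<in>{0..T}. p t = p0 + (LINT s|leb t. - Adj s (p s)))"
  proof (rule ode_exists[OF T0 Lc(1)])
    show "norm (- Adj t x - - Adj t y) \<le> Lc * norm (x - y)" if "t \<in> {0..T}" for t x y
    proof -
      have "- Adj t x - - Adj t y = Adj t (y - x)" unfolding Adj_diff[symmetric] by simp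
      then show ?thesis using Adj_bound[OF that, of "y - x"] norm_minus_commute[of x y] by simp
    qed
    show "integrable (leb T) (\<lambda>t. - Adj t (y t))" if "continuous_on {0..T} y" for y :: "real \<Rightarrow> 'a"
      using Adj_integrable[OF that] by simp
  qed
  then obtain p where p: "continuous_on {0..T} p" "\<And>t. t \<in> {0..T} \<Longrightarrow> p t = p0 + (LINT s|leb t. - Adj s (p s))" by blast
  have "AE s in lebesgue. s \<noteq> (0::real)"
    unfolding eventually_ae_filter_negligible by (intro exI[of _ "{0}"]) auto
  then have "AE s in lebesgue. s \<in> {0..0} \<longrightarrow> - Adj s (p s) = 0" by eventually_elim auto
  then have "AE s in leb 0. - Adj s (p s) = 0" by (simp add: AE_restrict_space_iff)
  then have "(LINT s|leb 0. - Adj s (p s)) = 0" by (rule integral_eq_zero_AE)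
  then have "p 0 = p0" using p(2)[of 0] T by simp
  then show ?thesis using p unfolding adjsol_def by blast
qed

text \<open>Integration by parts: the transposed terms cancel pointwise, so the terminal value of a
  linear solution is expressed through its initial value and its source.\<close>

lemma adjsol_dual:
  assumes p: "adjsol p" and z: "lsol (X 0) (W 0) \<zeta> r z" and r: "integrable (leb T) r"
  shows "p T \<bullet> z T = p 0 \<bullet> \<zeta> + (LINT s|leb T. p s \<bullet> r s)"
proof -
  have pc: "continuous_on {0..T} p" and zc: "continuous_on {0..T} z" using p z by (auto simp: adjsol_def lsol_def)
  have "p T \<bullet> z T - p 0 \<bullet> z 0 = (LINT s|leb T. - Adj s (p s) \<bullet> z s + p s \<bullet> (F1 (X 0 s, W 0 s) (z s, 0) + r s))"
  proof (rule primitive_product[OF T0])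
    show "integrable (leb T) (\<lambda>s. - Adj s (p s))" using Adj_integrable[OF pc] by simp
    show "integrable (leb T) (\<lambda>s. F1 (X 0 s, W 0 s) (z s, 0) + r s)" by (rule lsol_integrable[OF adm_0 r zc])
    show "\<And>t. t \<in> {0..T} \<Longrightarrow> p t = p 0 + (LINT s|leb t. - Adj s (p s))" using p unfolding adjsol_def by blast
    show "\<And>t. t \<in> {0..T} \<Longrightarrow> z t = \<zeta> + (LINT s|leb t. F1 (X 0 s, W 0 s) (z s, 0) + r s)" using z by (simp add: lsol_def)
  qed
  also have "\<dots> = (LINT s|leb T. p s \<bullet> r s)"
    by (intro Bochner_Integration.integral_cong refl) (simp add: Adj_inner inner_add_right)
  finally show ?thesis using lsol_init[OF z] by simp
qed

text \<open>Only equations with prescribed initial values have been solved. \<Phi> maps an initial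
  state to the terminal state of the homogeneous equation; duality makes it injective, hence
  surjective in finite dimension, and an adjoint started at \<open>adjoint \<Phi> pT\<close> ends at
  \<open>pT\<close>.\<close>

lemma adjsol_exists: "\<exists>p. adjsol p \<and> p T = pT"
proof -
  define \<Phi> where "\<Phi> z0 = Lin (X 0) (W 0) z0 (\<lambda>_. 0) T" for z0
  have l: "lsol (X 0) (W 0) z0 (\<lambda>_. 0) (Lin (X 0) (W 0) z0 (\<lambda>_. 0))" for z0
    by (rule Lin[OF adm_0 integrable_zero])
  have TT: "T \<in> {0..T}" using T by simp
  have comb: "\<Phi> (c *\<^sub>R x + d *\<^sub>R y) = c *\<^sub>R \<Phi> x + d *\<^sub>R \<Phi> y" for c d x y
  proof -
    have "lsol (X 0) (W 0) (c *\<^sub>R x + d *\<^sub>R y) (\<lambda>_. 0) (\<lambda>s. c *\<^sub>R Lin (X 0) (W 0) x (\<lambda>_. 0) s + d *\<^sub>R Lin (X 0) (W 0) y (\<lambda>_. 0) s)"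
      using lsol_lincomb[OF adm_0 integrable_zero integrable_zero l l, of c x d y] by simp
    from lsol_unique[OF adm_0 integrable_zero l this TT] show ?thesis by (simp add: \<Phi>_def)
  qed
  have lin: "linear \<Phi>"
    by (rule linearI) (use comb[of 1 _ 1] comb[of _ _ 0 0] in auto)
  have dual: "p T \<bullet> \<Phi> z0 = p 0 \<bullet> z0" if "adjsol p" for p z0
    using adjsol_dual[OF that l integrable_zero, of z0] by (simp add: \<Phi>_def)
  have "inj \<Phi>"
    unfolding linear_injective_0[OF lin]
  proof (intro allI impI)
    fix z0 assume z: "\<Phi> z0 = 0"
    obtain p where "adjsol p" "p 0 = z0" using adjsol_init_exists by blast
    then have "z0 \<bullet> z0 = 0" using dual[of p z0] z by simp
    then show "z0 = 0" by simp
  qed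
  then have surj: "surj \<Phi>" by (rule linear_inj_imp_surj[OF lin])
  obtain p where p: "adjsol p" "p 0 = adjoint \<Phi> pT" using adjsol_init_exists by blast
  have "(p T - pT) \<bullet> \<Phi> z0 = 0" for z0
    using dual[OF p(1), of z0] p(2) adjoint_clauses(2)[OF lin, of pT z0] by (simp add: inner_diff_left)
  then have "(p T - pT) \<bullet> (p T - pT) = 0" using surj by (metis surjD)
  then have "p T = pT" by simp
  then show ?thesis using p(1) by blast
qed

section \<open>Directions with square integrable controls\<close>

lemma Bm_L2: "Bm \<subseteq> L2 T"
proof
  fix \<omega> assume "\<omega> \<in> Bm"
  then obtain B where w: "\<omega> \<in> borel_measurable (leb T)" "\<And>t. t \<in> {0..T} \<Longrightarrow> norm (\<omega> t) \<le> B" unfolding Bm_def by blast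
  have "integrable (leb T) (\<lambda>t. (norm (\<omega> t))\<^sup>2)"
  proof (rule leb_bounded_integrable)
    show "(\<lambda>t. (norm (\<omega> t))\<^sup>2) \<in> borel_measurable (leb T)" using w(1) by measurable
    show "norm ((norm (\<omega> t))\<^sup>2) \<le> B\<^sup>2" if "t \<in> {0..T}" for t using w(2)[OF that] by (simp add: power_mono)
  qed
  then show "\<omega> \<in> L2 T" using w(1) by (simp add: L2_def)
qed

text \<open>Coordinates for \<open>H2\<close>: an element of it is determined by its initial state
  and its control, the state being \<open>Z 0 h\<close>.\<close>

definition Hs :: "('a \<times> (real \<Rightarrow> 'w)) set" where "Hs = UNIV \<times> L2 T"

lemma subspace_Hs: "subspace Hs"
  unfolding Hs_def by (rule subspace_Times_UNIV[OF subspace_L2])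

lemma Hs_integrable: "h \<in> Hs \<Longrightarrow> integrable (leb T) (snd h)"
  unfolding Hs_def by (auto intro: L2_integrable)

definition ap :: "nat \<Rightarrow> 'a \<times> (real \<Rightarrow> 'w) \<Rightarrow> 'a \<times> (real \<Rightarrow> 'w)"
  where "ap m h = (fst h, \<lambda>t. if norm (snd h t) \<le> real m then snd h t else 0)"

text \<open>Dominated pointwise convergence with a common initial state. It covers truncations as
  well as constant sequences, the two cases needed for \<open>apb\<close> and \<open>apb1\<close> of
  \<open>abnormal_problem\<close>.\<close>

definition l2conv :: "(nat \<Rightarrow> 'a \<times> (real \<Rightarrow> 'w)) \<Rightarrow> 'a \<times> (real \<Rightarrow> 'w) \<Rightarrow> bool"
  where "l2conv k h \<longleftrightarrow> h \<in> Hs \<and> (\<forall>n. k n \<in> Hs \<and> fst (k n) = fst h \<and> (\<forall>s. norm (snd (k n) s) \<le> norm (snd h s))) \<and>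
    (\<forall>s. (\<lambda>n. snd (k n) s) \<longlonglongrightarrow> snd h s)"

lemma l2conv_const: "h \<in> Hs \<Longrightarrow> l2conv (\<lambda>_. h) h"
  by (simp add: l2conv_def)

lemma ap_in: "h \<in> Hs \<Longrightarrow> ap m h \<in> UNIV \<times> Bm"
proof -
  assume "h \<in> Hs"
  then have "snd h \<in> borel_measurable (leb T)" by (auto simp: Hs_def L2_def)
  then have "(\<lambda>t. if norm (snd h t) \<le> real m then snd h t else 0) \<in> borel_measurable (leb T)"
    by measurable
  moreover have "\<forall>t\<in>{0..T}. norm (if norm (snd h t) \<le> real m then snd h t else 0) \<le> real m" by simp
  ultimately show ?thesis unfolding ap_def Bm_def by auto
qed

lemma l2conv_ap:
  assumes h: "h \<in> Hs"
  shows "l2conv (\<lambda>m. ap m h) h"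
proof -
  have "ap m h \<in> Hs" for m using ap_in[OF h, of m] Bm_L2 by (auto simp: Hs_def)
  moreover have "(\<lambda>m. snd (ap m h) s) \<longlonglongrightarrow> snd h s" for s
  proof (rule tendsto_eventually)
    obtain N :: nat where N: "norm (snd h s) \<le> real N" using real_arch_simple by blast
    show "\<forall>\<^sub>F m in sequentially. snd (ap m h) s = snd h s"
      using eventually_ge_at_top[of N] by eventually_elim (use N in \<open>auto simp: ap_def\<close>)
  qed
  ultimately show ?thesis using h by (auto simp: l2conv_def ap_def)
qed

lemma Z_l2conv:
  assumes k: "l2conv k h"
  shows "uconv (\<lambda>n. Z 0 (k n)) (Z 0 h)"
  unfolding uconv_def
proof (rule lsol_converges[OF adm_0 adm_0 _ _ Z_lsol[OF small_0] Z_lsol[OF small_0] _ Z_rhs_integrable[OF small_0] Z_rhs_integrable[OF small_0]])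
  have H: "h \<in> Hs" "\<And>n. k n \<in> Hs" using k by (auto simp: l2conv_def)
  show i: "integrable (leb T) (snd (k n))" "integrable (leb T) (snd h)" for n using H Hs_integrable by auto
  then show "integrable (leb T) (snd (k n))" "integrable (leb T) (snd h)" for n by auto
  show "(\<lambda>n. fst (k n)) \<longlonglongrightarrow> fst h" using k by (simp add: l2conv_def)
  have "(\<lambda>n. LINT s|leb T. norm (F1 (X 0 s, W 0 s) (0, snd (k n) s) - F1 (X 0 s, W 0 s) (0, snd h s))) \<longlonglongrightarrow> (LINT s|leb T. (0::real))"
  proof (rule integral_dominated_convergence[where w = "\<lambda>s. 2 * (Lc * norm (snd h s))"])
    show "(\<lambda>s. norm (F1 (X 0 s, W 0 s) (0, snd (k n) s) - F1 (X 0 s, W 0 s) (0, snd h s))) \<in> borel_measurable (leb T)" for n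
    proof -
      note [measurable] = borel_measurable_integrable[OF Z_rhs_integrable[OF small_0 i(1)], of n] borel_measurable_integrable[OF Z_rhs_integrable[OF small_0 i(2)]]
      show ?thesis by measurable
    qed
    show "integrable (leb T) (\<lambda>s. 2 * (Lc * norm (snd h s)))" using i(2) by simp
    show "AE s in leb T. (\<lambda>n. norm (F1 (X 0 s, W 0 s) (0, snd (k n) s) - F1 (X 0 s, W 0 s) (0, snd h s))) \<longlonglongrightarrow> 0"
    proof (rule AE_I2)
      fix s
      have "(\<lambda>n. F1 (X 0 s, W 0 s) (0, snd (k n) s)) \<longlonglongrightarrow> F1 (X 0 s, W 0 s) (0, snd h s)"
        using k by (intro C2_f1_tendsto[OF F] tendsto_Pair tendsto_const) (auto simp: l2conv_def)
      from tendsto_norm_zero[OF LIM_zero[OF this]]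
      show "(\<lambda>n. norm (F1 (X 0 s, W 0 s) (0, snd (k n) s) - F1 (X 0 s, W 0 s) (0, snd h s))) \<longlonglongrightarrow> 0" .
    qed
    show "AE s in leb T. norm (norm (F1 (X 0 s, W 0 s) (0, snd (k n) s) - F1 (X 0 s, W 0 s) (0, snd h s))) \<le> 2 * (Lc * norm (snd h s))" for n
    proof (rule AE_I2)
      fix s assume "s \<in> space (leb T)"
      then have K: "(X 0 s, W 0 s) \<in> K0" using adm_0 by (auto simp: adm_def)
      have "norm (F1 (X 0 s, W 0 s) (0, snd (k n) s)) \<le> Lc * norm (snd (k n) s)"
        using Lc(4)[OF K, of "(0, snd (k n) s)"] by (simp add: norm_Pair)
      also have "\<dots> \<le> Lc * norm (snd h s)" using k Lc(1) by (intro mult_left_mono) (auto simp: l2conv_def)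
      finally have "norm (F1 (X 0 s, W 0 s) (0, snd (k n) s)) \<le> Lc * norm (snd h s)" .
      moreover have "norm (F1 (X 0 s, W 0 s) (0, snd h s)) \<le> Lc * norm (snd h s)"
        using Lc(4)[OF K, of "(0, snd h s)"] by (simp add: norm_Pair)
      ultimately show "norm (norm (F1 (X 0 s, W 0 s) (0, snd (k n) s) - F1 (X 0 s, W 0 s) (0, snd h s))) \<le> 2 * (Lc * norm (snd h s))"
        using norm_triangle_ineq4[of "F1 (X 0 s, W 0 s) (0, snd (k n) s)" "F1 (X 0 s, W 0 s) (0, snd h s)"] by simp
    qed
  qed auto
  then show "(\<lambda>n. LINT s|leb T. norm (F1 (X 0 s, W 0 s) (0, snd (k n) s) - F1 (X 0 s, W 0 s) (0, snd h s))) \<longlonglongrightarrow> 0" by simp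
qed auto

lemma F2_two_measurable:
  assumes "h \<in> Hs" "h' \<in> Hs" "continuous_on {0..T} z" "continuous_on {0..T} z'" "continuous_on {0..T} p"
  shows "(\<lambda>s. p s \<bullet> F2 (X 0 s, W 0 s) (z s, snd h s) (z' s, snd h' s)) \<in> borel_measurable (leb T)"
proof -
  have m: "(\<lambda>s. (X 0 s, W 0 s)) \<in> borel_measurable (leb T)"
    using adm_0 unfolding adm_def by (intro borel_measurable_Pair) (auto intro: leb_continuous_measurable)
  have m1: "(\<lambda>s. (z s, snd h s)) \<in> borel_measurable (leb T)" "(\<lambda>s. (z' s, snd h' s)) \<in> borel_measurable (leb T)"
    using assms by (auto simp: Hs_def L2_def intro!: borel_measurable_Pair leb_continuous_measurable[OF assms(3)] leb_continuous_measurable[OF assms(4)])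
  show ?thesis
    by (intro borel_measurable_inner leb_continuous_measurable[OF assms(5)] C2_measurable(3)[OF F m m1])
qed

text \<open>The bound is multiplied out so that each term is integrable in time for square
  integrable controls; only the last one contains a product of two of them.\<close>

lemma F2_two_bound:
  assumes "s \<in> {0..T}" "norm a \<le> A" "norm a' \<le> A'" "norm p \<le> P" "norm w \<le> v" "norm w' \<le> v'"
  shows "\<bar>p \<bullet> F2 (X 0 s, W 0 s) (a, w) (a', w')\<bar> \<le> P * Lc * (A * A' + A * v' + A' * v + v * v')"
proof -
  have K: "(X 0 s, W 0 s) \<in> K0" using adm_0 assms(1) by (auto simp: adm_def)
  have n: "norm (a, w) \<le> A + v" "norm (a', w') \<le> A' + v'"
    using norm_Pair_le[of a w] norm_Pair_le[of a' w'] assms by linarith+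
  have nn: "0 \<le> A + v" "0 \<le> A' + v'" using n norm_ge_zero order_trans by blast+
  have "\<bar>p \<bullet> F2 (X 0 s, W 0 s) (a, w) (a', w')\<bar> \<le> norm p * norm (F2 (X 0 s, W 0 s) (a, w) (a', w'))"
    by (rule Cauchy_Schwarz_ineq2)
  also have "\<dots> \<le> P * (Lc * norm (a, w) * norm (a', w'))"
    using assms(4) order_trans[OF norm_ge_zero assms(4)] by (intro mult_mono Lc(5)[OF K]) auto
  also have "\<dots> \<le> P * (Lc * (A + v) * (A' + v'))"
    using n nn Lc(1) order_trans[OF norm_ge_zero assms(4)] by (intro mult_left_mono mult_mono) auto
  finally show ?thesis by (simp add: algebra_simps)
qed

lemma dom_integrable:
  assumes "h \<in> Hs" "h' \<in> Hs"
  shows "integrable (leb T) (\<lambda>s. P * Lc * (A * A' + A * norm (snd h' s) + A' * norm (snd h s) + norm (snd h s) * norm (snd h' s)))"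
proof -
  have L: "snd h \<in> L2 T" "snd h' \<in> L2 T" using assms by (auto simp: Hs_def)
  have "integrable (leb T) (\<lambda>s. A * A' :: real)" by (intro leb_continuous_integrable continuous_intros)
  then show ?thesis using L2_norm_integrable[OF L(1)] L2_norm_integrable[OF L(2)] L2_norm_mult_integrable[OF L]
    by (intro Bochner_Integration.integrable_mult_right Bochner_Integration.integrable_add) auto
qed

lemma F2_two_integrable:
  assumes h: "h \<in> Hs" "h' \<in> Hs" and z: "continuous_on {0..T} z" "continuous_on {0..T} z'" and p: "continuous_on {0..T} p"
  shows "integrable (leb T) (\<lambda>s. p s \<bullet> F2 (X 0 s, W 0 s) (z s, snd h s) (z' s, snd h' s))"
proof -
  obtain A where A: "\<And>s. s \<in> {0..T} \<Longrightarrow> norm (z s) \<le> A" using continuous_on_Icc_bounded[OF z(1)] by blast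
  obtain A' where A': "\<And>s. s \<in> {0..T} \<Longrightarrow> norm (z' s) \<le> A'" using continuous_on_Icc_bounded[OF z(2)] by blast
  obtain P where P: "\<And>s. s \<in> {0..T} \<Longrightarrow> norm (p s) \<le> P" using continuous_on_Icc_bounded[OF p] by blast
  show ?thesis
  proof (rule Bochner_Integration.integrable_bound[OF dom_integrable[OF h, of P A A'] F2_two_measurable[OF h z p]])
    show "AE s in leb T. norm (p s \<bullet> F2 (X 0 s, W 0 s) (z s, snd h s) (z' s, snd h' s))
      \<le> norm (P * Lc * (A * A' + A * norm (snd h' s) + A' * norm (snd h s) + norm (snd h s) * norm (snd h' s)))"
    proof (rule AE_I2)
      fix s assume "s \<in> space (leb T)"
      then have s: "s \<in> {0..T}" by simp
      have "\<bar>p s \<bullet> F2 (X 0 s, W 0 s) (z s, snd h s) (z' s, snd h' s)\<bar> \<le>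
         P * Lc * (A * A' + A * norm (snd h' s) + A' * norm (snd h s) + norm (snd h s) * norm (snd h' s))"
        by (rule F2_two_bound[OF s A[OF s] A'[OF s] P[OF s]]) auto
      then show "norm (p s \<bullet> F2 (X 0 s, W 0 s) (z s, snd h s) (z' s, snd h' s))
        \<le> norm (P * Lc * (A * A' + A * norm (snd h' s) + A' * norm (snd h s) + norm (snd h s) * norm (snd h' s)))" by simp
    qed
  qed
qed

lemma F2_integral_converges:
  assumes k: "l2conv k h" and k': "l2conv k' h'" and p: "continuous_on {0..T} p"
  shows "(\<lambda>n. LINT s|leb T. p s \<bullet> F2 (X 0 s, W 0 s) (Z 0 (k n) s, snd (k n) s) (Z 0 (k' n) s, snd (k' n) s))
    \<longlonglongrightarrow> (LINT s|leb T. p s \<bullet> F2 (X 0 s, W 0 s) (Z 0 h s, snd h s) (Z 0 h' s, snd h' s))"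
proof -
  have H: "h \<in> Hs" "\<And>n. k n \<in> Hs" "h' \<in> Hs" "\<And>n. k' n \<in> Hs" using k k' by (auto simp: l2conv_def)
  have zc: "continuous_on {0..T} (Z 0 u)" if "u \<in> Hs" for u by (rule Z_continuous[OF small_0 Hs_integrable[OF that]])
  obtain A where A: "\<And>n s. s \<in> {0..T} \<Longrightarrow> norm (Z 0 (k n) s) \<le> A"
    using uconv_bounded[OF Z_l2conv[OF k] zc[OF H(1)]] by blast
  obtain A' where A': "\<And>n s. s \<in> {0..T} \<Longrightarrow> norm (Z 0 (k' n) s) \<le> A'"
    using uconv_bounded[OF Z_l2conv[OF k'] zc[OF H(3)]] by blast
  obtain P where P: "\<And>s. s \<in> {0..T} \<Longrightarrow> norm (p s) \<le> P" using continuous_on_Icc_bounded[OF p] by blast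
  show ?thesis
  proof (rule integral_dominated_convergence[where w = "\<lambda>s. P * Lc * (A * A' + A * norm (snd h' s) + A' * norm (snd h s) + norm (snd h s) * norm (snd h' s))"])
    show "(\<lambda>s. p s \<bullet> F2 (X 0 s, W 0 s) (Z 0 h s, snd h s) (Z 0 h' s, snd h' s)) \<in> borel_measurable (leb T)"
      by (rule F2_two_measurable[OF H(1,3) zc[OF H(1)] zc[OF H(3)] p])
    show "(\<lambda>s. p s \<bullet> F2 (X 0 s, W 0 s) (Z 0 (k n) s, snd (k n) s) (Z 0 (k' n) s, snd (k' n) s)) \<in> borel_measurable (leb T)" for n
      by (rule F2_two_measurable[OF H(2,4) zc[OF H(2)] zc[OF H(4)] p])
    show "integrable (leb T) (\<lambda>s. P * Lc * (A * A' + A * norm (snd h' s) + A' * norm (snd h s) + norm (snd h s) * norm (snd h' s)))"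
      by (rule dom_integrable[OF H(1,3)])
    show "AE s in leb T. (\<lambda>n. p s \<bullet> F2 (X 0 s, W 0 s) (Z 0 (k n) s, snd (k n) s) (Z 0 (k' n) s, snd (k' n) s))
       \<longlonglongrightarrow> p s \<bullet> F2 (X 0 s, W 0 s) (Z 0 h s, snd h s) (Z 0 h' s, snd h' s)"
    proof (rule AE_I2)
      fix s assume "s \<in> space (leb T)"
      then have s: "s \<in> {0..T}" by simp
      have "(\<lambda>n. snd (k n) s) \<longlonglongrightarrow> snd h s" "(\<lambda>n. snd (k' n) s) \<longlonglongrightarrow> snd h' s" using k k' by (auto simp: l2conv_def)
      then show "(\<lambda>n. p s \<bullet> F2 (X 0 s, W 0 s) (Z 0 (k n) s, snd (k n) s) (Z 0 (k' n) s, snd (k' n) s))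
         \<longlonglongrightarrow> p s \<bullet> F2 (X 0 s, W 0 s) (Z 0 h s, snd h s) (Z 0 h' s, snd h' s)"
        by (intro tendsto_inner tendsto_const C2_f2_tendsto[OF F] tendsto_Pair uconv_tendsto[OF Z_l2conv[OF k] s] uconv_tendsto[OF Z_l2conv[OF k'] s])
    qed
    show "AE s in leb T. norm (p s \<bullet> F2 (X 0 s, W 0 s) (Z 0 (k n) s, snd (k n) s) (Z 0 (k' n) s, snd (k' n) s))
      \<le> P * Lc * (A * A' + A * norm (snd h' s) + A' * norm (snd h s) + norm (snd h s) * norm (snd h' s))" for n
    proof (rule AE_I2)
      fix s assume "s \<in> space (leb T)"
      then have s: "s \<in> {0..T}" by simp
      have "norm (snd (k n) s) \<le> norm (snd h s)" "norm (snd (k' n) s) \<le> norm (snd h' s)" using k k' by (auto simp: l2conv_def)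
      then show "norm (p s \<bullet> F2 (X 0 s, W 0 s) (Z 0 (k n) s, snd (k n) s) (Z 0 (k' n) s, snd (k' n) s))
        \<le> P * Lc * (A * A' + A * norm (snd h' s) + A' * norm (snd h s) + norm (snd h s) * norm (snd h' s))"
        using F2_two_bound[OF s A[OF s] A'[OF s] P[OF s]] by simp
    qed
  qed
qed

end

section \<open>Second-order forms of the endpoint functions\<close>

context endpoint_problem
begin

abbreviation "q0 \<equiv> (X 0 0, X 0 T)"

definition pT :: "nat \<Rightarrow> 'a" where "pT i = (\<Sum>b\<in>Basis. g1 i q0 (0, b) *\<^sub>R b)"

lemma pT_inner: 
  assumes "i < K"
  shows "pT i \<bullet> y = g1 i q0 (0, y)"
proof -
  note gl = C2_lin1[OF g[OF assms]]
  have l: "linear (\<lambda>a. g1 i q0 (0, a))"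
    by (rule linearI) (use linear_add[OF gl, of q0 "(0, _)" "(0, _)"] linear_scale[OF gl, of q0 _ "(0, _)"] in auto)
  have "g1 i q0 (0, y) = g1 i q0 (0, \<Sum>b\<in>Basis. (y \<bullet> b) *\<^sub>R b)" by (simp add: euclidean_representation)
  also have "\<dots> = (\<Sum>b\<in>Basis. (y \<bullet> b) * g1 i q0 (0, b))" by (simp add: linear_sum[OF l] linear_scale[OF l])
  finally show ?thesis by (simp add: pT_def inner_sum_left inner_commute[of y] mult.commute)
qed

text \<open>One adjoint per endpoint function, with the gradient in the terminal state as terminal
  value; the adjoint belonging to a multiplier is the corresponding combination.\<close>

definition Pa :: "nat \<Rightarrow> real \<Rightarrow> 'a" where "Pa i = (SOME p. adjsol p \<and> p T = pT i)"

lemma Pa: "adjsol (Pa i)" "Pa i T = pT i" "continuous_on {0..T} (Pa i)"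
proof -
  have "adjsol (Pa i) \<and> Pa i T = pT i" unfolding Pa_def by (rule someI_ex[OF adjsol_exists])
  then show "adjsol (Pa i)" "Pa i T = pT i" "continuous_on {0..T} (Pa i)" unfolding adjsol_def by blast+
qed

definition A :: "nat \<Rightarrow> 'a \<times> (real \<Rightarrow> 'w) \<Rightarrow> real" where "A i h = D1 0 h i"

text \<open>The second derivative with \<open>Y\<close> eliminated through the adjoint. What remains
  is bilinear in the pair of state variation and control, and makes sense for square integrable
  controls, to which \<open>Y_lsol\<close> does not apply.\<close>

definition b :: "nat \<Rightarrow> 'a \<times> (real \<Rightarrow> 'w) \<Rightarrow> 'a \<times> (real \<Rightarrow> 'w) \<Rightarrow> real"
  where "b i h h' = g2 i q0 (fst h, Z 0 h T) (fst h', Z 0 h' T) +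
    (LINT s|leb T. Pa i s \<bullet> F2 (X 0 s, W 0 s) (Z 0 h s, snd h s) (Z 0 h' s, snd h' s))"

lemma A_eq:
  assumes i: "i < K" and h: "integrable (leb T) (snd h)"
  shows "A i h = g1 i q0 (fst h, 0) + Pa i 0 \<bullet> fst h + (LINT s|leb T. Pa i s \<bullet> F1 (X 0 s, W 0 s) (0, snd h s))"
proof -
  have "A i h = g1 i q0 (fst h, 0) + g1 i q0 (0, Z 0 h T)"
    using linear_add[OF C2_lin1[OF g[OF i]], of q0 "(fst h, 0)" "(0, Z 0 h T)"] by (simp add: A_def D1_def)
  also have "g1 i q0 (0, Z 0 h T) = Pa i T \<bullet> Z 0 h T" by (simp add: Pa pT_inner[OF i])
  also have "\<dots> = Pa i 0 \<bullet> fst h + (LINT s|leb T. Pa i s \<bullet> F1 (X 0 s, W 0 s) (0, snd h s))"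
    by (rule adjsol_dual[OF Pa(1) Z_lsol[OF small_0 h] Z_rhs_integrable[OF small_0 h]])
  finally show ?thesis by simp
qed

text \<open>\<open>Y\<close> starts at 0, so duality leaves only the integral of its source against
  the adjoint.\<close>

lemma D2_eq_b:
  assumes i: "i < K" and h: "snd h \<in> Bm"
  shows "D2 0 h i = b i h h"
proof -
  have "g1 i q0 (0, Y 0 h T) = Pa i T \<bullet> Y 0 h T" by (simp add: Pa pT_inner[OF i])
  also have "\<dots> = Pa i 0 \<bullet> 0 + (LINT s|leb T. Pa i s \<bullet> F2 (X 0 s, W 0 s) (Z 0 h s, snd h s) (Z 0 h s, snd h s))"
    by (rule adjsol_dual[OF Pa(1) Y_lsol[OF small_0 h] F2_rhs(2)[OF small_0 h Z_continuous[OF small_0 Bm_integrable[OF h]]]])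
  finally show ?thesis by (simp add: D2_def b_def)
qed

lemma Z_Hs_lincomb:
  assumes "h \<in> Hs" "h' \<in> Hs" "t \<in> {0..T}"
  shows "Z 0 (h + h') t = Z 0 h t + Z 0 h' t" "Z 0 (c *\<^sub>R h) t = c *\<^sub>R Z 0 h t"
  using Z_lincomb[OF small_0 Hs_integrable[OF assms(1)] Hs_integrable[OF assms(2)] assms(3), of 1 1]
    Z_lincomb[OF small_0 Hs_integrable[OF assms(1)] Hs_integrable[OF assms(2)] assms(3), of c 0] by auto

lemma lin_A: "i < K \<Longrightarrow> lin_on Hs (A i)"
proof -
  assume i: "i < K"
  note gl = C2_lin1[OF g[OF i]]
  have TT: "T \<in> {0..T}" using T by simp
  have "A i (h + h') = A i h + A i h'" "A i (c *\<^sub>R h) = c * A i h" if "h \<in> Hs" "h' \<in> Hs" for h h' c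
    using linear_add[OF gl, of q0 "(fst h, Z 0 h T)" "(fst h', Z 0 h' T)"] linear_scale[OF gl, of q0 c "(fst h, Z 0 h T)"]
    by (auto simp: A_def D1_def Z_Hs_lincomb[OF that TT])
  then show ?thesis unfolding lin_on_def by blast
qed

lemma Hs_zc: "h \<in> Hs \<Longrightarrow> continuous_on {0..T} (Z 0 h)"
  by (rule Z_continuous[OF small_0 Hs_integrable])

lemma bilin_b: "i < K \<Longrightarrow> bilin_on Hs (b i)"
  unfolding bilin_on_def lin_on_def
proof (intro conjI ballI allI)
  assume i: "i < K"
  note gl = C2_lin2'[OF g[OF i]] and Fl = C2_lin2'[OF F]
  have TT: "T \<in> {0..T}" using T by simp
  note int = F2_two_integrable[OF _ _ Hs_zc Hs_zc Pa(3)]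
  show "b i x y = b i y x" if "x \<in> Hs" "y \<in> Hs" for x y
  proof -
    have "(LINT s|leb T. Pa i s \<bullet> F2 (X 0 s, W 0 s) (Z 0 x s, snd x s) (Z 0 y s, snd y s))
      = (LINT s|leb T. Pa i s \<bullet> F2 (X 0 s, W 0 s) (Z 0 y s, snd y s) (Z 0 x s, snd x s))"
      by (intro Bochner_Integration.integral_cong refl arg_cong2[where f = inner] C2_symmetric[OF F])
    then show ?thesis
      unfolding b_def by (simp add: C2_symmetric[OF g[OF i], of q0 "(fst x, Z 0 x T)" "(fst y, Z 0 y T)"])
  qed
  fix x y assume x: "x \<in> Hs" and y: "y \<in> Hs"
  show "b i (x + x') y = b i x y + b i x' y" if x': "x' \<in> Hs" for x'
  proof -
    have "(LINT s|leb T. Pa i s \<bullet> F2 (X 0 s, W 0 s) (Z 0 (x + x') s, snd (x + x') s) (Z 0 y s, snd y s))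
       = (LINT s|leb T. Pa i s \<bullet> F2 (X 0 s, W 0 s) (Z 0 x s, snd x s) (Z 0 y s, snd y s) + Pa i s \<bullet> F2 (X 0 s, W 0 s) (Z 0 x' s, snd x' s) (Z 0 y s, snd y s))"
    proof (rule Bochner_Integration.integral_cong[OF refl])
      fix s assume "s \<in> space (leb T)"
      then have s: "s \<in> {0..T}" by simp
      have "(Z 0 (x + x') s, snd (x + x') s) = (Z 0 x s, snd x s) + (Z 0 x' s, snd x' s)"
        by (simp add: Z_Hs_lincomb[OF x x' s])
      then show "Pa i s \<bullet> F2 (X 0 s, W 0 s) (Z 0 (x + x') s, snd (x + x') s) (Z 0 y s, snd y s)
         = Pa i s \<bullet> F2 (X 0 s, W 0 s) (Z 0 x s, snd x s) (Z 0 y s, snd y s) + Pa i s \<bullet> F2 (X 0 s, W 0 s) (Z 0 x' s, snd x' s) (Z 0 y s, snd y s)"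
        by (simp only: linear_add[OF Fl] inner_add_right)
    qed
    also have "\<dots> = (LINT s|leb T. Pa i s \<bullet> F2 (X 0 s, W 0 s) (Z 0 x s, snd x s) (Z 0 y s, snd y s)) + (LINT s|leb T. Pa i s \<bullet> F2 (X 0 s, W 0 s) (Z 0 x' s, snd x' s) (Z 0 y s, snd y s))"
      by (rule Bochner_Integration.integral_add[OF int[OF x y x y] int[OF x' y x' y]])
    finally have 1: "(LINT s|leb T. Pa i s \<bullet> F2 (X 0 s, W 0 s) (Z 0 (x + x') s, snd (x + x') s) (Z 0 y s, snd y s)) = \<dots>" .
    have "(fst (x + x'), Z 0 (x + x') T) = (fst x, Z 0 x T) + (fst x', Z 0 x' T)"
      by (simp add: Z_Hs_lincomb[OF x x' TT])
    then have 2: "g2 i q0 (fst (x + x'), Z 0 (x + x') T) (fst y, Z 0 y T) = g2 i q0 (fst x, Z 0 x T) (fst y, Z 0 y T) + g2 i q0 (fst x', Z 0 x' T) (fst y, Z 0 y T)"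
      by (simp only: linear_add[OF gl])
    show ?thesis unfolding b_def 1 2 by simp
  qed
  show "b i (c *\<^sub>R x) y = c * b i x y" for c
  proof -
    have "(LINT s|leb T. Pa i s \<bullet> F2 (X 0 s, W 0 s) (Z 0 (c *\<^sub>R x) s, snd (c *\<^sub>R x) s) (Z 0 y s, snd y s))
       = (LINT s|leb T. c * (Pa i s \<bullet> F2 (X 0 s, W 0 s) (Z 0 x s, snd x s) (Z 0 y s, snd y s)))"
    proof (rule Bochner_Integration.integral_cong[OF refl])
      fix s assume "s \<in> space (leb T)"
      then have s: "s \<in> {0..T}" by simp
      have "(Z 0 (c *\<^sub>R x) s, snd (c *\<^sub>R x) s) = c *\<^sub>R (Z 0 x s, snd x s)"
        by (simp add: Z_Hs_lincomb[OF x x s])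
      then show "Pa i s \<bullet> F2 (X 0 s, W 0 s) (Z 0 (c *\<^sub>R x) s, snd (c *\<^sub>R x) s) (Z 0 y s, snd y s)
         = c * (Pa i s \<bullet> F2 (X 0 s, W 0 s) (Z 0 x s, snd x s) (Z 0 y s, snd y s))"
        by (simp only: linear_scale[OF Fl] inner_scaleR_right)
    qed
    also have "\<dots> = c * (LINT s|leb T. Pa i s \<bullet> F2 (X 0 s, W 0 s) (Z 0 x s, snd x s) (Z 0 y s, snd y s))" by simp
    finally have 1: "(LINT s|leb T. Pa i s \<bullet> F2 (X 0 s, W 0 s) (Z 0 (c *\<^sub>R x) s, snd (c *\<^sub>R x) s) (Z 0 y s, snd y s)) = \<dots>" .
    have "(fst (c *\<^sub>R x), Z 0 (c *\<^sub>R x) T) = c *\<^sub>R (fst x, Z 0 x T)"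
      by (simp add: Z_Hs_lincomb[OF x x TT])
    then have 2: "g2 i q0 (fst (c *\<^sub>R x), Z 0 (c *\<^sub>R x) T) (fst y, Z 0 y T) = c * g2 i q0 (fst x, Z 0 x T) (fst y, Z 0 y T)"
      by (simp only: linear_scale[OF gl] real_scaleR_def)
    show ?thesis unfolding b_def 1 2 by (simp add: distrib_left)
  qed
qed

lemma A_converges:
  assumes "l2conv k h" "i < K"
  shows "(\<lambda>n. A i (k n)) \<longlonglongrightarrow> A i h"
  unfolding A_def D1_def
proof (intro C2_f1_tendsto[OF g[OF assms(2)]] tendsto_Pair tendsto_const)
  show "(\<lambda>n. fst (k n)) \<longlonglongrightarrow> fst h" using assms(1) by (simp add: l2conv_def)
  show "(\<lambda>n. Z 0 (k n) T) \<longlonglongrightarrow> Z 0 h T" using uconv_tendsto[OF Z_l2conv[OF assms(1)]] T by simp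
qed

lemma b_converges:
  assumes k: "l2conv k h" "l2conv k' h'" and i: "i < K"
  shows "(\<lambda>n. b i (k n) (k' n)) \<longlonglongrightarrow> b i h h'"
  unfolding b_def
proof (intro tendsto_add F2_integral_converges k Pa C2_f2_tendsto[OF g[OF i]] tendsto_Pair tendsto_const)
  show "(\<lambda>n. fst (k n)) \<longlonglongrightarrow> fst h" "(\<lambda>n. fst (k' n)) \<longlonglongrightarrow> fst h'" using k by (simp_all add: l2conv_def)
  show "(\<lambda>n. Z 0 (k n) T) \<longlonglongrightarrow> Z 0 h T" "(\<lambda>n. Z 0 (k' n) T) \<longlonglongrightarrow> Z 0 h' T"
    using uconv_tendsto[OF Z_l2conv[OF k(1)]] uconv_tendsto[OF Z_l2conv[OF k(2)]] T by simp_all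
qed

lemma abnormal: "abnormal_problem (UNIV \<times> Bm) Hs A b ap q K"
proof (rule abnormal_problem.intro)
  show "subspace (UNIV \<times> Bm :: ('a \<times> (real \<Rightarrow> 'w)) set)" by (rule subspace_Times_UNIV[OF subspace_Bm])
  show "subspace Hs" by (rule subspace_Hs)
  show XH: "UNIV \<times> Bm \<subseteq> Hs" using Bm_L2 by (auto simp: Hs_def)
  show "lin_on Hs (A i)" "bilin_on Hs (b i)" if "i < K" for i using lin_A[OF that] bilin_b[OF that] by auto
  show "ap m h \<in> UNIV \<times> Bm" if "h \<in> Hs" for m h by (rule ap_in[OF that])
  show "(\<lambda>m. A i (ap m h)) \<longlonglongrightarrow> A i h" if "h \<in> Hs" "i < K" for h i by (rule A_converges[OF l2conv_ap[OF that(1)] that(2)])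
  show "(\<lambda>m. b i (ap m h) (ap m h')) \<longlonglongrightarrow> b i h h'" if "h \<in> Hs" "h' \<in> Hs" "i < K" for h h' i
    by (rule b_converges[OF l2conv_ap[OF that(1)] l2conv_ap[OF that(2)] that(3)])
  show "(\<lambda>m. b i (ap m h) h') \<longlonglongrightarrow> b i h h'" if "h \<in> Hs" "h' \<in> Hs" "i < K" for h h' i
    by (rule b_converges[OF l2conv_ap[OF that(1)] l2conv_const[OF that(2)] that(3)])
  fix k :: nat and gen :: "nat \<Rightarrow> 'a \<times> (real \<Rightarrow> 'w)"
  assume k: "0 < k" and gen: "\<And>j. j < k \<Longrightarrow> gen j \<in> UNIV \<times> Bm" and c: "\<And>i. i < q \<Longrightarrow> A i (gen 0) \<le> 0"
    "\<And>i. q \<le> i \<Longrightarrow> i < K \<Longrightarrow> A i (gen 0) = 0"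
  have gB: "snd (gen j) \<in> Bm" if "j < k" for j using gen[OF that] by auto
  have cB: "snd (comb k gen \<xi>) \<in> Bm" for \<xi> using bconv_Bm(2)[OF comb_bconv[OF gB tendsto_const]] .
  have "\<exists>\<rho>. expansion k K q \<rho> (\<lambda>c. G (comb k gen c)) (\<lambda>c \<xi>. D1 (comb k gen c) (comb k gen \<xi>)) (\<lambda>c \<xi>. D2 (comb k gen c) (comb k gen \<xi>))"
    by (rule expansion_comb[OF k gB]) (use c in \<open>simp_all add: A_def\<close>)
  then obtain \<rho> where "expansion k K q \<rho> (\<lambda>c. G (comb k gen c)) (\<lambda>c \<xi>. D1 (comb k gen c) (comb k gen \<xi>)) (\<lambda>c \<xi>. D2 (comb k gen c) (comb k gen \<xi>))"
    by (elim exE)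
  moreover have "comb k gen 0 = 0" using linear_0[OF linear_comb] .
  ultimately show "\<exists>\<rho> G D1 D2. expansion k K q \<rho> G D1 D2 \<and>
        (\<forall>\<xi>\<in>vsupp k. \<forall>i<K. D1 0 \<xi> i = A i (comb k gen \<xi>) \<and> D2 0 \<xi> i = b i (comb k gen \<xi>) (comb k gen \<xi>))"
    using D2_eq_b[OF _ cB] by (intro exI conjI) (assumption, simp add: A_def)
qed

end

section \<open>Weak lower semicontinuity\<close>

definition C2 :: "('z::euclidean_space \<Rightarrow> 'b::euclidean_space) \<Rightarrow> bool"
  where "C2 f \<longleftrightarrow> (\<exists>f1 f2. C2fun f f1 f2)"

text \<open>Derivatives as functions of f alone. Any pair satisfying \<open>C2fun\<close> agrees
  with them, so the locales can be instantiated by terms that match the Frechet derivatives in the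
  definitions of the problem.\<close>

definition d1 :: "('z::euclidean_space \<Rightarrow> 'b::euclidean_space) \<Rightarrow> 'z \<Rightarrow> 'z \<Rightarrow> 'b"
  where "d1 f z = frechet_derivative f (at z)"

definition d2 :: "('z::euclidean_space \<Rightarrow> 'b::euclidean_space) \<Rightarrow> 'z \<Rightarrow> 'z \<Rightarrow> 'z \<Rightarrow> 'b"
  where "d2 f z h = frechet_derivative (\<lambda>y. d1 f y h) (at z)"

lemma C2fun_d: "C2fun f f1 f2 \<Longrightarrow> f1 = d1 f \<and> f2 = d2 f"
proof -
  assume f: "C2fun f f1 f2"
  have 1: "f1 = d1 f" unfolding d1_def using frechet_derivative_at[OF C2_d1[OF f]] by (auto simp: fun_eq_iff)
  have "f2 z h = frechet_derivative (\<lambda>y. f1 y h) (at z)" for z h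
    using frechet_derivative_at[OF C2_d2[OF f]] .
  then show ?thesis using 1 by (auto simp: fun_eq_iff d2_def)
qed

lemma C2_iff: "C2 f \<longleftrightarrow> C2fun f (d1 f) (d2 f)"
  unfolding C2_def using C2fun_d by blast

lemma C2fun_linear_compose:
  assumes f: "C2fun f f1 f2" and A: "bounded_linear A"
  shows "C2fun (\<lambda>z. f (A z)) (\<lambda>z h. f1 (A z) (A h)) (\<lambda>z h k. f2 (A z) (A h) (A k))"
  unfolding C2fun_def
proof (intro conjI allI)
  fix z h
  show "((\<lambda>z. f (A z)) has_derivative (\<lambda>h. f1 (A z) (A h))) (at z)"
    by (rule has_derivative_compose[OF bounded_linear_imp_has_derivative[OF A] C2_d1[OF f]])
  show "((\<lambda>z. f1 (A z) (A h)) has_derivative (\<lambda>k. f2 (A z) (A h) (A k))) (at z)"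
    by (rule has_derivative_compose[OF bounded_linear_imp_has_derivative[OF A] C2_d2[OF f]])
  show "continuous_on UNIV (\<lambda>(z, h, k). f2 (A z) (A h) (A k))"
    unfolding continuous_on_def case_prod_beta
    by (intro ballI C2_f2_tendsto[OF f] bounded_linear.tendsto[OF A] tendsto_fst tendsto_snd tendsto_ident_at)
qed

lemma C2fun_add:
  assumes f: "C2fun f f1 f2" and g: "C2fun g g1 g2"
  shows "C2fun (\<lambda>z. f z + g z) (\<lambda>z h. f1 z h + g1 z h) (\<lambda>z h k. f2 z h k + g2 z h k)"
  using f g unfolding C2fun_def case_prod_beta by (intro conjI allI has_derivative_add continuous_on_add) auto

lemma C2fun_const: "C2fun (\<lambda>z. c) (\<lambda>z h. 0) (\<lambda>z h k. 0)"
  unfolding C2fun_def case_prod_beta by (auto intro: continuous_on_const)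

text \<open>Used for the products v_i f_i(x, u), where V is the coordinate v_i.\<close>

lemma C2fun_scale:
  assumes f: "C2fun f f1 f2" and V: "bounded_linear V"
  shows "C2fun (\<lambda>z. V z *\<^sub>R f z) (\<lambda>z h. V z *\<^sub>R f1 z h + V h *\<^sub>R f z)
     (\<lambda>z h k. V z *\<^sub>R f2 z h k + V k *\<^sub>R f1 z h + V h *\<^sub>R f1 z k)"
  unfolding C2fun_def
proof (intro conjI allI)
  fix z h
  have dV: "(V has_derivative V) (at z)" by (rule bounded_linear_imp_has_derivative[OF V])
  show "((\<lambda>z. V z *\<^sub>R f z) has_derivative (\<lambda>h. V z *\<^sub>R f1 z h + V h *\<^sub>R f z)) (at z)"
    by (rule has_derivative_scaleR[OF dV C2_d1[OF f]])
  have "((\<lambda>z. V z *\<^sub>R f1 z h + V h *\<^sub>R f z) has_derivative (\<lambda>k. (V z *\<^sub>R f2 z h k + V k *\<^sub>R f1 z h) + V h *\<^sub>R f1 z k)) (at z)"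
    by (intro has_derivative_add has_derivative_scaleR[OF dV C2_d2[OF f]] has_derivative_scaleR_right C2_d1[OF f])
  then show "((\<lambda>z. V z *\<^sub>R f1 z h + V h *\<^sub>R f z) has_derivative (\<lambda>k. V z *\<^sub>R f2 z h k + V k *\<^sub>R f1 z h + V h *\<^sub>R f1 z k)) (at z)" .
  show "continuous_on UNIV (\<lambda>(z, h, k). V z *\<^sub>R f2 z h k + V k *\<^sub>R f1 z h + V h *\<^sub>R f1 z k)"
    unfolding continuous_on_def case_prod_beta
    by (intro ballI tendsto_add tendsto_scaleR C2_f2_tendsto[OF f] C2_f1_tendsto[OF f] bounded_linear.tendsto[OF V] tendsto_fst tendsto_snd tendsto_ident_at)
qed

lemma C2_linear_compose: "C2 f \<Longrightarrow> bounded_linear A \<Longrightarrow> C2 (\<lambda>z. f (A z))"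
  unfolding C2_def using C2fun_linear_compose by blast

lemma C2_add: "C2 f \<Longrightarrow> C2 g \<Longrightarrow> C2 (\<lambda>z. f z + g z)"
  unfolding C2_def using C2fun_add by blast

lemma C2_scale: "C2 f \<Longrightarrow> bounded_linear V \<Longrightarrow> C2 (\<lambda>z. V z *\<^sub>R f z)"
  unfolding C2_def using C2fun_scale by blast

lemma C2_const: "C2 (\<lambda>z. c)"
  unfolding C2_def using C2fun_const by blast

lemma C2_sum: "finite I \<Longrightarrow> (\<And>i. i \<in> I \<Longrightarrow> C2 (f i)) \<Longrightarrow> C2 (\<lambda>z. \<Sum>i\<in>I. f i z)"
  by (induction I rule: finite_induct) (auto intro: C2_const C2_add)

lemma lipschitz_second_derivative_C2:
  assumes "lipschitz_second_derivative f"
  shows "C2 f"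
proof -
  obtain f' f'' L where f': "\<And>z. (f has_derivative blinfun_apply (f' z)) (at z)"
    and f'': "\<And>z. (f' has_derivative blinfun_apply (f'' z)) (at z)" and L: "L-lipschitz_on UNIV f''"
    using assms unfolding lipschitz_second_derivative_def by blast
  have "C2fun f (\<lambda>z h. blinfun_apply (f' z) h) (\<lambda>z h k. blinfun_apply (blinfun_apply (f'' z) k) h)"
    unfolding C2fun_def
  proof (intro conjI allI f')
    show "((\<lambda>z. blinfun_apply (f' z) h) has_derivative (\<lambda>k. blinfun_apply (blinfun_apply (f'' z) k) h)) (at z)" for z h
      using bounded_linear.has_derivative[OF blinfun.bounded_linear_left f''] .
    have "continuous_on UNIV f''" using L by (rule lipschitz_on_continuous_on)
    then have c: "isCont f'' z" for z by (simp add: continuous_on_eq_continuous_at)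
    show "continuous_on UNIV (\<lambda>(z, h, k). blinfun_apply (blinfun_apply (f'' z) k) h)"
      unfolding continuous_on_def case_prod_beta
      by (intro ballI blinfun.tendsto isCont_tendsto_compose[OF c] tendsto_fst tendsto_snd tendsto_ident_at)
  qed
  then show ?thesis unfolding C2_def by blast
qed

section \<open>Inequalities in L^2 and W^{1,2} on the interval\<close>

lemma L2_mult_integrable:
  fixes f g :: "real \<Rightarrow> real"
  assumes "f \<in> L2 T" "g \<in> L2 T"
  shows "integrable (leb T) (\<lambda>s. f s * g s)"
  by (rule Bochner_Integration.integrable_bound[OF L2_norm_mult_integrable[OF assms]])
     (use assms[THEN L2_measurable] in \<open>auto simp: abs_mult\<close>)

lemma L2_Cauchy_Schwarz:
  fixes x :: "real \<Rightarrow> 'a::euclidean_space" and y :: "real \<Rightarrow> 'b::euclidean_space"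
  assumes x: "x \<in> L2 T" and y: "y \<in> L2 T"
  shows "(LINT s|leb T. norm (x s) * norm (y s)) \<le> L2_norm T x * L2_norm T y"
proof -
  define ip where "ip f g = (LINT s|leb T. f s * g s)" for f g :: "real \<Rightarrow> real"
  have b: "bilin_on (L2 T) ip"
    unfolding bilin_on_def lin_on_def
  proof (intro conjI ballI allI)
    show "ip (f + g) h = ip f h + ip g h" if "h \<in> L2 T" "f \<in> L2 T" "g \<in> L2 T" for f g h
      using L2_mult_integrable[OF that(2,1)] L2_mult_integrable[OF that(3,1)] by (simp add: ip_def distrib_right)
    show "ip (c *\<^sub>R f) h = c * ip f h" if "h \<in> L2 T" "f \<in> L2 T" for f h c
      by (simp add: ip_def mult.assoc)
    show "ip f g = ip g f" for f g by (simp add: ip_def mult.commute)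
  qed
  have nx: "(\<lambda>s. norm (x s)) \<in> L2 T" and ny: "(\<lambda>s. norm (y s)) \<in> L2 T" using x y by (auto simp: L2_def)
  have "(ip (\<lambda>s. norm (x s)) (\<lambda>s. norm (y s)))\<^sup>2 \<le> ip (\<lambda>s. norm (x s)) (\<lambda>s. norm (x s)) * ip (\<lambda>s. norm (y s)) (\<lambda>s. norm (y s))"
    by (rule psd_Cauchy_Schwarz[OF b subspace_L2 _ nx ny]) (auto simp: ip_def intro!: integral_nonneg_AE)
  then have "ip (\<lambda>s. norm (x s)) (\<lambda>s. norm (y s)) \<le> sqrt (ip (\<lambda>s. norm (x s)) (\<lambda>s. norm (x s)) * ip (\<lambda>s. norm (y s)) (\<lambda>s. norm (y s)))"
    by (rule real_le_rsqrt)
  then show ?thesis by (simp add: ip_def L2_norm_def real_sqrt_mult power2_eq_square)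
qed

lemma L2_norm_nonneg: "0 \<le> L2_norm T x"
  unfolding L2_norm_def by (auto intro!: integral_nonneg_AE)

lemma L2_norm_sq: "(L2_norm T x)\<^sup>2 = (LINT t|leb T. (norm (x t))\<^sup>2)"
  unfolding L2_norm_def by (intro real_sqrt_pow2 integral_nonneg_AE) auto

lemma L1_le_L2:
  fixes x :: "real \<Rightarrow> 'a::euclidean_space"
  assumes "x \<in> L2 T" "0 \<le> T"
  shows "(LINT s|leb T. norm (x s)) \<le> L2_norm T x * sqrt T"
proof -
  have "L2_norm T (\<lambda>_. 1::real) = sqrt T" unfolding L2_norm_def using leb_integral_const[OF assms(2), of 1] by simp
  then show ?thesis using L2_Cauchy_Schwarz[OF assms(1) const_L2[of "1::real" T]] by simp
qed

lemma W12_wderiv: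
  fixes x :: "real \<Rightarrow> 'a::euclidean_space"
  assumes "x \<in> W12 T" "0 \<le> T"
  shows "has_wderiv T x (wderiv T x)" "wderiv T x \<in> L2 T" "continuous_on {0..T} x" "x \<in> L2 T"
proof -
  obtain g where g: "g \<in> L2 T" "has_wderiv T x g" using assms(1) unfolding W12_def by blast
  show w: "has_wderiv T x (wderiv T x)" by (rule has_wderiv_wderiv[OF g(2)])
  have ae: "AE s in leb T. wderiv T x s = g s" by (rule wderiv_AE[OF g(2) assms(2)])
  have i: "integrable (leb T) (wderiv T x)" using w by (simp add: has_wderiv_def)
  have m: "wderiv T x \<in> borel_measurable (leb T)" using i by auto
  have "integrable (leb T) (\<lambda>t. (norm (wderiv T x t))\<^sup>2) \<longleftrightarrow> integrable (leb T) (\<lambda>t. (norm (g t))\<^sup>2)"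
  proof (rule integrable_cong_AE)
    show "(\<lambda>t. (norm (wderiv T x t))\<^sup>2) \<in> borel_measurable (leb T)" using m by measurable
    show "(\<lambda>t. (norm (g t))\<^sup>2) \<in> borel_measurable (leb T)" using L2_measurable[OF g(1)] by measurable
    show "AE t in leb T. (norm (wderiv T x t))\<^sup>2 = (norm (g t))\<^sup>2" using ae by eventually_elim simp
  qed
  then show "wderiv T x \<in> L2 T" using g(1) m by (simp add: L2_def)
  show c: "continuous_on {0..T} x"
    using w unfolding has_wderiv_def by (intro primitive_continuous[OF i, of x "x 0"]) blast
  have "integrable (leb T) (\<lambda>t. (norm (x t))\<^sup>2)" by (intro leb_continuous_integrable continuous_intros c)
  then show "x \<in> L2 T" using leb_continuous_measurable[OF c] by (simp add: L2_def)
qed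

text \<open>The oscillation of x is at most the L^1 norm D of its derivative. Averaging |x t| \<le>
  |x s| + D over s and bounding both L^1 norms by L^2 norms gives the two terms.\<close>

lemma Sobolev_bound:
  fixes x :: "real \<Rightarrow> 'a::euclidean_space"
  assumes x: "x \<in> W12 T" and T: "0 < T" and t: "t \<in> {0..T}"
  shows "norm (x t) \<le> L2_norm T x / sqrt T + sqrt T * L2_norm T (wderiv T x)"
proof -
  have T0: "0 \<le> T" using T by simp
  note w = W12_wderiv[OF x T0]
  have i: "integrable (leb T) (wderiv T x)" using w(1) by (simp add: has_wderiv_def)
  define D where "D = (LINT s|leb T. norm (wderiv T x s))"
  have le: "norm (x t) \<le> norm (x s) + D" if s: "s \<in> {0..T}" for s
  proof -
    have d: "norm (x v - x u) \<le> D" if "0 \<le> u" "u \<le> v" "v \<le> T" for u v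
    proof -
      have "x v = x 0 + (LINT s|leb v. wderiv T x s)" "x u = x 0 + (LINT s|leb u. wderiv T x s)"
        using w(1) that unfolding has_wderiv_def by (meson atLeastAtMost_iff order_trans)+
      then have "x v - x u = (LINT s|lebesgue_on {u..v}. wderiv T x s)"
        using leb_integral_diff[OF i that] by simp
      then have "norm (x v - x u) \<le> (LINT s|lebesgue_on {u..v}. norm (wderiv T x s))" by simp
      also have "\<dots> = (LINT s|leb v. norm (wderiv T x s)) - (LINT s|leb u. norm (wderiv T x s))"
        using leb_integral_diff[OF integrable_norm[OF i] that] by simp
      also have "\<dots> \<le> (LINT s|leb v. norm (wderiv T x s))" by (simp add: integral_nonneg_AE)
      also have "\<dots> \<le> D" unfolding D_def by (rule leb_integral_mono_set[OF integrable_norm[OF i] that(3)]) simp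
      finally show ?thesis .
    qed
    have "norm (x t - x s) \<le> D"
    proof (cases "s \<le> t")
      case True then show ?thesis using d[of s t] s t by auto
    next
      case False then show ?thesis using d[of t s] s t by (auto simp: norm_minus_commute)
    qed
    then show ?thesis using norm_triangle_ineq[of "x s" "x t - x s"] by simp
  qed
  have nx: "integrable (leb T) (\<lambda>s. norm (x s))" using L2_norm_integrable[OF w(4)] .
  have ci: "integrable (leb T) (\<lambda>s. c)" for c :: real by (intro leb_continuous_integrable continuous_intros)
  have "(LINT s|leb T. norm (x t)) \<le> (LINT s|leb T. norm (x s) + D)"
    by (rule leb_integral_le[OF ci Bochner_Integration.integrable_add[OF nx ci] le])
  also have "\<dots> = (LINT s|leb T. norm (x s)) + T * D"
    using Bochner_Integration.integral_add[OF nx ci[of D]] leb_integral_const[OF T0, of D] by linarith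
  finally have "T * norm (x t) \<le> (LINT s|leb T. norm (x s)) + T * D"
    using leb_integral_const[OF T0, of "norm (x t)"] by linarith
  also have "\<dots> \<le> L2_norm T x * sqrt T + T * (L2_norm T (wderiv T x) * sqrt T)"
    unfolding D_def using L1_le_L2[OF w(4) T0] L1_le_L2[OF w(2) T0] T by (intro add_mono mult_left_mono) auto
  finally have fin: "T * norm (x t) \<le> L2_norm T x * sqrt T + T * (L2_norm T (wderiv T x) * sqrt T)" .
  have "T * norm (x t) \<le> T * (L2_norm T x / sqrt T + sqrt T * L2_norm T (wderiv T x))"
  proof -
    have "T * (L2_norm T x / sqrt T) = L2_norm T x * sqrt T"
      using T real_sqrt_mult_self[of T] by (simp add: field_simps)
    then show ?thesis using fin
      by (simp add: distrib_left mult.commute mult.left_commute)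
  qed
  then show ?thesis using T by simp
qed

text \<open>Weak lower semicontinuity is stated in \<open>ereal\<close>; eventual strict
  inequalities between reals are easier to combine and to rescale.\<close>

lemma ereal_le_liminf_iff:
  fixes s :: "nat \<Rightarrow> real"
  shows "ereal a \<le> liminf (\<lambda>k. ereal (s k)) \<longleftrightarrow> (\<forall>y<a. \<forall>\<^sub>F k in sequentially. y < s k)"
proof
  assume l: "ereal a \<le> liminf (\<lambda>k. ereal (s k))"
  show "\<forall>y<a. \<forall>\<^sub>F k in sequentially. y < s k"
  proof (intro allI impI)
    fix y assume "y < a"
    then have "ereal y < ereal a" by simp
    then have "\<forall>\<^sub>F k in sequentially. ereal y < ereal (s k)" using l unfolding le_Liminf_iff by blast
    then show "\<forall>\<^sub>F k in sequentially. y < s k" by simp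
  qed
next
  assume r: "\<forall>y<a. \<forall>\<^sub>F k in sequentially. y < s k"
  show "ereal a \<le> liminf (\<lambda>k. ereal (s k))"
    unfolding le_Liminf_iff
  proof (intro allI impI)
    fix y assume "y < ereal a"
    then obtain y' where y': "y \<le> ereal y'" "y' < a"
    proof (cases y)
      case (real z)
      then show ?thesis using \<open>y < ereal a\<close> dense[of z a] that by (auto intro: less_imp_le)
    next
      case PInf
      then show ?thesis using \<open>y < ereal a\<close> by simp
    next
      case MInf
      then show ?thesis using that[of "a - 1"] by simp
    qed
    from r y'(2) have "\<forall>\<^sub>F k in sequentially. y' < s k" by blast
    then show "\<forall>\<^sub>F k in sequentially. y < ereal (s k)"
      by eventually_elim (use y'(1) in \<open>auto intro: le_less_trans\<close>)
  qed
qed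

section \<open>Lower semicontinuity of the quadratic forms\<close>

context control_system
begin

definition ip :: "'a \<times> (real \<Rightarrow> 'w) \<Rightarrow> 'a \<times> (real \<Rightarrow> 'w) \<Rightarrow> real"
  where "ip h h' = fst h \<bullet> fst h' + (LINT s|leb T. snd h s \<bullet> snd h' s)"

lemma L2_inner_integrable:
  fixes x y :: "real \<Rightarrow> 'c::euclidean_space"
  assumes "x \<in> L2 T" "y \<in> L2 T"
  shows "integrable (leb T) (\<lambda>s. x s \<bullet> y s)"
proof (rule Bochner_Integration.integrable_bound[OF L2_norm_mult_integrable[OF assms]])
  show "(\<lambda>s. x s \<bullet> y s) \<in> borel_measurable (leb T)" using assms[THEN L2_measurable] by measurable
  show "AE s in leb T. norm (x s \<bullet> y s) \<le> norm (norm (x s) * norm (y s))"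
    by (intro AE_I2) (simp add: Cauchy_Schwarz_ineq2)
qed

lemma bilin_ip: "bilin_on Hs ip"
  unfolding bilin_on_def lin_on_def
proof (intro conjI ballI allI)
  fix x y assume H: "x \<in> Hs" "y \<in> Hs"
  show "ip x y = ip y x" by (simp add: ip_def inner_commute)
  show "ip (x + x') y = ip x y + ip x' y" if "x' \<in> Hs" for x'
    using L2_inner_integrable[of "snd x" "snd y"] L2_inner_integrable[of "snd x'" "snd y"] H that
    by (auto simp: ip_def Hs_def inner_add_left)
  show "ip (c *\<^sub>R x) y = c * ip x y" for c
    by (simp add: ip_def distrib_left)
qed

lemma ip_self: "ip h h = (norm (fst h))\<^sup>2 + (L2_norm T (snd h))\<^sup>2"
  unfolding ip_def L2_norm_sq by (simp add: power2_norm_eq_inner)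

lemma ip_nonneg: "0 \<le> ip h h" by (simp add: ip_self)

lemma ip_bounds: "norm (fst h) \<le> sqrt (ip h h)" "L2_norm T (snd h) \<le> sqrt (ip h h)"
  unfolding ip_self by (auto intro!: real_le_rsqrt)

text \<open>From \<open>lsol_bound\<close>: the source of Z has L^1 norm at most Lc sqrt T times the
  L^2 norm of the control.\<close>

definition "cz = (1 + Lc * sqrt T) * gr"

lemma cz: "0 \<le> cz" unfolding cz_def using Lc(1) gr_pos T by (intro mult_nonneg_nonneg add_nonneg_nonneg) auto

lemma Z_bound:
  assumes h: "h \<in> Hs" and t: "t \<in> {0..T}"
  shows "norm (Z 0 h t) \<le> cz * sqrt (ip h h)"
proof -
  have hi: "integrable (leb T) (snd h)" by (rule Hs_integrable[OF h])
  have hL: "snd h \<in> L2 T" using h by (auto simp: Hs_def)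
  have "norm (Z 0 h t) \<le> (norm (fst h) + (LINT s|leb T. norm (F1 (X 0 s, W 0 s) (0, snd h s)))) * gr"
    by (rule lsol_bound[OF adm_0 Z_rhs_integrable[OF small_0 hi] Z_lsol[OF small_0 hi] t])
  also have "\<dots> \<le> (sqrt (ip h h) + Lc * (sqrt (ip h h) * sqrt T)) * gr"
  proof (intro mult_right_mono add_mono)
    show "norm (fst h) \<le> sqrt (ip h h)" by (rule ip_bounds)
    have "(LINT s|leb T. norm (F1 (X 0 s, W 0 s) (0, snd h s))) \<le> (LINT s|leb T. Lc * norm (snd h s))"
    proof (rule leb_integral_le)
      show "integrable (leb T) (\<lambda>s. norm (F1 (X 0 s, W 0 s) (0, snd h s)))" using Z_rhs_integrable[OF small_0 hi] by simp
      show "integrable (leb T) (\<lambda>s. Lc * norm (snd h s))" using hi by simp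
      fix s assume "s \<in> {0..T}"
      then have K: "(X 0 s, W 0 s) \<in> K0" using adm_0 by (auto simp: adm_def)
      show "norm (F1 (X 0 s, W 0 s) (0, snd h s)) \<le> Lc * norm (snd h s)"
        using Lc(4)[OF K, of "(0, snd h s)"] by (simp add: norm_Pair)
    qed
    also have "\<dots> = Lc * (LINT s|leb T. norm (snd h s))" by simp
    also have "\<dots> \<le> Lc * (L2_norm T (snd h) * sqrt T)"
      using L1_le_L2[OF hL T0] Lc(1) by (rule mult_left_mono)
    also have "\<dots> \<le> Lc * (sqrt (ip h h) * sqrt T)"
      using ip_bounds(2)[of h] Lc(1) T by (intro mult_left_mono mult_right_mono) auto
    finally show "(LINT s|leb T. norm (F1 (X 0 s, W 0 s) (0, snd h s))) \<le> Lc * (sqrt (ip h h) * sqrt T)" .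
  qed (use gr_pos in auto)
  also have "\<dots> = cz * sqrt (ip h h)" by (simp add: cz_def algebra_simps)
  finally show ?thesis .
qed

end

context endpoint_problem
begin

text \<open>Controls the effect of changing the multiplier, uniformly over bounded sets of
  directions, as \<open>lsc_limit\<close> requires.\<close>

lemma b_bound:
  assumes i: "i < K"
  shows "\<exists>C\<ge>0. \<forall>h\<in>Hs. \<bar>b i h h\<bar> \<le> C * ip h h"
proof -
  obtain C where C: "C \<ge> 0" "\<And>u v. norm (g2 i q0 u v) \<le> C * norm u * norm v"
    using C2_bounds[OF g[OF i], of "{q0}"] by auto
  obtain P where P: "0 \<le> P" "\<And>s. s \<in> {0..T} \<Longrightarrow> norm (Pa i s) \<le> P" using continuous_on_Icc_bounded[OF Pa(3)] by blast
  have "\<bar>b i h h\<bar> \<le> (C * (1 + cz\<^sup>2) + P * Lc * (T * cz\<^sup>2 + 1)) * ip h h" if h: "h \<in> Hs" for h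
  proof -
    have TT: "T \<in> {0..T}" using T by simp
    have hL: "snd h \<in> L2 T" using h by (auto simp: Hs_def)
    have Zsq: "(norm (Z 0 h t))\<^sup>2 \<le> cz\<^sup>2 * ip h h" if "t \<in> {0..T}" for t
      using power_mono[OF Z_bound[OF h that] norm_ge_zero, of 2] ip_nonneg[of h] by (simp add: power_mult_distrib)
    have nsq: "(norm (u, v))\<^sup>2 = (norm u)\<^sup>2 + (norm v)\<^sup>2" for u :: 'a and v :: "'c::euclidean_space"
      by (simp add: norm_Pair)
    have 1: "\<bar>g2 i q0 (fst h, Z 0 h T) (fst h, Z 0 h T)\<bar> \<le> C * (1 + cz\<^sup>2) * ip h h"
    proof -
      have "\<bar>g2 i q0 (fst h, Z 0 h T) (fst h, Z 0 h T)\<bar> \<le> C * (norm (fst h, Z 0 h T))\<^sup>2"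
        using C(2)[of "(fst h, Z 0 h T)" "(fst h, Z 0 h T)"] by (simp add: power2_eq_square mult.assoc)
      also have "\<dots> \<le> C * (ip h h + cz\<^sup>2 * ip h h)"
        unfolding nsq using Zsq[OF TT] C(1) by (intro mult_left_mono add_mono) (auto simp: ip_self)
      finally show ?thesis by (simp add: algebra_simps)
    qed
    have 2: "\<bar>LINT s|leb T. Pa i s \<bullet> F2 (X 0 s, W 0 s) (Z 0 h s, snd h s) (Z 0 h s, snd h s)\<bar> \<le> P * Lc * (T * cz\<^sup>2 + 1) * ip h h"
    proof -
      have int: "integrable (leb T) (\<lambda>s. (norm (snd h s))\<^sup>2)" using hL by (simp add: L2_def)
      have ci: "integrable (leb T) (\<lambda>s. cz\<^sup>2 * ip h h)" by (intro leb_continuous_integrable continuous_intros)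
      have "norm (LINT s|leb T. Pa i s \<bullet> F2 (X 0 s, W 0 s) (Z 0 h s, snd h s) (Z 0 h s, snd h s))
        \<le> (LINT s|leb T. P * Lc * (cz\<^sup>2 * ip h h + (norm (snd h s))\<^sup>2))"
      proof (rule Bochner_Integration.integral_norm_bound_integral[OF F2_two_integrable[OF h h Hs_zc[OF h] Hs_zc[OF h] Pa(3)]])
        show "integrable (leb T) (\<lambda>s. P * Lc * (cz\<^sup>2 * ip h h + (norm (snd h s))\<^sup>2))" using int ci by simp
        fix s assume "s \<in> space (leb T)"
        then have s: "s \<in> {0..T}" by simp
        then have Kc: "(X 0 s, W 0 s) \<in> K0" using adm_0 by (auto simp: adm_def)
        have "norm (Pa i s \<bullet> F2 (X 0 s, W 0 s) (Z 0 h s, snd h s) (Z 0 h s, snd h s))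
          \<le> norm (Pa i s) * norm (F2 (X 0 s, W 0 s) (Z 0 h s, snd h s) (Z 0 h s, snd h s))"
          by (simp add: Cauchy_Schwarz_ineq2)
        also have "\<dots> \<le> P * (Lc * norm (Z 0 h s, snd h s) * norm (Z 0 h s, snd h s))"
          using P s by (intro mult_mono Lc(5)[OF Kc]) auto
        also have "\<dots> = P * Lc * ((norm (Z 0 h s))\<^sup>2 + (norm (snd h s))\<^sup>2)"
          unfolding nsq[symmetric] by (simp add: power2_eq_square mult.assoc)
        also have "\<dots> \<le> P * Lc * (cz\<^sup>2 * ip h h + (norm (snd h s))\<^sup>2)"
          using Zsq[OF s] P(1) Lc(1) by (intro mult_left_mono add_mono) auto
        finally show "norm (Pa i s \<bullet> F2 (X 0 s, W 0 s) (Z 0 h s, snd h s) (Z 0 h s, snd h s)) \<le> P * Lc * (cz\<^sup>2 * ip h h + (norm (snd h s))\<^sup>2)" .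
      qed
      also have "\<dots> = P * Lc * (LINT s|leb T. cz\<^sup>2 * ip h h + (norm (snd h s))\<^sup>2)" by simp
      also have "(LINT s|leb T. cz\<^sup>2 * ip h h + (norm (snd h s))\<^sup>2) = T * (cz\<^sup>2 * ip h h) + (L2_norm T (snd h))\<^sup>2"
        using Bochner_Integration.integral_add[OF ci int] leb_integral_const[OF T0, of "cz\<^sup>2 * ip h h"] by (simp only: L2_norm_sq)
      also have "P * Lc * (T * (cz\<^sup>2 * ip h h) + (L2_norm T (snd h))\<^sup>2) \<le> P * Lc * (T * (cz\<^sup>2 * ip h h) + ip h h)"
        using P(1) Lc(1) by (intro mult_left_mono add_left_mono) (auto simp: ip_self)
      finally show ?thesis by (simp add: algebra_simps)
    qed
    have "\<bar>b i h h\<bar> \<le> C * (1 + cz\<^sup>2) * ip h h + P * Lc * (T * cz\<^sup>2 + 1) * ip h h"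
      using 1 2 unfolding b_def by linarith
    then show ?thesis by (simp add: distrib_right)
  qed
  moreover have "0 \<le> C * (1 + cz\<^sup>2) + P * Lc * (T * cz\<^sup>2 + 1)" using C(1) P(1) Lc(1) T by simp
  ultimately show ?thesis by blast
qed

definition J :: "(nat \<Rightarrow> real) \<Rightarrow> 'a \<times> (real \<Rightarrow> 'w) \<Rightarrow> 'a \<times> (real \<Rightarrow> 'w) \<Rightarrow> real"
  where "J \<mu> h h' = (\<Sum>i<K. \<mu> i * b i h h')"

lemma bilin_J: "bilin_on Hs (J \<mu>)"
  unfolding J_def by (rule bilin_on_lincomb[OF bilin_b]) auto

text \<open>Only convergence against the functionals \<open>b i _ g\<close> is recorded, the part of
  weak convergence that enters the expansion of J about the limit.\<close>

definition wconv :: "(nat \<Rightarrow> 'a \<times> (real \<Rightarrow> 'w)) \<Rightarrow> 'a \<times> (real \<Rightarrow> 'w) \<Rightarrow> bool"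
  where "wconv hs h \<longleftrightarrow> h \<in> Hs \<and> (\<forall>k. hs k \<in> Hs) \<and> (\<forall>i<K. \<forall>g\<in>Hs. (\<lambda>k. b i (hs k) g) \<longlonglongrightarrow> b i h g)"

text \<open>The form at hs k is 2 J (hs k) h - J h h plus the form at hs k - h. The first part
  converges to J h h, and the second is bounded below by minus finitely many squares of functionals
  that tend to 0.\<close>

lemma finite_index_lsc:
  assumes w: "wconv hs h" and v: "\<And>j. j < r \<Longrightarrow> v j \<in> Hs"
    and low: "\<And>u. u \<in> Hs \<Longrightarrow> - (\<Sum>j<(r::nat). (J \<mu> u (v j))\<^sup>2) \<le> J \<mu> u u" and y: "y < J \<mu> h h"
  shows "\<forall>\<^sub>F k in sequentially. y < J \<mu> (hs k) (hs k)"
proof -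
  have H: "h \<in> Hs" "\<And>k. hs k \<in> Hs" using w by (auto simp: wconv_def)
  have Jl: "(\<lambda>k. J \<mu> (hs k) v) \<longlonglongrightarrow> J \<mu> h v" if "v \<in> Hs" for v
    unfolding J_def using w that by (intro tendsto_sum tendsto_mult tendsto_const) (auto simp: wconv_def)
  have dH: "hs k - h \<in> Hs" for k using H subspace_Hs by (simp add: subspace_diff)
  have Jd: "J \<mu> (hs k - h) v = J \<mu> (hs k) v - J \<mu> h v" if "v \<in> Hs" for k v
    by (rule lin_on_diff[OF bilin_on_lin[OF bilin_J that] subspace_Hs H(2,1)])
  have ex: "J \<mu> (hs k) (hs k) = 2 * J \<mu> (hs k) h - J \<mu> h h + J \<mu> (hs k - h) (hs k - h)" for k
  proof -
    have "J \<mu> (hs k - h) (hs k - h) = J \<mu> (hs k) (hs k - h) - J \<mu> h (hs k - h)" by (rule Jd[OF dH])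
    moreover have "J \<mu> (hs k) (hs k - h) = J \<mu> (hs k) (hs k) - J \<mu> (hs k) h"
      by (rule lin_on_diff[OF bilin_on_lin'[OF bilin_J subspace_Hs H(2)] subspace_Hs H(2,1)])
    moreover have "J \<mu> h (hs k - h) = J \<mu> h (hs k) - J \<mu> h h"
      by (rule lin_on_diff[OF bilin_on_lin'[OF bilin_J subspace_Hs H(1)] subspace_Hs H(2,1)])
    moreover have "J \<mu> h (hs k) = J \<mu> (hs k) h" by (rule bilin_on_sym[OF bilin_J H(1) H(2)])
    ultimately show ?thesis by linarith
  qed
  define low' where "low' k = 2 * J \<mu> (hs k) h - J \<mu> h h - (\<Sum>j<r. (J \<mu> (hs k) (v j) - J \<mu> h (v j))\<^sup>2)" for k
  have "low' k \<le> J \<mu> (hs k) (hs k)" for k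
  proof -
    have "(\<Sum>j<r. (J \<mu> (hs k - h) (v j))\<^sup>2) = (\<Sum>j<r. (J \<mu> (hs k) (v j) - J \<mu> h (v j))\<^sup>2)"
      by (intro sum.cong refl) (simp add: Jd[OF v])
    then show ?thesis using low[OF dH, of k] unfolding ex low'_def by simp
  qed
  moreover have "low' \<longlonglongrightarrow> 2 * J \<mu> h h - J \<mu> h h - (\<Sum>j<r. (J \<mu> h (v j) - J \<mu> h (v j))\<^sup>2)"
    unfolding low'_def by (intro tendsto_intros Jl H v) auto
  then have "low' \<longlonglongrightarrow> J \<mu> h h" by simp
  then have "\<forall>\<^sub>F k in sequentially. y < low' k" using y by (rule order_tendstoD(1))
  then show ?thesis by eventually_elim (use calculation less_le_trans in blast)
qed

text \<open>On a bounded sequence the forms J (\<mu>s n) converge uniformly to J \<mu>, by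
  \<open>b_bound\<close>. Uniformity matters because n has to be fixed before k tends to
  infinity.\<close>

lemma lsc_limit:
  assumes H: "h \<in> Hs" "\<And>k. hs k \<in> Hs" and C: "\<And>k. ip (hs k) (hs k) \<le> C"
    and lsc: "\<And>n y. y < J (\<mu>s n) h h \<Longrightarrow> \<forall>\<^sub>F k in sequentially. y < J (\<mu>s n) (hs k) (hs k)"
    and mu: "\<And>i. i < K \<Longrightarrow> (\<lambda>n. \<mu>s n i) \<longlonglongrightarrow> \<mu> i" and y: "y < J \<mu> h h"
  shows "\<forall>\<^sub>F k in sequentially. y < J \<mu> (hs k) (hs k)"
proof -
  have "\<forall>i. \<exists>D. i < K \<longrightarrow> 0 \<le> D \<and> (\<forall>h\<in>Hs. \<bar>b i h h\<bar> \<le> D * ip h h)" using b_bound by blast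
  then obtain D where D: "\<And>i. i < K \<Longrightarrow> 0 \<le> D i" "\<And>i h. i < K \<Longrightarrow> h \<in> Hs \<Longrightarrow> \<bar>b i h h\<bar> \<le> D i * ip h h" by metis
  define e where "e n = (\<Sum>i<K. \<bar>\<mu>s n i - \<mu> i\<bar> * D i)" for n
  have "(\<lambda>n. \<Sum>i<K. \<bar>\<mu>s n i - \<mu> i\<bar> * D i) \<longlonglongrightarrow> (\<Sum>i<K. \<bar>\<mu> i - \<mu> i\<bar> * D i)"
    by (intro tendsto_sum tendsto_mult tendsto_rabs tendsto_diff mu tendsto_const) auto
  then have el: "e \<longlonglongrightarrow> 0" unfolding e_def by simp
  have dist: "\<bar>J (\<mu>s n) u u - J \<mu> u u\<bar> \<le> e n * ip u u" if "u \<in> Hs" for n u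
  proof -
    have "J (\<mu>s n) u u - J \<mu> u u = (\<Sum>i<K. (\<mu>s n i - \<mu> i) * b i u u)"
      by (simp add: J_def sum_subtractf left_diff_distrib)
    also have "\<bar>\<dots>\<bar> \<le> (\<Sum>i<K. \<bar>\<mu>s n i - \<mu> i\<bar> * (D i * ip u u))"
      by (rule order_trans[OF sum_abs]) (intro sum_mono, unfold abs_mult, use D(2)[OF _ that] in \<open>auto intro!: mult_left_mono\<close>)
    finally show ?thesis by (simp add: e_def sum_distrib_right mult.assoc)
  qed
  define M where "M = \<bar>C\<bar> + ip h h + 1"
  have M: "M > 0" using ip_nonneg[of h] by (simp add: M_def)
  \<comment> \<open>A third of the gap is spent on replacing the multiplier at h, a third on
    replacing it at \<open>hs k\<close>, and a third is left for the semicontinuity of the fixed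
    form.\<close>
  define \<delta> where "\<delta> = (J \<mu> h h - y) / (3 * M)"
  have "\<delta> > 0" using y M by (simp add: \<delta>_def)
  then have "\<forall>\<^sub>F n in sequentially. e n < \<delta>" using el by (simp add: order_tendstoD(2))
  then obtain n where n: "e n < \<delta>" by (metis eventually_happens' sequentially_bot)
  have en: "0 \<le> e n" unfolding e_def using D(1) by (intro sum_nonneg mult_nonneg_nonneg) auto
  have bd: "e n * ip u u \<le> (J \<mu> h h - y) / 3" if "ip u u \<le> M" "0 \<le> ip u u" for u
  proof -
    have "e n * ip u u \<le> \<delta> * M" using n en that by (intro mult_mono) auto
    then show ?thesis using M by (simp add: \<delta>_def)
  qed
  have "e n * ip h h \<le> (J \<mu> h h - y) / 3" by (rule bd) (simp_all add: M_def ip_nonneg)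
  then have "y + 2 * ((J \<mu> h h - y) / 3) \<le> J (\<mu>s n) h h"
    using abs_le_D2[OF dist[OF H(1), of n]] by argo
  then have "y + (J \<mu> h h - y) / 3 < J (\<mu>s n) h h" using y by (simp add: field_simps)
  from lsc[OF this] show ?thesis
  proof eventually_elim
    fix k assume k: "y + (J \<mu> h h - y) / 3 < J (\<mu>s n) (hs k) (hs k)"
    have "ip (hs k) (hs k) \<le> M" using C[of k] ip_nonneg[of h] by (simp add: M_def)
    then have "e n * ip (hs k) (hs k) \<le> (J \<mu> h h - y) / 3" by (rule bd) (rule ip_nonneg)
    then show "y < J \<mu> (hs k) (hs k)"
      using abs_le_D1[OF dist[OF H(2), of n k]] k by linarith
  qed
qed

end

section \<open>Multipliers of the optimal control problem\<close>

definition dynz :: "('n::finite, 'l::finite, 'm::finite) ocp \<Rightarrow> (real^'n) \<times> (real^'l) \<times> (real^'m) \<Rightarrow> real^'n"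
  where "dynz P z = dyn P (fst z) (fst (snd z)) (snd (snd z))"

lemma dyn_dynz: "dyn P x u v = dynz P (x, u, v)"
  by (simp add: dynz_def)

text \<open>Cost, inequalities and equalities in one list, as \<open>expansion\<close> expects with
  q = dphi + 1. The numbering of \<open>eta\<close> starts at 1, so index dphi + j stands for
  \<open>eta P j\<close>.\<close>

definition cf :: "('n::finite, 'l::finite, 'm::finite) ocp \<Rightarrow> nat \<Rightarrow> (real^'n) \<times> (real^'n) \<Rightarrow> real"
  where "cf P i = (if i \<le> dphi P then phi P i else eta P (i - dphi P))"

lemma C2_dynz:
  fixes P :: "('n::finite, 'l::finite, 'm::finite) ocp"
  assumes "smooth_data P"
  shows "C2 (dynz P)"
proof -
  have E: "bounded_linear (\<lambda>z::(real^'n) \<times> (real^'l) \<times> (real^'m). (fst z, fst (snd z)))"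
    by (rule bounded_linear_Pair[OF bounded_linear_fst bounded_linear_compose[OF bounded_linear_fst bounded_linear_snd]])
  have V: "bounded_linear (\<lambda>z::(real^'n) \<times> (real^'l) \<times> (real^'m). snd (snd z) $ i)" for i
    by (rule bounded_linear_compose[OF bounded_linear_vec_nth bounded_linear_compose[OF bounded_linear_snd bounded_linear_snd]])
  have f0: "C2 (f0 P)" and fs: "C2 (fs P i)" for i
    using assms by (auto simp: smooth_data_def intro: lipschitz_second_derivative_C2)
  have "C2 (\<lambda>z::(real^'n) \<times> (real^'l) \<times> (real^'m). f0 P (fst z, fst (snd z)) +
      (\<Sum>i\<in>UNIV. (snd (snd z) $ i) *\<^sub>R fs P i (fst z, fst (snd z))))"
    by (rule C2_add[OF C2_linear_compose[OF f0 E] C2_sum[OF finite C2_scale[OF C2_linear_compose[OF fs E] V]]])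
  then show ?thesis unfolding dynz_def[abs_def] dyn_def .
qed

lemma C2_cf:
  assumes "smooth_data P" "i < Suc (dphi P) + deta P"
  shows "C2 (cf P i)"
proof (cases "i \<le> dphi P")
  case True
  then show ?thesis using assms(1) by (auto simp: cf_def smooth_data_def intro: lipschitz_second_derivative_C2)
next
  case False
  then have "i - dphi P \<in> {1..deta P}" using assms(2) by auto
  then show ?thesis using assms(1) False by (auto simp: cf_def smooth_data_def intro: lipschitz_second_derivative_C2)
qed

lemma C2fun_inner:
  assumes "C2fun F F1 F2"
  shows "C2fun (\<lambda>z. p \<bullet> F z) (\<lambda>z h. p \<bullet> F1 z h) (\<lambda>z h k. p \<bullet> F2 z h k)"
  using assms unfolding C2fun_def case_prod_beta
  by (intro conjI allI has_derivative_inner_right continuous_on_inner continuous_on_const) auto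

lemma C2fun_lincomb:
  fixes f :: "'i \<Rightarrow> 'z::euclidean_space \<Rightarrow> real"
  assumes "\<And>i. i \<in> I \<Longrightarrow> C2fun (f i) (f1 i) (f2 i)"
  shows "C2fun (\<lambda>z. \<Sum>i\<in>I. c i * f i z) (\<lambda>z h. \<Sum>i\<in>I. c i * f1 i z h) (\<lambda>z h k. \<Sum>i\<in>I. c i * f2 i z h k)"
  unfolding C2fun_def case_prod_beta
  by (intro conjI allI has_derivative_sum has_derivative_mult_right continuous_on_sum continuous_on_mult_left)
    (use assms in \<open>auto simp: C2fun_def case_prod_beta\<close>)

lemma C2fun_shift: "C2fun f f1 f2 \<Longrightarrow> C2fun (\<lambda>z. f z - c) f1 f2"
  using C2fun_add[OF _ C2fun_const[of "- c"]] by simp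

section \<open>Partial derivatives and the blocks of the Hessian\<close>

lemma C2_frechet:
  assumes "C2fun G G1 G2" "(e has_derivative e') (at s)"
  shows "frechet_derivative (\<lambda>s. G (e s)) (at s) = (\<lambda>h. G1 (e s) (e' h))"
    "frechet_derivative (\<lambda>s. G1 (e s) k) (at s) = (\<lambda>h. G2 (e s) k (e' h))"
  by (rule frechet_derivative_at[symmetric], rule has_derivative_compose[OF assms(2)], rule C2_d1[OF assms(1)])
    (rule frechet_derivative_at[symmetric], rule has_derivative_compose[OF assms(2)], rule C2_d2[OF assms(1)])

context
  fixes G :: "'x::euclidean_space \<times> 'u::euclidean_space \<times> 'v::euclidean_space \<Rightarrow> 'b::euclidean_space" and G1 G2
  assumes G: "C2fun G G1 G2"
begin

lemma has_derivative_slots: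
  "((\<lambda>y. (y, u, v)) has_derivative (\<lambda>h. (h, 0))) (at (x::'x))"
  "((\<lambda>r. (x, r, v)) has_derivative (\<lambda>h. (0, h, 0))) (at (u::'u))"
  "((\<lambda>s. (x, u, s)) has_derivative (\<lambda>h. (0, 0, h))) (at (v::'v))"
  by (rule has_derivative_Pair[OF has_derivative_ident has_derivative_const]
      has_derivative_Pair[OF has_derivative_const has_derivative_Pair[OF has_derivative_ident has_derivative_const]]
      has_derivative_Pair[OF has_derivative_const has_derivative_Pair[OF has_derivative_const has_derivative_ident]])+

lemma frechet_partial:
  "frechet_derivative (\<lambda>y. G (y, u, v)) (at x) = (\<lambda>h. G1 (x, u, v) (h, 0))"
  "frechet_derivative (\<lambda>r. G (x, r, v)) (at u) = (\<lambda>h. G1 (x, u, v) (0, h, 0))"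
  "frechet_derivative (\<lambda>s. G (x, u, s)) (at v) = (\<lambda>h. G1 (x, u, v) (0, 0, h))"
  by (rule C2_frechet(1)[OF G has_derivative_slots(1)] C2_frechet(1)[OF G has_derivative_slots(2)]
      C2_frechet(1)[OF G has_derivative_slots(3)])+

lemma frechet_partial2:
  "frechet_derivative (\<lambda>y. G1 (y, u, v) k) (at x) = (\<lambda>h. G2 (x, u, v) k (h, 0))"
  "frechet_derivative (\<lambda>r. G1 (x, r, v) k) (at u) = (\<lambda>h. G2 (x, u, v) k (0, h, 0))"
  by (rule C2_frechet(2)[OF G has_derivative_slots(1)] C2_frechet(2)[OF G has_derivative_slots(2)])+

lemma has_derivative_partial:
  "((\<lambda>y. G (y, u, v)) has_derivative (\<lambda>h. G1 (x, u, v) (h, 0))) (at x)"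
  "((\<lambda>r. G (x, r, v)) has_derivative (\<lambda>h. G1 (x, u, v) (0, h, 0))) (at u)"
  "((\<lambda>s. G (x, u, s)) has_derivative (\<lambda>h. G1 (x, u, v) (0, 0, h))) (at v)"
  by (rule has_derivative_compose[OF has_derivative_slots(1) C2_d1[OF G]]
      has_derivative_compose[OF has_derivative_slots(2) C2_d1[OF G]]
      has_derivative_compose[OF has_derivative_slots(3) C2_d1[OF G]])+

end

lemma second_partials:
  fixes G :: "'x::euclidean_space \<times> 'u::euclidean_space \<times> 'v::euclidean_space \<Rightarrow> real"
  assumes G: "C2fun G G1 G2"
  shows "D2 (\<lambda>y. G (y, u, v)) x h k = G2 (x, u, v) (h, 0) (k, 0)"
    "D2 (\<lambda>r. G (x, r, v)) u h' k' = G2 (x, u, v) (0, h', 0) (0, k', 0)"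
    "Dmix (\<lambda>r y. G (y, r, v)) u x h' k = G2 (x, u, v) (0, h', 0) (k, 0)"
    "Dmix (\<lambda>s y. G (y, u, s)) v x h'' k = G2 (x, u, v) (0, 0, h'') (k, 0)"
    "Dmix (\<lambda>s r. G (x, r, s)) v u h'' k' = G2 (x, u, v) (0, 0, h'') (0, k', 0)"
  unfolding D2_def Dmix_def by (simp_all only: frechet_partial[OF G] frechet_partial2[OF G])

text \<open>In the full form each mixed block occurs twice, by symmetry, and the vv-block vanishes;
  half of it therefore contains each mixed block once and the xx- and uu-blocks with factor
  1/2.\<close>

lemma quadratic_split:
  fixes G :: "'x::euclidean_space \<times> 'u::euclidean_space \<times> 'v::euclidean_space \<Rightarrow> real"
  assumes G: "C2fun G G1 G2" and vv: "G2 z (0, 0, v) (0, 0, v) = 0"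
  shows "1/2 * G2 z (x, 0) (x, 0) + G2 z (0, u, 0) (x, 0) + G2 z (0, 0, v) (x, 0)
    + 1/2 * G2 z (0, u, 0) (0, u, 0) + G2 z (0, 0, v) (0, u, 0) = 1/2 * G2 z (x, u, v) (x, u, v)"
proof -
  have s: "(x, u, v) = (x, 0) + ((0, u, 0) + (0, 0, v))" by (simp add: zero_prod_def)
  note l = linear_add[OF C2_lin2[OF G]] linear_add[OF C2_lin2'[OF G]]
  show ?thesis unfolding s l
    using C2_symmetric[OF G, of z "(x, 0)" "(0, u, 0)"] C2_symmetric[OF G, of z "(x, 0)" "(0, 0, v)"]
      C2_symmetric[OF G, of z "(0, u, 0)" "(0, 0, v)"] vv by argo
qed

text \<open>The dynamics are affine in \<open>v\<close>, which is why \<open>Omega\<close> has no term quadratic in \<open>v\<close>.\<close>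

lemma dynz_vv:
  fixes P :: "('n::finite, 'l::finite, 'm::finite) ocp"
  assumes F: "C2fun (dynz P) F1 F2"
  shows "F2 z (0, 0, v) (0, 0, v') = 0"
proof -
  obtain x u w where z: "z = (x, u, w)" by (cases z)
  \<comment> \<open>The derivative in the v-direction does not depend on v itself, so a second
    differentiation in v gives 0.\<close>
  have F1v: "F1 (x, u, s) (0, 0, v) = (\<Sum>i\<in>UNIV. (v $ i) *\<^sub>R fs P i (x, u))" for s
  proof -
    have "((\<lambda>s. dynz P (x, u, s)) has_derivative (\<lambda>h. \<Sum>i\<in>UNIV. (h $ i) *\<^sub>R fs P i (x, u))) (at s)"
      unfolding dynz_def dyn_def fst_conv snd_conv
      by (rule derivative_eq_intros bounded_linear_imp_has_derivative[OF bounded_linear_vec_nth] refl)+ simp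
    from has_derivative_unique[OF has_derivative_partial(3)[OF F] this]
    show ?thesis by (rule fun_cong)
  qed
  have "((\<lambda>s. F1 (x, u, s) (0, 0, v)) has_derivative (\<lambda>h. F2 (x, u, w) (0, 0, v) (0, 0, h))) (at w)"
    by (rule has_derivative_compose[OF has_derivative_slots(3)[OF F] C2_d2[OF F]])
  then have "((\<lambda>s. \<Sum>i\<in>UNIV. (v $ i) *\<^sub>R fs P i (x, u)) has_derivative (\<lambda>h. F2 (x, u, w) (0, 0, v) (0, 0, h))) (at w)"
    unfolding F1v .
  from has_derivative_unique[OF this has_derivative_const]
  show ?thesis unfolding z by (rule fun_cong)
qed

lemma grad_eq_iff:
  assumes "(g has_derivative g') (at z)"
  shows "grad g z = y \<longleftrightarrow> (\<forall>h. g' h = y \<bullet> h)"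
proof -
  have l: "linear g'" using assms by (rule has_derivative_linear)
  have "grad g z \<bullet> h = g' h" for h
  proof -
    have "g' h = g' (\<Sum>b\<in>Basis. (h \<bullet> b) *\<^sub>R b)" by (simp add: euclidean_representation)
    also have "\<dots> = (\<Sum>b\<in>Basis. (h \<bullet> b) * g' b)" by (simp add: linear_sum[OF l] linear_scale[OF l])
    also have "\<dots> = grad g z \<bullet> h"
      unfolding grad_def frechet_derivative_at[OF assms, symmetric] inner_sum_left
      by (intro sum.cong refl) (simp add: inner_commute mult.commute)
    finally show ?thesis by simp
  qed
  then show ?thesis by (metis vector_eq_rdot)
qed

lemma leb_integral_cong_AE:
  fixes f g :: "real \<Rightarrow> 'a::euclidean_space"
  assumes "integrable (leb T) f" "integrable (leb T) g" "AE s in leb T. f s = g s" "t \<le> T"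
  shows "(LINT s|leb t. f s) = (LINT s|leb t. g s)"
  using leb_integrable_mono[OF assms(1,4)] leb_integrable_mono[OF assms(2,4)] leb_AE_mono[OF assms(3,4)]
  by (intro integral_cong_AE borel_measurable_integrable)

lemma L2_Pair:
  fixes u :: "real \<Rightarrow> 'a::euclidean_space" and v :: "real \<Rightarrow> 'b::euclidean_space"
  assumes "u \<in> L2 T" "v \<in> L2 T"
  shows "(\<lambda>t. (u t, v t)) \<in> L2 T"
    and "(L2_norm T (\<lambda>t. (u t, v t)))\<^sup>2 = (L2_norm T u)\<^sup>2 + (L2_norm T v)\<^sup>2"
proof -
  have n: "(norm (u t, v t))\<^sup>2 = (norm (u t))\<^sup>2 + (norm (v t))\<^sup>2" for t by (simp add: norm_Pair)
  have i: "integrable (leb T) (\<lambda>t. (norm (u t))\<^sup>2)" "integrable (leb T) (\<lambda>t. (norm (v t))\<^sup>2)"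
    using assms by (auto simp: L2_def)
  show "(\<lambda>t. (u t, v t)) \<in> L2 T"
    unfolding L2_def mem_Collect_eq n using Bochner_Integration.integrable_add[OF i] L2_measurable[OF assms(1)] L2_measurable[OF assms(2)]
    by (intro conjI borel_measurable_Pair)
  show "(L2_norm T (\<lambda>t. (u t, v t)))\<^sup>2 = (L2_norm T u)\<^sup>2 + (L2_norm T v)\<^sup>2"
    unfolding L2_norm_sq n by (rule Bochner_Integration.integral_add[OF i])
qed

text \<open>\<open>wh\<close> is an everywhere bounded representative of \<open>(uh, vh)\<close>.\<close>

locale ocp_point = endpoint_problem "horizon P" "dynz P" "d1 (dynz P)" "d2 (dynz P)" xh wh
    "\<lambda>i q. cf P i q - cf P i (xh 0, xh (horizon P))" "\<lambda>i. d1 (cf P i)" "\<lambda>i. d2 (cf P i)"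
    "Suc (dphi P)" "Suc (dphi P) + deta P"
  for P :: "('n::finite, 'l::finite, 'm::finite) ocp" and xh and wh :: "real \<Rightarrow> (real^'l) \<times> (real^'m)" +
  fixes uh vh
  assumes wh_AE: "AE t in leb (horizon P). wh t = (uh t, vh t)"
    and uv_measurable: "uh \<in> borel_measurable (leb (horizon P))" "vh \<in> borel_measurable (leb (horizon P))"
    and cf: "\<And>i. i < Suc (dphi P) + deta P \<Longrightarrow> C2fun (cf P i) (d1 (cf P i)) (d2 (cf P i))"
begin

abbreviation "F1 \<equiv> d1 (dynz P)"
abbreviation "F2 \<equiv> d2 (dynz P)"
abbreviation "TT \<equiv> horizon P"
abbreviation "KK \<equiv> Suc (dphi P) + deta P"
abbreviation "what \<equiv> (xh, uh, vh)"

lemma q0_eq: "q0 = (xh 0, xh TT)"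
  using X_0[of 0] X_0[of TT] T0 by simp

lemma AE_ref: "AE t in leb TT. t \<in> {0..TT} \<and> (X 0 t, W 0 t) = (xh t, uh t, vh t)"
proof -
  have "AE t in leb TT. t \<in> {0..TT}" using AE_space[of "leb TT"] by simp
  with wh_AE show ?thesis by eventually_elim (simp add: X_0 W_0)
qed

lemma lsol_wderiv:
  assumes w: "has_wderiv TT x d" "continuous_on {0..TT} x" and r: "integrable (leb TT) r"
    and ae: "AE s in leb TT. d s = F1 (X 0 s, W 0 s) (x s, 0) + r s"
  shows "lsol (X 0) (W 0) (x 0) r x"
  unfolding lsol_def
proof (intro conjI ballI w(2))
  fix t assume t: "t \<in> {0..TT}"
  have i: "integrable (leb TT) d" and "x t = x 0 + (LINT s|leb t. d s)"
    using w(1) t unfolding has_wderiv_def by blast+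
  moreover have "(LINT s|leb t. d s) = (LINT s|leb t. F1 (X 0 s, W 0 s) (x s, 0) + r s)"
    by (rule leb_integral_cong_AE[OF i lsol_integrable[OF adm_0 r w(2)] ae]) (use t in simp)
  ultimately show "x t = x 0 + (LINT s|leb t. F1 (X 0 s, W 0 s) (x s, 0) + r s)" by simp
qed

text \<open>On \<open>H2\<close> this inverts the passage from h to its state \<open>Z 0 h\<close>
  and control; it translates critical directions into the coordinates \<open>Hs\<close>.\<close>

definition direction :: "('n, 'l, 'm) traj \<Rightarrow> (real^'n) \<times> (real \<Rightarrow> (real^'l) \<times> (real^'m))"
  where "direction w = (fst w 0, \<lambda>t. (fst (snd w) t, snd (snd w) t))"

lemma direction_simp [simp]: "fst (direction (x, u, v)) = x 0" "snd (direction (x, u, v)) = (\<lambda>t. (u t, v t))"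
  by (simp_all add: direction_def)

lemma direction_Hs:
  assumes "(x, u, v) \<in> W2 TT"
  shows "direction (x, u, v) \<in> Hs"
  using assms L2_Pair(1) by (auto simp: W2_def Hs_def direction_def)

text \<open>The almost everywhere equation, once integrated, makes the state an \<open>lsol\<close>
  with the same data as \<open>Z\<close>, and such solutions are unique. \<open>AE_ref\<close>
  absorbs the difference between \<open>wh\<close> and the given controls.\<close>

lemma H2_Z:
  assumes w: "(x, u, v) \<in> H2 P what"
  shows "(x, u, v) \<in> W2 TT" "\<And>t. t \<in> {0..TT} \<Longrightarrow> x t = Z 0 (direction (x, u, v)) t"
proof -
  show W: "(x, u, v) \<in> W2 TT" using w by (simp add: H2_def)
  have ae: "AE t in leb TT. wderiv TT x t = F1 (xh t, uh t, vh t) (x t, 0)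
      + F1 (xh t, uh t, vh t) (0, u t, 0) + F1 (xh t, uh t, vh t) (0, 0, v t)"
    using w unfolding H2_def dyn_dynz by (simp only: frechet_partial[OF F] mem_Collect_eq case_prod_conv)
  have x: "x \<in> W12 TT" using W by (simp add: W2_def)
  note h = direction_Hs[OF W]
  have r: "integrable (leb TT) (\<lambda>s. F1 (X 0 s, W 0 s) (0, snd (direction (x, u, v)) s))"
    by (rule Z_rhs_integrable[OF small_0 Hs_integrable[OF h]])
  have "lsol (X 0) (W 0) (x 0) (\<lambda>s. F1 (X 0 s, W 0 s) (0, snd (direction (x, u, v)) s)) x"
  proof (rule lsol_wderiv[OF W12_wderiv(1,3)[OF x T0] r])
    show "AE s in leb TT. wderiv TT x s = F1 (X 0 s, W 0 s) (x s, 0) + F1 (X 0 s, W 0 s) (0, snd (direction (x, u, v)) s)"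
      using ae AE_ref
    proof eventually_elim
      case (elim t)
      have "F1 (X 0 t, W 0 t) (0, u t, v t) = F1 (X 0 t, W 0 t) (0, u t, 0) + F1 (X 0 t, W 0 t) (0, 0, v t)"
        using linear_add[OF C2_lin1[OF F], of "(X 0 t, W 0 t)" "(0, u t, 0)" "(0, 0, v t)"] by simp
      then show ?case using elim by simp
    qed
  qed
  moreover have "lsol (X 0) (W 0) (x 0) (\<lambda>s. F1 (X 0 s, W 0 s) (0, snd (direction (x, u, v)) s)) (Z 0 (direction (x, u, v)))"
    using Z_lsol[OF small_0 Hs_integrable[OF h]] by simp
  ultimately show "x t = Z 0 (direction (x, u, v)) t" if "t \<in> {0..TT}" for t
    by (rule lsol_unique[OF adm_0 r _ _ that])
qed

definition Pm :: "(nat \<Rightarrow> real) \<Rightarrow> real \<Rightarrow> real^'n"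
  where "Pm \<mu> t = (\<Sum>i<KK. \<mu> i *\<^sub>R Pa i t)"

lemma Pm_continuous: "continuous_on {0..TT} (Pm \<mu>)"
  unfolding Pm_def[abs_def] by (intro continuous_intros Pa(3))

lemma J_eq:
  assumes h: "h \<in> Hs"
  shows "J \<mu> h h = (\<Sum>i<KK. \<mu> i * d2 (cf P i) q0 (fst h, Z 0 h TT) (fst h, Z 0 h TT))
    + (LINT s|leb TT. Pm \<mu> s \<bullet> F2 (X 0 s, W 0 s) (Z 0 h s, snd h s) (Z 0 h s, snd h s))"
proof -
  let ?f = "\<lambda>i s. Pa i s \<bullet> F2 (X 0 s, W 0 s) (Z 0 h s, snd h s) (Z 0 h s, snd h s)"
  have i: "integrable (leb TT) (?f i)" for i by (rule F2_two_integrable[OF h h Hs_zc[OF h] Hs_zc[OF h] Pa(3)])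
  have "(LINT s|leb TT. Pm \<mu> s \<bullet> F2 (X 0 s, W 0 s) (Z 0 h s, snd h s) (Z 0 h s, snd h s))
      = (LINT s|leb TT. (\<Sum>i<KK. \<mu> i * ?f i s))"
    by (simp only: Pm_def inner_sum_left inner_scaleR_left)
  also have "\<dots> = (\<Sum>i<KK. LINT s|leb TT. \<mu> i * ?f i s)"
    by (rule Bochner_Integration.integral_sum) (rule integrable_mult_right[OF i])
  also have "\<dots> = (\<Sum>i<KK. \<mu> i * (LINT s|leb TT. ?f i s))" by simp
  finally show ?thesis by (simp only: J_def b_def distrib_left sum.distrib)
qed

definition mu :: "(nat \<Rightarrow> real) \<Rightarrow> (nat \<Rightarrow> real) \<Rightarrow> nat \<Rightarrow> real"
  where "mu \<alpha> \<beta> i = (if i \<le> dphi P then \<alpha> i else if i < KK then \<beta> (i - dphi P) else 0)"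

lemma mu_sum: "(\<Sum>i<KK. mu \<alpha> \<beta> i * c i) = (\<Sum>i=0..dphi P. \<alpha> i * c i) + (\<Sum>j=1..deta P. \<beta> j * c (j + dphi P))"
proof -
  have "{..<KK} = {0..dphi P} \<union> {1 + dphi P..deta P + dphi P}" "{0..dphi P} \<inter> {1 + dphi P..deta P + dphi P} = {}" by auto
  then have "(\<Sum>i<KK. mu \<alpha> \<beta> i * c i) = (\<Sum>i=0..dphi P. mu \<alpha> \<beta> i * c i) + (\<Sum>i=1 + dphi P..deta P + dphi P. mu \<alpha> \<beta> i * c i)"
    by (simp add: sum.union_disjoint)
  also have "(\<Sum>i=1 + dphi P..deta P + dphi P. mu \<alpha> \<beta> i * c i) = (\<Sum>j=1..deta P. mu \<alpha> \<beta> (j + dphi P) * c (j + dphi P))"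
    by (rule sum.shift_bounds_cl_nat_ivl)
  finally show ?thesis by (simp add: mu_def)
qed

lemma ell_eq: "ell P (\<alpha>, \<beta>, p) = (\<lambda>q. \<Sum>i<KK. mu \<alpha> \<beta> i * cf P i q)"
  unfolding ell_def mu_sum by (auto simp: cf_def intro!: sum.cong)

lemma ell_C2: "C2fun (ell P (\<alpha>, \<beta>, p)) (\<lambda>q h. \<Sum>i<KK. mu \<alpha> \<beta> i * d1 (cf P i) q h) (\<lambda>q h k. \<Sum>i<KK. mu \<alpha> \<beta> i * d2 (cf P i) q h k)"
  unfolding ell_eq by (rule C2fun_lincomb) (simp add: cf)

lemma Ham_eq: "Ham P (\<alpha>, \<beta>, p) x u v t = p t \<bullet> dynz P (x, u, v)"
  by (simp add: Ham_def dyn_dynz)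

text \<open>\<open>Omega\<close> carries the factor 1/2 of the Taylor expansion, while J is the full
  second derivative. The hypothesis on p is confined to the interval because values outside it are
  ignored.\<close>

lemma Omega_eq:
  assumes w: "(x, u, v) \<in> H2 P what" and p: "\<And>t. t \<in> {0..TT} \<Longrightarrow> p t = Pm (mu \<alpha> \<beta>) t"
  shows "Omega P what (\<alpha>, \<beta>, p) (x, u, v) = J (mu \<alpha> \<beta>) (direction (x, u, v)) (direction (x, u, v)) / 2"
proof -
  note xZ = H2_Z(2)[OF w]
  let ?h = "direction (x, u, v)"
  have h: "?h \<in> Hs" using direction_Hs H2_Z(1)[OF w] .
  let ?I = "\<lambda>s. Pm (mu \<alpha> \<beta>) s \<bullet> F2 (X 0 s, W 0 s) (Z 0 ?h s, snd ?h s) (Z 0 ?h s, snd ?h s)"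
  let ?O = "\<lambda>t. 1/2 * Defs.D2 (\<lambda>y. Ham P (\<alpha>, \<beta>, p) y (uh t) (vh t) t) (xh t) (x t) (x t)
          + Dmix (\<lambda>r y. Ham P (\<alpha>, \<beta>, p) y r (vh t) t) (uh t) (xh t) (u t) (x t)
          + Dmix (\<lambda>s y. Ham P (\<alpha>, \<beta>, p) y (uh t) s t) (vh t) (xh t) (v t) (x t)
          + 1/2 * Defs.D2 (\<lambda>r. Ham P (\<alpha>, \<beta>, p) (xh t) r (vh t) t) (uh t) (u t) (u t)
          + Dmix (\<lambda>s r. Ham P (\<alpha>, \<beta>, p) (xh t) r s t) (vh t) (uh t) (v t) (u t)"
  have O: "?O t = 1/2 * (p t \<bullet> F2 (xh t, uh t, vh t) (x t, u t, v t) (x t, u t, v t))" for t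
  proof -
    note C = C2fun_inner[OF F, of "p t"]
    show ?thesis
      unfolding Ham_eq by (simp only: second_partials[OF C]) (rule quadratic_split[OF C], simp add: dynz_vv[OF F])
  qed
  let ?O' = "\<lambda>t. 1/2 * (Pm (mu \<alpha> \<beta>) t \<bullet> F2 (xh t, uh t, vh t) (x t, u t, v t) (x t, u t, v t))"
  have W: "x \<in> W12 TT" "u \<in> L2 TT" "v \<in> L2 TT" using H2_Z(1)[OF w] by (auto simp: W2_def)
  have "(LINT t|leb TT. ?O t) = (LINT t|leb TT. ?O' t)"
    unfolding O by (rule Bochner_Integration.integral_cong) (use p in simp_all)
  also have "\<dots> = (LINT t|leb TT. 1/2 * ?I t)"
  proof (rule integral_cong_AE)
    show "AE t in leb TT. ?O' t = 1/2 * ?I t"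
      using AE_ref
    proof eventually_elim
      case (elim t)
      then show ?case using xZ[of t] by simp
    qed
    have m: "(\<lambda>t. (xh t, uh t, vh t)) \<in> borel_measurable (leb TT)" "(\<lambda>t. (x t, u t, v t)) \<in> borel_measurable (leb TT)"
      by (intro borel_measurable_Pair leb_continuous_measurable[OF xhc] uv_measurable
          L2_measurable W12_wderiv(4)[OF W(1) T0] W)+
    show "?O' \<in> borel_measurable (leb TT)"
      by (intro borel_measurable_times borel_measurable_const borel_measurable_inner C2_measurable(3)[OF F] m
          leb_continuous_measurable Pm_continuous)
    show "(\<lambda>t. 1/2 * ?I t) \<in> borel_measurable (leb TT)"
      by (intro borel_measurable_integrable integrable_mult_right F2_two_integrable h Hs_zc Pm_continuous)
  qed
  finally have "(LINT t|leb TT. ?O t) = (LINT t|leb TT. 1/2 * ?I t)" .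
  moreover have "Defs.D2 (ell P (\<alpha>, \<beta>, p)) (xh 0, xh TT) (x 0, x TT) (x 0, x TT)
    = (\<Sum>i<KK. mu \<alpha> \<beta> i * d2 (cf P i) q0 (fst ?h, Z 0 ?h TT) (fst ?h, Z 0 ?h TT))"
    unfolding Defs.D2_def C2_frechet[OF ell_C2 has_derivative_ident] q0_eq using xZ[of TT] T0 by simp
  ultimately show ?thesis
    unfolding Omega_def J_eq[OF h] by simp
qed

end

lemma continuous_inner_integrable:
  fixes p r :: "real \<Rightarrow> 'a::euclidean_space"
  assumes p: "continuous_on {0..T} p" and r: "integrable (leb T) r"
  shows "integrable (leb T) (\<lambda>s. p s \<bullet> r s)"
proof -
  obtain B where B: "0 \<le> B" "\<And>s. s \<in> {0..T} \<Longrightarrow> norm (p s) \<le> B" using continuous_on_Icc_bounded[OF p] by blast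
  show ?thesis
  proof (rule Bochner_Integration.integrable_bound)
    show "integrable (leb T) (\<lambda>s. B * norm (r s))" using r by simp
    show "(\<lambda>s. p s \<bullet> r s) \<in> borel_measurable (leb T)"
      by (intro borel_measurable_inner leb_continuous_measurable p borel_measurable_integrable r)
    show "AE s in leb T. norm (p s \<bullet> r s) \<le> norm (B * norm (r s))"
    proof (rule AE_I2)
      fix s assume "s \<in> space (leb T)"
      then have "norm (p s) \<le> B" using B(2) by simp
      then have "norm (p s) * norm (r s) \<le> B * norm (r s)" by (rule mult_right_mono) simp
      then show "norm (p s \<bullet> r s) \<le> norm (B * norm (r s))"
        using Cauchy_Schwarz_ineq2[of "p s" "r s"] B(1) by simp
    qed
  qed
qed

context control_system
begin

lemma adjsol_sum:
  assumes p: "\<And>i. i \<in> I \<Longrightarrow> adjsol (p i)"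
  shows "adjsol (\<lambda>t. \<Sum>i\<in>I. c i *\<^sub>R p i t)"
  unfolding adjsol_def
proof (intro conjI ballI)
  have pc: "continuous_on {0..T} (p i)" if "i \<in> I" for i using p[OF that] by (simp add: adjsol_def)
  then show "continuous_on {0..T} (\<lambda>t. \<Sum>i\<in>I. c i *\<^sub>R p i t)" by (intro continuous_intros)
  fix t assume t: "t \<in> {0..T}"
  have Adj: "- Adj s (\<Sum>i\<in>I. c i *\<^sub>R p i s) = (\<Sum>i\<in>I. c i *\<^sub>R - Adj s (p i s))" for s
  proof -
    have "\<forall>a. - Adj s (\<Sum>i\<in>I. c i *\<^sub>R p i s) \<bullet> a = (\<Sum>i\<in>I. c i *\<^sub>R - Adj s (p i s)) \<bullet> a"
      by (simp add: Adj_inner inner_sum_left sum_negf)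
    then show ?thesis by (rule vector_eq_rdot[THEN iffD1])
  qed
  have i: "integrable (leb t) (\<lambda>s. - Adj s (p i s))" if "i \<in> I" for i
    using leb_integrable_mono[OF Adj_integrable[OF pc[OF that]]] t by simp
  have "(\<Sum>i\<in>I. c i *\<^sub>R p i t) = (\<Sum>i\<in>I. c i *\<^sub>R (p i 0 + (LINT s|leb t. - Adj s (p i s))))"
  proof (intro sum.cong refl)
    fix i assume "i \<in> I"
    then have "p i t = p i 0 + (LINT s|leb t. - Adj s (p i s))" using p t unfolding adjsol_def by blast
    then show "c i *\<^sub>R p i t = c i *\<^sub>R (p i 0 + (LINT s|leb t. - Adj s (p i s)))" by (rule arg_cong)
  qed
  also have "\<dots> = (\<Sum>i\<in>I. c i *\<^sub>R p i 0) + (\<Sum>i\<in>I. LINT s|leb t. c i *\<^sub>R - Adj s (p i s))"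
    by (simp only: scaleR_add_right sum.distrib integral_scaleR_right)
  also have "(\<Sum>i\<in>I. LINT s|leb t. c i *\<^sub>R - Adj s (p i s)) = (LINT s|leb t. (\<Sum>i\<in>I. c i *\<^sub>R - Adj s (p i s)))"
    by (rule Bochner_Integration.integral_sum[symmetric]) (intro integrable_scaleR_right i)
  finally show "(\<Sum>i\<in>I. c i *\<^sub>R p i t) = (\<Sum>i\<in>I. c i *\<^sub>R p i 0) + (LINT s|leb t. - Adj s (\<Sum>i\<in>I. c i *\<^sub>R p i s))"
    unfolding Adj .
qed

text \<open>Duality with homogeneous solutions gives p 0 = 0, after which the forward Gronwall
  estimate applies.\<close>

lemma adjsol_terminal_zero:
  assumes p: "adjsol p" "p T = 0" and t: "t \<in> {0..T}"
  shows "p t = 0"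
proof -
  have pc: "continuous_on {0..T} p" using p(1) by (simp add: adjsol_def)
  have "p 0 \<bullet> \<zeta> = 0" for \<zeta>
    using adjsol_dual[OF p(1) Lin[OF adm_0 integrable_zero, of \<zeta>] integrable_zero] p(2) by simp
  then have p0: "p 0 = 0" by (metis inner_eq_zero_iff)
  have "norm (p t) \<le> (norm (p 0) + (LINT s|leb T. 0)) * gron Lc T"
  proof (rule gronwall_primitive[OF T0 Lc(1) _ _ integrable_zero])
    show "integrable (leb T) (\<lambda>s. - Adj s (p s))" using Adj_integrable[OF pc] by simp
    show "\<And>t. t \<in> {0..T} \<Longrightarrow> p t = p 0 + (LINT s|leb t. - Adj s (p s))" using p(1) unfolding adjsol_def by blast
    show "AE s in leb T. norm (- Adj s (p s)) \<le> Lc * norm (p s) + 0"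
      by (rule AE_I2) (use Adj_bound in simp)
    show "t \<in> {0..T}" by (rule t)
  qed simp
  then show ?thesis using p0 by simp
qed

lemma adjsol_terminal_unique:
  assumes "adjsol p" "adjsol p'" "p T = p' T" and t: "t \<in> {0..T}"
  shows "p t = p' t"
proof -
  let ?p = "\<lambda>i::nat. if i = 0 then p else p'" and ?c = "\<lambda>i::nat. if i = 0 then 1 else - 1 :: real"
  have "adjsol (\<lambda>t. \<Sum>i<2. ?c i *\<^sub>R ?p i t)" by (rule adjsol_sum) (use assms in simp)
  then have "adjsol (\<lambda>t. p t - p' t)" by (simp add: numeral_2_eq_2)
  from adjsol_terminal_zero[OF this _ t] show ?thesis using assms(3) by simp
qed

end

section \<open>Multipliers in \<open>Lambda\<close> and annihilating coefficients\<close>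

context ocp_point
begin

lemma Pm_adj: "adjsol (Pm \<mu>)"
  unfolding Pm_def[abs_def] by (rule adjsol_sum) (rule Pa(1))

lemma Pm_T: "Pm \<mu> TT \<bullet> y = (\<Sum>i<KK. \<mu> i * d1 (cf P i) q0 (0, y))"
  unfolding Pm_def inner_sum_left by (intro sum.cong refl) (simp add: Pa(2) pT_inner)

lemma lincomb_A_eq:
  assumes h: "integrable (leb TT) (snd h)"
  shows "(\<Sum>i<KK. \<mu> i * A i h) = (\<Sum>i<KK. \<mu> i * d1 (cf P i) q0 (fst h, 0)) + Pm \<mu> 0 \<bullet> fst h
    + (LINT s|leb TT. Pm \<mu> s \<bullet> F1 (X 0 s, W 0 s) (0, snd h s))"
proof -
  let ?r = "\<lambda>s. F1 (X 0 s, W 0 s) (0, snd h s)"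
  have i: "integrable (leb TT) (\<lambda>s. Pa i s \<bullet> ?r s)" for i
    by (rule continuous_inner_integrable[OF Pa(3) Z_rhs_integrable[OF small_0 h]])
  have "(LINT s|leb TT. Pm \<mu> s \<bullet> ?r s) = (LINT s|leb TT. (\<Sum>i<KK. \<mu> i * (Pa i s \<bullet> ?r s)))"
    by (simp only: Pm_def inner_sum_left inner_scaleR_left)
  also have "\<dots> = (\<Sum>i<KK. LINT s|leb TT. \<mu> i * (Pa i s \<bullet> ?r s))"
    by (rule Bochner_Integration.integral_sum) (rule integrable_mult_right[OF i])
  also have "\<dots> = (\<Sum>i<KK. \<mu> i * (LINT s|leb TT. Pa i s \<bullet> ?r s))" by simp
  finally have I: "(LINT s|leb TT. Pm \<mu> s \<bullet> ?r s) = (\<Sum>i<KK. \<mu> i * (LINT s|leb TT. Pa i s \<bullet> ?r s))" .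
  have "Pm \<mu> 0 \<bullet> fst h = (\<Sum>i<KK. \<mu> i * (Pa i 0 \<bullet> fst h))" by (simp only: Pm_def inner_sum_left inner_scaleR_left)
  moreover have "(\<Sum>i<KK. \<mu> i * A i h) = (\<Sum>i<KK. \<mu> i * d1 (cf P i) q0 (fst h, 0) + \<mu> i * (Pa i 0 \<bullet> fst h)
      + \<mu> i * (LINT s|leb TT. Pa i s \<bullet> ?r s))"
    by (intro sum.cong refl) (simp add: A_eq[OF _ h] distrib_left)
  ultimately show ?thesis unfolding I by (simp only: sum.distrib)
qed

lemma grad_Ham:
  "grad (\<lambda>x. Ham P (\<alpha>, \<beta>, p) x u v t) x = y \<longleftrightarrow> (\<forall>h. p t \<bullet> F1 (x, u, v) (h, 0) = y \<bullet> h)"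
  "grad (\<lambda>u. Ham P (\<alpha>, \<beta>, p) x u v t) u = y' \<longleftrightarrow> (\<forall>h. p t \<bullet> F1 (x, u, v) (0, h, 0) = y' \<bullet> h)"
  "grad (\<lambda>v. Ham P (\<alpha>, \<beta>, p) x u v t) v = y'' \<longleftrightarrow> (\<forall>h. p t \<bullet> F1 (x, u, v) (0, 0, h) = y'' \<bullet> h)"
  unfolding Ham_eq
  by (rule grad_eq_iff, rule has_derivative_partial[OF C2fun_inner[OF F]])+

lemma grad_ell:
  "grad (\<lambda>x0. ell P (\<alpha>, \<beta>, p) (x0, xh TT)) (xh 0) = y \<longleftrightarrow> (\<forall>h. (\<Sum>i<KK. mu \<alpha> \<beta> i * d1 (cf P i) q0 (h, 0)) = y \<bullet> h)"
  "grad (\<lambda>xT. ell P (\<alpha>, \<beta>, p) (xh 0, xT)) (xh TT) = y \<longleftrightarrow> (\<forall>h. (\<Sum>i<KK. mu \<alpha> \<beta> i * d1 (cf P i) q0 (0, h)) = y \<bullet> h)"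
  unfolding q0_eq
  by (rule grad_eq_iff, rule has_derivative_compose[OF has_derivative_Pair[OF has_derivative_ident has_derivative_const] C2_d1[OF ell_C2]])
    (rule grad_eq_iff, rule has_derivative_compose[OF has_derivative_Pair[OF has_derivative_const has_derivative_ident] C2_d1[OF ell_C2]])

lemma F1_control_split: "F1 z (0, u, v) = F1 z (0, u, 0) + F1 z (0, 0, v)"
  using linear_add[OF C2_lin1[OF F], of z "(0, u, 0)" "(0, 0, v)"] by simp

definition annihilates :: "(nat \<Rightarrow> real) \<Rightarrow> bool"
  where "annihilates \<mu> \<longleftrightarrow> (\<forall>h\<in>UNIV \<times> Bm. (\<Sum>i<KK. \<mu> i * A i h) = 0)"

text \<open>On the interval a multiplier is determined by its finite-dimensional part: p and
  \<open>Pm\<close> solve the same adjoint equation with the same terminal value. This reduces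
  compactness of the multiplier set to finite dimensions.\<close>

lemma Lambda_adjoint:
  assumes "(\<alpha>, \<beta>, p) \<in> Lambda P what" and t: "t \<in> {0..TT}"
  shows "p t = Pm (mu \<alpha> \<beta>) t"
proof (rule adjsol_terminal_unique[OF _ Pm_adj _ t])
  have p: "p \<in> W1inf TT" and pT: "p TT = grad (\<lambda>xT. ell P (\<alpha>, \<beta>, p) (xh 0, xT)) (xh TT)"
    and ae: "AE t in leb TT. - wderiv TT p t = grad (\<lambda>x. Ham P (\<alpha>, \<beta>, p) x (uh t) (vh t) t) (xh t)"
    using assms(1) by (simp_all add: Lambda_def)
  have w: "has_wderiv TT p (wderiv TT p)" using p has_wderiv_wderiv unfolding W1inf_def by blast
  have i: "integrable (leb TT) (wderiv TT p)" and e: "\<And>t. t \<in> {0..TT} \<Longrightarrow> p t = p 0 + (LINT s|leb t. wderiv TT p s)"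
    using w unfolding has_wderiv_def by blast+
  have c: "continuous_on {0..TT} p" by (rule primitive_continuous[OF i e])
  have iA: "integrable (leb TT) (\<lambda>s. - Adj s (p s))" using Adj_integrable[OF c] by simp
  have "AE s in leb TT. wderiv TT p s = - Adj s (p s)"
    using ae AE_ref
  proof eventually_elim
    case (elim s)
    from elim(1) have "\<forall>h. p s \<bullet> F1 (xh s, uh s, vh s) (h, 0) = (- wderiv TT p s) \<bullet> h"
      by (rule iffD1[OF grad_Ham(1) sym])
    then have "\<forall>h. Adj s (p s) \<bullet> h = (- wderiv TT p s) \<bullet> h" using elim(2) by (simp add: Adj_inner)
    then have "Adj s (p s) = - wderiv TT p s" by (rule vector_eq_rdot[THEN iffD1])
    then show ?case by simp
  qed
  then have "p t = p 0 + (LINT s|leb t. - Adj s (p s))" if "t \<in> {0..TT}" for t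
    using e[OF that] leb_integral_cong_AE[OF i iA, of t] that by simp
  then show "adjsol p" using c unfolding adjsol_def by blast
  have "\<forall>h. p TT \<bullet> h = Pm (mu \<alpha> \<beta>) TT \<bullet> h"
    using pT[symmetric] unfolding grad_ell Pm_T by simp
  then show "p TT = Pm (mu \<alpha> \<beta>) TT" by (rule vector_eq_rdot[THEN iffD1])
qed

text \<open>Through the adjoint, the combination of the A i becomes an initial-state term and an
  integral; transversality at time 0 removes the first, stationarity of the Hamiltonian in both
  controls the second.\<close>

lemma Lambda_annihilates:
  assumes L: "(\<alpha>, \<beta>, p) \<in> Lambda P what"
  shows "annihilates (mu \<alpha> \<beta>)"
  unfolding annihilates_def
proof
  fix h assume "h \<in> (UNIV :: (real^'n) set) \<times> Bm"
  then have i: "integrable (leb TT) (snd h)" using Bm_integrable by auto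
  have p0: "p 0 = - grad (\<lambda>x0. ell P (\<alpha>, \<beta>, p) (x0, xh TT)) (xh 0)"
    and u: "AE t in leb TT. grad (\<lambda>u. Ham P (\<alpha>, \<beta>, p) (xh t) u (vh t) t) (uh t) = 0"
    and v: "AE t in leb TT. grad (\<lambda>v. Ham P (\<alpha>, \<beta>, p) (xh t) (uh t) v t) (vh t) = 0"
    using L by (simp_all add: Lambda_def)
  have pe: "\<And>t. t \<in> {0..TT} \<Longrightarrow> p t = Pm (mu \<alpha> \<beta>) t" by (rule Lambda_adjoint[OF L])
  have "grad (\<lambda>x0. ell P (\<alpha>, \<beta>, p) (x0, xh TT)) (xh 0) = - p 0" using p0 by simp
  then have "(\<Sum>i<KK. mu \<alpha> \<beta> i * d1 (cf P i) q0 (fst h, 0)) = (- p 0) \<bullet> fst h" unfolding grad_ell by blast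
  then have 1: "(\<Sum>i<KK. mu \<alpha> \<beta> i * d1 (cf P i) q0 (fst h, 0)) + Pm (mu \<alpha> \<beta>) 0 \<bullet> fst h = 0" using pe[of 0] T0 by simp
  have "AE s in leb TT. Pm (mu \<alpha> \<beta>) s \<bullet> F1 (X 0 s, W 0 s) (0, snd h s) = 0"
    using u v AE_ref
  proof eventually_elim
    case (elim s)
    have "p s \<bullet> F1 (xh s, uh s, vh s) (0, fst (snd h s), 0) = 0" "p s \<bullet> F1 (xh s, uh s, vh s) (0, 0, snd (snd h s)) = 0"
      using elim(1,2) unfolding grad_Ham by simp_all
    then have "p s \<bullet> F1 (xh s, uh s, vh s) (0, fst (snd h s), snd (snd h s)) = 0"
      by (subst F1_control_split) (simp add: inner_add_right)
    then show ?case using pe[of s] elim(3) by simp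
  qed
  then have "(LINT s|leb TT. Pm (mu \<alpha> \<beta>) s \<bullet> F1 (X 0 s, W 0 s) (0, snd h s)) = 0" by (rule integral_eq_zero_AE)
  then show "(\<Sum>i<KK. mu \<alpha> \<beta> i * A i h) = 0" unfolding lincomb_A_eq[OF i] using 1 by simp
qed

text \<open>Annihilation is tested twice: with the zero control it yields the initial condition for
  the adjoint, and with the control \<omega>, the gradient of the Hamiltonian in the controls, it
  says that the integral of |\<omega>|^2 is zero.\<close>

lemma annihilates_stationary:
  assumes a: "annihilates \<mu>"
  shows "(\<Sum>i<KK. \<mu> i * d1 (cf P i) q0 (\<xi>, 0)) = (- Pm \<mu> 0) \<bullet> \<xi>"
    and "AE s in leb TT. \<forall>k. Pm \<mu> s \<bullet> F1 (X 0 s, W 0 s) (0, k) = 0"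
proof -
  have zB: "(\<lambda>_. 0) \<in> Bm" using subspace_0[OF subspace_Bm] by (simp add: zero_fun_def)
  have l0: "F1 z (0, 0) = 0" for z using linear_0[OF C2_lin1[OF F], of z] by (simp add: zero_prod_def)
  have "(\<Sum>i<KK. \<mu> i * A i (\<xi>, \<lambda>_. 0)) = 0" using a zB unfolding annihilates_def by blast
  then show "(\<Sum>i<KK. \<mu> i * d1 (cf P i) q0 (\<xi>, 0)) = (- Pm \<mu> 0) \<bullet> \<xi>"
    using lincomb_A_eq[of "(\<xi>, \<lambda>_. 0)" \<mu>] Bm_integrable[OF zB]
    by (simp only: fst_conv snd_conv l0 inner_zero_right Bochner_Integration.integral_zero inner_minus_left)
  \<comment> \<open>Riesz representative of k \<mapsto> Pm \<bullet> F1 (0, k). It is bounded and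
    measurable, hence an admissible test direction.\<close>
  define \<omega> where "\<omega> s = (\<Sum>b\<in>Basis. (Pm \<mu> s \<bullet> F1 (X 0 s, W 0 s) (0, b)) *\<^sub>R b)" for s
  have om: "\<omega> s \<bullet> k = Pm \<mu> s \<bullet> F1 (X 0 s, W 0 s) (0, k)" for s k
  proof -
    have l: "linear (\<lambda>k. Pm \<mu> s \<bullet> F1 (X 0 s, W 0 s) (0, k))"
    proof (rule linearI)
      show "Pm \<mu> s \<bullet> F1 (X 0 s, W 0 s) (0, k + k') = Pm \<mu> s \<bullet> F1 (X 0 s, W 0 s) (0, k) + Pm \<mu> s \<bullet> F1 (X 0 s, W 0 s) (0, k')" for k k'
        using linear_add[OF C2_lin1[OF F], of "(X 0 s, W 0 s)" "(0, k)" "(0, k')"] by (simp add: inner_add_right)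
      show "Pm \<mu> s \<bullet> F1 (X 0 s, W 0 s) (0, c *\<^sub>R k) = c *\<^sub>R (Pm \<mu> s \<bullet> F1 (X 0 s, W 0 s) (0, k))" for c k
        using linear_scale[OF C2_lin1[OF F], of "(X 0 s, W 0 s)" c "(0, k)"] by simp
    qed
    have "Pm \<mu> s \<bullet> F1 (X 0 s, W 0 s) (0, k) = (\<Sum>b\<in>Basis. (k \<bullet> b) *\<^sub>R (Pm \<mu> s \<bullet> F1 (X 0 s, W 0 s) (0, b)))"
      using linear_sum[OF l, of "\<lambda>b. (k \<bullet> b) *\<^sub>R b" Basis] linear_scale[OF l] by (simp only: euclidean_representation)
    then show ?thesis
      unfolding \<omega>_def inner_sum_left inner_scaleR_left real_scaleR_def by (simp only: inner_commute[of _ k] mult.commute)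
  qed
  obtain B where B: "0 \<le> B" "\<And>s. s \<in> {0..TT} \<Longrightarrow> norm (Pm \<mu> s) \<le> B" using continuous_on_Icc_bounded[OF Pm_continuous] by blast
  have omB: "\<omega> \<in> Bm"
    unfolding Bm_def
  proof (intro CollectI conjI exI ballI)
    have b: "(\<lambda>s. Pm \<mu> s \<bullet> F1 (X 0 s, W 0 s) (0, b)) \<in> borel_measurable (leb TT)" for b
      by (rule borel_measurable_inner[OF leb_continuous_measurable[OF Pm_continuous]])
        (rule adm_measurable(2)[OF adm_0], simp_all)
    show "\<omega> \<in> borel_measurable (leb TT)" unfolding \<omega>_def[abs_def] using b by measurable
    fix s assume s: "s \<in> {0..TT}"
    have z: "(X 0 s, W 0 s) \<in> K0" using adm_0 s by (simp add: adm_def)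
    have "norm (\<omega> s) * norm (\<omega> s) = Pm \<mu> s \<bullet> F1 (X 0 s, W 0 s) (0, \<omega> s)"
      using om[of s "\<omega> s"] by (simp add: dot_square_norm power2_eq_square)
    also have "\<dots> \<le> norm (Pm \<mu> s) * norm (F1 (X 0 s, W 0 s) (0, \<omega> s))" by (rule norm_cauchy_schwarz)
    also have "\<dots> \<le> B * (Lc * norm (\<omega> s))"
      using B Lc(4)[OF z, of "(0, \<omega> s)"] s by (intro mult_mono) (auto simp: norm_Pair)
    finally have "norm (\<omega> s) * norm (\<omega> s) \<le> (B * Lc) * norm (\<omega> s)" by (simp add: mult.assoc)
    then show "norm (\<omega> s) \<le> B * Lc"
      using B(1) Lc(1) by (cases "\<omega> s = 0") auto
  qed
  have "(\<Sum>i<KK. \<mu> i * A i (0, \<omega>)) = 0" using a omB unfolding annihilates_def by blast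
  then have I0: "(LINT s|leb TT. Pm \<mu> s \<bullet> F1 (X 0 s, W 0 s) (0, \<omega> s)) = 0"
    using lincomb_A_eq[of "(0, \<omega>)" \<mu>] Bm_integrable[OF omB] linear_0[OF C2_lin1[OF cf], of _ q0] by (simp add: zero_prod_def)
  have "(LINT s|leb TT. \<omega> s \<bullet> \<omega> s) = 0" using I0 by (simp only: om)
  moreover have oL: "\<omega> \<in> L2 TT" using omB Bm_L2 by blast
  ultimately have "AE s in leb TT. \<omega> s \<bullet> \<omega> s = 0"
    using integral_nonneg_eq_0_iff_AE[OF L2_inner_integrable[OF oL oL]] by simp
  then show "AE s in leb TT. \<forall>k. Pm \<mu> s \<bullet> F1 (X 0 s, W 0 s) (0, k) = 0"
    by eventually_elim (simp add: om[symmetric])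
qed

definition mult_norm :: "(nat \<Rightarrow> real) \<Rightarrow> real"
  where "mult_norm \<mu> = L2_set \<mu> {0..dphi P} + L2_set (\<lambda>j. \<mu> (j + dphi P)) {1..deta P}"

lemma mult_norm_mu: "mult_norm (mu \<alpha> \<beta>) = L2_set \<alpha> {0..dphi P} + L2_set \<beta> {1..deta P}"
proof -
  have "L2_set (mu \<alpha> \<beta>) {0..dphi P} = L2_set \<alpha> {0..dphi P}" by (rule L2_set_cong) (auto simp: mu_def)
  moreover have "L2_set (\<lambda>j. mu \<alpha> \<beta> (j + dphi P)) {1..deta P} = L2_set \<beta> {1..deta P}" by (rule L2_set_cong) (auto simp: mu_def)
  ultimately show ?thesis by (simp add: mult_norm_def)
qed

text \<open>\<open>Lambda\<close> requires extensional coefficient functions, hence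
  \<open>restrict\<close>; for sequences vanishing from index \<open>KK\<close> on,
  \<open>mu_restrict\<close> shows that nothing is lost.\<close>

definition mult_of :: "(nat \<Rightarrow> real) \<Rightarrow> 'n multiplier"
  where "mult_of \<mu> = (restrict \<mu> {0..dphi P}, restrict (\<lambda>j. \<mu> (j + dphi P)) {1..deta P}, Pm \<mu>)"

lemma mu_restrict:
  assumes "\<forall>i\<ge>KK. \<mu> i = 0"
  shows "mu (restrict \<mu> {0..dphi P}) (restrict (\<lambda>j. \<mu> (j + dphi P)) {1..deta P}) = \<mu>"
  using assms by (auto simp: mu_def fun_eq_iff)

lemma Pm_W1inf: "Pm \<mu> \<in> W1inf TT" "has_wderiv TT (Pm \<mu>) (\<lambda>s. - Adj s (Pm \<mu> s))"
proof -
  have i: "integrable (leb TT) (\<lambda>s. - Adj s (Pm \<mu> s))" using Adj_integrable[OF Pm_continuous] by simp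
  show w: "has_wderiv TT (Pm \<mu>) (\<lambda>s. - Adj s (Pm \<mu> s))"
    unfolding has_wderiv_def using i Pm_adj[of \<mu>] unfolding adjsol_def by blast
  obtain B where B: "0 \<le> B" "\<And>s. s \<in> {0..TT} \<Longrightarrow> norm (Pm \<mu> s) \<le> B" using continuous_on_Icc_bounded[OF Pm_continuous] by blast
  have "Linf_norm TT (\<lambda>s. - Adj s (Pm \<mu> s)) \<le> ereal (Lc * B)"
    unfolding Linf_norm_def
  proof (rule esssup_I)
    show "(\<lambda>t. ereal (norm (- Adj t (Pm \<mu> t)))) \<in> borel_measurable (leb TT)" using i by measurable
    show "AE t in leb TT. ereal (norm (- Adj t (Pm \<mu> t))) \<le> ereal (Lc * B)"
    proof (rule AE_I2)
      fix s assume "s \<in> space (leb TT)"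
      then have s: "s \<in> {0..TT}" by simp
      have "Lc * norm (Pm \<mu> s) \<le> Lc * B" using B(2)[OF s] Lc(1) by (rule mult_left_mono)
      then show "ereal (norm (- Adj s (Pm \<mu> s))) \<le> ereal (Lc * B)" using Adj_bound[OF s, of "Pm \<mu> s"] by simp
    qed
  qed
  then have "Linf_norm TT (\<lambda>s. - Adj s (Pm \<mu> s)) < \<infinity>" by (rule le_less_trans) simp
  then have "(\<lambda>s. - Adj s (Pm \<mu> s)) \<in> Linf TT" using i by (simp add: Linf_def borel_measurable_integrable)
  then show "Pm \<mu> \<in> W1inf TT" unfolding W1inf_def using w by blast
qed

lemma mult_of_Lambda:
  assumes s: "\<forall>i\<ge>KK. \<mu> i = 0" and pos: "\<forall>i<Suc (dphi P). 0 \<le> \<mu> i" and N: "mult_norm \<mu> = 1" and a: "annihilates \<mu>"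
  shows "mult_of \<mu> \<in> Lambda P what"
proof -
  let ?\<alpha> = "restrict \<mu> {0..dphi P}" and ?\<beta> = "restrict (\<lambda>j. \<mu> (j + dphi P)) {1..deta P}"
  note mu = mu_restrict[OF s]
  have 1: "L2_set ?\<alpha> {0..dphi P} + L2_set ?\<beta> {1..deta P} = 1" using N mult_norm_mu[of ?\<alpha> ?\<beta>] mu by simp
  have st: "AE s in leb TT. \<forall>k. Pm \<mu> s \<bullet> F1 (xh s, uh s, vh s) (0, k) = 0"
    using annihilates_stationary(2)[OF a] AE_ref by eventually_elim simp
  have 2: "AE t in leb TT. grad (\<lambda>u. Ham P (?\<alpha>, ?\<beta>, Pm \<mu>) (xh t) u (vh t) t) (uh t) = 0"
    "AE t in leb TT. grad (\<lambda>v. Ham P (?\<alpha>, ?\<beta>, Pm \<mu>) (xh t) (uh t) v t) (vh t) = 0"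
    unfolding grad_Ham using st by (eventually_elim, simp)+
  have 3: "AE t in leb TT. - wderiv TT (Pm \<mu>) t = grad (\<lambda>x. Ham P (?\<alpha>, ?\<beta>, Pm \<mu>) x (uh t) (vh t) t) (xh t)"
    using wderiv_AE[OF Pm_W1inf(2)[of \<mu>] T0] AE_ref
  proof eventually_elim
    case (elim t)
    have "\<forall>h. Pm \<mu> t \<bullet> F1 (xh t, uh t, vh t) (h, 0) = (- wderiv TT (Pm \<mu>) t) \<bullet> h"
      using elim Adj_inner[of t "Pm \<mu> t"] by simp
    then show ?case by (rule sym[OF iffD2[OF grad_Ham(1)]])
  qed
  have "grad (\<lambda>x0. ell P (?\<alpha>, ?\<beta>, Pm \<mu>) (x0, xh TT)) (xh 0) = - Pm \<mu> 0"
    unfolding grad_ell mu using annihilates_stationary(1)[OF a] by blast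
  then have 4: "Pm \<mu> 0 = - grad (\<lambda>x0. ell P (?\<alpha>, ?\<beta>, Pm \<mu>) (x0, xh TT)) (xh 0)" by simp
  have "grad (\<lambda>xT. ell P (?\<alpha>, ?\<beta>, Pm \<mu>) (xh 0, xT)) (xh TT) = Pm \<mu> TT"
    unfolding grad_ell mu using Pm_T by simp
  then have 5: "Pm \<mu> TT = grad (\<lambda>xT. ell P (?\<alpha>, ?\<beta>, Pm \<mu>) (xh 0, xT)) (xh TT)" by simp
  show ?thesis
    unfolding Lambda_def mult_of_def case_prod_conv mem_Collect_eq
    using 1 2 3 4 5 pos Pm_W1inf(1) by (intro conjI) auto
qed

end

section \<open>Continuous functionals and weak convergence\<close>

lemma W2_norm_ge:
  fixes x :: "real \<Rightarrow> real^'n::finite" and u :: "real \<Rightarrow> real^'l::finite" and v :: "real \<Rightarrow> real^'m::finite"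
  assumes "(x, u, v) \<in> W2 T"
  shows "L2_norm T x \<le> W2_norm T (x, u, v)" "L2_norm T (wderiv T x) \<le> W2_norm T (x, u, v)"
    "L2_norm T (\<lambda>t. (u t, v t)) \<le> W2_norm T (x, u, v)"
proof -
  have "(L2_norm T (\<lambda>t. (u t, v t)))\<^sup>2 = (L2_norm T u)\<^sup>2 + (L2_norm T v)\<^sup>2"
    using assms L2_Pair(2) by (auto simp: W2_def)
  then show "L2_norm T x \<le> W2_norm T (x, u, v)" "L2_norm T (wderiv T x) \<le> W2_norm T (x, u, v)"
    "L2_norm T (\<lambda>t. (u t, v t)) \<le> W2_norm T (x, u, v)"
    unfolding W2_norm_def case_prod_conv by (auto intro!: real_le_rsqrt)
qed

lemma W2_pointwise_bound:
  fixes x :: "real \<Rightarrow> real^'n::finite" and u :: "real \<Rightarrow> real^'l::finite" and v :: "real \<Rightarrow> real^'m::finite"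
  assumes w: "(x, u, v) \<in> W2 T" and T: "0 < T" and t: "t \<in> {0..T}"
  shows "norm (x t) \<le> (1 / sqrt T + sqrt T) * W2_norm T (x, u, v)"
proof -
  have "x \<in> W12 T" using w by (simp add: W2_def)
  then have "norm (x t) \<le> L2_norm T x / sqrt T + sqrt T * L2_norm T (wderiv T x)" using T t by (rule Sobolev_bound)
  also have "\<dots> \<le> W2_norm T (x, u, v) / sqrt T + sqrt T * W2_norm T (x, u, v)"
    using W2_norm_ge[OF w] T by (intro add_mono divide_right_mono mult_left_mono) auto
  finally show ?thesis by (simp add: distrib_right)
qed

lemma W2_dualI:
  fixes L :: "('n::finite, 'l::finite, 'm::finite) traj \<Rightarrow> real"
  assumes "\<And>x u v y r s. (x, u, v) \<in> W2 T \<Longrightarrow> (y, r, s) \<in> W2 T \<Longrightarrow>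
      L (\<lambda>t. x t + y t, \<lambda>t. u t + r t, \<lambda>t. v t + s t) = L (x, u, v) + L (y, r, s)"
    and "\<And>x u v c. (x, u, v) \<in> W2 T \<Longrightarrow> L (\<lambda>t. c *\<^sub>R x t, \<lambda>t. c *\<^sub>R u t, \<lambda>t. c *\<^sub>R v t) = c * L (x, u, v)"
    and "\<And>x u v. (x, u, v) \<in> W2 T \<Longrightarrow> \<bar>L (x, u, v)\<bar> \<le> C * W2_norm T (x, u, v)"
  shows "L \<in> W2_dual T"
  unfolding W2_dual_def mem_Collect_eq
proof (intro conjI exI ballI)
  show "case p of (x, u, v) \<Rightarrow> \<forall>(y, r, s)\<in>W2 T.
      L (\<lambda>t. x t + y t, \<lambda>t. u t + r t, \<lambda>t. v t + s t) = L (x, u, v) + L (y, r, s)" if "p \<in> W2 T" for p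
    using assms(1) that by (cases p) fast
  show "case p of (x, u, v) \<Rightarrow> \<forall>c. L (\<lambda>t. c *\<^sub>R x t, \<lambda>t. c *\<^sub>R u t, \<lambda>t. c *\<^sub>R v t) = c * L (x, u, v)"
    if "p \<in> W2 T" for p
    using assms(2) that by (cases p) fast
  show "\<bar>L p\<bar> \<le> C * W2_norm T p" if "p \<in> W2 T" for p
    using assms(3) that by (cases p) fast
qed

lemma abs_le_L2_set:
  assumes "finite I" "i \<in> I"
  shows "\<bar>f i\<bar> \<le> L2_set f I"
proof -
  have "(f i)\<^sup>2 \<le> (\<Sum>j\<in>I. (f j)\<^sup>2)" using assms by (intro member_le_sum) auto
  then show ?thesis unfolding L2_set_def by (intro real_le_rsqrt) simp
qed

context ocp_point
begin

abbreviation "cS \<equiv> 1 / sqrt TT + sqrt TT"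

lemma cS: "0 \<le> cS" using T by simp

lemma direction_add: "direction (\<lambda>t. x t + y t, \<lambda>t. u t + r t, \<lambda>t. v t + s t) = direction (x, u, v) + direction (y, r, s)"
  by (simp add: direction_def plus_fun_def)

lemma direction_scale: "direction (\<lambda>t. c *\<^sub>R x t, \<lambda>t. c *\<^sub>R u t, \<lambda>t. c *\<^sub>R v t) = c *\<^sub>R direction (x, u, v)"
  by (simp add: direction_def scaleR_fun_def)

lemma ip_direction_bound:
  assumes w: "(x, u, v) \<in> W2 TT"
  shows "sqrt (ip (direction (x, u, v)) (direction (x, u, v))) \<le> (cS + 1) * W2_norm TT (x, u, v)"
proof -
  have "sqrt (ip (direction (x, u, v)) (direction (x, u, v))) \<le> norm (x 0) + L2_norm TT (\<lambda>t. (u t, v t))"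
    unfolding ip_self direction_simp by (rule sqrt_sum_squares_le_sum) (simp_all add: L2_norm_nonneg)
  also have "\<dots> \<le> cS * W2_norm TT (x, u, v) + W2_norm TT (x, u, v)"
    by (intro add_mono W2_pointwise_bound[OF w T] W2_norm_ge(3)[OF w]) (simp add: T0)
  finally show ?thesis by (simp add: distrib_right)
qed

text \<open>Weak convergence is tested by functionals on all of \<open>W2\<close>, where the state
  is not tied to the control. Using the state component itself in place of its Z extends
  \<open>b i _ h\<close> from \<open>H2\<close> to a bounded functional on
  \<open>W2\<close>.\<close>

definition weak_functional :: "nat \<Rightarrow> (real^'n) \<times> (real \<Rightarrow> (real^'l) \<times> (real^'m)) \<Rightarrow> ('n, 'l, 'm) traj \<Rightarrow> real"
  where "weak_functional i h w = d2 (cf P i) q0 (fst w 0, fst w TT) (fst h, Z 0 h TT) +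
    (LINT s|leb TT. Pa i s \<bullet> F2 (X 0 s, W 0 s) (fst w s, snd (direction w) s) (Z 0 h s, snd h s))"

lemma weak_functional_dual:
  assumes i: "i < KK" and h: "h \<in> Hs"
  shows "weak_functional i h \<in> W2_dual TT"
proof -
  have int: "integrable (leb TT) (\<lambda>s. Pa i s \<bullet> F2 (X 0 s, W 0 s) (x s, u s, v s) (Z 0 h s, snd h s))"
    if w: "(x, u, v) \<in> W2 TT" for x :: "real \<Rightarrow> real^'n" and u :: "real \<Rightarrow> real^'l" and v :: "real \<Rightarrow> real^'m"
  proof -
    have "continuous_on {0..TT} x" using w W12_wderiv(3)[of x TT] T0 by (simp add: W2_def)
    then show ?thesis using F2_two_integrable[OF direction_Hs[OF w] h _ Hs_zc[OF h] Pa(3)] by simp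
  qed
  obtain B where B: "0 \<le> B" "\<And>s. s \<in> {0..TT} \<Longrightarrow> norm (Z 0 h s) \<le> B" using continuous_on_Icc_bounded[OF Hs_zc[OF h]] by blast
  obtain Q where Q: "0 \<le> Q" "\<And>s. s \<in> {0..TT} \<Longrightarrow> norm (Pa i s) \<le> Q" using continuous_on_Icc_bounded[OF Pa(3)] by blast
  obtain C where C: "0 \<le> C" "\<And>y z. norm (d2 (cf P i) q0 y z) \<le> C * norm y * norm z"
    using C2_bounds[OF cf[OF i], of "{q0}"] by auto
  have hL: "snd h \<in> L2 TT" using h by (auto simp: Hs_def)
  \<comment> \<open>The bound for the endpoint term plus those for the four terms of
    \<open>F2_two_bound\<close>, each with the norm of the argument factored out.\<close>
  define M where "M = C * (2 * cS) * norm (fst h, Z 0 h TT)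
    + Q * Lc * (TT * (cS * B) + cS * (LINT s|leb TT. norm (snd h s)) + B * sqrt TT + L2_norm TT (snd h))"
  show ?thesis
  proof (rule W2_dualI[where C = M])
    fix x y :: "real \<Rightarrow> real^'n" and u r :: "real \<Rightarrow> real^'l" and v s :: "real \<Rightarrow> real^'m" assume w: "(x, u, v) \<in> W2 TT" "(y, r, s) \<in> W2 TT"
    have "d2 (cf P i) q0 (x 0 + y 0, x TT + y TT) k = d2 (cf P i) q0 (x 0, x TT) k + d2 (cf P i) q0 (y 0, y TT) k" for k
      using linear_add[OF C2_lin2'[OF cf[OF i]], of q0 "(x 0, x TT)" "(y 0, y TT)" k] by simp
    moreover have "F2 z (x t + y t, u t + r t, v t + s t) k = F2 z (x t, u t, v t) k + F2 z (y t, r t, s t) k" for z t k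
      using linear_add[OF C2_lin2'[OF F], of z "(x t, u t, v t)" "(y t, r t, s t)" k] by simp
    ultimately show "weak_functional i h (\<lambda>t. x t + y t, \<lambda>t. u t + r t, \<lambda>t. v t + s t) = weak_functional i h (x, u, v) + weak_functional i h (y, r, s)"
      unfolding weak_functional_def direction_simp fst_conv
      by (simp only: inner_add_right Bochner_Integration.integral_add[OF int[OF w(1)] int[OF w(2)]] add_ac)
  next
    fix x :: "real \<Rightarrow> real^'n" and u :: "real \<Rightarrow> real^'l" and v :: "real \<Rightarrow> real^'m" and c assume w: "(x, u, v) \<in> W2 TT"
    have "d2 (cf P i) q0 (c *\<^sub>R x 0, c *\<^sub>R x TT) k = c * d2 (cf P i) q0 (x 0, x TT) k" for k
      using linear_scale[OF C2_lin2'[OF cf[OF i]], of q0 c "(x 0, x TT)" k] by simp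
    moreover have "F2 z (c *\<^sub>R x t, c *\<^sub>R u t, c *\<^sub>R v t) k = c *\<^sub>R F2 z (x t, u t, v t) k" for z t k
      using linear_scale[OF C2_lin2'[OF F], of z c "(x t, u t, v t)" k] by simp
    ultimately show "weak_functional i h (\<lambda>t. c *\<^sub>R x t, \<lambda>t. c *\<^sub>R u t, \<lambda>t. c *\<^sub>R v t) = c * weak_functional i h (x, u, v)"
      unfolding weak_functional_def direction_simp fst_conv
      by (simp only: inner_scaleR_right Bochner_Integration.integral_mult_right_zero distrib_left)
  next
    fix x :: "real \<Rightarrow> real^'n" and u :: "real \<Rightarrow> real^'l" and v :: "real \<Rightarrow> real^'m" assume w: "(x, u, v) \<in> W2 TT"
    define N where "N = W2_norm TT (x, u, v)"
    have N: "0 \<le> N" using W2_norm_ge(1)[OF w] L2_norm_nonneg[of TT x] unfolding N_def by linarith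
    have xN: "norm (x t) \<le> cS * N" if "t \<in> {0..TT}" for t
      unfolding N_def by (rule W2_pointwise_bound[OF w T that])
    let ?k = "direction (x, u, v)"
    have k: "?k \<in> Hs" by (rule direction_Hs[OF w])
    have kL: "snd ?k \<in> L2 TT" using k unfolding Hs_def mem_Times_iff by blast
    have kN: "L2_norm TT (snd ?k) \<le> N" using W2_norm_ge(3)[OF w] by (simp add: N_def)
    have "norm (x 0, x TT) \<le> norm (x 0) + norm (x TT)" by (rule norm_Pair_le)
    also have "\<dots> \<le> cS * N + cS * N" by (intro add_mono xN) (simp_all add: T0)
    also have "\<dots> = 2 * cS * N" by (simp only: mult_2 distrib_right)
    finally have "C * norm (x 0, x TT) * norm (fst h, Z 0 h TT) \<le> C * (2 * cS * N) * norm (fst h, Z 0 h TT)"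
      using C(1) by (intro mult_right_mono mult_left_mono) auto
    then have 1: "\<bar>d2 (cf P i) q0 (x 0, x TT) (fst h, Z 0 h TT)\<bar> \<le> C * (2 * cS * N) * norm (fst h, Z 0 h TT)"
      using C(2)[of "(x 0, x TT)" "(fst h, Z 0 h TT)"] by simp
    let ?f = "\<lambda>s. Pa i s \<bullet> F2 (X 0 s, W 0 s) (x s, u s, v s) (Z 0 h s, snd h s)"
    let ?A = "cS * N"
    have i1: "integrable (leb TT) (\<lambda>s. ?A * B)" "integrable (leb TT) (\<lambda>s. ?A * norm (snd h s))"
      "integrable (leb TT) (\<lambda>s. B * norm (snd ?k s))" "integrable (leb TT) (\<lambda>s. norm (snd ?k s) * norm (snd h s))"
      using L2_norm_integrable[OF hL] L2_norm_integrable[OF kL] L2_norm_mult_integrable[OF kL hL]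
      by (simp_all add: leb_continuous_integrable)
    have "\<bar>LINT s|leb TT. ?f s\<bar> \<le> (LINT s|leb TT. \<bar>?f s\<bar>)" by (rule integral_abs_bound)
    also have "\<dots> \<le> (LINT s|leb TT. Q * Lc * (?A * B + ?A * norm (snd h s) + B * norm (snd ?k s) + norm (snd ?k s) * norm (snd h s)))"
    proof (rule leb_integral_le[OF integrable_abs[OF int[OF w]] dom_integrable[OF k h]])
      fix s assume s: "s \<in> {0..TT}"
      show "\<bar>?f s\<bar> \<le> Q * Lc * (?A * B + ?A * norm (snd h s) + B * norm (snd ?k s) + norm (snd ?k s) * norm (snd h s))"
        by (rule F2_two_bound[OF s xN[OF s] B(2)[OF s] Q(2)[OF s]]) simp_all
    qed
    also have "\<dots> = Q * Lc * (TT * (?A * B) + ?A * (LINT s|leb TT. norm (snd h s)) + B * (LINT s|leb TT. norm (snd ?k s))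
        + (LINT s|leb TT. norm (snd ?k s) * norm (snd h s)))"
      using i1 leb_integral_const[OF T0, of "?A * B"] by (simp only: Bochner_Integration.integral_mult_right_zero
          Bochner_Integration.integral_add Bochner_Integration.integrable_add)
    also have "\<dots> \<le> Q * Lc * (TT * (?A * B) + ?A * (LINT s|leb TT. norm (snd h s)) + B * (N * sqrt TT) + N * L2_norm TT (snd h))"
    proof (intro mult_left_mono add_mono order_refl)
      show "(LINT s|leb TT. norm (snd ?k s)) \<le> N * sqrt TT"
        by (rule order_trans[OF L1_le_L2[OF kL T0] mult_right_mono[OF kN]]) (simp add: T0)
      show "(LINT s|leb TT. norm (snd ?k s) * norm (snd h s)) \<le> N * L2_norm TT (snd h)"
        by (rule order_trans[OF L2_Cauchy_Schwarz[OF kL hL] mult_right_mono[OF kN L2_norm_nonneg]])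
    qed (use B(1) Q(1) Lc(1) mult_nonneg_nonneg[OF cS N] T0 in auto)
    finally have 2: "\<bar>LINT s|leb TT. ?f s\<bar> \<le> Q * Lc * (TT * (?A * B) + ?A * (LINT s|leb TT. norm (snd h s)) + B * (N * sqrt TT) + N * L2_norm TT (snd h))" .
    have "\<bar>weak_functional i h (x, u, v)\<bar> \<le> C * (2 * cS * N) * norm (fst h, Z 0 h TT) + Q * Lc * (TT * (?A * B) + ?A * (LINT s|leb TT. norm (snd h s)) + B * (N * sqrt TT) + N * L2_norm TT (snd h))"
      unfolding weak_functional_def direction_simp fst_conv by (rule order_trans[OF abs_triangle_ineq add_mono[OF 1 2]])
    also have "\<dots> = M * N" unfolding M_def by (simp only: distrib_right distrib_left mult_ac)
    finally show "\<bar>weak_functional i h (x, u, v)\<bar> \<le> M * W2_norm TT (x, u, v)" by (simp add: N_def)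
  qed
qed

text \<open>Geometrically weighted series over vectors of the unit ball converge absolutely to
  bounded functionals; these are the test functionals of \<open>gliding_hump\<close>.\<close>

lemma ip_series_dual:
  assumes e: "\<And>j. e j \<in> Hs" "\<And>j. ip (e j) (e j) \<le> 1" and s: "\<And>j::nat. \<bar>s j\<bar> \<le> (1/3)^j"
  shows "(\<lambda>w. \<Sum>j. s j * ip (direction w) (e j)) \<in> W2_dual TT"
proof -
  have b: "norm (s j * ip h (e j)) \<le> (1/3)^j * sqrt (ip h h)" if h: "h \<in> Hs" for h j
  proof -
    have "(ip h (e j))\<^sup>2 \<le> ip h h * ip (e j) (e j)" by (rule psd_Cauchy_Schwarz[OF bilin_ip subspace_Hs ip_nonneg h e(1)])
    also have "\<dots> \<le> ip h h" using e(2)[of j] ip_nonneg[of h] by (simp add: mult_left_le)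
    finally have "\<bar>ip h (e j)\<bar> \<le> sqrt (ip h h)" by (intro real_le_rsqrt) simp
    then show ?thesis using s[of j] by (simp add: abs_mult mult_mono)
  qed
  have g: "summable (\<lambda>j. (1/3::real)^j)" by (rule summable_geometric) simp
  have sm: "summable (\<lambda>j. s j * ip h (e j))" if "h \<in> Hs" for h
    by (rule summable_comparison_test'[OF summable_mult2[OF g] b[OF that]])
  let ?C = "\<Sum>j. (1/3::real)^j"
  have C: "0 \<le> ?C" by (rule suminf_nonneg[OF g]) simp
  show ?thesis
  proof (rule W2_dualI[where C = "?C * (cS + 1)"])
    fix x y :: "real \<Rightarrow> real^'n" and u r :: "real \<Rightarrow> real^'l" and v q :: "real \<Rightarrow> real^'m" assume w: "(x, u, v) \<in> W2 TT" "(y, r, q) \<in> W2 TT"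
    note h = direction_Hs[OF w(1)] direction_Hs[OF w(2)]
    have "s j * ip (direction (x, u, v) + direction (y, r, q)) (e j) = s j * ip (direction (x, u, v)) (e j) + s j * ip (direction (y, r, q)) (e j)" for j
      using lin_on_add[OF bilin_on_lin[OF bilin_ip e(1)] h, of j] by (simp add: distrib_left)
    then show "(\<Sum>j. s j * ip (direction (\<lambda>t. x t + y t, \<lambda>t. u t + r t, \<lambda>t. v t + q t)) (e j)) =
        (\<Sum>j. s j * ip (direction (x, u, v)) (e j)) + (\<Sum>j. s j * ip (direction (y, r, q)) (e j))"
      unfolding direction_add by (simp only: suminf_add[OF sm[OF h(1)] sm[OF h(2)]])
  next
    fix x :: "real \<Rightarrow> real^'n" and u :: "real \<Rightarrow> real^'l" and v :: "real \<Rightarrow> real^'m" and c assume w: "(x, u, v) \<in> W2 TT"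
    note h = direction_Hs[OF w]
    have "s j * ip (c *\<^sub>R direction (x, u, v)) (e j) = c * (s j * ip (direction (x, u, v)) (e j))" for j
      using lin_on_scale[OF bilin_on_lin[OF bilin_ip e(1)] h, of c j] by simp
    then show "(\<Sum>j. s j * ip (direction (\<lambda>t. c *\<^sub>R x t, \<lambda>t. c *\<^sub>R u t, \<lambda>t. c *\<^sub>R v t)) (e j)) = c * (\<Sum>j. s j * ip (direction (x, u, v)) (e j))"
      unfolding direction_scale by (simp only: suminf_mult[OF sm[OF h]])
  next
    fix x :: "real \<Rightarrow> real^'n" and u :: "real \<Rightarrow> real^'l" and v :: "real \<Rightarrow> real^'m" assume w: "(x, u, v) \<in> W2 TT"
    note h = direction_Hs[OF w]
    have "norm (\<Sum>j. s j * ip (direction (x, u, v)) (e j)) \<le> (\<Sum>j. (1/3)^j * sqrt (ip (direction (x, u, v)) (direction (x, u, v))))"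
      by (rule norm_suminf_le[OF b[OF h] summable_mult2[OF g]])
    also have "\<dots> = ?C * sqrt (ip (direction (x, u, v)) (direction (x, u, v)))" by (rule suminf_mult2[OF g, symmetric])
    also have "\<dots> \<le> ?C * ((cS + 1) * W2_norm TT (x, u, v))" using ip_direction_bound[OF w] C by (rule mult_left_mono)
    finally show "\<bar>\<Sum>j. s j * ip (direction (x, u, v)) (e j)\<bar> \<le> ?C * (cS + 1) * W2_norm TT (x, u, v)" by (simp only: real_norm_def mult.assoc)
  qed
qed

context
  fixes ws :: "nat \<Rightarrow> ('n, 'l, 'm) traj" and w :: "('n, 'l, 'm) traj"
  assumes w: "w \<in> H2 P what" and ws: "\<And>k. ws k \<in> H2 P what" and wk: "weakly_converges TT ws w"
begin

lemma H2_direction_Hs: "w' \<in> H2 P what \<Longrightarrow> direction w' \<in> Hs"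
  by (cases w') (use H2_Z(1) direction_Hs in blast)

text \<open>Along a weakly convergent sequence the values of every functional from
  \<open>ip_series_dual\<close> converge and so are bounded; the gliding hump turns this into a
  bound on the seminorm given by \<open>ip\<close>.\<close>

lemma weak_bounded: "\<exists>C. \<forall>k. ip (direction (ws k)) (direction (ws k)) \<le> C"
proof (rule gliding_hump[OF bilin_ip subspace_Hs ip_nonneg H2_direction_Hs[OF ws]])
  fix e :: "nat \<Rightarrow> (real^'n) \<times> (real \<Rightarrow> (real^'l) \<times> (real^'m))" and s :: "nat \<Rightarrow> real"
  assume "\<And>j. e j \<in> Hs" "\<And>j. ip (e j) (e j) \<le> 1" "\<And>j. \<bar>s j\<bar> \<le> (1/3)^j"
  then have "(\<lambda>w. \<Sum>j. s j * ip (direction w) (e j)) \<in> W2_dual TT" by (rule ip_series_dual)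
  then have "(\<lambda>k. \<Sum>j. s j * ip (direction (ws k)) (e j)) \<longlonglongrightarrow> (\<Sum>j. s j * ip (direction w) (e j))"
    using wk unfolding weakly_converges_def by (rule bspec[rotated])
  then have "Bseq (\<lambda>k. \<Sum>j. s j * ip (direction (ws k)) (e j))" by (rule convergent_imp_Bseq[OF convergentI])
  then show "\<exists>B. \<forall>k. \<bar>\<Sum>j. s j * ip (direction (ws k)) (e j)\<bar> \<le> B" unfolding Bseq_def real_norm_def by blast
qed

lemma b_weak_functional:
  assumes "w' \<in> H2 P what"
  shows "b i (direction w') h = weak_functional i h w'"
proof (cases w')
  case (fields x u v)
  have x: "\<And>t. t \<in> {0..TT} \<Longrightarrow> x t = Z 0 (direction w') t" using H2_Z(2) assms unfolding fields by blast
  have "(LINT s|leb TT. Pa i s \<bullet> F2 (X 0 s, W 0 s) (Z 0 (direction w') s, snd (direction w') s) (Z 0 h s, snd h s))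
    = (LINT s|leb TT. Pa i s \<bullet> F2 (X 0 s, W 0 s) (fst w' s, snd (direction w') s) (Z 0 h s, snd h s))"
    by (rule Bochner_Integration.integral_cong) (use x fields in auto)
  then show ?thesis using x[of TT] T0 fields by (simp add: b_def weak_functional_def direction_def)
qed

lemma weak_wconv: "wconv (\<lambda>k. direction (ws k)) (direction w)"
  unfolding wconv_def
proof (intro conjI allI impI ballI)
  show "direction w \<in> Hs" "direction (ws k) \<in> Hs" for k using H2_direction_Hs w ws by blast+
  fix i h assume "i < KK" "h \<in> Hs"
  then show "(\<lambda>k. b i (direction (ws k)) h) \<longlonglongrightarrow> b i (direction w) h"
    using wk weak_functional_dual unfolding weakly_converges_def b_weak_functional[OF w] b_weak_functional[OF ws] by blast
qed

end

definition LSC :: "(nat \<Rightarrow> real) \<Rightarrow> bool"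
  where "LSC \<mu> \<longleftrightarrow> (\<forall>ws w. w \<in> H2 P what \<longrightarrow> (\<forall>k. ws k \<in> H2 P what) \<longrightarrow> weakly_converges TT ws w \<longrightarrow>
    (\<forall>y<J \<mu> (direction w) (direction w). \<forall>\<^sub>F k in sequentially. y < J \<mu> (direction (ws k)) (direction (ws k))))"

lemma LSC_iff:
  assumes p: "\<And>t. t \<in> {0..TT} \<Longrightarrow> p t = Pm (mu \<alpha> \<beta>) t"
  shows "weakly_lsc_on TT (H2 P what) (Omega P what (\<alpha>, \<beta>, p)) \<longleftrightarrow> LSC (mu \<alpha> \<beta>)"
proof -
  let ?J = "\<lambda>w. J (mu \<alpha> \<beta>) (direction w) (direction w)"
  have O: "Omega P what (\<alpha>, \<beta>, p) w = ?J w / 2" if "w \<in> H2 P what" for w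
    using that by (cases w) (simp only: Omega_eq[OF _ p])
  have half: "(\<forall>y<a/2. \<forall>\<^sub>F k in sequentially. y < f k / 2) \<longleftrightarrow> (\<forall>y<a. \<forall>\<^sub>F k in sequentially. y < f k)" for a :: real and f
  proof (intro iffI allI impI)
    fix y assume "\<forall>y<a/2. \<forall>\<^sub>F k in sequentially. y < f k / 2" "y < a"
    then have "\<forall>\<^sub>F k in sequentially. y / 2 < f k / 2" by (metis divide_strict_right_mono zero_less_numeral)
    then show "\<forall>\<^sub>F k in sequentially. y < f k" by simp
  next
    fix y assume "\<forall>y<a. \<forall>\<^sub>F k in sequentially. y < f k" "y < a / 2"
    then have "\<forall>\<^sub>F k in sequentially. 2 * y < f k" by simp
    then show "\<forall>\<^sub>F k in sequentially. y < f k / 2" by eventually_elim simp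
  qed
  have "ereal (Omega P what (\<alpha>, \<beta>, p) w) \<le> liminf (\<lambda>k. ereal (Omega P what (\<alpha>, \<beta>, p) (ws k))) \<longleftrightarrow>
      (\<forall>y<?J w. \<forall>\<^sub>F k in sequentially. y < ?J (ws k))" if "w \<in> H2 P what" "\<forall>k. ws k \<in> H2 P what" for ws w
    unfolding ereal_le_liminf_iff O[OF that(1)] using that(2) half[of "?J w" "\<lambda>k. ?J (ws k)"] by (simp only: O)
  then show ?thesis unfolding weakly_lsc_on_def LSC_def by blast
qed

text \<open>\<open>Lambda_sharp\<close> without the adjoint component: coefficient sequences only,
  so that compactness can be studied in the product topology. \<open>mu\<close> and
  \<open>mult_of\<close> translate between the two.\<close>

definition lsc_multipliers :: "(nat \<Rightarrow> real) set"
  where "lsc_multipliers = {\<mu>. (\<forall>i\<ge>KK. \<mu> i = 0) \<and> (\<forall>i<Suc (dphi P). 0 \<le> \<mu> i) \<and> mult_norm \<mu> = 1 \<and> annihilates \<mu> \<and> LSC \<mu>}"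

lemma mu_in_lsc_multipliers:
  assumes "(\<alpha>, \<beta>, p) \<in> Lambda_sharp P what"
  shows "mu \<alpha> \<beta> \<in> lsc_multipliers" "w \<in> H2 P what \<Longrightarrow> Omega P what (\<alpha>, \<beta>, p) w = J (mu \<alpha> \<beta>) (direction w) (direction w) / 2"
proof -
  have L: "(\<alpha>, \<beta>, p) \<in> Lambda P what" and ls: "weakly_lsc_on TT (H2 P what) (Omega P what (\<alpha>, \<beta>, p))"
    using assms by (auto simp: Lambda_sharp_def)
  note p = Lambda_adjoint[OF L]
  have "\<forall>i\<in>{0..dphi P}. 0 \<le> \<alpha> i" "mult_norm (mu \<alpha> \<beta>) = 1" using L by (simp_all add: Lambda_def mult_norm_mu)
  then show "mu \<alpha> \<beta> \<in> lsc_multipliers" using Lambda_annihilates[OF L] LSC_iff[OF p] ls by (simp add: lsc_multipliers_def mu_def)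
  show "Omega P what (\<alpha>, \<beta>, p) w = J (mu \<alpha> \<beta>) (direction w) (direction w) / 2" if "w \<in> H2 P what"
    using that by (cases w) (simp only: Omega_eq[OF _ p])
qed

lemma mult_of_Lambda_sharp:
  assumes "\<mu> \<in> lsc_multipliers"
  shows "mult_of \<mu> \<in> Lambda_sharp P what" "w \<in> H2 P what \<Longrightarrow> Omega P what (mult_of \<mu>) w = J \<mu> (direction w) (direction w) / 2"
proof -
  have s: "\<forall>i\<ge>KK. \<mu> i = 0" and a: "LSC \<mu>" and L: "mult_of \<mu> \<in> Lambda P what"
    using assms mult_of_Lambda by (auto simp: lsc_multipliers_def)
  show "mult_of \<mu> \<in> Lambda_sharp P what"
    using L LSC_iff[of "Pm \<mu>"] a mu_restrict[OF s] unfolding Lambda_sharp_def mult_of_def by simp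
  show "Omega P what (mult_of \<mu>) w = J \<mu> (direction w) (direction w) / 2" if "w \<in> H2 P what"
    using that unfolding mult_of_def by (cases w) (simp only: Omega_eq mu_restrict[OF s])
qed

lemma LSC_limit:
  assumes l: "\<And>n. LSC (\<mu>s n)" and mu: "\<And>i. (\<lambda>n. \<mu>s n i) \<longlonglongrightarrow> \<mu> i"
  shows "LSC \<mu>"
  unfolding LSC_def
proof (intro allI impI)
  fix ws w y assume w: "w \<in> H2 P what" "\<forall>k. ws k \<in> H2 P what" "weakly_converges TT ws w" and y: "y < J \<mu> (direction w) (direction w)"
  obtain C where C: "\<And>k. ip (direction (ws k)) (direction (ws k)) \<le> C" using weak_bounded[OF w(1) _ w(3)] w(2) by blast
  have "wconv (\<lambda>k. direction (ws k)) (direction w)" using weak_wconv[OF w(1) _ w(3)] w(2) by blast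
  then have H: "direction w \<in> Hs" "\<And>k. direction (ws k) \<in> Hs" unfolding wconv_def by blast+
  show "\<forall>\<^sub>F k in sequentially. y < J \<mu> (direction (ws k)) (direction (ws k))"
    by (rule lsc_limit[OF H C _ mu y]) (use l w in \<open>unfold LSC_def, blast\<close>)
qed

text \<open>The normalization bounds every coefficient by 1, and all conditions are closed; for
  semicontinuity this is \<open>LSC_limit\<close>, where boundedness of weakly convergent sequences
  enters.\<close>

lemma compact_lsc_multipliers: "compact lsc_multipliers"
proof -
  let ?B = "{c::nat \<Rightarrow> real. \<forall>j. - 1 \<le> c j \<and> c j \<le> 1}"
  have "\<bar>\<mu> j\<bar> \<le> 1" if m: "\<mu> \<in> lsc_multipliers" for \<mu> j
  proof -
    have N: "L2_set \<mu> {0..dphi P} + L2_set (\<lambda>j. \<mu> (j + dphi P)) {1..deta P} = 1" and z: "j \<ge> KK \<Longrightarrow> \<mu> j = 0"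
      using m by (auto simp: lsc_multipliers_def mult_norm_def)
    consider "j \<le> dphi P" | "j - dphi P \<in> {1..deta P}" "j - dphi P + dphi P = j" | "j \<ge> KK" by fastforce
    then show ?thesis
    proof cases
      case 1
      then show ?thesis using abs_le_L2_set[of "{0..dphi P}" j \<mu>] N L2_set_nonneg[of "\<lambda>j. \<mu> (j + dphi P)" "{1..deta P}"]
        by (simp del: L2_set_nonneg)
    next
      case 2
      then show ?thesis using abs_le_L2_set[of "{1..deta P}" "j - dphi P" "\<lambda>j. \<mu> (j + dphi P)"] N L2_set_nonneg[of \<mu> "{0..dphi P}"]
        by (simp del: L2_set_nonneg)
    next
      case 3
      then show ?thesis using z by simp
    qed
  qed
  then have "lsc_multipliers \<subseteq> ?B" by (auto simp: abs_le_iff intro: minus_le_iff[THEN iffD1])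
  then have BS: "?B \<inter> lsc_multipliers = lsc_multipliers" by blast
  have "closed lsc_multipliers"
    unfolding closed_sequential_limits
  proof (intro allI impI, elim conjE)
    fix f :: "nat \<Rightarrow> nat \<Rightarrow> real" and l assume f: "\<forall>n. f n \<in> lsc_multipliers" and lim: "f \<longlonglongrightarrow> l"
    have c: "(\<lambda>n. f n i) \<longlonglongrightarrow> l i" for i by (rule tendsto_coord[OF lim])
    have "l i = 0" if "i \<ge> KK" for i
    proof -
      have "(\<lambda>n. f n i) = (\<lambda>n. 0)" using f that by (auto simp: lsc_multipliers_def)
      then show ?thesis using c[of i] by (simp add: LIMSEQ_const_iff)
    qed
    moreover have "0 \<le> l i" if "i < Suc (dphi P)" for i
      by (rule LIMSEQ_le_const[OF c]) (use f that in \<open>auto simp: lsc_multipliers_def\<close>)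
    moreover have "mult_norm l = 1"
    proof -
      have "(\<lambda>n. mult_norm (f n)) \<longlonglongrightarrow> mult_norm l"
        unfolding mult_norm_def L2_set_def by (intro tendsto_add tendsto_real_sqrt tendsto_sum tendsto_power c)
      moreover have "(\<lambda>n. mult_norm (f n)) = (\<lambda>n. 1)" using f by (auto simp: lsc_multipliers_def)
      ultimately show ?thesis by (simp add: LIMSEQ_const_iff)
    qed
    moreover have "annihilates l"
      unfolding annihilates_def
    proof
      fix h assume h: "h \<in> (UNIV :: (real^'n) set) \<times> Bm"
      have "(\<lambda>n. \<Sum>i<KK. f n i * A i h) \<longlonglongrightarrow> (\<Sum>i<KK. l i * A i h)"
        by (intro tendsto_sum tendsto_mult c tendsto_const)
      moreover have "(\<lambda>n. \<Sum>i<KK. f n i * A i h) = (\<lambda>n. 0)" using f h unfolding lsc_multipliers_def annihilates_def by blast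
      ultimately show "(\<Sum>i<KK. l i * A i h) = 0" by (simp only: LIMSEQ_const_iff)
    qed
    moreover have "LSC l" by (rule LSC_limit[OF _ c]) (use f in \<open>auto simp: lsc_multipliers_def\<close>)
    ultimately show "l \<in> lsc_multipliers" by (simp add: lsc_multipliers_def)
  qed
  from compact_Int_closed[OF compact_nat_box[of "\<lambda>_. - 1" "\<lambda>_. 1"] this] show ?thesis unfolding BS .
qed

lemma lsc_multipliers_nonempty:
  assumes w: "(x, u, v) \<in> critical_cone P what"
  shows "\<exists>\<mu>\<in>lsc_multipliers. 0 \<le> J \<mu> (direction (x, u, v)) (direction (x, u, v))"
proof -
  have wH: "(x, u, v) \<in> H2 P what" using w by (simp add: critical_cone_def)
  let ?h = "direction (x, u, v)"
  have h: "?h \<in> Hs" using H2_Z(1)[OF wH] by (rule direction_Hs)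
  have A: "A i ?h = d1 (cf P i) (xh 0, xh TT) (x 0, x TT)" for i
    using H2_Z(2)[OF wH, of TT] T0 q0_eq unfolding A_def D1_def by simp
  have neg: "A i ?h \<le> 0" if "i < Suc (dphi P)" for i
    using w that unfolding A critical_cone_def by (auto simp: cf_def d1_def)
  have zero: "A i ?h = 0" if "Suc (dphi P) \<le> i" "i < KK" for i
  proof -
    have "i - dphi P \<in> {1..deta P}" using that by auto
    then have "frechet_derivative (eta P (i - dphi P)) (at (xh 0, xh TT)) (x 0, x TT) = 0"
      using w unfolding critical_cone_def by blast
    then show ?thesis unfolding A using that by (simp add: cf_def d1_def)
  qed
  interpret ab: abnormal_problem "UNIV \<times> Bm" Hs A b ap "Suc (dphi P)" KK by (rule abnormal)
  obtain \<mu> and r :: nat and e where m: "ab.mult \<mu>" "0 \<le> J \<mu> ?h ?h" and e: "\<And>j. j < r \<Longrightarrow> e j \<in> Hs"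
    and low: "\<And>y. y \<in> Hs \<Longrightarrow> - (\<Sum>j<r. (J \<mu> y (e j))\<^sup>2) \<le> J \<mu> y y"
    using ab.multiplier_finite_index[OF h neg zero q(2)] unfolding J_def by blast
  have us: "\<mu> \<in> usphere KK" and pos: "\<forall>i<Suc (dphi P). 0 \<le> \<mu> i" and ann: "annihilates \<mu>"
    using m(1) unfolding ab.mult_def annihilates_def by blast+
  \<comment> \<open>The unit sphere constrains all coefficients together, so the norms of the two
    blocks cannot both vanish.\<close>
  have N: "mult_norm \<mu> > 0"
  proof (rule ccontr)
    assume "\<not> mult_norm \<mu> > 0"
    then have "L2_set \<mu> {0..dphi P} = 0" "L2_set (\<lambda>j. \<mu> (j + dphi P)) {1..deta P} = 0"
      using L2_set_nonneg[of \<mu> "{0..dphi P}"] L2_set_nonneg[of "\<lambda>j. \<mu> (j + dphi P)" "{1..deta P}"] unfolding mult_norm_def by linarith+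
    then have z: "\<And>i. i \<in> {0..dphi P} \<Longrightarrow> \<mu> i = 0" "\<And>j. j \<in> {1..deta P} \<Longrightarrow> \<mu> (j + dphi P) = 0"
      by (auto simp: L2_set_eq_0_iff)
    have "\<mu> i = 0" if "i < KK" for i
    proof (cases "i \<le> dphi P")
      case False
      then have "i - dphi P \<in> {1..deta P}" "i - dphi P + dphi P = i" using that by auto
      then show ?thesis using z(2)[of "i - dphi P"] by simp
    qed (use z(1) in auto)
    then have "(\<Sum>i<KK. (\<mu> i)\<^sup>2) = 0" by simp
    then show False using us unfolding usphere_def by simp
  qed
  \<comment> \<open>The sphere normalization is replaced by |\<alpha>| + |\<beta>| = 1; the
    remaining conditions are invariant under positive scaling.\<close>
  define c where "c = 1 / mult_norm \<mu>"
  have c: "0 < c" using N by (simp add: c_def)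
  define \<nu> where "\<nu> i = c * \<mu> i" for i
  have J: "J \<nu> y y' = c * J \<mu> y y'" for y y' by (simp only: J_def \<nu>_def sum_distrib_left mult.assoc)
  have "LSC \<mu>"
    unfolding LSC_def
  proof (intro allI impI)
    fix ws w y assume w: "w \<in> H2 P what" "\<forall>k. ws k \<in> H2 P what" "weakly_converges TT ws w" and y: "y < J \<mu> (direction w) (direction w)"
    have "wconv (\<lambda>k. direction (ws k)) (direction w)" using weak_wconv[OF w(1) _ w(3)] w(2) by blast
    then show "\<forall>\<^sub>F k in sequentially. y < J \<mu> (direction (ws k)) (direction (ws k))" by (rule finite_index_lsc[OF _ e low y])
  qed
  then have "LSC \<nu>"
    unfolding LSC_def J
  proof (intro allI impI)
    fix ws w y
    assume l: "\<forall>ws w. w \<in> H2 P what \<longrightarrow> (\<forall>k. ws k \<in> H2 P what) \<longrightarrow> weakly_converges TT ws w \<longrightarrow>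
        (\<forall>y<J \<mu> (direction w) (direction w). \<forall>\<^sub>F k in sequentially. y < J \<mu> (direction (ws k)) (direction (ws k)))"
      and w: "w \<in> H2 P what" "\<forall>k. ws k \<in> H2 P what" "weakly_converges TT ws w" and y: "y < c * J \<mu> (direction w) (direction w)"
    have "y / c < J \<mu> (direction w) (direction w)" using y c by (simp add: pos_divide_less_eq mult.commute)
    then have "\<forall>\<^sub>F k in sequentially. y / c < J \<mu> (direction (ws k)) (direction (ws k))" using l w by blast
    then show "\<forall>\<^sub>F k in sequentially. y < c * J \<mu> (direction (ws k)) (direction (ws k))"
      by eventually_elim (use c in \<open>simp add: pos_divide_less_eq mult.commute\<close>)
  qed
  moreover have "mult_norm \<nu> = 1"
  proof -
    have "mult_norm \<nu> = c * mult_norm \<mu>"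
      using L2_set_right_distrib[of c \<mu> "{0..dphi P}"] L2_set_right_distrib[of c "\<lambda>j. \<mu> (j + dphi P)" "{1..deta P}"] c
      by (simp add: mult_norm_def \<nu>_def[abs_def] distrib_left)
    then show ?thesis using N by (simp add: c_def)
  qed
  moreover have "annihilates \<nu>"
    unfolding annihilates_def
  proof
    fix y assume "y \<in> (UNIV :: (real^'n) set) \<times> Bm"
    then have "(\<Sum>i<KK. \<mu> i * A i y) = 0" using ann unfolding annihilates_def by blast
    moreover have "(\<Sum>i<KK. \<nu> i * A i y) = c * (\<Sum>i<KK. \<mu> i * A i y)"
      by (simp only: \<nu>_def sum_distrib_left mult.assoc)
    ultimately show "(\<Sum>i<KK. \<nu> i * A i y) = 0" by (simp only: mult_zero_right)
  qed
  ultimately have "\<nu> \<in> lsc_multipliers" using us pos c by (auto simp: lsc_multipliers_def \<nu>_def usphere_def)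
  moreover have "0 \<le> J \<nu> ?h ?h" unfolding J using c m(2) by simp
  ultimately show ?thesis by blast
qed

text \<open>For fixed w the value of \<open>Omega\<close> is linear in the coefficients and depends
  on the multiplier through them alone, so a maximizer over the compact set
  \<open>lsc_multipliers\<close> gives one over \<open>Lambda_sharp\<close>.\<close>

theorem arg_max_Omega:
  assumes w: "w \<in> critical_cone P what"
  shows "\<exists>lm. is_arg_max (\<lambda>\<mu>. Omega P what \<mu> w) (\<lambda>\<mu>. \<mu> \<in> Lambda_sharp P what) lm \<and> 0 \<le> Omega P what lm w"
proof -
  have wH: "w \<in> H2 P what" using w by (cases w) (simp add: critical_cone_def)
  obtain \<mu>0 where m0: "\<mu>0 \<in> lsc_multipliers" "0 \<le> J \<mu>0 (direction w) (direction w)" using lsc_multipliers_nonempty w by (cases w) blast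
  have "continuous_on lsc_multipliers (\<lambda>\<mu>. J \<mu> (direction w) (direction w))"
    unfolding J_def by (intro continuous_on_sum continuous_on_mult continuous_on_coord continuous_on_const)
  then obtain \<mu> where m: "\<mu> \<in> lsc_multipliers" "\<And>\<nu>. \<nu> \<in> lsc_multipliers \<Longrightarrow> J \<nu> (direction w) (direction w) \<le> J \<mu> (direction w) (direction w)"
    using continuous_attains_sup[OF compact_lsc_multipliers] m0(1) by blast
  have "Omega P what \<nu> w \<le> Omega P what (mult_of \<mu>) w" if "\<nu> \<in> Lambda_sharp P what" for \<nu>
    using mu_in_lsc_multipliers[of "fst \<nu>" "fst (snd \<nu>)" "snd (snd \<nu>)"] that wH m(2) mult_of_Lambda_sharp(2)[OF m(1) wH] by fastforce
  then have "is_arg_max (\<lambda>\<mu>. Omega P what \<mu> w) (\<lambda>\<mu>. \<mu> \<in> Lambda_sharp P what) (mult_of \<mu>)"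
    unfolding is_arg_max_def using mult_of_Lambda_sharp(1)[OF m(1)] by (auto simp: not_less)
  moreover have "0 \<le> Omega P what (mult_of \<mu>) w"
    unfolding mult_of_Lambda_sharp(2)[OF m(1) wH] using m0 m(2) by fastforce
  ultimately show ?thesis by blast
qed

end

section \<open>Application to the optimal control problem\<close>

lemma Linf_norm_le:
  fixes u :: "real \<Rightarrow> 'a::euclidean_space"
  assumes "u \<in> borel_measurable (leb T)" "AE t in leb T. norm (u t) \<le> B"
  shows "Linf_norm T u \<le> ereal B" "u \<in> Linf T"
proof -
  have m: "(\<lambda>t. ereal (norm (u t))) \<in> borel_measurable (leb T)" using assms(1) by measurable
  show "Linf_norm T u \<le> ereal B"
    unfolding Linf_norm_def using assms(2) by (intro esssup_I m) simp
  then have "Linf_norm T u < \<infinity>" by (rule le_less_trans) simp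
  then show "u \<in> Linf T" using assms(1) by (simp add: Linf_def)
qed

lemma Linf_AE_bound:
  fixes u :: "real \<Rightarrow> 'a::euclidean_space"
  assumes "u \<in> Linf T"
  obtains M where "0 \<le> M" "AE t in leb T. norm (u t) \<le> M"
proof -
  have "Linf_norm T u \<noteq> \<infinity>" using assms by (auto simp: Linf_def)
  then obtain n :: nat where n: "Linf_norm T u < ereal (real n)" using less_PInf_Ex_of_nat by blast
  have "AE t in leb T. ereal (norm (u t)) \<le> Linf_norm T u"
    unfolding Linf_norm_def by (rule esssup_AE)
  then have "AE t in leb T. norm (u t) \<le> real n"
  proof eventually_elim
    case (elim t)
    then have "ereal (norm (u t)) < ereal (real n)" using n by (rule le_less_trans)
    then show ?case by simp
  qed
  then show ?thesis using that[of "real n"] by simp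
qed

context control_system
begin

lemma X_diff_bound:
  assumes h: "small r h" "small \<rho>0 h" and t: "t \<in> {0..T}"
  shows "norm (X h t - xh t) \<le> r * ((1 + T * Lc) * gr)"
proof -
  have "norm (X h t - xh t) \<le> (norm (fst h) + (LINT s|leb T. Lc * norm (snd h s))) * gr"
    using traj_diff[OF small_0 traj_ref h(2) X[OF h(2)] t] by simp
  also have "\<dots> \<le> (r + T * (Lc * r)) * gr"
  proof (intro mult_right_mono add_mono)
    show "norm (fst h) \<le> r" using h(1) by (simp add: small_def)
    have m: "snd h \<in> borel_measurable (leb T)" and b: "\<And>s. s \<in> {0..T} \<Longrightarrow> norm (snd h s) \<le> r" using h(1) by (auto simp: small_def)
    have i: "integrable (leb T) (\<lambda>s. Lc * norm (snd h s))" using leb_bounded_integrable[OF m b] by simp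
    have c: "integrable (leb T) (\<lambda>s. Lc * r)" by (intro leb_continuous_integrable continuous_intros)
    have "(LINT s|leb T. Lc * norm (snd h s)) \<le> (LINT s|leb T. Lc * r)"
      by (rule leb_integral_le[OF i c]) (use b Lc(1) in \<open>auto intro: mult_left_mono\<close>)
    then show "(LINT s|leb T. Lc * norm (snd h s)) \<le> T * (Lc * r)"
      unfolding leb_integral_const[OF T0] .
  qed (use gr_pos in simp)
  also have "\<dots> = r * ((1 + T * Lc) * gr)" by (simp add: algebra_simps)
  finally show ?thesis .
qed

lemma X_wderiv:
  assumes h: "small \<rho>0 h"
  shows "has_wderiv T (X h) (\<lambda>s. F (X h s, W h s))" "X h \<in> W1inf T"
proof -
  note i = adm_F_integrable[OF X_adm[OF h]]
  show w: "has_wderiv T (X h) (\<lambda>s. F (X h s, W h s))"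
    unfolding has_wderiv_def X_init[OF h] using i X[OF h] unfolding traj_def by blast
  have "bounded (F ` K0)" by (intro compact_imp_bounded compact_continuous_image C2_cont[OF F] K0)
  then obtain B where B: "\<And>z. z \<in> K0 \<Longrightarrow> norm (F z) \<le> B" by (auto simp: bounded_iff)
  have "(\<lambda>s. F (X h s, W h s)) \<in> Linf T"
  proof (rule Linf_norm_le(2))
    show "AE s in leb T. norm (F (X h s, W h s)) \<le> B"
      by (rule AE_I2) (use X_adm[OF h] B in \<open>auto simp: adm_def\<close>)
  qed (use i in auto)
  then show "X h \<in> W1inf T" using w unfolding W1inf_def by blast
qed

end

theorem theorem3p9:
  fixes P :: "('n::finite, 'l::finite, 'm::finite) ocp"
    and xh :: "real \<Rightarrow> real^'n" and uh :: "real \<Rightarrow> real^'l" and vh :: "real \<Rightarrow> real^'m"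
  assumes "horizon P > 0"
    and "smooth_data P"
    and "(xh, uh, vh) \<in> feasible P"
    and "\<forall>i\<in>{1..dphi P}. phi P i (xh 0, xh (horizon P)) = 0"
    and "weak_minimum P (xh, uh, vh)"
  shows "\<forall>w \<in> critical_cone P (xh, uh, vh).
    \<exists>lam. is_arg_max (\<lambda>mu. Omega P (xh, uh, vh) mu w)
                     (\<lambda>mu. mu \<in> Lambda_sharp P (xh, uh, vh)) lam \<and>
          0 \<le> Omega P (xh, uh, vh) lam w"
proof -
  let ?T = "horizon P" and ?F = "dynz P"
  let ?qh = "(xh 0, xh ?T)"
  have T: "0 < ?T" and T0: "0 \<le> ?T" using assms(1) by simp_all
  have F: "C2fun ?F (d1 ?F) (d2 ?F)" using C2_dynz[OF assms(2)] by (simp add: C2_iff)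
  have cf: "C2fun (cf P i) (d1 (cf P i)) (d2 (cf P i))" if "i < Suc (dphi P) + deta P" for i
    using C2_cf[OF assms(2) that] by (simp add: C2_iff)
  have feas: "xh \<in> W1inf ?T" "uh \<in> Linf ?T" "vh \<in> Linf ?T"
    "AE t in leb ?T. wderiv ?T xh t = dynz P (xh t, uh t, vh t)" "\<forall>j\<in>{1..deta P}. eta P j ?qh = 0"
    using assms(3) unfolding feasible_def dyn_dynz by simp_all
  obtain Mu where Mu: "0 \<le> Mu" "AE t in leb ?T. norm (uh t) \<le> Mu" using Linf_AE_bound[OF feas(2)] .
  obtain Mv where Mv: "0 \<le> Mv" "AE t in leb ?T. norm (vh t) \<le> Mv" using Linf_AE_bound[OF feas(3)] .
  have m: "uh \<in> borel_measurable (leb ?T)" "vh \<in> borel_measurable (leb ?T)" using feas(2,3) by (auto simp: Linf_def)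
  \<comment> \<open>Truncation at essential bounds alters the controls on a null set only and makes
    them bounded everywhere, as \<open>control_system\<close> demands.\<close>
  define wh where "wh t = (if norm (uh t) \<le> Mu then uh t else 0, if norm (vh t) \<le> Mv then vh t else 0)" for t
  have wh_AE: "AE t in leb ?T. wh t = (uh t, vh t)" using Mu(2) Mv(2) by eventually_elim (simp add: wh_def)
  have whm: "wh \<in> borel_measurable (leb ?T)" unfolding wh_def[abs_def] using m by (intro borel_measurable_Pair; measurable)
  have "norm (wh t) \<le> Mu + Mv" for t
    unfolding wh_def by (rule order_trans[OF norm_Pair_le]) (use Mu(1) Mv(1) in auto)
  then have whb: "\<exists>M. \<forall>t\<in>{0..?T}. norm (wh t) \<le> M" by blast
  have w: "has_wderiv ?T xh (wderiv ?T xh)" using feas(1) has_wderiv_wderiv unfolding W1inf_def by blast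
  have wi: "integrable (leb ?T) (wderiv ?T xh)" and wx: "\<And>t. t \<in> {0..?T} \<Longrightarrow> xh t = xh 0 + (LINT s|leb t. wderiv ?T xh s)"
    using w unfolding has_wderiv_def by blast+
  have xhc: "continuous_on {0..?T} xh" by (rule primitive_continuous[OF wi wx])
  have ae: "AE s in leb ?T. wderiv ?T xh s = ?F (xh s, wh s)" using feas(4) wh_AE by eventually_elim simp
  have zm: "(\<lambda>s. (xh s, wh s)) \<in> borel_measurable (leb ?T)"
    by (intro borel_measurable_Pair leb_continuous_measurable xhc whm)
  have Fi: "integrable (leb ?T) (\<lambda>s. ?F (xh s, wh s))"
    by (rule integrable_cong_AE_imp[OF wi C2_measurable(1)[OF F zm zm zm] ae])
  interpret cs: control_system ?T ?F "d1 ?F" "d2 ?F" xh wh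
  proof
    show "xh t = xh 0 + (LINT s|leb t. ?F (xh s, wh s))" if "t \<in> {0..?T}" for t
      using wx[OF that] leb_integral_cong_AE[OF wi Fi ae, of t] that by simp
  qed (rule T F whm whb xhc)+
  obtain \<epsilon> where eps: "0 < \<epsilon>" "\<And>x u v. (x, u, v) \<in> feasible P \<Longrightarrow> Linf_norm ?T (\<lambda>t. x t - xh t) < ereal \<epsilon> \<Longrightarrow>
      Linf_norm ?T (\<lambda>t. u t - uh t) < ereal \<epsilon> \<Longrightarrow> Linf_norm ?T (\<lambda>t. v t - vh t) < ereal \<epsilon> \<Longrightarrow> phi P 0 ?qh \<le> phi P 0 (x 0, x ?T)"
    using assms(5) unfolding weak_minimum_def by blast
  define c where "c = (1 + ?T * cs.Lc) * cs.gr"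
  have c: "0 < c" unfolding c_def using cs.Lc(1) T cs.gr_pos by (simp add: add_pos_nonneg)
  \<comment> \<open>By \<open>X_diff_bound\<close> a perturbation of size r moves the state by at
    most r c, and the controls move by at most r; this r keeps both below \<epsilon>.\<close>
  define r where "r = \<epsilon> / (2 * (1 + c))"
  have r: "0 < r" "r < \<epsilon>" "r * c < \<epsilon>"
    using eps(1) c by (simp_all add: r_def field_simps add_pos_pos)
  have minimal: "\<not> (cf P 0 (cs.X h 0, cs.X h ?T) - cf P 0 ?qh < 0 \<and>
      (\<forall>i<Suc (dphi P). cf P i (cs.X h 0, cs.X h ?T) - cf P i ?qh \<le> 0) \<and>
      (\<forall>i. Suc (dphi P) \<le> i \<and> i < Suc (dphi P) + deta P \<longrightarrow> cf P i (cs.X h 0, cs.X h ?T) - cf P i ?qh = 0))"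
    if h: "cs.small r h" "cs.small cs.\<rho>0 h" for h
  proof (intro notI, elim conjE)
    assume neg: "cf P 0 (cs.X h 0, cs.X h ?T) - cf P 0 ?qh < 0"
      and le: "\<forall>i<Suc (dphi P). cf P i (cs.X h 0, cs.X h ?T) - cf P i ?qh \<le> 0"
      and eq: "\<forall>i. Suc (dphi P) \<le> i \<and> i < Suc (dphi P) + deta P \<longrightarrow> cf P i (cs.X h 0, cs.X h ?T) - cf P i ?qh = 0"
    let ?x = "cs.X h" and ?u = "\<lambda>t. fst (cs.W h t)" and ?v = "\<lambda>t. snd (cs.W h t)"
    have Wm: "cs.W h \<in> borel_measurable (leb ?T)" by (rule cs.W_measurable[OF h(2)])
    have uvm: "?u \<in> borel_measurable (leb ?T)" "?v \<in> borel_measurable (leb ?T)"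
      by (rule borel_measurable_continuous_on[OF _ Wm], intro continuous_intros)+
    have Wb: "norm (fst (cs.W h t)) \<le> cs.Rad + 1" "norm (snd (cs.W h t)) \<le> cs.Rad + 1" if "t \<in> {0..?T}" for t
      using cs.W_in[OF h(2) that] norm_fst_le[of "fst (cs.W h t)" "snd (cs.W h t)"] norm_snd_le[of "snd (cs.W h t)" "fst (cs.W h t)"] by simp_all
    have "(?x, ?u, ?v) \<in> feasible P"
      unfolding feasible_def mem_Collect_eq case_prod_conv
    proof (intro conjI ballI)
      show "?x \<in> W1inf ?T" by (rule cs.X_wderiv(2)[OF h(2)])
      show "?u \<in> Linf ?T" by (rule Linf_norm_le(2)[OF uvm(1) AE_I2]) (use Wb in simp)
      show "?v \<in> Linf ?T" by (rule Linf_norm_le(2)[OF uvm(2) AE_I2]) (use Wb in simp)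
      show "AE t in leb ?T. wderiv ?T ?x t = dyn P (?x t) (?u t) (?v t)"
        using wderiv_AE[OF cs.X_wderiv(1)[OF h(2)] T0] by (simp add: dyn_dynz)
      show "eta P j (?x 0, ?x ?T) = 0" if "j \<in> {1..deta P}" for j
        using eq[rule_format, of "dphi P + j"] that feas(5) by (simp add: cf_def split: if_splits)
      \<comment> \<open>The inequality constraints are active at the reference, so not exceeding the
        reference value is feasibility.\<close>
      show "phi P i (?x 0, ?x ?T) \<le> 0" if "i \<in> {1..dphi P}" for i
        using le[rule_format, of i] that assms(4) by (simp add: cf_def)
    qed
    moreover have "Linf_norm ?T (\<lambda>t. ?x t - xh t) \<le> ereal (r * c)"
    proof (rule Linf_norm_le(1)[OF _ AE_I2])
      have "continuous_on {0..?T} ?x" using cs.X_adm[OF h(2)] by (simp add: cs.adm_def)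
      then show "(\<lambda>t. ?x t - xh t) \<in> borel_measurable (leb ?T)" by (intro leb_continuous_measurable continuous_intros xhc)
    qed (use cs.X_diff_bound[OF h] in \<open>simp add: c_def\<close>)
    moreover have sb: "norm (fst (snd h t)) \<le> r" "norm (snd (snd h t)) \<le> r" if "t \<in> {0..?T}" for t
      using h(1) that norm_fst_le[of "fst (snd h t)" "snd (snd h t)"] norm_snd_le[of "snd (snd h t)" "fst (snd h t)"]
      by (auto simp: cs.small_def intro: order_trans)
    have "AE t in leb ?T. t \<in> {0..?T}" using AE_space[of "leb ?T"] by simp
    then have d: "AE t in leb ?T. norm (?u t - uh t) \<le> r" "AE t in leb ?T. norm (?v t - vh t) \<le> r"
      using wh_AE by (eventually_elim, use sb in \<open>simp add: cs.W_def\<close>)+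
    have "Linf_norm ?T (\<lambda>t. ?u t - uh t) \<le> ereal r"
      by (rule Linf_norm_le(1)[OF borel_measurable_diff[OF uvm(1) m(1)] d(1)])
    moreover have "Linf_norm ?T (\<lambda>t. ?v t - vh t) \<le> ereal r"
      by (rule Linf_norm_le(1)[OF borel_measurable_diff[OF uvm(2) m(2)] d(2)])
    ultimately have "phi P 0 ?qh \<le> phi P 0 (?x 0, ?x ?T)"
      using r(2,3) by (intro eps(2)) (auto intro: le_less_trans)
    then show False using neg by (simp add: cf_def)
  qed
  interpret ocp_point P xh wh uh vh
  proof (intro ocp_point.intro endpoint_problem.intro cs.control_system_axioms endpoint_problem_axioms.intro ocp_point_axioms.intro)
    show "\<exists>\<epsilon>>0. \<forall>h. cs.small \<epsilon> h \<and> cs.small cs.\<rho>0 h \<longrightarrow>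
      \<not> (cf P 0 (cs.X h 0, cs.X h ?T) - cf P 0 ?qh < 0 \<and>
      (\<forall>i<Suc (dphi P). cf P i (cs.X h 0, cs.X h ?T) - cf P i ?qh \<le> 0) \<and>
      (\<forall>i. Suc (dphi P) \<le> i \<and> i < Suc (dphi P) + deta P \<longrightarrow> cf P i (cs.X h 0, cs.X h ?T) - cf P i ?qh = 0))"
      using r(1) minimal by blast
    show "C2fun (\<lambda>q. cf P i q - cf P i ?qh) (d1 (cf P i)) (d2 (cf P i))" if "i < Suc (dphi P) + deta P" for i
      by (rule C2fun_shift[OF cf[OF that]])
  qed (use cf wh_AE m in auto)
  show ?thesis by (intro ballI arg_max_Omega)
qed

end
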